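(* Let $\ell_1,\ell_2$ be distinct primes with $\ell_1,\ell_2\equiv1\pmod 4$, and let $F=\mathbb{Q}(\sqrt{\ell_1\ell_2})$, so that $\mathrm{Cl}_2(F)\simeq C_{2^n}$ for some $n\ge1$. Let $p$ be a prime with $\left(\frac{\ell_1}{p}\right)=\left(\frac{\ell_2}{p}\right)=-1$. Then $(p)$ splits into exactly $2$ primes in the extension $F^1_{(2)}/\mathbb{Q}$.
   Context: $\left(\frac{a}{b}\right)$ is the Kronecker symbol. $\mathrm{Cl}_2(F)$ is the $2$-primary part of the (wide) class group of $F$; $C_m$ is cyclic of order $m$. $F^1_{(2)}$ is the Hilbert $2$-class field of $F$, the maximal abelian $2$-extension of $F$ unramified at all finite and infinite places. *)

theory Defs
  imports
    "HOL-Algebra.Algebra"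
    "HOL-Algebra.Algebraic_Closure_Type"
    "HOL-Number_Theory.Number_Theory"
begin

text \<open>Number fields are subfields of the complex numbers, represented by their sets of elements.
  The HOL-Algebra record of such a field, or of a subring of it, is obtained from \<open>\<complex>\<close> by
  restricting the carrier.\<close>

abbreviation complex_ring :: "complex ring" ("CC")
  where "CC \<equiv> ring_of_type_algebra"

definition quadratic_field :: "int \<Rightarrow> complex set"
  where "quadratic_field d = generate_field CC {csqrt (of_int d)}"

definition ring_of_integers :: "complex set \<Rightarrow> complex ring"
  where "ring_of_integers K = CC\<lparr>carrier := {x \<in> K. algebraic_int x}\<rparr>"


subsection \<open>Kronecker symbol\<close>

text \<open>The constant \<open>Legendre\<close> is not the Kronecker symbol at 2: it equals 1 at every odd number there.\<close>

definition kronecker_at_prime :: "int \<Rightarrow> int \<Rightarrow> int"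
  where "kronecker_at_prime a p =
    (if p = 2 then (if even a then 0 else if a mod 8 \<in> {1, 7} then 1 else - 1)
     else Legendre a p)"

definition kronecker :: "int \<Rightarrow> int \<Rightarrow> int"
  where "kronecker a b =
    (if b = 0 then (if \<bar>a\<bar> = 1 then 1 else 0)
     else (if a < 0 \<and> b < 0 then - 1 else 1) *
          (\<Prod>p\<in>prime_factors b. kronecker_at_prime a p ^ multiplicity p b))"


subsection \<open>Class group\<close>

definition fractional_ideal :: "complex set \<Rightarrow> complex set \<Rightarrow> bool"
  where "fractional_ideal K I \<longleftrightarrow>
    I \<subseteq> K \<and> additive_subgroup I CC \<and> I \<noteq> {0} \<and>
    (\<forall>a\<in>carrier (ring_of_integers K). \<forall>x\<in>I. a * x \<in> I) \<and>
    (\<exists>d\<in>carrier (ring_of_integers K) - {0}. \<forall>x\<in>I. d * x \<in> carrier (ring_of_integers K))"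

text \<open>\<open>ideal_prod CC I J\<close> is the set of finite sums of products of elements of \<open>I\<close> and \<open>J\<close>, which is
  the product of fractional ideals as well as that of ideals.\<close>

definition fractional_ideal_group :: "complex set \<Rightarrow> complex set monoid"
  where "fractional_ideal_group K =
    \<lparr>carrier = {I. fractional_ideal K I}, monoid.mult = ideal_prod CC,
     one = carrier (ring_of_integers K)\<rparr>"

definition principal_fractional_ideals :: "complex set \<Rightarrow> complex set set"
  where "principal_fractional_ideals K =
    {(\<lambda>a. x * a) ` carrier (ring_of_integers K) | x. x \<in> K \<and> x \<noteq> 0}"

definition class_group :: "complex set \<Rightarrow> complex set set monoid"
  where "class_group K = fractional_ideal_group K Mod principal_fractional_ideals K"

definition primary_part :: "nat \<Rightarrow> 'a monoid \<Rightarrow> 'a monoid"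
  where "primary_part q G =
    G\<lparr>carrier := {x \<in> carrier G. \<exists>k::nat. x [^]\<^bsub>G\<^esub> (q ^ k) = \<one>\<^bsub>G\<^esub>}\<rparr>"


subsection \<open>Galois extensions\<close>

text \<open>The definitions of this and the next subsection take the base field first: \<open>F\<close> is the base
  field of the extension \<open>L\<close>.\<close>

definition galois_group :: "complex set \<Rightarrow> complex set \<Rightarrow> (complex \<Rightarrow> complex) monoid"
  where "galois_group F L = (BijGroup L)
    \<lparr>carrier := {\<sigma> \<in> Bij L. \<sigma> \<in> ring_hom (CC\<lparr>carrier := L\<rparr>) (CC\<lparr>carrier := L\<rparr>) \<and>
                            (\<forall>x\<in>F. \<sigma> x = x)}\<rparr>"

definition finite_galois_extension :: "complex set \<Rightarrow> complex set \<Rightarrow> bool"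
  where "finite_galois_extension F L \<longleftrightarrow>
    subfield F CC \<and> subfield L CC \<and> F \<subseteq> L \<and> ring.finite_dimension CC F L \<and>
    {x \<in> L. \<forall>\<sigma>\<in>carrier (galois_group F L). \<sigma> x = x} = F"

definition abelian_2_extension :: "complex set \<Rightarrow> complex set \<Rightarrow> bool"
  where "abelian_2_extension F L \<longleftrightarrow>
    finite_galois_extension F L \<and> comm_group (galois_group F L) \<and>
    (\<exists>k. Coset.order (galois_group F L) = 2 ^ k)"


subsection \<open>Primes, ramification and the Hilbert 2-class field\<close>

definition finite_primes :: "complex set \<Rightarrow> complex set set"
  where "finite_primes K = {P. primeideal P (ring_of_integers K) \<and> P \<noteq> {0}}"

text \<open>The ramification index of \<open>P\<close> over \<open>\<pp> = P \<inter> O\<^sub>F\<close> is the exponent of \<open>P\<close> in \<open>\<pp> O\<^sub>L\<close>.\<close>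

definition ramification_index :: "complex set \<Rightarrow> complex set \<Rightarrow> complex set \<Rightarrow> nat"
  where "ramification_index F L P =
    (GREATEST e. genideal (ring_of_integers L) (P \<inter> carrier (ring_of_integers F))
                   \<subseteq> P [^]\<^bsub>ideals_set (ring_of_integers L)\<^esub> e)"

text \<open>Residue fields of number fields are finite, so residue extensions are always separable and
  \<open>e = 1\<close> is the whole condition at a finite prime.\<close>

definition unramified_at_finite_places :: "complex set \<Rightarrow> complex set \<Rightarrow> bool"
  where "unramified_at_finite_places F L \<longleftrightarrow>
    (\<forall>P\<in>finite_primes L. ramification_index F L P = 1)"

text \<open>An infinite place ramifies if it is complex and lies over a real place.\<close>

definition unramified_at_infinite_places :: "complex set \<Rightarrow> complex set \<Rightarrow> bool"
  where "unramified_at_infinite_places F L \<longleftrightarrow>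
    (\<forall>\<tau>\<in>ring_hom (CC\<lparr>carrier := L\<rparr>) CC. \<tau> ` F \<subseteq> \<real> \<longrightarrow> \<tau> ` L \<subseteq> \<real>)"

definition unramified_abelian_2_extension :: "complex set \<Rightarrow> complex set \<Rightarrow> bool"
  where "unramified_abelian_2_extension F L \<longleftrightarrow>
    abelian_2_extension F L \<and> unramified_at_finite_places F L \<and> unramified_at_infinite_places F L"

text \<open>Every finite extension of \<open>F\<close> embeds over \<open>F\<close> into \<open>\<complex>\<close>, and a Galois one has only one image
  there, so it suffices to compare with subfields of \<open>\<complex>\<close>.\<close>

definition hilbert_2_class_field :: "complex set \<Rightarrow> complex set \<Rightarrow> bool"
  where "hilbert_2_class_field F H \<longleftrightarrow>
    unramified_abelian_2_extension F H \<and>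
    (\<forall>L. unramified_abelian_2_extension F L \<longrightarrow> L \<subseteq> H)"

definition primes_above :: "complex set \<Rightarrow> nat \<Rightarrow> complex set set"
  where "primes_above K p = {P \<in> finite_primes K. of_nat p \<in> P}"

text \<open>Splitting is meant literally: \<open>(p)\<close> is the product of the \<open>g\<close> distinct primes above it.\<close>

definition splits_into_exactly :: "complex set \<Rightarrow> nat \<Rightarrow> nat \<Rightarrow> bool"
  where "splits_into_exactly K p g \<longleftrightarrow>
    finite (primes_above K p) \<and> card (primes_above K p) = g \<and>
    cgenideal (ring_of_integers K) (of_nat p) =
      finprod (ideals_set (ring_of_integers K)) (\<lambda>P. P) (primes_above K p)"

end

theory Submission
  imports Defs "HOL-Analysis.Kronecker_Approximation_Theorem"
begin

text \<open>Write \<open>s = \<surd>(l1 l2)\<close> and let \<open>cj\<close> be the conjugation of \<open>F\<close>.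

  Splitting. The prime \<open>p\<close> is inert in the two fields \<open>\<rat>(\<surd>l1)\<close> and \<open>\<rat>(\<surd>l2)\<close>, hence splits in \<open>F\<close>,
  and it remains to see that each prime of \<open>F\<close> above \<open>p\<close> has only one prime \<open>P\<close> above it in \<open>H\<close>. Otherwise
  the decomposition group of \<open>P\<close> lies in a subgroup of index two of the 2-group \<open>Gal(H/F)\<close>, whose
  fixed field is \<open>F(y)\<close> with \<open>y\<^sup>2 = \<alpha> \<in> F\<close>. Since \<open>H/F\<close> is unramified, \<open>\<alpha> O\<^sub>F\<close> is the square of an
  ideal \<open>I\<close> and \<open>\<alpha>\<close> is totally positive; as \<open>I cj(I)\<close> is generated by a rational, \<open>\<alpha> cj(\<alpha>)\<close> is a
  rational square, and Hilbert 90 makes \<open>\<alpha>\<close> a rational times a square. Up to squares, \<open>\<alpha>\<close> is then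
  \<open>l1\<close>. But \<open>\<surd>l1\<close> cannot be fixed by the decomposition group, since \<open>p\<close> is inert in \<open>\<rat>(\<surd>l1)\<close> and
  the residue field of \<open>F\<close> at a prime above \<open>p\<close> is the prime field.

  Class group. A finite abelian group with exactly one element of order two has cyclic 2-primary
  part. If \<open>I\<^sup>2 = \<alpha> O\<^sub>F\<close>, then \<open>\<alpha> cj(\<alpha>) = \<plusminus> g\<^sup>2\<close> with \<open>g\<close> rational. In the positive case Hilbert 90
  leaves the class of \<open>1\<close> or of the ramified prime above \<open>l1\<close>. The negative case does occur, because
  \<open>l1 l2\<close> is a sum of two squares. If the fundamental unit has norm \<open>-1\<close>, the negative case reduces
  to the positive one and the ramified prime is not principal; if it has norm \<open>1\<close>, the ramified
  prime is principal and the ideals of the negative case form the only nontrivial class.\<close>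

section \<open>Algebraic integers\<close>

text \<open>Invertibility of ideals is proved only over \<open>F\<close>, where it comes from the
  fact that an ideal times its conjugate is generated by a rational. Over \<open>H\<close> neither
  unique factorisation nor residue degrees are used; the arguments there rest on finite residue
  rings, prime avoidance, norms over subgroups of the Galois group, and one consequence of
  ramification index one: no prime P of \<open>H\<close> satisfies P \<inter> O_F \<subseteq> P^2.
  The factorisation of (p) is therefore obtained by extending the explicit ideals (p, w - c) and (p,
  w - 1 + c) of O_F, where w = (1 + s) / 2 and c is a root modulo p of the minimal polynomial of w.
  Likewise the behaviour of \<surd>l1 under the decomposition group is decided by a norm form over
  \<int> and not by residue field extensions. That form is a^2 + a b - k b^2, coming from (1 +
  \<surd>l1) / 2, so that p = 2 is exceptional only in the evaluation of the Kronecker symbol.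
  Finiteness of the class group, the existence of units and the sum of two squares all come from
  Dirichlet approximation.\<close>

inductive_set int_hull :: "complex set \<Rightarrow> complex set" for S where
  int_hull_0: "0 \<in> int_hull S"
| int_hull_base: "s \<in> S \<Longrightarrow> s \<in> int_hull S"
| int_hull_add: "x \<in> int_hull S \<Longrightarrow> y \<in> int_hull S \<Longrightarrow> x + y \<in> int_hull S"
| int_hull_minus: "x \<in> int_hull S \<Longrightarrow> - x \<in> int_hull S"

definition add_closed :: "complex set \<Rightarrow> bool"
  where "add_closed G \<longleftrightarrow> 0 \<in> G \<and> (\<forall>x\<in>G. \<forall>y\<in>G. x + y \<in> G) \<and> (\<forall>x\<in>G. - x \<in> G)"

lemma add_closed_int_hull: "add_closed (int_hull S)"
  unfolding add_closed_def by (auto intro: int_hull.intros)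

lemma add_closed_of_nat_mult: "add_closed G \<Longrightarrow> x \<in> G \<Longrightarrow> of_nat n * x \<in> G"
  by (induction n) (auto simp: add_closed_def algebra_simps)

lemma add_closed_of_int_mult:
  assumes "add_closed G" "x \<in> G"
  shows "of_int n * x \<in> G"
proof (cases n rule: int_cases2)
  case (nonneg k)
  then show ?thesis using add_closed_of_nat_mult[OF assms] by simp
next
  case (nonpos k)
  then have "of_int n * x = - (of_nat k * x)" by simp
  then show ?thesis using add_closed_of_nat_mult[OF assms, of k] assms(1) by (simp add: add_closed_def)
qed

lemma add_closed_diff: "add_closed G \<Longrightarrow> x \<in> G \<Longrightarrow> y \<in> G \<Longrightarrow> x - y \<in> G"
  unfolding add_closed_def by (metis diff_conv_add_uminus)

lemma add_closed_sum: "add_closed G \<Longrightarrow> (\<And>i. i \<in> I \<Longrightarrow> f i \<in> G) \<Longrightarrow> sum f I \<in> G"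
  by (induction I rule: infinite_finite_induct) (auto simp: add_closed_def)

lemma int_hull_least: "add_closed G \<Longrightarrow> S \<subseteq> G \<Longrightarrow> int_hull S \<subseteq> G"
proof
  fix x assume "add_closed G" "S \<subseteq> G" "x \<in> int_hull S"
  show "x \<in> G" using \<open>x \<in> int_hull S\<close>
    by induction (use \<open>add_closed G\<close> \<open>S \<subseteq> G\<close> in \<open>auto simp: add_closed_def\<close>)
qed

lemma int_hull_insert:
  "z \<in> int_hull (insert v S) \<Longrightarrow> \<exists>c::int. \<exists>w\<in>int_hull S. z = of_int c * v + w"
proof (induction rule: int_hull.induct)
  case int_hull_0
  show ?case by (rule exI[of _ 0], rule bexI[of _ 0]) (auto intro: int_hull.intros)
next
  case (int_hull_base s)
  show ?case
  proof (cases "s = v")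
    case True
    then show ?thesis by (intro exI[of _ 1] bexI[of _ 0]) (auto intro: int_hull.intros)
  next
    case False
    then show ?thesis using int_hull_base
      by (intro exI[of _ 0] bexI[of _ s]) (auto intro: int_hull.intros)
  qed
next
  case (int_hull_add x y)
  then obtain c w c' w' where "w \<in> int_hull S" "w' \<in> int_hull S" "x = of_int c * v + w" "y = of_int c' * v + w'"
    by blast
  then show ?case
    by (intro exI[of _ "c + c'"] bexI[of _ "w + w'"]) (auto intro: int_hull.intros simp: algebra_simps)
next
  case (int_hull_minus x)
  then obtain c w where "w \<in> int_hull S" "x = of_int c * v + w"
    by blast
  then show ?case
    by (intro exI[of _ "- c"] bexI[of _ "- w"]) (auto intro: int_hull.intros simp: algebra_simps)
qed

lemma int_subgroup_cyclic:
  fixes G :: "int set"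
  assumes "0 \<in> G" "\<And>x y. x \<in> G \<Longrightarrow> y \<in> G \<Longrightarrow> x - y \<in> G"
  shows "\<exists>g\<in>G. \<forall>x\<in>G. g dvd x"
proof (cases "G = {0}")
  case True
  then show ?thesis by auto
next
  case False
  have neg: "- x \<in> G" if "x \<in> G" for x using assms(2)[OF assms(1) that] by simp
  have add: "x + y \<in> G" if "x \<in> G" "y \<in> G" for x y using assms(2)[OF that(1) neg[OF that(2)]] by simp
  have muln: "int n * x \<in> G" if "x \<in> G" for n x
    by (induction n) (auto simp: assms(1) that add algebra_simps)
  have mul: "k * x \<in> G" if "x \<in> G" for k x
    by (cases k rule: int_cases2) (use muln[OF that] neg in fastforce)+
  obtain x1 where x1: "x1 \<in> G" "x1 \<noteq> 0" using False assms(1) by blast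
  obtain x0 where x0: "x0 \<in> G" "x0 > 0"
    by (cases "x1 > 0") (use x1 neg[OF x1(1)] in force)+
  define n where "n = (LEAST n. n > 0 \<and> int n \<in> G)"
  have ex: "\<exists>n. n > 0 \<and> int n \<in> G" by (rule exI[of _ "nat x0"]) (use x0 in auto)
  have n: "n > 0" "int n \<in> G" using LeastI_ex[OF ex] by (auto simp: n_def)
  have "int n dvd x" if "x \<in> G" for x
  proof (rule ccontr)
    assume nd: "\<not> int n dvd x"
    have "x mod int n = x - (x div int n) * int n" by (simp add: minus_div_mult_eq_mod)
    then have "x mod int n \<in> G" using assms(2)[OF that mul[OF n(2)]] by simp
    moreover have "0 < x mod int n" using nd n(1) by (metis dvd_eq_mod_eq_0 of_nat_0_less_iff order_le_less pos_mod_sign)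
    ultimately have "nat (x mod int n) > 0 \<and> int (nat (x mod int n)) \<in> G" by auto
    then have "n \<le> nat (x mod int n)" unfolding n_def by (rule Least_le)
    then show False using n(1) pos_mod_bound[of "int n" x] by linarith
  qed
  then show ?thesis using n by blast
qed

text \<open>Induction on the generators. The coefficients with which the new generator
  \<open>v\<close> occurs in elements of \<open>G\<close> form a subgroup of \<int>; an element
  \<open>e\<close> of \<open>G\<close> realising the generator of that subgroup is kept, and
  subtracting multiples of \<open>e\<close> moves every other element of \<open>G\<close> into
  \<open>int_hull S\<close>.\<close>

lemma add_closed_finitely_generated:
  assumes "finite S" "add_closed G" "G \<subseteq> int_hull S"
  shows "\<exists>T. finite T \<and> T \<subseteq> G \<and> G \<subseteq> int_hull T"
  using assms
proof (induction S arbitrary: G rule: finite_induct)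
  case empty
  have "int_hull {} \<subseteq> {0}" by (rule int_hull_least) (auto simp: add_closed_def)
  then have "G \<subseteq> int_hull {}" using empty by (auto intro: int_hull.intros)
  then show ?case by blast
next
  case (insert v S)
  define C where "C = {c::int. \<exists>w\<in>int_hull S. of_int c * v + w \<in> G}"
  have "\<exists>g\<in>C. \<forall>x\<in>C. g dvd x"
  proof (rule int_subgroup_cyclic)
    show "0 \<in> C" using insert.prems(1) unfolding C_def add_closed_def
      by (auto intro!: bexI[of _ 0] int_hull.intros)
    fix x y assume "x \<in> C" "y \<in> C"
    then obtain w w' where w: "w \<in> int_hull S" "w' \<in> int_hull S" "of_int x * v + w \<in> G" "of_int y * v + w' \<in> G"
      unfolding C_def by blast
    have "of_int (x - y) * v + (w - w') \<in> G" using add_closed_diff[OF insert.prems(1) w(3,4)]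
      by (simp add: algebra_simps)
    moreover have "w - w' \<in> int_hull S" by (rule add_closed_diff[OF add_closed_int_hull w(1,2)])
    ultimately show "x - y \<in> C" unfolding C_def by blast
  qed
  then obtain g w0 where g: "w0 \<in> int_hull S" "of_int g * v + w0 \<in> G" "\<forall>x\<in>C. g dvd x" unfolding C_def by blast
  define e where "e = of_int g * v + w0"
  have "add_closed (G \<inter> int_hull S)"
    using insert.prems(1) add_closed_int_hull[of S] by (auto simp: add_closed_def)
  then obtain T where T: "finite T" "T \<subseteq> G \<inter> int_hull S" "G \<inter> int_hull S \<subseteq> int_hull T"
    using insert.IH[of "G \<inter> int_hull S"] by blast
  have sub: "G \<subseteq> int_hull (insert e T)"
  proof
    fix z assume z: "z \<in> G"
    obtain c w where cw: "w \<in> int_hull S" "z = of_int c * v + w"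
      using int_hull_insert[of z v S] z insert.prems(2) by blast
    then have "c \<in> C" using z unfolding C_def by blast
    then obtain k where k: "c = g * k" using g(3) by blast
    have "z - of_int k * e = w - of_int k * w0" unfolding e_def cw(2) k by (simp add: algebra_simps)
    moreover have "z - of_int k * e \<in> G"
      by (rule add_closed_diff[OF insert.prems(1) z]) (rule add_closed_of_int_mult[OF insert.prems(1)], use g e_def in simp)
    moreover have "w - of_int k * w0 \<in> int_hull S"
      by (rule add_closed_diff[OF add_closed_int_hull cw(1)]) (rule add_closed_of_int_mult[OF add_closed_int_hull g(1)])
    ultimately have "z - of_int k * e \<in> int_hull T" using T by auto
    moreover have "int_hull T \<subseteq> int_hull (insert e T)"
      by (rule int_hull_least[OF add_closed_int_hull]) (auto intro: int_hull.intros)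
    moreover have "of_int k * e \<in> int_hull (insert e T)"
      by (rule add_closed_of_int_mult[OF add_closed_int_hull]) (auto intro: int_hull.intros)
    ultimately have "(z - of_int k * e) + of_int k * e \<in> int_hull (insert e T)"
      by (intro int_hull.int_hull_add) auto
    then show "z \<in> int_hull (insert e T)" by simp
  qed
  show ?case by (rule exI[of _ "insert e T"]) (use sub T g e_def in auto)
qed

lemma int_poly_eqI:
  shows "poly (map_poly of_int (p + q)) (x::complex) = poly (map_poly of_int p) x + poly (map_poly of_int q) x"
    "poly (map_poly of_int (- p)) (x::complex) = - poly (map_poly of_int p) x"
    "poly (map_poly of_int (p - q)) (x::complex) = poly (map_poly of_int p) x - poly (map_poly of_int q) x"
    "poly (map_poly of_int (p * q)) (x::complex) = poly (map_poly of_int p) x * poly (map_poly of_int q) x"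
    "poly (map_poly of_int (monom c n)) (x::complex) = of_int c * x ^ n"
proof -
  show "poly (map_poly of_int (p + q)) (x::complex) = poly (map_poly of_int p) x + poly (map_poly of_int q) x"
    by (simp flip: poly_add) (rule arg_cong[where f="\<lambda>p. poly p x"], simp add: poly_eq_iff coeff_map_poly)
  show "poly (map_poly of_int (- p)) (x::complex) = - poly (map_poly of_int p) x"
    by (simp flip: poly_minus) (rule arg_cong[where f="\<lambda>p. poly p x"], simp add: poly_eq_iff coeff_map_poly)
  show "poly (map_poly of_int (p - q)) (x::complex) = poly (map_poly of_int p) x - poly (map_poly of_int q) x"
    by (simp flip: poly_diff) (rule arg_cong[where f="\<lambda>p. poly p x"], simp add: poly_eq_iff coeff_map_poly)
  show "poly (map_poly of_int (p * q)) (x::complex) = poly (map_poly of_int p) x * poly (map_poly of_int q) x"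
    by (simp flip: poly_mult) (rule arg_cong[where f="\<lambda>p. poly p x"], simp add: poly_eq_iff coeff_map_poly coeff_mult)
  show "poly (map_poly of_int (monom c n)) (x::complex) = of_int c * x ^ n"
    by (simp add: map_poly_monom poly_monom)
qed

text \<open>The ring generated by \<open>x\<close> lies in a finitely generated group, hence is
  generated as a group by finitely many of its own elements, that is by polynomials in
  \<open>x\<close> of bounded degree. A power of \<open>x\<close> beyond these degrees is then an
  integral combination of lower powers, which is a monic equation.\<close>

lemma algebraic_int_if_powers_in_hull:
  assumes "finite S" "\<And>k. x ^ k \<in> int_hull S"
  shows "algebraic_int x"
proof -
  define ev where "ev = (\<lambda>f. poly (map_poly of_int f) x)"
  define G where "G = range ev"
  have ac: "add_closed G"
    unfolding add_closed_def G_def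
  proof (intro conjI ballI)
    show "0 \<in> range ev" by (rule range_eqI[of _ _ 0]) (simp add: ev_def)
    show "a + b \<in> range ev" if "a \<in> range ev" "b \<in> range ev" for a b
      using that by (auto simp: ev_def int_poly_eqI(1)[symmetric])
    show "- a \<in> range ev" if "a \<in> range ev" for a
      using that by (auto simp: ev_def int_poly_eqI(2)[symmetric])
  qed
  have "ev f \<in> int_hull S" for f
    unfolding ev_def poly_altdef
    by (rule add_closed_sum[OF add_closed_int_hull])
      (auto simp: coeff_map_poly intro: add_closed_of_int_mult[OF add_closed_int_hull] assms)
  then have "G \<subseteq> int_hull S" unfolding G_def by auto
  then obtain T where T: "finite T" "T \<subseteq> G" "G \<subseteq> int_hull T"
    using add_closed_finitely_generated[OF assms(1) ac] by blast
  obtain F where F: "\<And>t. t \<in> T \<Longrightarrow> t = ev (F t)" using T(2) unfolding G_def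
    by (metis image_iff subset_iff)
  \<comment> \<open>The inserted 0 keeps \<open>Max\<close> meaningful when \<open>T\<close> is
    empty.\<close>
  define N where "N = Suc (Max (insert 0 ((\<lambda>t. degree (F t)) ` T)))"
  have N: "degree (F t) < N" if "t \<in> T" for t
    unfolding N_def less_Suc_eq_le by (rule Max_ge) (use that T(1) in auto)
  define L where "L = {ev f | f. degree f < N}"
  have "add_closed L"
    unfolding add_closed_def
  proof (intro conjI ballI)
    show "0 \<in> L" unfolding L_def by (auto intro!: exI[of _ 0] simp: ev_def N_def)
    show "a + b \<in> L" if ab: "a \<in> L" "b \<in> L" for a b
    proof -
      obtain f g where "a = ev f" "b = ev g" "degree f < N" "degree g < N" using ab unfolding L_def by blast
      then show ?thesis unfolding L_def by (auto intro!: exI[of _ "f + g"] degree_add_less simp: ev_def int_poly_eqI)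
    qed
    show "- a \<in> L" if ab: "a \<in> L" for a
    proof -
      obtain f where "a = ev f" "degree f < N" using ab unfolding L_def by auto
      then show ?thesis unfolding L_def by (auto intro!: exI[of _ "- f"] simp: ev_def int_poly_eqI)
    qed
  qed
  then have "int_hull T \<subseteq> L" by (rule int_hull_least) (use N F L_def in blast)
  moreover have "x ^ N \<in> G" unfolding G_def by (rule range_eqI[of _ _ "monom 1 N"]) (simp add: ev_def int_poly_eqI)
  ultimately obtain f where f: "x ^ N = ev f" "degree f < N" using T(3) unfolding L_def by auto
  define h where "h = monom 1 N - f"
  have "degree h = N" unfolding h_def
    using degree_add_eq_left[of "- f" "monom 1 N"] f(2) by (simp add: degree_monom_eq)
  moreover have "coeff h N = 1" unfolding h_def using f(2) by (simp add: coeff_eq_0)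
  ultimately have "lead_coeff h = 1" by simp
  moreover have "poly (map_poly of_int h) x = 0" unfolding h_def int_poly_eqI using f(1) by (simp add: ev_def)
  ultimately show ?thesis unfolding algebraic_int_altdef_ipoly by blast
qed

lemma algebraic_int_power_rel:
  assumes "algebraic_int (x::complex)"
  obtains n a where "n > 0" "x ^ n = (\<Sum>i<n. of_int (a i) * x ^ i)"
proof -
  obtain p where p: "poly (map_poly of_int p) x = 0" "lead_coeff p = 1"
    using assms unfolding algebraic_int_altdef_ipoly by blast
  have "degree p > 0"
  proof (rule ccontr)
    assume "\<not> degree p > 0"
    then have "p = [:1:]" using p(2) by (metis degree_eq_zeroE gr0I lead_coeff_pCons(2) coeff_pCons_0 degree_pCons_0)
    then show False using p(1) by (simp add: one_pCons[symmetric])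
  qed
  have "0 = (\<Sum>i\<le>degree p. of_int (coeff p i) * x ^ i)"
    using p(1) by (simp add: poly_altdef degree_map_poly coeff_map_poly)
  also have "\<dots> = (\<Sum>i<degree p. of_int (coeff p i) * x ^ i) + x ^ degree p"
    using p(2) by (simp add: lessThan_Suc_atMost[symmetric])
  finally have "x ^ degree p = (\<Sum>i<degree p. of_int (- coeff p i) * x ^ i)"
    by (simp add: sum_negf eq_neg_iff_add_eq_0 add.commute)
  then show ?thesis using that[of "degree p" "\<lambda>i. - coeff p i"] \<open>degree p > 0\<close> by simp
qed

text \<open>The monomials x^i y^j below the degrees of the two monic equations span a group that
  contains 1 and is mapped into itself by multiplication with \<open>x\<close> and with
  \<open>y\<close>. Hence it contains all powers of x + y and of x y.\<close>

lemma algebraic_int_subring: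
  assumes "algebraic_int x" "algebraic_int y"
  shows algebraic_int_add: "algebraic_int (x + y)" and algebraic_int_mult: "algebraic_int (x * y :: complex)"
proof -
  obtain n a where n: "n > 0" "x ^ n = (\<Sum>i<n. of_int (a i) * x ^ i)" by (rule algebraic_int_power_rel[OF assms(1)])
  obtain m b where m: "m > 0" "y ^ m = (\<Sum>i<m. of_int (b i) * y ^ i)" by (rule algebraic_int_power_rel[OF assms(2)])
  define S where "S = (\<lambda>(i,j). x ^ i * y ^ j) ` ({..<n} \<times> {..<m})"
  have S: "x ^ i * y ^ j \<in> int_hull S" if "i < n" "j < m" for i j
    by (rule int_hull_base) (use that S_def in force)
  have mult: "c * z \<in> int_hull S" if z: "z \<in> int_hull S" and c: "\<forall>s\<in>S. c * s \<in> int_hull S" for c z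
    using z
  proof induction
    case int_hull_0
    show ?case by (simp add: int_hull.int_hull_0)
  next
    case (int_hull_base s)
    then show ?case using c by simp
  next
    case (int_hull_add u v)
    then show ?case by (simp add: distrib_left int_hull.int_hull_add)
  next
    case (int_hull_minus u)
    then show ?case by (simp add: int_hull.int_hull_minus)
  qed
  have "x * s \<in> int_hull S" if sS: "s \<in> S" for s
  proof -
    obtain i j where s: "s = x ^ i * y ^ j" "i < n" "j < m" using sS unfolding S_def by (elim imageE SigmaE) auto
    show ?thesis
    proof (cases "Suc i < n")
      case True
      then show ?thesis using S[of "Suc i" j] s by (simp add: mult.assoc)
    next
      case False
      then have "x * s = x ^ n * y ^ j" using s by (metis Suc_lessI mult.assoc power_Suc)
      also have "\<dots> = (\<Sum>i<n. of_int (a i) * (x ^ i * y ^ j))" unfolding n(2) by (simp add: sum_distrib_right mult.assoc)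
      finally show ?thesis using S s(3)
        by (auto intro!: add_closed_sum add_closed_of_int_mult add_closed_int_hull)
    qed
  qed
  then have x: "x * z \<in> int_hull S" if "z \<in> int_hull S" for z using mult that by blast
  have "y * s \<in> int_hull S" if sS: "s \<in> S" for s
  proof -
    obtain i j where s: "s = x ^ i * y ^ j" "i < n" "j < m" using sS unfolding S_def by (elim imageE SigmaE) auto
    show ?thesis
    proof (cases "Suc j < m")
      case True
      then show ?thesis using S[of i "Suc j"] s by (simp add: mult.left_commute)
    next
      case False
      then have "y * s = x ^ i * y ^ m" using s by (metis Suc_lessI mult.left_commute power_Suc)
      also have "\<dots> = (\<Sum>j<m. of_int (b j) * (x ^ i * y ^ j))" unfolding m(2)
        by (simp add: sum_distrib_left mult.left_commute)
      finally show ?thesis using S s(2)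
        by (auto intro!: add_closed_sum add_closed_of_int_mult add_closed_int_hull)
    qed
  qed
  then have y: "y * z \<in> int_hull S" if "z \<in> int_hull S" for z using mult that by blast
  have one: "1 \<in> int_hull S" using S[OF n(1) m(1)] by simp
  have "(x + y) ^ k \<in> int_hull S" for k
    by (induction k) (auto simp: one distrib_right intro!: int_hull.int_hull_add x y)
  then show "algebraic_int (x + y)" by (rule algebraic_int_if_powers_in_hull[rotated]) (simp add: S_def)
  have "(x * y) ^ k \<in> int_hull S" for k
    by (induction k) (auto simp: one mult.assoc intro!: x y)
  then show "algebraic_int (x * y)" by (rule algebraic_int_if_powers_in_hull[rotated]) (simp add: S_def)
qed

lemma algebraic_int_diff: "algebraic_int x \<Longrightarrow> algebraic_int y \<Longrightarrow> algebraic_int (x - y :: complex)"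
  using algebraic_int_add[of x "- y"] by auto

lemma algebraic_int_power: "algebraic_int x \<Longrightarrow> algebraic_int (x ^ n :: complex)"
  by (induction n) (auto intro: algebraic_int_mult)

lemma algebraic_int_prod: "(\<And>i. i \<in> I \<Longrightarrow> algebraic_int (f i)) \<Longrightarrow> algebraic_int (prod f I :: complex)"
  by (induction I rule: infinite_finite_induct) (auto intro: algebraic_int_mult)

section \<open>Products of modules\<close>

lemma CC_simps [simp]:
  "carrier CC = UNIV" "x \<otimes>\<^bsub>CC\<^esub> y = x * y" "x \<oplus>\<^bsub>CC\<^esub> y = x + y" "\<one>\<^bsub>CC\<^esub> = 1" "\<zero>\<^bsub>CC\<^esub> = 0"
  by (simp_all add: ring_of_type_algebra_def)

abbreviation set_prod :: "complex set \<Rightarrow> complex set \<Rightarrow> complex set" (infixl "\<diamondop>" 75)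
  where "I \<diamondop> J \<equiv> ideal_prod CC I J"

lemma set_prod_mult: "i \<in> I \<Longrightarrow> j \<in> J \<Longrightarrow> i * j \<in> I \<diamondop> J"
  using ideal_prod.prod[of i I j J CC] by simp

lemma set_prod_add: "x \<in> I \<diamondop> J \<Longrightarrow> y \<in> I \<diamondop> J \<Longrightarrow> x + y \<in> I \<diamondop> J"
  using ideal_prod.sum[of x CC I J y] by simp

lemma set_prod_induct [consumes 1, case_names mult add]:
  assumes "x \<in> I \<diamondop> J" "\<And>i j. i \<in> I \<Longrightarrow> j \<in> J \<Longrightarrow> P (i * j)" "\<And>x y. P x \<Longrightarrow> P y \<Longrightarrow> P (x + y)"
  shows "P x"
  using assms(1) by (induction rule: ideal_prod.induct) (auto intro: assms(2,3))

lemma set_prod_least: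
  assumes "\<And>i j. i \<in> I \<Longrightarrow> j \<in> J \<Longrightarrow> i * j \<in> G" "\<And>x y. x \<in> G \<Longrightarrow> y \<in> G \<Longrightarrow> x + y \<in> G"
  shows "I \<diamondop> J \<subseteq> G"
proof
  fix x assume "x \<in> I \<diamondop> J"
  then show "x \<in> G" by (induction rule: set_prod_induct) (auto intro: assms)
qed

lemma set_prod_mono: "I \<subseteq> I' \<Longrightarrow> J \<subseteq> J' \<Longrightarrow> I \<diamondop> J \<subseteq> I' \<diamondop> J'"
  by (rule set_prod_least) (auto intro: set_prod_mult set_prod_add)

lemma set_prod_commute: "I \<diamondop> J = J \<diamondop> I"
proof -
  have "I \<diamondop> J \<subseteq> J \<diamondop> I" for I J :: "complex set"
  proof (rule set_prod_least)
    show "i * j \<in> J \<diamondop> I" if "i \<in> I" "j \<in> J" for i j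
      using set_prod_mult[OF that(2,1)] by (simp add: mult.commute)
  qed (rule set_prod_add)
  then show ?thesis by blast
qed

lemma set_prod_assoc: "(I \<diamondop> J) \<diamondop> M = I \<diamondop> (J \<diamondop> M)"
proof
  show "(I \<diamondop> J) \<diamondop> M \<subseteq> I \<diamondop> (J \<diamondop> M)"
  proof (rule set_prod_least)
    fix x m assume "x \<in> I \<diamondop> J" and m: "m \<in> M"
    then show "x * m \<in> I \<diamondop> (J \<diamondop> M)"
      by (induction rule: set_prod_induct) (auto simp: mult.assoc distrib_right intro: m set_prod_mult set_prod_add)
  qed (rule set_prod_add)
  show "I \<diamondop> (J \<diamondop> M) \<subseteq> (I \<diamondop> J) \<diamondop> M"
  proof (rule set_prod_least)
    fix i x assume i: "i \<in> I" and "x \<in> J \<diamondop> M"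
    from this(2) show "i * x \<in> (I \<diamondop> J) \<diamondop> M"
      by (induction rule: set_prod_induct) (auto simp: mult.assoc[symmetric] distrib_left intro: i set_prod_mult set_prod_add)
  qed (rule set_prod_add)
qed

lemma set_prod_scale: "((\<lambda>x. c * x) ` I) \<diamondop> J = (\<lambda>x. c * x) ` (I \<diamondop> J)"
proof
  show "((\<lambda>x. c * x) ` I) \<diamondop> J \<subseteq> (\<lambda>x. c * x) ` (I \<diamondop> J)"
    by (rule set_prod_least) (auto simp: mult.assoc distrib_left[symmetric] intro!: imageI intro: set_prod_mult set_prod_add)
  have "c * x \<in> ((\<lambda>x. c * x) ` I) \<diamondop> J" if "x \<in> I \<diamondop> J" for x
    using that by (induction rule: set_prod_induct)
      (auto simp: mult.assoc[symmetric] distrib_left intro: set_prod_mult set_prod_add)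
  then show "(\<lambda>x. c * x) ` (I \<diamondop> J) \<subseteq> ((\<lambda>x. c * x) ` I) \<diamondop> J" by blast
qed

lemma set_prod_scale_right: "I \<diamondop> ((\<lambda>x. c * x) ` J) = (\<lambda>x. c * x) ` (I \<diamondop> J)"
  using set_prod_scale[of c J I] by (simp add: set_prod_commute)

lemma add_closed_set_prod:
  assumes "add_closed I" "J \<noteq> {}"
  shows "add_closed (I \<diamondop> J)"
proof -
  have "- x \<in> I \<diamondop> J" if "x \<in> I \<diamondop> J" for x
    using that
  proof (induction rule: set_prod_induct)
    case (mult i j)
    then show ?case using set_prod_mult[of "- i" I j J] assms by (simp add: add_closed_def)
  next
    case (add x y)
    then show ?case using set_prod_add[of "- x" I J "- y"] by simp
  qed
  moreover obtain j where "j \<in> J" using assms(2) by blast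
  then have "0 \<in> I \<diamondop> J" using set_prod_mult[of 0 I j J] assms(1) by (simp add: add_closed_def)
  ultimately show ?thesis unfolding add_closed_def by (auto intro: set_prod_add)
qed


section \<open>Rational linear algebra in \<open>\<complex>\<close>\<close>

interpretation QV: vector_space "\<lambda>(r::rat) (x::complex). of_rat r * x"
  by unfold_locales (simp_all add: distrib_left distrib_right of_rat_add of_rat_mult)

text \<open>More vectors than the size of a spanning set are dependent over \<rat>; multiplying by
  the product of the denominators makes the coefficients integral.\<close>

lemma integer_relation:
  fixes f :: "nat \<Rightarrow> complex"
  assumes "finite T" "\<And>i. f i \<in> QV.span T" "card T < N"
  shows "\<exists>c::nat \<Rightarrow> int. (\<exists>i<N. c i \<noteq> 0) \<and> (\<Sum>i<N. of_int (c i) * f i) = 0"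
proof -
  have "\<exists>r::nat \<Rightarrow> rat. (\<exists>i<N. r i \<noteq> 0) \<and> (\<Sum>i<N. of_rat (r i) * f i) = 0"
  proof (cases "inj_on f {..<N}")
    \<comment> \<open>Dependence is a property of sets of vectors, so a repeated value has to be
      turned into a relation separately.\<close>
    case False
    then obtain i j where ij: "i < N" "j < N" "i \<noteq> j" "f i = f j" by (auto simp: inj_on_def)
    define r :: "nat \<Rightarrow> rat" where "r = (\<lambda>k. if k = i then 1 else if k = j then -1 else 0)"
    have "(\<Sum>k<N. of_rat (r k) * f k) = (\<Sum>k\<in>{i,j}. of_rat (r k) * f k)"
      by (rule sum.mono_neutral_right) (use ij in \<open>auto simp: r_def\<close>)
    also have "\<dots> = 0" using ij by (simp add: r_def)
    finally show ?thesis using ij by (intro exI[of _ r]) (auto simp: r_def)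
  next
    case True
    then have "card (f ` {..<N}) = N" by (simp add: card_image)
    then have "QV.dependent (f ` {..<N})"
      using QV.independent_span_bound[of T "f ` {..<N}"] assms by auto
    then obtain u v where uv: "v \<in> f ` {..<N}" "u v \<noteq> 0" "(\<Sum>v\<in>f ` {..<N}. of_rat (u v) * v) = 0"
      using QV.dependent_finite[of "f ` {..<N}"] by auto
    have "(\<Sum>i<N. of_rat (u (f i)) * f i) = 0" using uv(3) by (simp add: sum.reindex[OF True])
    then show ?thesis using uv by (intro exI[of _ "u \<circ> f"]) auto
  qed
  then obtain r :: "nat \<Rightarrow> rat" where r: "\<exists>i<N. r i \<noteq> 0" "(\<Sum>i<N. of_rat (r i) * f i) = 0" by blast
  define D where "D = (\<Prod>i<N. snd (quotient_of (r i)))"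
  have dpos: "snd (quotient_of x) > 0" for x by (simp add: quotient_of_denom_pos')
  then have D: "D \<noteq> 0" unfolding D_def by (simp add: less_imp_neq[symmetric])
  have "\<exists>c. of_int c = of_int D * r i" if "i < N" for i
  proof -
    have "of_int (snd (quotient_of (r i))) * r i = of_int (fst (quotient_of (r i)))"
      using dpos[of "r i"] quotient_of_div[of "r i"] by (metis less_numeral_extra(3) nonzero_mult_div_cancel_left of_int_0_eq_iff prod.collapse times_divide_eq_right)
    moreover have "D = snd (quotient_of (r i)) * (\<Prod>i\<in>{..<N} - {i}. snd (quotient_of (r i)))"
      unfolding D_def using that by (intro prod.remove) auto
    ultimately have "of_int D * r i = of_int (fst (quotient_of (r i)) * (\<Prod>i\<in>{..<N} - {i}. snd (quotient_of (r i))))"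
      by (metis (no_types, lifting) mult.assoc mult.commute of_int_mult)
    then show ?thesis by metis
  qed
  then obtain c where c: "\<And>i. i < N \<Longrightarrow> of_int (c i) = of_int D * r i" by metis
  have "(\<Sum>i<N. of_int (c i) * f i) = (\<Sum>i<N. of_int D * (of_rat (r i) * f i))"
  proof (rule sum.cong)
    fix i assume "i \<in> {..<N}"
    then have "(of_int (c i) :: complex) = of_rat (of_int D * r i)" using c[of i] by (metis lessThan_iff of_rat_of_int_eq)
    then show "of_int (c i) * f i = of_int D * (of_rat (r i) * f i)" by (simp add: of_rat_mult)
  qed simp
  also have "\<dots> = 0" using r(2) by (simp add: sum_distrib_left[symmetric])
  finally show ?thesis using r(1) c D by (intro exI[of _ c]) (metis mult_eq_0_iff of_int_0 of_int_0_eq_iff)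
qed

text \<open>Among the nontrivial integral relations, one with the smallest sum of absolute values is
  taken; if \<open>q\<close> divided all its coefficients, dividing by \<open>q\<close> would give a
  smaller one. This allows relations to be reduced modulo a prime.\<close>

lemma integer_relation_not_all_divisible:
  fixes f :: "nat \<Rightarrow> complex"
  assumes "finite T" "\<And>i. f i \<in> QV.span T" "card T < N" "q > 1"
  shows "\<exists>c::nat \<Rightarrow> int. (\<exists>i<N. \<not> q dvd c i) \<and> (\<Sum>i<N. of_int (c i) * f i) = 0"
proof -
  define Q where "Q = (\<lambda>c::nat \<Rightarrow> int. (\<exists>i<N. c i \<noteq> 0) \<and> (\<Sum>i<N. of_int (c i) * f i) = 0)"
  define M where "M = (\<lambda>c::nat \<Rightarrow> int. \<Sum>i<N. nat \<bar>c i\<bar>)"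
  have "\<exists>c. Q c" unfolding Q_def by (rule integer_relation[OF assms(1-3)])
  then obtain c where c: "Q c" "\<And>c'. Q c' \<Longrightarrow> M c \<le> M c'"
    using ex_has_least_nat[of Q _ M] by metis
  have "\<exists>i<N. \<not> q dvd c i"
  proof (rule ccontr)
    assume "\<not> (\<exists>i<N. \<not> q dvd c i)"
    then have dv: "c i = q * (c i div q)" if "i < N" for i using that by auto
    have "(\<Sum>i<N. of_int (c i) * f i) = (\<Sum>i<N. of_int q * (of_int (c i div q) * f i))"
    proof (rule sum.cong)
      fix i assume "i \<in> {..<N}"
      then have "(of_int (c i) :: complex) = of_int q * of_int (c i div q)" using dv[of i] by (metis lessThan_iff of_int_mult)
      then show "of_int (c i) * f i = of_int q * (of_int (c i div q) * f i)" by simp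
    qed simp
    then have "of_int q * (\<Sum>i<N. of_int (c i div q) * f i) = 0"
      using c(1) by (simp add: Q_def sum_distrib_left)
    then have "(\<Sum>i<N. of_int (c i div q) * f i) = 0" using assms(4) by simp
    moreover obtain i where "i < N" "c i \<noteq> 0" using c(1) Q_def by blast
    then have "i < N" "c i div q \<noteq> 0" using dv[of i] by auto
    ultimately have "Q (\<lambda>i. c i div q)" unfolding Q_def by blast
    then have "M c \<le> M (\<lambda>i. c i div q)" by (rule c(2))
    moreover have "M (\<lambda>i. c i div q) < M c"
    proof -
      obtain i where i: "i < N" "c i \<noteq> 0" using c(1) Q_def by blast
      have *: "nat \<bar>c j\<bar> = nat q * nat \<bar>c j div q\<bar>" if "j < N" for j
        using dv[OF that] assms(4) by (metis abs_mult abs_of_pos less_trans nat_mult_distrib order_less_imp_le zero_less_one)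
      show ?thesis unfolding M_def
      proof (rule sum_strict_mono_ex1)
        show "\<forall>j\<in>{..<N}. nat \<bar>c j div q\<bar> \<le> nat \<bar>c j\<bar>" using * assms(4) by auto
        show "\<exists>j\<in>{..<N}. nat \<bar>c j div q\<bar> < nat \<bar>c j\<bar>"
          using *[OF i(1)] i assms(4) by (intro bexI[of _ i]) auto
      qed simp
    qed
    ultimately show False by simp
  qed
  then show ?thesis using c(1) Q_def by blast
qed

lemma algebraic_int_multiple:
  fixes x :: complex
  assumes "finite T" "\<And>i. x ^ i \<in> QV.span T"
  shows "\<exists>n>0::nat. algebraic_int (of_nat n * x)"
proof -
  obtain c where c: "\<exists>i<Suc (card T). c i \<noteq> (0::int)" "(\<Sum>i<Suc (card T). of_int (c i) * x ^ i) = 0"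
    using integer_relation[of T "\<lambda>i. x ^ i" "Suc (card T)"] assms by (auto simp del: sum.lessThan_Suc)
  define p where "p = (\<Sum>i<Suc (card T). monom (c i) i)"
  have cp: "coeff p i = (if i < Suc (card T) then c i else 0)" for i
    unfolding p_def by (simp add: coeff_sum del: sum.lessThan_Suc)
  have "p \<noteq> 0" using c(1) cp by (metis coeff_0)
  have "degree p < Suc (card T)" unfolding less_Suc_eq_le by (rule degree_le) (use cp in auto)
  have "(\<Sum>i<Suc (card T). of_int (c i) * x ^ i) = (\<Sum>i<Suc (card T). of_int (coeff p i) * x ^ i)"
    by (rule sum.cong) (auto simp: cp)
  also have "\<dots> = (\<Sum>i\<le>degree p. of_int (coeff p i) * x ^ i)"
    by (rule sum.mono_neutral_right) (use \<open>degree p < _\<close> in \<open>auto simp: coeff_eq_0\<close>)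
  finally have px: "(\<Sum>i\<le>degree p. of_int (coeff p i) * x ^ i) = 0" using c(2) by simp
  define a where "a = lead_coeff p"
  define n where "n = degree p"
  have a: "a \<noteq> 0" using \<open>p \<noteq> 0\<close> a_def by simp
  have "n > 0"
  proof (rule ccontr)
    assume "\<not> n > 0"
    then show False using px a by (simp add: n_def a_def)
  qed
  have px': "(\<Sum>i<n. of_int (coeff p i) * x ^ i) + of_int a * x ^ n = 0"
    using px by (simp add: n_def a_def lessThan_Suc_atMost[symmetric])
  \<comment> \<open>This is a^(n-1) p(X / a), where n is the degree and a the leading coefficient of
    p: it is monic with integral coefficients and vanishes at a x.\<close>
  define q where "q = (\<Sum>i<n. monom (coeff p i * a ^ (n - 1 - i)) i) + monom 1 n"
  have cq: "coeff q i = (if i < n then coeff p i * a ^ (n - 1 - i) else if i = n then 1 else 0)" for i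
    unfolding q_def by (simp add: coeff_sum)
  have dq: "degree q = n" by (rule antisym[OF degree_le le_degree]) (auto simp: cq)
  have "poly (map_poly of_int q) (of_int a * x) = (\<Sum>i\<le>n. of_int (coeff q i) * (of_int a * x) ^ i)"
    by (simp add: poly_altdef degree_map_poly coeff_map_poly dq)
  also have "\<dots> = (\<Sum>i<n. of_int (coeff q i) * (of_int a * x) ^ i) + (of_int a * x) ^ n"
    by (simp add: lessThan_Suc_atMost[symmetric] cq)
  also have "(\<Sum>i<n. of_int (coeff q i) * (of_int a * x) ^ i) = of_int a ^ (n - 1) * (\<Sum>i<n. of_int (coeff p i) * x ^ i)"
    unfolding sum_distrib_left
  proof (rule sum.cong)
    fix i assume i: "i \<in> {..<n}"
    define k where "k = n - 1 - i"
    have k: "n - 1 = k + i" "n - Suc i = k" using i by (simp_all add: k_def)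
    show "of_int (coeff q i) * (of_int a * x) ^ i = of_int a ^ (n - 1) * (of_int (coeff p i) * x ^ i)"
      using i unfolding k(1) by (simp add: cq k(2) power_mult_distrib power_add)
  qed simp
  also have "(of_int a * x) ^ n = of_int a ^ (n - 1) * (of_int a * x ^ n)"
    using \<open>n > 0\<close> by (cases n) (auto simp: power_mult_distrib)
  finally have "poly (map_poly of_int q) (of_int a * x) = of_int a ^ (n - 1) * ((\<Sum>i<n. of_int (coeff p i) * x ^ i) + of_int a * x ^ n)"
    by (simp add: distrib_left)
  then have "poly (map_poly of_int q) (of_int a * x) = 0" using px' by simp
  moreover have "lead_coeff q = 1" using dq cq by simp
  ultimately have "algebraic_int (of_int a * x)" unfolding algebraic_int_altdef_ipoly by blast
  then have "algebraic_int (of_int \<bar>a\<bar> * x)" by (cases "a \<ge> 0") (auto simp: abs_if)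
  then show ?thesis using a by (intro exI[of _ "nat \<bar>a\<bar>"]) auto
qed

section \<open>Rings of integers\<close>

lemma int_poly_pcompose:
  "poly (map_poly of_int (pcompose p q)) (x::complex) = poly (map_poly of_int p) (poly (map_poly of_int q) x)"
proof (induction p)
  case 0
  then show ?case by simp
next
  case (pCons a p)
  have "poly (map_poly of_int (pCons b r)) y = of_int b + y * poly (map_poly of_int r) y" for b r and y :: complex
    by (cases "b = 0 \<and> r = 0") (auto simp: map_poly_pCons)
  then show ?case using pCons.IH by (simp add: pcompose_pCons int_poly_eqI)
qed

text \<open>The degree enters only through a finite set spanning \<open>K\<close> over \<rat>,
  possibly from outside \<open>K\<close>: all that is drawn from it is a bound on the number of
  independent elements.\<close>

locale number_field =
  fixes K :: "complex set"
  assumes one_mem: "1 \<in> K"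
    and diff_mem: "x \<in> K \<Longrightarrow> y \<in> K \<Longrightarrow> x - y \<in> K"
    and mult_mem: "x \<in> K \<Longrightarrow> y \<in> K \<Longrightarrow> x * y \<in> K"
    and inverse_mem: "x \<in> K \<Longrightarrow> inverse x \<in> K"
    and finite_degree: "\<exists>T. finite T \<and> K \<subseteq> QV.span T"
begin

lemma zero_mem: "0 \<in> K"
  using diff_mem[OF one_mem one_mem] by simp

lemma minus_mem: "x \<in> K \<Longrightarrow> - x \<in> K"
  using diff_mem[OF zero_mem] by simp

lemma add_mem: "x \<in> K \<Longrightarrow> y \<in> K \<Longrightarrow> x + y \<in> K"
  using diff_mem[of x "- y"] minus_mem[of y] by simp

lemma divide_mem: "x \<in> K \<Longrightarrow> y \<in> K \<Longrightarrow> x / y \<in> K"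
  using mult_mem[of x "inverse y"] inverse_mem[of y] by (simp add: divide_inverse)

lemma power_mem: "x \<in> K \<Longrightarrow> x ^ n \<in> K"
  by (induction n) (auto intro: one_mem mult_mem)

lemma of_nat_mem: "of_nat n \<in> K"
  by (induction n) (auto intro: zero_mem one_mem add_mem)

lemma of_int_mem: "of_int n \<in> K"
  by (cases n rule: int_cases2) (auto intro: of_nat_mem minus_mem)

lemma numeral_mem: "numeral n \<in> K"
  using of_nat_mem[of "numeral n"] by simp

lemma of_rat_mem: "of_rat r \<in> K"
  by (cases r) (auto simp: of_rat_rat intro: divide_mem of_int_mem)

lemma Rats_mem: "x \<in> \<rat> \<Longrightarrow> x \<in> K"
  by (auto elim!: Rats_cases intro: of_rat_mem)

lemma sum_mem: "(\<And>i. i \<in> I \<Longrightarrow> f i \<in> K) \<Longrightarrow> sum f I \<in> K"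
  by (induction I rule: infinite_finite_induct) (auto intro: zero_mem add_mem)

lemma prod_mem: "(\<And>i. i \<in> I \<Longrightarrow> f i \<in> K) \<Longrightarrow> prod f I \<in> K"
  by (induction I rule: infinite_finite_induct) (auto intro: one_mem mult_mem)

definition OK :: "complex set"
  where "OK = {x \<in> K. algebraic_int x}"

lemma carrier_ring_of_integers [simp]: "carrier (ring_of_integers K) = OK"
  by (simp add: ring_of_integers_def OK_def)

lemma OK_mem: "x \<in> OK \<Longrightarrow> x \<in> K"
  by (simp add: OK_def)

lemma OK_0 [simp]: "0 \<in> OK" and OK_1 [simp]: "1 \<in> OK" and OK_of_int [simp]: "of_int n \<in> OK"
  and OK_of_nat [simp]: "of_nat m \<in> OK"
  by (auto simp: OK_def zero_mem one_mem of_int_mem of_nat_mem)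

lemma OK_add: "x \<in> OK \<Longrightarrow> y \<in> OK \<Longrightarrow> x + y \<in> OK"
  and OK_diff: "x \<in> OK \<Longrightarrow> y \<in> OK \<Longrightarrow> x - y \<in> OK"
  and OK_mult: "x \<in> OK \<Longrightarrow> y \<in> OK \<Longrightarrow> x * y \<in> OK"
  and OK_minus: "x \<in> OK \<Longrightarrow> - x \<in> OK"
  and OK_power: "x \<in> OK \<Longrightarrow> x ^ n \<in> OK"
  by (auto simp: OK_def intro: add_mem mult_mem diff_mem minus_mem power_mem algebraic_int_add algebraic_int_mult
      algebraic_int_diff algebraic_int_power)

lemma OK_prod: "(\<And>i. i \<in> I \<Longrightarrow> f i \<in> OK) \<Longrightarrow> prod f I \<in> OK"
  by (auto simp: OK_def intro: prod_mem algebraic_int_prod)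

lemma add_closed_OK: "add_closed OK"
  by (auto simp: add_closed_def intro: OK_add OK_minus)

lemma OK_rational: "x \<in> OK \<Longrightarrow> x \<in> \<rat> \<Longrightarrow> x \<in> \<int>"
  using rational_algebraic_int_is_int by (auto simp: OK_def)

lemma integral_multiple:
  assumes "x \<in> K"
  shows "\<exists>n>0::nat. of_nat n * x \<in> OK"
proof -
  obtain T where T: "finite T" "K \<subseteq> QV.span T" using finite_degree by blast
  obtain n :: nat where "n > 0" "algebraic_int (of_nat n * x)"
    using algebraic_int_multiple[OF T(1), of x] T(2) power_mem[OF assms] by blast
  then show ?thesis using assms by (auto simp: OK_def intro: mult_mem of_nat_mem)
qed

lemma nat_multiple:
  assumes "c \<in> K" "c \<noteq> 0"
  shows "\<exists>n>0::nat. \<exists>c'\<in>OK. of_nat n = c * c'"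
proof -
  obtain n :: nat where n: "n > 0" "of_nat n * inverse c \<in> OK"
    using integral_multiple[OF inverse_mem[OF assms(1)]] by blast
  then show ?thesis using assms(2) by (intro exI[of _ n]) (auto intro!: bexI[of _ "of_nat n * inverse c"])
qed

text \<open>A monic integral polynomial of \<open>w\<close> composed with X^j - X^i is again monic
  and vanishes at \<open>x\<close>. Pigeonhole arguments on the powers of \<open>x\<close> end in
  such an equation.\<close>

lemma OK_root:
  assumes "x \<in> K" "w \<in> OK" "i < j" "x ^ j - x ^ i = w"
  shows "x \<in> OK"
proof -
  obtain p where p: "poly (map_poly of_int p) w = 0" "lead_coeff p = 1"
    using assms(2) unfolding OK_def algebraic_int_altdef_ipoly by blast
  define q :: "int poly" where "q = monom 1 j - monom 1 i"
  have dq: "degree q = j" unfolding q_def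
    using degree_add_eq_left[of "- monom 1 i" "monom (1::int) j"] assms(3) by (simp add: degree_monom_eq)
  have lq: "lead_coeff q = 1" unfolding dq using assms(3) by (simp add: q_def)
  have "lead_coeff (pcompose p q) = 1"
    using lead_coeff_comp[of q p] dq lq p(2) assms(3) by simp
  moreover have "poly (map_poly of_int (pcompose p q)) x = 0"
    using p(1) assms(4) unfolding int_poly_pcompose q_def int_poly_eqI by simp
  ultimately have "algebraic_int x" unfolding algebraic_int_altdef_ipoly by metis
  then show ?thesis using assms(1) by (simp add: OK_def)
qed

text \<open>No integral basis is constructed. A family of integers that is independent modulo
  \<open>q\<close> cannot be longer than a spanning set, because a longer one has an integral
  relation with a coefficient prime to \<open>q\<close>. A family of maximal length then spans O_K
  modulo \<open>q\<close>, and combinations with coefficients from 0 to q - 1 represent all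
  classes.\<close>

lemma finite_residues_prime:
  assumes q: "Factorial_Ring.prime (q::nat)"
  shows "\<exists>S. finite S \<and> S \<subseteq> OK \<and> (\<forall>x\<in>OK. \<exists>s\<in>S. \<exists>w\<in>OK. x = s + of_nat q * w)"
proof -
  obtain T where T: "finite T" "K \<subseteq> QV.span T" using finite_degree by blast
  \<comment> \<open>The first \<open>k\<close> values of \<open>f\<close> are linearly independent
    in O_K / q O_K over the field with q elements.\<close>
  define ind where "ind = (\<lambda>k (f::nat \<Rightarrow> complex). (\<forall>i. f i \<in> OK) \<and>
     (\<forall>c::nat\<Rightarrow>int. (\<exists>w\<in>OK. (\<Sum>i<k. of_int (c i) * f i) = of_nat q * w) \<longrightarrow> (\<forall>i<k. int q dvd c i)))"
  have q1: "int q > 1" using q prime_gt_1_nat by auto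
  have bound: "k \<le> card T" if "ind k f" for k f
  proof (rule ccontr)
    assume "\<not> k \<le> card T"
    then have "card T < k" by simp
    moreover have "\<And>i. f i \<in> QV.span T" using that T(2) by (auto simp: ind_def OK_def)
    ultimately obtain c where c: "\<exists>i<k. \<not> int q dvd c i" "(\<Sum>i<k. of_int (c i) * f i) = 0"
      using integer_relation_not_all_divisible[OF T(1) _ _ q1, of f k] by blast
    have "\<exists>w\<in>OK. (\<Sum>i<k. of_int (c i) * f i) = of_nat q * w" using c(2) by (intro bexI[of _ 0]) auto
    then have "\<forall>i<k. int q dvd c i" using that unfolding ind_def by blast
    then show False using c(1) by blast
  qed
  have "\<exists>f. ind 0 f" unfolding ind_def by (rule exI[of _ "\<lambda>_. 0"]) auto
  then obtain k where k: "\<exists>f. ind k f" "\<And>j. (\<exists>f. ind j f) \<Longrightarrow> j \<le> k"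
    using bound GreatestI_ex_nat[of "\<lambda>k. \<exists>f. ind k f" "card T"] Greatest_le_nat[of "\<lambda>k. \<exists>f. ind k f" _ "card T"] by blast
  obtain f where f: "ind k f" using k(1) by blast
  have fO: "f i \<in> OK" for i using f ind_def by blast
  define S where "S = (\<lambda>c. \<Sum>i<k. of_int (c i) * f i) ` ({..<k} \<rightarrow>\<^sub>E {0..<int q})"
  have "finite S" unfolding S_def by (intro finite_imageI finite_PiE) auto
  moreover have "(\<Sum>i<k. of_int (c i) * f i) \<in> OK" for c
    by (rule add_closed_sum[OF add_closed_OK]) (simp add: OK_mult fO)
  then have "S \<subseteq> OK" unfolding S_def by blast
  moreover have "\<exists>s\<in>S. \<exists>w\<in>OK. x = s + of_nat q * w" if x: "x \<in> OK" for x
  proof -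
    define g where "g = (\<lambda>i. if i = k then x else f i)"
    have "\<not> ind (Suc k) g" using k(2)[of "Suc k"] by auto
    moreover have "\<forall>i. g i \<in> OK" using x fO by (simp add: g_def)
    ultimately obtain c w where cw: "w \<in> OK" "(\<Sum>i<Suc k. of_int (c i) * g i) = of_nat q * w" "\<not> (\<forall>i<Suc k. int q dvd c i)"
      unfolding ind_def by blast
    have eq: "(\<Sum>i<k. of_int (c i) * f i) + of_int (c k) * x = of_nat q * w"
      using cw(2) by (simp add: g_def)
    \<comment> \<open>Otherwise the term with \<open>x\<close> could be moved to the right-hand
      side, and what remains would contradict the independence of \<open>f\<close>.\<close>
    have "\<not> int q dvd c k"
    proof
      assume "int q dvd c k"
      then obtain e where e: "c k = int q * e" by blast
      have "(\<Sum>i<k. of_int (c i) * f i) = of_nat q * (w - of_int e * x)"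
        using eq e by (simp add: algebra_simps)
      moreover have "w - of_int e * x \<in> OK" using cw(1) x by (intro OK_diff OK_mult) auto
      ultimately have "\<forall>i<k. int q dvd c i" using f unfolding ind_def by blast
      then show False using cw(3) \<open>int q dvd c k\<close> by (auto simp: less_Suc_eq)
    qed
    then have "coprime (c k) (int q)" using q
      by (metis coprime_commute prime_imp_coprime prime_nat_int_transfer)
    then obtain u v where uv: "u * c k + v * int q = 1" using bezout_int[of "c k" "int q"] by auto
    have "x = of_int (u * c k + v * int q) * x" using uv by simp
    also have "\<dots> = of_int u * (of_int (c k) * x) + of_nat q * (of_int v * x)" by (simp add: algebra_simps)
    also have "of_int (c k) * x = of_nat q * w - (\<Sum>i<k. of_int (c i) * f i)" using eq by (simp add: algebra_simps)
    finally have xeq: "x = (\<Sum>i<k. of_int (- u * c i) * f i) + of_nat q * (of_int u * w + of_int v * x)"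
      by (simp add: algebra_simps sum_distrib_left sum_negf)
    define r where "r = (\<lambda>i. (- u * c i) mod int q)"
    define t where "t = (\<lambda>i. (- u * c i) div int q)"
    have "(\<Sum>i<k. of_int (- u * c i) * f i) = (\<Sum>i<k. of_int (r i) * f i + of_nat q * (of_int (t i) * f i))"
    proof (rule sum.cong)
      fix i
      have "- u * c i = r i + int q * t i" by (simp add: r_def t_def)
      then have "(of_int (- u * c i) :: complex) = of_int (r i) + of_nat q * of_int (t i)"
        by (metis of_int_add of_int_mult of_int_of_nat_eq)
      then show "of_int (- u * c i) * f i = of_int (r i) * f i + of_nat q * (of_int (t i) * f i)"
        by (simp add: algebra_simps)
    qed simp
    also have "\<dots> = (\<Sum>i<k. of_int (r i) * f i) + of_nat q * (\<Sum>i<k. of_int (t i) * f i)"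
      by (simp add: sum.distrib sum_distrib_left)
    finally have "x = (\<Sum>i<k. of_int (r i) * f i) + of_nat q * ((\<Sum>i<k. of_int (t i) * f i) + (of_int u * w + of_int v * x))"
      using xeq by (simp add: algebra_simps)
    moreover have "(\<Sum>i<k. of_int (r i) * f i) \<in> S"
    proof -
      have "restrict r {..<k} \<in> {..<k} \<rightarrow>\<^sub>E {0..<int q}" using q1 by (auto simp: r_def)
      moreover have "(\<Sum>i<k. of_int (r i) * f i) = (\<Sum>i<k. of_int (restrict r {..<k} i) * f i)"
        by (rule sum.cong) auto
      ultimately show ?thesis unfolding S_def by (intro image_eqI[where x="restrict r {..<k}"])
    qed
    moreover have "(\<Sum>i<k. of_int (t i) * f i) + (of_int u * w + of_int v * x) \<in> OK"
      using cw(1) x fO by (intro OK_add OK_mult add_closed_sum[OF add_closed_OK]) auto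
    ultimately show ?thesis by blast
  qed
  ultimately show ?thesis by blast
qed

text \<open>Splitting off one prime factor, m = q n: the elements r + q s, with r a representative
  modulo \<open>q\<close> and s one modulo \<open>n\<close>, represent all classes modulo
  \<open>m\<close>.\<close>

lemma finite_residues:
  assumes "m > 0"
  shows "\<exists>S. finite S \<and> S \<subseteq> OK \<and> (\<forall>x\<in>OK. \<exists>s\<in>S. \<exists>w\<in>OK. x = s + of_nat m * w)"
  using assms
proof (induction m rule: less_induct)
  case (less m)
  show ?case
  proof (cases "m = 1")
    case True
    then show ?thesis by (intro exI[of _ "{0}"]) auto
  next
    case False
    then obtain q where q: "Factorial_Ring.prime q" "q dvd m" using prime_factor_nat by blast
    then obtain n where n: "m = q * n" by blast
    have "n < m" "n > 0" using n q(1) less.prems prime_gt_1_nat[of q] by auto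
    then obtain S where S: "finite S" "S \<subseteq> OK" "\<And>x. x \<in> OK \<Longrightarrow> \<exists>s\<in>S. \<exists>w\<in>OK. x = s + of_nat n * w"
      using less.IH[of n] by auto
    obtain R where R: "finite R" "R \<subseteq> OK" "\<And>x. x \<in> OK \<Longrightarrow> \<exists>s\<in>R. \<exists>w\<in>OK. x = s + of_nat q * w"
      using finite_residues_prime[OF q(1)] by auto
    define U where "U = (\<lambda>(r,s). r + of_nat q * s) ` (R \<times> S)"
    have "\<exists>s\<in>U. \<exists>w\<in>OK. x = s + of_nat m * w" if x: "x \<in> OK" for x
    proof -
      obtain r w where r: "r \<in> R" "w \<in> OK" "x = r + of_nat q * w" using R(3)[OF x] by blast
      obtain s v where s: "s \<in> S" "v \<in> OK" "w = s + of_nat n * v" using S(3)[OF r(2)] by blast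
      have "x = (r + of_nat q * s) + of_nat m * v" unfolding r(3) s(3) n by (simp add: algebra_simps)
      moreover have "r + of_nat q * s \<in> U" unfolding U_def using r(1) s(1) by force
      ultimately show ?thesis using s(2) by blast
    qed
    moreover have "finite U" unfolding U_def using R(1) S(1) by auto
    moreover have "U \<subseteq> OK" unfolding U_def using R(2) S(2) by (auto intro!: OK_add OK_mult)
    ultimately show ?thesis by blast
  qed
qed


subsection \<open>Ideals\<close>

definition integral_ideal :: "complex set \<Rightarrow> bool"
  where "integral_ideal I \<longleftrightarrow> I \<subseteq> OK \<and> add_closed I \<and> (\<forall>a\<in>OK. \<forall>x\<in>I. a * x \<in> I)"

lemma integral_idealD:
  assumes "integral_ideal I"
  shows "x \<in> I \<Longrightarrow> x \<in> OK" "add_closed I" "a \<in> OK \<Longrightarrow> x \<in> I \<Longrightarrow> a * x \<in> I" "0 \<in> I"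
    "x \<in> I \<Longrightarrow> y \<in> I \<Longrightarrow> x + y \<in> I" "x \<in> I \<Longrightarrow> y \<in> I \<Longrightarrow> x - y \<in> I" "x \<in> I \<Longrightarrow> - x \<in> I"
    "a \<in> OK \<Longrightarrow> x \<in> I \<Longrightarrow> x * a \<in> I"
  using assms add_closed_diff[of I x y] by (auto simp: integral_ideal_def add_closed_def mult.commute[of x a])

lemma integral_ideal_OK: "integral_ideal OK"
  by (auto simp: integral_ideal_def add_closed_OK intro: OK_mult)

lemma integral_ideal_prod:
  assumes "integral_ideal I" "integral_ideal J"
  shows "integral_ideal (I \<diamondop> J)"
proof -
  have "J \<noteq> {}" using integral_idealD(4)[OF assms(2)] by blast
  moreover have "a * x \<in> I \<diamondop> J" if "a \<in> OK" "x \<in> I \<diamondop> J" for a x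
    using that(2)
  proof (induction rule: set_prod_induct)
    case (mult i j)
    then show ?case using set_prod_mult[of "a * i" I j J] integral_idealD(3)[OF assms(1) that(1)] by (simp add: mult.assoc)
  next
    case (add x y)
    then show ?case by (simp add: distrib_left set_prod_add)
  qed
  moreover have "I \<diamondop> J \<subseteq> OK"
    by (rule set_prod_least) (use assms in \<open>auto intro: OK_mult OK_add integral_idealD(1)\<close>)
  ultimately show ?thesis using add_closed_set_prod[OF integral_idealD(2)[OF assms(1)]] by (auto simp: integral_ideal_def)
qed

lemma set_prod_subset:
  assumes "integral_ideal I" "integral_ideal J"
  shows "I \<diamondop> J \<subseteq> I" "I \<diamondop> J \<subseteq> J"
  by (rule set_prod_least; use assms in \<open>auto intro: integral_idealD\<close>)+

lemma set_prod_OK: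
  assumes "add_closed I" "\<And>a x. a \<in> OK \<Longrightarrow> x \<in> I \<Longrightarrow> a * x \<in> I"
  shows "OK \<diamondop> I = I" "I \<diamondop> OK = I"
proof -
  show 1: "OK \<diamondop> I = I"
  proof
    show "OK \<diamondop> I \<subseteq> I" by (rule set_prod_least) (use assms in \<open>auto simp: add_closed_def\<close>)
    show "I \<subseteq> OK \<diamondop> I" using set_prod_mult[OF OK_1] by force
  qed
  then show "I \<diamondop> OK = I" by (simp add: set_prod_commute)
qed

text \<open>An ideal containing \<open>m\<close> is determined by the representatives modulo
  \<open>m\<close> that it contains, and these form a finite set. The result plays the part of the
  ascending chain condition.\<close>

lemma finite_ideals_above:
  assumes "m > (0::nat)"
  shows "finite {I. integral_ideal I \<and> of_nat m \<in> I}"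
proof -
  obtain S where S: "finite S" "\<forall>x\<in>OK. \<exists>s\<in>S. \<exists>w\<in>OK. x = s + of_nat m * w"
    using finite_residues[OF assms] by blast
  have "I \<subseteq> J" if IJ: "integral_ideal I" "integral_ideal J" "of_nat m \<in> I" "of_nat m \<in> J" "I \<inter> S = J \<inter> S" for I J
  proof
    fix x assume x: "x \<in> I"
    then obtain s w where s: "s \<in> S" "w \<in> OK" "x = s + of_nat m * w"
      using S(2) integral_idealD(1)[OF IJ(1)] by blast
    have "x - of_nat m * w \<in> I" using integral_idealD(6,8)[OF IJ(1)] x IJ(3) s(2) by blast
    then have "s \<in> J" using s IJ(5) by auto
    then show "x \<in> J" unfolding s(3) using integral_idealD(5,8)[OF IJ(2)] IJ(4) s(2) by blast
  qed
  then have "inj_on (\<lambda>I. I \<inter> S) {I. integral_ideal I \<and> of_nat m \<in> I}" by (intro inj_onI) blast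
  moreover have "(\<lambda>I. I \<inter> S) ` {I. integral_ideal I \<and> of_nat m \<in> I} \<subseteq> Pow S" by blast
  ultimately show ?thesis using S(1) by (meson finite_Pow_iff inj_on_finite)
qed

lemma integral_ideal_contains_nat:
  assumes "integral_ideal I" "I \<noteq> {0}"
  shows "\<exists>n>0::nat. of_nat n \<in> I"
proof -
  obtain c where c: "c \<in> I" "c \<noteq> 0" using assms integral_idealD(4)[OF assms(1)] by blast
  then obtain n c' where "n > (0::nat)" "c' \<in> OK" "of_nat n = c * c'"
    using nat_multiple integral_idealD(1)[OF assms(1)] OK_mem by blast
  then show ?thesis using integral_idealD(8)[OF assms(1) _ c(1), of c'] by auto
qed

text \<open>The elements x^k m stay in \<open>I\<close> and fall into finitely many classes modulo
  \<open>m\<close>. Two powers of \<open>x\<close> in the same class differ by an algebraic integer,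
  so that \<open>OK_root\<close> applies.\<close>

lemma OK_if_stable:
  assumes "integral_ideal I" "I \<noteq> {0}" "x \<in> K" "\<And>y. y \<in> I \<Longrightarrow> x * y \<in> I"
  shows "x \<in> OK"
proof -
  obtain m where m: "m > (0::nat)" "of_nat m \<in> I" using integral_ideal_contains_nat[OF assms(1,2)] by blast
  obtain S where S: "finite S" "\<forall>x\<in>OK. \<exists>s\<in>S. \<exists>w\<in>OK. x = s + of_nat m * w"
    using finite_residues[OF m(1)] by blast
  have "x ^ k * of_nat m \<in> I" for k
    by (induction k) (auto simp: m mult.assoc intro: assms(4))
  then have "\<exists>s\<in>S. \<exists>w\<in>OK. x ^ k * of_nat m = s + of_nat m * w" for k
    using S(2) integral_idealD(1)[OF assms(1)] by blast
  then obtain s w where sw: "\<And>k. s k \<in> S" "\<And>k. w k \<in> OK" "\<And>k. x ^ k * of_nat m = s k + of_nat m * w k" by metis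
  have "\<not> inj_on s UNIV" using S(1) sw(1) by (metis finite_imageD finite_subset image_subsetI infinite_UNIV_nat)
  then obtain i j where ij: "s i = s j" "i < j" unfolding inj_on_def by (metis linorder_neqE_nat)
  have "of_nat m * (x ^ j - x ^ i) = of_nat m * (w j - w i)" using sw(3)[of i] sw(3)[of j] ij(1)
    by (simp add: algebra_simps)
  then have "x ^ j - x ^ i = w j - w i" using m(1) by simp
  then show ?thesis using OK_root[OF assms(3) _ ij(2)] sw(2) OK_diff by blast
qed

definition maximal :: "complex set \<Rightarrow> bool"
  where "maximal P \<longleftrightarrow> integral_ideal P \<and> 1 \<notin> P \<and> (\<forall>J. integral_ideal J \<longrightarrow> P \<subseteq> J \<longrightarrow> 1 \<notin> J \<longrightarrow> J = P)"

lemma maximal_ideal_exists: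
  assumes "integral_ideal I" "1 \<notin> I" "I \<noteq> {0}"
  shows "\<exists>P. maximal P \<and> I \<subseteq> P"
proof -
  obtain m where m: "m > (0::nat)" "of_nat m \<in> I" using integral_ideal_contains_nat[OF assms(1,3)] by blast
  define Q where "Q = {J. integral_ideal J \<and> I \<subseteq> J \<and> 1 \<notin> J}"
  have "finite Q" by (rule finite_subset[OF _ finite_ideals_above[OF m(1)]]) (use m(2) Q_def in auto)
  moreover have "I \<in> Q" using assms Q_def by auto
  ultimately obtain P where P: "P \<in> Q" "\<forall>J\<in>Q. P \<subseteq> J \<longrightarrow> P = J"
    using finite_has_maximal[of Q] by blast
  then have "maximal P" unfolding maximal_def Q_def by blast
  then show ?thesis using P(1) Q_def by blast
qed

text \<open>The last part is the statement that the quotient by \<open>P\<close> is a field: P + x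
  O_K is larger than \<open>P\<close>, hence contains 1.\<close>

lemma maximalD:
  assumes "maximal P"
  shows "integral_ideal P" "1 \<notin> P" "x \<in> OK \<Longrightarrow> x \<notin> P \<Longrightarrow> \<exists>a\<in>OK. 1 - a * x \<in> P"
proof -
  show P: "integral_ideal P" "1 \<notin> P" using assms by (auto simp: maximal_def)
  assume x: "x \<in> OK" "x \<notin> P"
  define J where "J = {p + a * x | p a. p \<in> P \<and> a \<in> OK}"
  have "integral_ideal J"
    unfolding integral_ideal_def add_closed_def
  proof (intro conjI ballI)
    show "J \<subseteq> OK" using x P(1) integral_idealD(1)[OF P(1)] unfolding J_def by (auto intro!: OK_add OK_mult)
    show "0 \<in> J" using integral_idealD(4)[OF P(1)] unfolding J_def by (auto intro!: exI[of _ 0])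
    fix u assume "u \<in> J"
    then obtain p a where u: "u = p + a * x" "p \<in> P" "a \<in> OK" unfolding J_def by blast
    have "- u = - p + (- a) * x" using u by simp
    then show "- u \<in> J" using u integral_idealD(7)[OF P(1)] OK_minus unfolding J_def by blast
    fix v assume "v \<in> J"
    then obtain p' a' where v: "v = p' + a' * x" "p' \<in> P" "a' \<in> OK" unfolding J_def by blast
    have "u + v = (p + p') + (a + a') * x" using u v by (simp add: algebra_simps)
    then show "u + v \<in> J" using u v integral_idealD(5)[OF P(1)] OK_add unfolding J_def by blast
  next
    fix b u assume b: "b \<in> OK" "u \<in> J"
    then obtain p a where u: "u = p + a * x" "p \<in> P" "a \<in> OK" unfolding J_def by blast
    have "b * u = b * p + (b * a) * x" using u by (simp add: algebra_simps)
    then show "b * u \<in> J" using u b(1) integral_idealD(3)[OF P(1)] OK_mult unfolding J_def by blast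
  qed
  moreover have "P \<subseteq> J"
  proof
    fix p assume "p \<in> P"
    moreover have "p = p + 0 * x" by simp
    ultimately show "p \<in> J" using OK_0 unfolding J_def by blast
  qed
  moreover have "x = 0 + 1 * x" by simp
  then have "x \<in> J" using integral_idealD(4)[OF P(1)] OK_1 unfolding J_def by blast
  then have "J \<noteq> P" using x(2) by blast
  ultimately have "1 \<in> J" using assms unfolding maximal_def by blast
  then obtain p a where "1 = p + a * x" "p \<in> P" "a \<in> OK" unfolding J_def by blast
  then show "\<exists>a\<in>OK. 1 - a * x \<in> P" by (metis add_diff_cancel_right')
qed

definition prime_id :: "complex set \<Rightarrow> bool"
  where "prime_id P \<longleftrightarrow> integral_ideal P \<and> 1 \<notin> P \<and> P \<noteq> {0} \<and> (\<forall>x\<in>OK. \<forall>y\<in>OK. x * y \<in> P \<longrightarrow> x \<in> P \<or> y \<in> P)"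

lemma maximal_prime:
  assumes "maximal P" "x \<in> OK" "y \<in> OK" "x * y \<in> P"
  shows "x \<in> P \<or> y \<in> P"
proof (rule disjCI)
  assume "y \<notin> P"
  then obtain a where a: "a \<in> OK" "1 - a * y \<in> P" using maximalD(3)[OF assms(1,3)] by blast
  have "x * (1 - a * y) + a * (x * y) \<in> P"
    using integral_idealD(3,5)[OF maximalD(1)[OF assms(1)]] a assms by blast
  then show "x \<in> P" by (simp add: algebra_simps)
qed

lemma maximal_imp_prime: "maximal P \<Longrightarrow> P \<noteq> {0} \<Longrightarrow> prime_id P"
  using maximal_prime maximalD by (auto simp: prime_id_def)

text \<open>The quotient by a nonzero prime is a finite domain. The powers of an element
  \<open>x\<close> outside \<open>P\<close> repeat modulo \<open>P\<close>, so some positive power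
  of \<open>x\<close> is 1 modulo \<open>P\<close>, and every ideal containing \<open>P\<close> and
  \<open>x\<close> contains 1.\<close>

lemma prime_id_maximal:
  assumes "prime_id P"
  shows "maximal P"
proof -
  have P: "integral_ideal P" "1 \<notin> P" "P \<noteq> {0}" and pr: "\<And>x y. x \<in> OK \<Longrightarrow> y \<in> OK \<Longrightarrow> x * y \<in> P \<Longrightarrow> x \<in> P \<or> y \<in> P"
    using assms by (auto simp: prime_id_def)
  obtain m where m: "m > (0::nat)" "of_nat m \<in> P" using integral_ideal_contains_nat[OF P(1,3)] by blast
  obtain S where S: "finite S" "\<forall>x\<in>OK. \<exists>s\<in>S. \<exists>w\<in>OK. x = s + of_nat m * w"
    using finite_residues[OF m(1)] by blast
  have "1 \<in> J" if J: "integral_ideal J" "P \<subseteq> J" "J \<noteq> P" for J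
  proof -
    obtain x where x: "x \<in> J" "x \<notin> P" using J(2,3) by blast
    have xO: "x \<in> OK" using integral_idealD(1)[OF J(1) x(1)] .
    have "\<exists>s\<in>S. \<exists>w\<in>OK. x ^ k = s + of_nat m * w" for k using S(2) OK_power[OF xO] by blast
    then obtain s w where sw: "\<And>k. s k \<in> S" "\<And>k. w k \<in> OK" "\<And>k. x ^ k = s k + of_nat m * w k" by metis
    have "\<not> inj_on s UNIV" using S(1) sw(1) by (metis finite_imageD finite_subset image_subsetI infinite_UNIV_nat)
    then obtain i j where ij: "s i = s j" "i < j" unfolding inj_on_def by (metis linorder_neqE_nat)
    have "x ^ j - x ^ i = of_nat m * (w j - w i)" using sw(3)[of i] sw(3)[of j] ij(1) by (simp add: algebra_simps)
    moreover have "x ^ j = x ^ i * x ^ (j - i)" using ij(2) by (simp flip: power_add)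
    ultimately have "x ^ i * (x ^ (j - i) - 1) = (w j - w i) * of_nat m" by (simp add: algebra_simps)
    then have "x ^ i * (x ^ (j - i) - 1) \<in> P" using integral_idealD(3)[OF P(1) OK_diff[OF sw(2,2)] m(2)] by simp
    then have "x ^ i \<in> P \<or> x ^ (j - i) - 1 \<in> P" using pr OK_power[OF xO] OK_diff[OF OK_power[OF xO] OK_1] by blast
    moreover have "x ^ k \<notin> P" for k
      by (induction k) (use P(2) pr[OF xO OK_power[OF xO]] x(2) in auto)
    ultimately have "x ^ (j - i) - 1 \<in> J" using J(2) by blast
    moreover have "x ^ (j - i) \<in> J"
      using integral_idealD(3)[OF J(1) OK_power[OF xO, of "j - i - 1"] x(1)] ij(2)
      by (metis Suc_diff_Suc Suc_diff_diff diff_Suc_1 mult.commute power_Suc)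
    ultimately have "x ^ (j - i) - (x ^ (j - i) - 1) \<in> J" using integral_idealD(6)[OF J(1)] by blast
    then show "1 \<in> J" by simp
  qed
  then show ?thesis using P unfolding maximal_def by blast
qed


text \<open>Nakayama's lemma by elimination of generators. If \<open>v\<close> occurs in its own
  expression with coefficient 1, then 1 lies in \<open>D\<close>; otherwise \<open>v\<close> is
  eliminated from the expressions of the other generators.\<close>

lemma idempotent_span:
  assumes "finite Y" "\<exists>x\<in>Y. x \<noteq> (0::complex)" "integral_ideal D"
    "\<And>x. x \<in> Y \<Longrightarrow> \<exists>c. (\<forall>y. c y \<in> D) \<and> x = (\<Sum>y\<in>Y. c y * y)"
  shows "1 \<in> D"
  using assms(1,2,4)
proof (induction Y rule: finite_induct)
  case empty
  then show ?case by simp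
next
  case (insert v Y)
  note D = integral_idealD[OF assms(3)]
  obtain c where c: "\<And>y. c y \<in> D" "v = (\<Sum>y\<in>insert v Y. c y * y)" using insert.prems(2)[of v] by auto
  have cv: "(1 - c v) * v = (\<Sum>y\<in>Y. c y * y)" using c(2) insert.hyps by (simp add: algebra_simps)
  show ?case
  proof (cases "1 - c v = 0")
    case True
    then show ?thesis using c(1)[of v] by simp
  next
    case False
    have "\<exists>x\<in>Y. x \<noteq> 0"
    proof (rule ccontr)
      assume "\<not> (\<exists>x\<in>Y. x \<noteq> 0)"
      then have "(1 - c v) * v = 0" unfolding cv by (intro sum.neutral) auto
      then have "v = 0" using False by simp
      then show False using insert.prems(1) \<open>\<not> (\<exists>x\<in>Y. x \<noteq> 0)\<close> by auto
    qed
    moreover have "\<exists>e. (\<forall>y. e y \<in> D) \<and> x = (\<Sum>y\<in>Y. e y * y)" if x: "x \<in> Y" for x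
    proof -
      obtain b where b: "\<And>y. b y \<in> D" "x = (\<Sum>y\<in>insert v Y. b y * y)" using insert.prems(2)[of x] x by auto
      have bx: "x = b v * v + (\<Sum>y\<in>Y. b y * y)" using b(2) insert.hyps by simp
      have "(1 - c v) * x = b v * ((1 - c v) * v) + (1 - c v) * (\<Sum>y\<in>Y. b y * y)"
        by (subst bx) (simp add: algebra_simps)
      also have "\<dots> = (\<Sum>y\<in>Y. (b v * c y + (1 - c v) * b y) * y)"
        unfolding cv by (simp add: sum_distrib_left sum.distrib[symmetric] algebra_simps)
      \<comment> \<open>The factor 1 - \<open>c v\<close> is never cancelled: \<open>c v * x\<close>
        has its coefficient in \<open>D\<close>, and \<open>x\<close> is itself one of the remaining
        generators.\<close>
      finally have "x = (\<Sum>y\<in>Y. (b v * c y + (1 - c v) * b y) * y) + c v * x" by (simp add: algebra_simps)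
      also have "c v * x = (\<Sum>y\<in>Y. (if y = x then c v else 0) * y)"
      proof -
        have "(\<Sum>y\<in>Y. (if y = x then c v else 0) * y) = (\<Sum>y\<in>Y. if y = x then c v * y else 0)"
          by (rule sum.cong) auto
        then show ?thesis using x insert.hyps by simp
      qed
      finally have "x = (\<Sum>y\<in>Y. (b v * c y + (1 - c v) * b y + (if y = x then c v else 0)) * y)"
        by (simp add: sum.distrib[symmetric] distrib_right)
      moreover have "b v * c y + (1 - c v) * b y + (if y = x then c v else 0) \<in> D" for y
        by (intro D(5) D(3)) (use b(1) c(1) D(1,4) in \<open>auto intro!: OK_diff\<close>)
      ultimately show ?thesis by (intro exI[of _ "\<lambda>y. b v * c y + (1 - c v) * b y + (if y = x then c v else 0)"]) auto
    qed
    ultimately show ?thesis by (rule insert.IH)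
  qed
qed

text \<open>The ideal \<open>D\<close> is generated over O_K by \<open>m\<close> and the
  representatives modulo \<open>m\<close> that lie in \<open>D\<close>; D = D D writes each of them
  with coefficients from \<open>D\<close>, which is the hypothesis of
  \<open>idempotent_span\<close>. The lemma prevents the powers of a prime from becoming
  stationary.\<close>

lemma idempotent_ideal:
  assumes D: "integral_ideal D" "D \<noteq> {0}" "D \<diamondop> D = D"
  shows "1 \<in> D"
proof -
  obtain m where m: "m > (0::nat)" "of_nat m \<in> D" using integral_ideal_contains_nat[OF D(1,2)] by blast
  obtain S where S: "finite S" "\<forall>x\<in>OK. \<exists>s\<in>S. \<exists>w\<in>OK. x = s + of_nat m * w"
    using finite_residues[OF m(1)] by blast
  define Y where "Y = insert (of_nat m) (S \<inter> D)"
  have finX: "finite Y" using S(1) by (simp add: Y_def)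
  have gen: "\<exists>c. (\<forall>y. c y \<in> OK) \<and> x = (\<Sum>y\<in>Y. c y * y)" if x: "x \<in> D" for x
  proof -
    obtain s w where s: "s \<in> S" "w \<in> OK" "x = s + of_nat m * w" using S(2) integral_idealD(1)[OF D(1) x] by blast
    have "x - of_nat m * w \<in> D" using integral_idealD(6,8)[OF D(1)] x m(2) s(2) by blast
    then have sX: "s \<in> Y" using s by (simp add: Y_def)
    have mX: "of_nat m \<in> Y" by (simp add: Y_def)
    have "(\<Sum>y\<in>Y. ((if y = s then 1 else 0) + (if y = of_nat m then w else 0)) * y) =
       (\<Sum>y\<in>Y. (if y = s then y else 0)) + (\<Sum>y\<in>Y. (if y = of_nat m then w * y else 0))"
      unfolding sum.distrib[symmetric] by (rule sum.cong) (auto simp: algebra_simps)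
    also have "\<dots> = s + w * of_nat m" using sX mX finX by simp
    finally have "x = (\<Sum>y\<in>Y. ((if y = s then 1 else 0) + (if y = of_nat m then w else 0)) * y)"
      using s(3) by (simp add: mult.commute)
    then show ?thesis using s(2) by (intro exI[of _ "\<lambda>y. (if y = s then 1 else 0) + (if y = of_nat m then w else 0)"]) (auto intro!: OK_add)
  qed
  have "\<exists>c. (\<forall>y. c y \<in> D) \<and> x = (\<Sum>y\<in>Y. c y * y)" if x: "x \<in> D \<diamondop> D" for x
    using x
  proof (induction rule: set_prod_induct)
    case (mult i j)
    obtain c where c: "\<forall>y. c y \<in> OK" "j = (\<Sum>y\<in>Y. c y * y)" using gen[OF mult(2)] by blast
    show ?case
      by (rule exI[of _ "\<lambda>y. i * c y"]) (use c mult(1) in \<open>auto simp: sum_distrib_left mult.assoc intro: integral_idealD(8)[OF D(1)]\<close>)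
  next
    case (add x y)
    then obtain c c' where "\<forall>y. c y \<in> D" "x = (\<Sum>y\<in>Y. c y * y)" "\<forall>y. c' y \<in> D" "y = (\<Sum>y\<in>Y. c' y * y)" by blast
    then show ?case
      by (intro exI[of _ "\<lambda>y. c y + c' y"]) (auto simp: sum.distrib distrib_right intro: integral_idealD(5)[OF D(1)])
  qed
  then have "\<exists>c. (\<forall>y. c y \<in> D) \<and> x = (\<Sum>y\<in>Y. c y * y)" if "x \<in> Y" for x
    using that m(2) D(3) by (auto simp: Y_def)
  moreover have "\<exists>x\<in>Y. x \<noteq> 0" using m(1) by (auto simp: Y_def)
  ultimately show ?thesis using idempotent_span[OF finX _ D(1)] by blast
qed

end

section \<open>Passage between HOL-Algebra structures and sets of complex numbers\<close>

lemma CC_minus [simp]: "\<ominus>\<^bsub>CC\<^esub> x = - x"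
proof -
  interpret CC: cring CC by (rule cring_from_type_algebra)
  show ?thesis by (rule CC.minus_equality) auto
qed

lemma CC_inv: "x \<noteq> 0 \<Longrightarrow> inv\<^bsub>CC\<^esub> x = inverse x"
proof -
  interpret CC: cring CC by (rule cring_from_type_algebra)
  assume "x \<noteq> 0"
  then show ?thesis by (intro CC.comm_inv_char) auto
qed

lemma subfield_CC_D:
  assumes "subfield K CC"
  shows "1 \<in> K" "\<And>x y. x \<in> K \<Longrightarrow> y \<in> K \<Longrightarrow> x - y \<in> K" "\<And>x y. x \<in> K \<Longrightarrow> y \<in> K \<Longrightarrow> x * y \<in> K"
    "\<And>x. x \<in> K \<Longrightarrow> inverse x \<in> K"
proof -
  interpret CC: cring CC by (rule cring_from_type_algebra)
  note r = subringE[OF subfieldE(1)[OF assms]]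
  show "1 \<in> K" using r(3) by simp
  show "x - y \<in> K" if "x \<in> K" "y \<in> K" for x y
    using r(7)[OF that(1) r(5)[OF that(2)]] by simp
  show "x * y \<in> K" if "x \<in> K" "y \<in> K" for x y
    using r(6)[OF that] by simp
  show "inverse x \<in> K" if "x \<in> K" for x
  proof (cases "x = 0")
    case False
    then show ?thesis using CC.subfield_m_inv(1)[OF assms, of x] that CC_inv[OF False] by simp
  qed (use that in simp)
qed

text \<open>Follows the inductive definition of dimension: L = K v + E is spanned over \<rat> by a
  spanning set of \<open>E\<close> together with the products u v, u from a spanning set of the base
  field. The spanning set is kept inside \<open>L\<close> because embeddings are later extended
  along its elements.\<close>

lemma finite_dimension_span:
  assumes "subfield F CC" "F \<subseteq> QV.span U" "finite U" "U \<subseteq> F" "ring.finite_dimension CC F L"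
  shows "\<exists>T. finite T \<and> T \<subseteq> L \<and> L \<subseteq> QV.span T"
proof -
  interpret CC: cring CC by (rule cring_from_type_algebra)
  obtain n where "CC.dimension n F L" using assms(5) unfolding CC.finite_dimension_def by blast
  then have "0 \<in> L \<and> (\<exists>T. finite T \<and> T \<subseteq> L \<and> L \<subseteq> QV.span T)"
    using assms(1,2,4)
  proof (induction n F L rule: CC.dimension.induct)
    case (zero_dim K)
    then show ?case by (auto intro!: exI[of _ "{0}"] intro: QV.span_base)
  next
    case (Suc_dim v E n K)
    then obtain T where T: "finite T" "T \<subseteq> E" "E \<subseteq> QV.span T" and E0: "0 \<in> E" by blast
    have K0: "0 \<in> K" using subfield_CC_D(1,2)[OF Suc_dim.prems(1)] by force
    have L: "CC.line_extension K v E = {k * v + e | k e. k \<in> K \<and> e \<in> E}"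
      unfolding CC.line_extension_def set_add_def' r_coset_def by (auto simp: ring_of_type_algebra_def)
    define T' where "T' = T \<union> (\<lambda>u. u * v) ` U"
    have "k * v \<in> QV.span T'" if "k \<in> QV.span U" for k
      using that
    proof (induction rule: QV.span_induct_alt)
      case base
      show ?case by (simp add: QV.span_zero)
    next
      case (step c x y)
      have "x * v \<in> QV.span T'" using step by (intro QV.span_base) (auto simp: T'_def)
      then have "of_rat c * (x * v) + y * v \<in> QV.span T'" using step by (intro QV.span_add QV.span_scale)
      then show ?case by (simp add: algebra_simps)
    qed
    moreover have "QV.span T \<subseteq> QV.span T'" by (rule QV.span_mono) (auto simp: T'_def)
    ultimately have "CC.line_extension K v E \<subseteq> QV.span T'"
      unfolding L using T(3) Suc_dim.prems(2) by (auto intro!: QV.span_add)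
    moreover have "T' \<subseteq> CC.line_extension K v E"
    proof
      fix t assume "t \<in> T'"
      then consider "t \<in> E" | u where "u \<in> K" "t = u * v" using T(2) Suc_dim.prems(3) by (auto simp: T'_def)
      then show "t \<in> CC.line_extension K v E"
      proof cases
        case 1
        moreover have "t = 0 * v + t" by simp
        ultimately show ?thesis unfolding L using K0 by blast
      next
        case 2
        moreover have "t = u * v + 0" using 2 by simp
        ultimately show ?thesis unfolding L using E0 by blast
      qed
    qed
    moreover have "0 = 0 * v + 0" by simp
    then have "0 \<in> CC.line_extension K v E" unfolding L using K0 E0 by blast
    moreover have "finite T'" using T(1) assms(3) by (simp add: T'_def)
    ultimately show ?case by blast
  qed
  then show ?thesis by blast
qed

section \<open>Ideals of the ring record and powers of prime ideals\<close>

context number_field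
begin

abbreviation R where "R \<equiv> ring_of_integers K"

lemma R_simps: "x \<otimes>\<^bsub>R\<^esub> y = x * y" "x \<oplus>\<^bsub>R\<^esub> y = x + y" "\<one>\<^bsub>R\<^esub> = 1" "\<zero>\<^bsub>R\<^esub> = 0"
  by (simp_all add: ring_of_integers_def)

lemma cring_R: "cring R"
proof (rule cringI)
  show "abelian_group R"
  proof (rule abelian_groupI)
    fix x assume "x \<in> carrier R"
    then show "\<exists>y\<in>carrier R. y \<oplus>\<^bsub>R\<^esub> x = \<zero>\<^bsub>R\<^esub>"
      by (intro bexI[of _ "- x"]) (auto simp: R_simps intro: OK_minus)
  qed (auto simp: R_simps intro: OK_add)
  show "Group.comm_monoid R"
    by (rule comm_monoidI) (auto simp: R_simps intro: OK_mult)
qed (auto simp: R_simps distrib_right)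

lemma ideal_R_iff: "ideal I R \<longleftrightarrow> integral_ideal I"
proof
  interpret R: cring R by (rule cring_R)
  assume "ideal I R"
  then interpret ideal I R .
  have "- x \<in> I" if "x \<in> I" for x
    using I_l_closed[OF that, of "-1"] OK_minus[OF OK_1] by (simp add: R_simps)
  then show "integral_ideal I" unfolding integral_ideal_def add_closed_def
    using a_subset additive_subgroup.zero_closed[OF is_additive_subgroup] I_l_closed a_closed
    by (auto simp: R_simps)
next
  interpret R: cring R by (rule cring_R)
  assume I: "integral_ideal I"
  show "ideal I R"
  proof (rule idealI)
    show "ring R" by (rule R.ring_axioms)
    show "subgroup I (add_monoid R)"
    proof (rule R.add.subgroupI)
      show "I \<subseteq> carrier R" "I \<noteq> {}" using integral_idealD[OF I] by auto
      fix a assume a: "a \<in> I"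
      then have "\<ominus>\<^bsub>R\<^esub> a = - a" using integral_idealD(1)[OF I]
        by (intro R.minus_equality) (auto simp: R_simps intro: OK_minus)
      then show "\<ominus>\<^bsub>R\<^esub> a \<in> I" using integral_idealD(7)[OF I a] by simp
      fix b assume "b \<in> I"
      then show "a \<oplus>\<^bsub>R\<^esub> b \<in> I" using integral_idealD(5)[OF I a] by (simp add: R_simps)
    qed
  qed (use integral_idealD[OF I] in \<open>auto simp: R_simps\<close>)
qed

lemma ideal_prod_R: "ideal_prod R I J = I \<diamondop> J"
proof
  show "ideal_prod R I J \<subseteq> I \<diamondop> J"
  proof
    fix x assume "x \<in> ideal_prod R I J"
    then show "x \<in> I \<diamondop> J"
      by (induction rule: ideal_prod.induct) (auto simp: R_simps intro: set_prod_mult set_prod_add)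
  qed
  show "I \<diamondop> J \<subseteq> ideal_prod R I J"
    by (rule set_prod_least) (use ideal_prod.prod[where R = R] ideal_prod.sum[where R = R] in \<open>auto simp: R_simps\<close>)
qed

lemma finite_primes_iff: "P \<in> finite_primes K \<longleftrightarrow> prime_id P"
proof
  assume P: "P \<in> finite_primes K"
  then interpret primeideal P R by (simp add: finite_primes_def)
  have I: "integral_ideal P" using is_ideal ideal_R_iff by blast
  moreover have "1 \<notin> P"
  proof
    assume "1 \<in> P"
    then have "carrier R \<subseteq> P" using integral_idealD(3)[OF I, of _ 1] by auto
    then show False using I_notcarr integral_idealD(1)[OF I] by auto
  qed
  ultimately show "prime_id P" using P I_prime unfolding prime_id_def finite_primes_def by (auto simp: R_simps)
next
  assume P: "prime_id P"
  have "primeideal P R"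
  proof (rule primeidealI)
    show "ideal P R" "cring R" using P cring_R by (auto simp: ideal_R_iff prime_id_def)
    show "carrier R \<noteq> P" using P OK_1 by (auto simp: prime_id_def)
  qed (use P in \<open>auto simp: prime_id_def R_simps\<close>)
  then show "P \<in> finite_primes K" using P by (auto simp: finite_primes_def prime_id_def)
qed

lemma genideal_subset_iff: "integral_ideal I \<Longrightarrow> S \<subseteq> OK \<Longrightarrow> genideal R S \<subseteq> I \<longleftrightarrow> S \<subseteq> I"
proof -
  interpret R: cring R by (rule cring_R)
  assume I: "integral_ideal I" "S \<subseteq> OK"
  show ?thesis using R.genideal_minimal[of I S] R.genideal_self[of S] I ideal_R_iff by auto
qed

definition ideal_power :: "complex set \<Rightarrow> nat \<Rightarrow> complex set"
  where "ideal_power P e = P [^]\<^bsub>ideals_set R\<^esub> e"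

lemma ideal_power_simps: "ideal_power P 0 = OK" "ideal_power P (Suc e) = ideal_power P e \<diamondop> P"
  by (simp_all add: ideal_power_def nat_pow_def ideals_set_def ideal_prod_R)

lemma integral_ideal_power: "integral_ideal P \<Longrightarrow> integral_ideal (ideal_power P e)"
  by (induction e) (auto simp: ideal_power_simps intro: integral_ideal_OK integral_ideal_prod)

lemma ideal_power_add: "integral_ideal P \<Longrightarrow> ideal_power P (i + j) = ideal_power P i \<diamondop> ideal_power P j"
proof (induction j)
  case 0
  then show ?case using set_prod_OK(2)[of "ideal_power P i"] integral_ideal_power[OF 0, of i]
    by (auto simp: ideal_power_simps integral_ideal_def)
next
  case (Suc j)
  then show ?case by (simp add: ideal_power_simps set_prod_assoc)
qed

lemma ideal_power_antimono: "integral_ideal P \<Longrightarrow> i \<le> j \<Longrightarrow> ideal_power P j \<subseteq> ideal_power P i"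
  using set_prod_subset(1)[OF integral_ideal_power integral_ideal_power, of P P i "j - i"]
  by (simp flip: ideal_power_add)

text \<open>If \<open>c\<close> were in all powers of \<open>P\<close>, all of them would contain
  one positive integer \<open>m\<close>. Only finitely many ideals do, so the powers become
  stationary at an idempotent ideal, which contains 1.\<close>

lemma ideal_power_avoids:
  assumes P: "integral_ideal P" "1 \<notin> P" "P \<noteq> {0}" and c: "c \<in> OK" "c \<noteq> 0"
  shows "\<exists>e. c \<notin> ideal_power P e"
proof (rule ccontr)
  assume "\<not> ?thesis"
  then have all: "c \<in> ideal_power P e" for e by blast
  obtain m c' where m: "m > (0::nat)" "c' \<in> OK" "of_nat m = c * c'" using nat_multiple[OF OK_mem] c by blast
  have "of_nat m \<in> ideal_power P e" for e
    unfolding m(3) using integral_idealD(8)[OF integral_ideal_power[OF P(1)] m(2) all] .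
  then have "range (\<lambda>e. ideal_power P (Suc e)) \<subseteq> {I. integral_ideal I \<and> of_nat m \<in> I}"
    using integral_ideal_power[OF P(1)] by blast
  then have "\<not> inj (\<lambda>e. ideal_power P (Suc e))"
    using finite_ideals_above[OF m(1)] finite_subset infinite_UNIV_nat finite_imageD by blast
  then obtain i j where ij: "i < j" "ideal_power P (Suc i) = ideal_power P (Suc j)"
    unfolding inj_def by (metis linorder_neqE_nat)
  \<comment> \<open>The exponent has to be positive, so that the stationary power lies in
    \<open>P\<close> and cannot contain 1.\<close>
  define k where "k = Suc i"
  have k: "ideal_power P (Suc k) = ideal_power P k"
    using ideal_power_antimono[OF P(1), of k "Suc k"] ideal_power_antimono[OF P(1), of "Suc k" "Suc j"] ij
    by (auto simp: k_def)
  have "ideal_power P (k + l) = ideal_power P k" for l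
    by (induction l) (use k in \<open>simp_all add: ideal_power_simps\<close>)
  then have "ideal_power P k \<diamondop> ideal_power P k = ideal_power P k"
    using ideal_power_add[OF P(1), of k k] by simp
  moreover have "ideal_power P k \<noteq> {0}" using all[of k] c by auto
  ultimately have "1 \<in> ideal_power P k" using idempotent_ideal[OF integral_ideal_power[OF P(1)]] by blast
  then have "1 \<in> P" using ideal_power_antimono[OF P(1), of 1 k] set_prod_OK(1)[of P] P(1)
    by (auto simp: k_def ideal_power_simps integral_ideal_def)
  then show False using P(2) by blast
qed

end

text \<open>The form in which ramification index one is used. The exponents in question are bounded
  by \<open>ideal_power_avoids\<close>, so \<open>GREATEST\<close> is a true maximum, and
  containment in the square of \<open>P\<close> would make it at least 2.\<close>

lemma unramified_not_subset_square:
  assumes "number_field F" "number_field L" "F \<subseteq> L"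
    and P: "number_field.prime_id L P" and ram: "ramification_index F L P = 1"
  shows "\<not> P \<inter> number_field.OK F \<subseteq> P \<diamondop> P"
proof
  interpret F: number_field F by fact
  interpret L: number_field L by fact
  have PI: "L.integral_ideal P" "1 \<notin> P" "P \<noteq> {0}" using P by (auto simp: L.prime_id_def)
  obtain n where n: "n > (0::nat)" "of_nat n \<in> P" using L.integral_ideal_contains_nat[OF PI(1,3)] by blast
  define Q where "Q = P \<inter> F.OK"
  have nQ: "of_nat n \<in> Q" using n by (simp add: Q_def)
  have QO: "Q \<subseteq> L.OK" using L.integral_idealD(1)[OF PI(1)] by (auto simp: Q_def)
  define E where "E = (\<lambda>e. Q \<subseteq> L.ideal_power P e)"
  have E: "genideal (ring_of_integers L) Q \<subseteq> P [^]\<^bsub>ideals_set (ring_of_integers L)\<^esub> e \<longleftrightarrow> E e" for e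
    using L.genideal_subset_iff[OF L.integral_ideal_power[OF PI(1)] QO, of e] by (simp add: E_def L.ideal_power_def)
  assume "P \<inter> number_field.OK F \<subseteq> P \<diamondop> P"
  then have E2: "E 2" using L.set_prod_OK(1)[of P] PI(1)
    by (simp add: E_def Q_def numeral_2_eq_2 L.ideal_power_simps L.integral_ideal_def)
  obtain b where b: "of_nat n \<notin> L.ideal_power P b" using L.ideal_power_avoids[OF PI, of "of_nat n"] n(1) by auto
  have "e \<le> b" if "E e" for e
  proof (rule ccontr)
    assume "\<not> e \<le> b"
    then have "L.ideal_power P e \<subseteq> L.ideal_power P b" by (intro L.ideal_power_antimono[OF PI(1)]) simp
    then show False using b that nQ unfolding E_def by blast
  qed
  then have "2 \<le> (GREATEST e. E e)" using Greatest_le_nat[of E 2 b] E2 by blast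
  then show False using ram unfolding ramification_index_def F.carrier_ring_of_integers Q_def[symmetric] E by simp
qed

section \<open>Extension of embeddings\<close>

definition hom_on :: "complex set \<Rightarrow> (complex \<Rightarrow> complex) \<Rightarrow> bool"
  where "hom_on K \<phi> \<longleftrightarrow> \<phi> 1 = 1 \<and> (\<forall>x\<in>K. \<forall>y\<in>K. \<phi> (x + y) = \<phi> x + \<phi> y \<and> \<phi> (x * y) = \<phi> x * \<phi> y)"

definition subfield_set :: "complex set \<Rightarrow> bool"
  where "subfield_set K \<longleftrightarrow> 1 \<in> K \<and> (\<forall>x\<in>K. \<forall>y\<in>K. x - y \<in> K \<and> x * y \<in> K) \<and> (\<forall>x\<in>K. inverse x \<in> K)"

lemma subfield_set_closed:
  assumes "subfield_set K"
  shows "0 \<in> K" "1 \<in> K" "x \<in> K \<Longrightarrow> y \<in> K \<Longrightarrow> x - y \<in> K" "x \<in> K \<Longrightarrow> y \<in> K \<Longrightarrow> x * y \<in> K" "x \<in> K \<Longrightarrow> inverse x \<in> K"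
    "x \<in> K \<Longrightarrow> - x \<in> K" "x \<in> K \<Longrightarrow> y \<in> K \<Longrightarrow> x + y \<in> K" "x \<in> K \<Longrightarrow> y \<in> K \<Longrightarrow> x / y \<in> K" "of_int n \<in> K"
    "(\<And>i. i \<in> I \<Longrightarrow> f i \<in> K) \<Longrightarrow> sum f I \<in> K" "x \<in> K \<Longrightarrow> x ^ k \<in> K"
proof -
  note s = assms[unfolded subfield_set_def]
  show 0: "0 \<in> K" using s by (metis cancel_comm_monoid_add_class.diff_cancel)
  show m: "- x \<in> K" if "x \<in> K" for x using s 0 that by (metis diff_0)
  show a: "x + y \<in> K" if "x \<in> K" "y \<in> K" for x y using s m that by (metis diff_minus_eq_add)
  show "1 \<in> K" "x \<in> K \<Longrightarrow> y \<in> K \<Longrightarrow> x - y \<in> K" "x \<in> K \<Longrightarrow> y \<in> K \<Longrightarrow> x * y \<in> K" "x \<in> K \<Longrightarrow> inverse x \<in> K" using s by auto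
  show "x \<in> K \<Longrightarrow> y \<in> K \<Longrightarrow> x / y \<in> K" using s by (simp add: divide_inverse)
  show "(\<And>i. i \<in> I \<Longrightarrow> f i \<in> K) \<Longrightarrow> sum f I \<in> K"
    by (induction I rule: infinite_finite_induct) (auto intro: 0 a)
  have "of_nat n \<in> K" for n by (induction n) (use 0 s a in auto)
  then show "of_int n \<in> K" by (cases n rule: int_cases2) (auto intro: m)
  show "x \<in> K \<Longrightarrow> x ^ k \<in> K" by (induction k) (use s in auto)
qed

lemma hom_on_simps:
  assumes "subfield_set K" "hom_on K \<phi>"
  shows "\<phi> 0 = 0" "\<phi> 1 = 1" "x \<in> K \<Longrightarrow> y \<in> K \<Longrightarrow> \<phi> (x + y) = \<phi> x + \<phi> y" "x \<in> K \<Longrightarrow> y \<in> K \<Longrightarrow> \<phi> (x * y) = \<phi> x * \<phi> y"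
    "(\<And>i. i \<in> I \<Longrightarrow> f i \<in> K) \<Longrightarrow> \<phi> (sum f I) = (\<Sum>i\<in>I. \<phi> (f i))" "x \<in> K \<Longrightarrow> \<phi> (- x) = - \<phi> x"
proof -
  note s = subfield_set_closed[OF assms(1)]
  show a: "x \<in> K \<Longrightarrow> y \<in> K \<Longrightarrow> \<phi> (x + y) = \<phi> x + \<phi> y" for x y using assms(2) by (simp add: hom_on_def)
  show "\<phi> 1 = 1" "x \<in> K \<Longrightarrow> y \<in> K \<Longrightarrow> \<phi> (x * y) = \<phi> x * \<phi> y" using assms(2) by (auto simp: hom_on_def)
  show 0: "\<phi> 0 = 0" using a[OF s(1,1)] by simp
  show "(\<And>i. i \<in> I \<Longrightarrow> f i \<in> K) \<Longrightarrow> \<phi> (sum f I) = (\<Sum>i\<in>I. \<phi> (f i))"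
    by (induction I rule: infinite_finite_induct) (auto simp: 0 a s(10))
  show "x \<in> K \<Longrightarrow> \<phi> (- x) = - \<phi> x" using a[of x "- x"] s(6)[of x] 0 by (simp add: eq_neg_iff_add_eq_0 add.commute)
qed

definition polys_over :: "complex set \<Rightarrow> complex poly set"
  where "polys_over K = {f. \<forall>i. coeff f i \<in> K}"

lemma polys_over_closed:
  assumes "subfield_set K"
  shows "0 \<in> polys_over K" "f \<in> polys_over K \<Longrightarrow> g \<in> polys_over K \<Longrightarrow> f + g \<in> polys_over K"
    "f \<in> polys_over K \<Longrightarrow> g \<in> polys_over K \<Longrightarrow> f - g \<in> polys_over K"
    "f \<in> polys_over K \<Longrightarrow> g \<in> polys_over K \<Longrightarrow> f * g \<in> polys_over K"
    "c \<in> K \<Longrightarrow> monom c n \<in> polys_over K"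
  using subfield_set_closed[OF assms]
  by (auto simp: polys_over_def coeff_mult intro!: subfield_set_closed(10)[OF assms])

lemma map_poly_hom_on:
  assumes K: "subfield_set K" "hom_on K \<phi>" and fg: "f \<in> polys_over K" "g \<in> polys_over K"
  shows "map_poly \<phi> (f + g) = map_poly \<phi> f + map_poly \<phi> g" "map_poly \<phi> (f * g) = map_poly \<phi> f * map_poly \<phi> g"
proof -
  note h = hom_on_simps[OF K]
  note c = subfield_set_closed[OF K(1)]
  show "map_poly \<phi> (f + g) = map_poly \<phi> f + map_poly \<phi> g"
    using fg by (intro poly_eqI) (simp add: coeff_map_poly h polys_over_def)
  show "map_poly \<phi> (f * g) = map_poly \<phi> f * map_poly \<phi> g"
    using fg by (intro poly_eqI) (simp add: coeff_map_poly h polys_over_def coeff_mult c)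
qed

lemma monic_division:
  assumes K: "subfield_set K" and m: "m \<in> polys_over K" "lead_coeff m = 1" and f: "f \<in> polys_over K"
  shows "\<exists>g\<in>polys_over K. \<exists>r\<in>polys_over K. f = m * g + r \<and> (r = 0 \<or> degree r < degree m)"
  using f
proof (induction "degree f" arbitrary: f rule: less_induct)
  case less
  note c = polys_over_closed[OF K]
  show ?case
  proof (cases "f = 0 \<or> degree f < degree m")
    case True
    then show ?thesis using less.prems c(1) by (intro bexI[of _ 0] bexI[of _ f]) auto
  next
    case False
    define t where "t = monom (lead_coeff f) (degree f - degree m)"
    have t: "t \<in> polys_over K" unfolding t_def using less.prems by (intro c) (auto simp: polys_over_def)
    have dt: "degree t = degree f - degree m" using False by (simp add: t_def degree_monom_eq)
    have "m \<noteq> 0" "t \<noteq> 0" using m(2) False by (auto simp: t_def monom_eq_0_iff)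
    then have dmt: "degree (m * t) = degree f" using False dt by (simp add: degree_mult_eq)
    have lmt: "lead_coeff (m * t) = lead_coeff f"
      unfolding lead_coeff_mult m(2) dt by (simp add: t_def degree_monom_eq False)
    show ?thesis
    proof (cases "f - m * t = 0")
      case True
      then show ?thesis using t c(1) by (intro bexI[of _ t] bexI[of _ 0]) auto
    next
      case nz: False
      have "degree (f - m * t) \<le> degree f" using dmt by (simp add: degree_diff_le)
      moreover have "coeff (f - m * t) (degree f) = 0" using lmt dmt by simp
      then have "degree (f - m * t) \<noteq> degree f" using nz by (metis leading_coeff_0_iff)
      ultimately have "degree (f - m * t) < degree f" by simp
      then obtain g r where "g \<in> polys_over K" "r \<in> polys_over K" "f - m * t = m * g + r" "r = 0 \<or> degree r < degree m"
        using less.hyps c(3)[OF less.prems c(4)[OF m(1) t]] by blast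
      moreover from this have "f = m * (t + g) + r" by (simp add: algebra_simps)
      ultimately show ?thesis using c(2)[OF t] by blast
    qed
  qed
qed

text \<open>A nonzero integer polynomial of least degree vanishing at \<open>w\<close> has a nonzero
  constant term \<open>a\<close>; dividing its equation by \<open>w\<close> expresses a / w as a
  polynomial in \<open>w\<close>. This closes rings of polynomial values under inverses.\<close>

lemma algebraic_int_inverse_in_ring:
  assumes "algebraic_int w" "w \<noteq> (0::complex)"
  shows "\<exists>(a::int) (f::int poly). a \<noteq> 0 \<and> of_int a * inverse w = poly (map_poly of_int f) w"
proof -
  obtain p0 where "poly (map_poly of_int p0) w = 0" "lead_coeff p0 = (1::int)"
    using assms(1) unfolding algebraic_int_altdef_ipoly by blast
  then have "p0 \<noteq> 0 \<and> poly (map_poly of_int p0) w = 0" by auto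
  then obtain p where p: "p \<noteq> 0" "poly (map_poly of_int p) w = 0"
    "\<And>q. q \<noteq> 0 \<and> poly (map_poly of_int q) w = 0 \<Longrightarrow> degree p \<le> degree q"
    using ex_has_least_nat[of "\<lambda>p. p \<noteq> 0 \<and> poly (map_poly of_int p) w = 0" p0 degree] by blast
  obtain a q where aq: "p = pCons a q" by (cases p)
  have e: "of_int a + w * poly (map_poly of_int q) w = 0"
    using p(1,2) unfolding aq by (simp add: map_poly_pCons)
  have "a \<noteq> 0"
  proof
    assume "a = 0"
    then have "q \<noteq> 0" "poly (map_poly of_int q) w = 0" using e p(1) aq assms(2) by auto
    then have "degree p \<le> degree q" using p(3) by blast
    then show False using \<open>q \<noteq> 0\<close> by (simp add: aq)
  qed
  moreover have "of_int a * inverse w = poly (map_poly of_int (- q)) w"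
    using e assms(2) by (simp add: int_poly_eqI field_simps add_eq_0_iff)
  ultimately show ?thesis by blast
qed

lemma (in number_field) subfield_set: "subfield_set K"
  by (auto simp: subfield_set_def intro: one_mem diff_mem mult_mem inverse_mem)

text \<open>The values at \<open>x\<close> of polynomials over \<open>K\<close> form a field. With m
  the minimal polynomial of \<open>x\<close> over \<open>K\<close> and z a complex root of its image
  under \<open>\<phi>\<close>, the extension sends f(x) to the value at z of the image of f.\<close>

lemma embedding_adjoin:
  assumes H: "number_field H" and K: "subfield_set K" "K \<subseteq> H" and \<phi>: "hom_on K \<phi>" and x: "x \<in> H"
  shows "\<exists>K' \<phi>'. subfield_set K' \<and> K \<subseteq> K' \<and> K' \<subseteq> H \<and> x \<in> K' \<and> hom_on K' \<phi>' \<and> (\<forall>y\<in>K. \<phi>' y = \<phi> y)"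
proof -
  interpret H: number_field H by fact
  note c = subfield_set_closed[OF K(1)]
  note pc = polys_over_closed[OF K(1)]
  note h = hom_on_simps[OF K(1) \<phi>]
  define K' where "K' = (\<lambda>f. poly f x) ` polys_over K"
  have KK': "y \<in> K'" if "y \<in> K" for y
    unfolding K'_def using pc(5)[OF that, of 0] by (intro image_eqI[of _ _ "monom y 0"]) (auto simp: poly_monom)
  have K'H: "K' \<subseteq> H"
    using K(2) x unfolding K'_def by (auto simp: poly_altdef polys_over_def intro!: H.sum_mem H.mult_mem H.power_mem)
  have xK': "x \<in> K'" unfolding K'_def using pc(5)[OF c(2), of 1] by (intro image_eqI[of _ _ "monom 1 1"]) (auto simp: poly_monom)
  have diff': "u - v \<in> K'" if "u \<in> K'" "v \<in> K'" for u v using that pc(3) unfolding K'_def by (auto simp flip: poly_diff)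
  have add': "u + v \<in> K'" if "u \<in> K'" "v \<in> K'" for u v using that pc(2) unfolding K'_def by (auto simp flip: poly_add)
  have mult': "u * v \<in> K'" if "u \<in> K'" "v \<in> K'" for u v using that pc(4) unfolding K'_def by (auto simp flip: poly_mult)
  have ipoly': "poly (map_poly of_int f) w \<in> K'" if "w \<in> K'" for w f
  proof (induction f)
    case 0
    then show ?case using KK'[OF c(1)] by simp
  next
    case (pCons a f)
    then show ?case using add'[OF KK'[OF c(9)] mult'[OF that]] by (auto simp: map_poly_pCons)
  qed
  have inv': "inverse u \<in> K'" if u: "u \<in> K'" for u
  proof (cases "u = 0")
    case False
    obtain n :: nat where n: "n > 0" "of_nat n * u \<in> H.OK" using H.integral_multiple u K'H by blast
    then obtain a f where af: "a \<noteq> 0" "of_int a * inverse (of_nat n * u) = poly (map_poly of_int f) (of_nat n * u)"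
      using algebraic_int_inverse_in_ring[of "of_nat n * u"] False by (auto simp: H.OK_def)
    have nK: "of_nat n \<in> K" using c(9)[of "int n"] by simp
    have "inverse u = (of_nat n / of_int a) * (of_int a * inverse (of_nat n * u))" using n(1) af(1) False by (simp add: field_simps)
    also have "\<dots> \<in> K'" unfolding af(2) by (intro mult' ipoly' KK' u c(8) c(9) nK)
    finally show ?thesis .
  qed (use KK'[OF c(1)] in simp)
  have sub': "subfield_set K'" unfolding subfield_set_def using KK'[OF c(2)] diff' mult' inv' by blast
  define Z where "Z = (\<lambda>f. f \<in> polys_over K \<and> f \<noteq> 0 \<and> poly f x = 0)"
  have "\<exists>f. Z f"
  proof -
    obtain n :: nat where n: "n > 0" "of_nat n * x \<in> H.OK" using H.integral_multiple x by blast
    then obtain p where p: "poly (map_poly of_int p) (of_nat n * x) = 0" "lead_coeff p = (1::int)"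
      unfolding H.OK_def algebraic_int_altdef_ipoly by blast
    \<comment> \<open>An integral equation for n x read as an equation for \<open>x\<close>: the
      i-th coefficient acquires the factor n^i.\<close>
    define f where "f = (\<Sum>i\<le>degree p. monom (of_int (coeff p i) * of_nat n ^ i) i :: complex poly)"
    have cf: "coeff f i = (if i \<le> degree p then of_int (coeff p i) * of_nat n ^ i else 0)" for i
      unfolding f_def by (simp add: coeff_sum)
    have nK: "of_nat n \<in> K" using c(9)[of "int n"] by simp
    have "f \<in> polys_over K" unfolding polys_over_def using c(1,4,9) c(11)[OF nK] by (simp add: cf)
    moreover have "coeff f (degree p) \<noteq> 0" using p(2) n(1) by (simp add: cf)
    then have "f \<noteq> 0" by auto
    moreover have "poly f x = (\<Sum>i\<le>degree p. of_int (coeff p i) * of_nat n ^ i * x ^ i)"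
      unfolding f_def by (simp add: poly_sum poly_monom)
    then have "poly f x = 0" using p(1)
      by (simp add: poly_altdef degree_map_poly coeff_map_poly power_mult_distrib mult.assoc)
    ultimately show ?thesis unfolding Z_def by blast
  qed
  then obtain m0 where m0: "Z m0" "\<And>f. Z f \<Longrightarrow> degree m0 \<le> degree f" using ex_has_least_nat[of Z _ degree] by blast
  define m where "m = smult (inverse (lead_coeff m0)) m0"
  have lc: "lead_coeff m0 \<noteq> 0" "lead_coeff m0 \<in> K" using m0(1) by (auto simp: Z_def polys_over_def)
  have mP: "m \<in> polys_over K" using m0(1) c(4)[OF c(5)[OF lc(2)]] by (simp add: m_def Z_def polys_over_def)
  have md: "degree m = degree m0" using lc(1) by (simp add: m_def)
  have ml: "lead_coeff m = 1" using lc(1) by (simp add: m_def)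
  have mx: "poly m x = 0" using m0(1) by (simp add: m_def Z_def)
  have dm: "degree m > 0"
  proof (rule ccontr)
    assume "\<not> degree m > 0"
    then obtain a where "m = [:a:]" by (auto elim: degree_eq_zeroE)
    then show False using mx ml by simp
  qed
  define M where "M = map_poly \<phi> m"
  have cM: "coeff M (degree m) = 1" using ml h(1,2) by (simp add: M_def coeff_map_poly)
  then have "degree M \<ge> degree m" by (intro le_degree) simp
  then have "\<not> constant (poly M)" using dm constant_degree[of M] by simp
  then obtain z where z: "poly M z = 0" using fundamental_theorem_of_algebra by blast
  have vanish: "poly (map_poly \<phi> f) z = 0" if f: "f \<in> polys_over K" "poly f x = 0" for f
  proof -
    obtain g r where gr: "g \<in> polys_over K" "r \<in> polys_over K" "f = m * g + r" "r = 0 \<or> degree r < degree m"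
      using monic_division[OF K(1) mP ml f(1)] by blast
    have "poly r x = 0" using f(2) mx gr(3) by simp
    then have "r = 0" using gr(2,4) m0(2)[of r] md unfolding Z_def by linarith
    then have "map_poly \<phi> f = M * map_poly \<phi> g" using gr(3) map_poly_hom_on(2)[OF K(1) \<phi> mP gr(1)] by (simp add: M_def)
    then show ?thesis using z by simp
  qed
  \<comment> \<open>Some polynomial representing \<open>u\<close> is chosen; by
    \<open>vanish\<close>, the value of the extension does not depend on the choice.\<close>
  define lift where "lift = (\<lambda>u. SOME f. f \<in> polys_over K \<and> poly f x = u)"
  have lift: "lift u \<in> polys_over K" "poly (lift u) x = u" if "u \<in> K'" for u
    using that someI_ex[of "\<lambda>f. f \<in> polys_over K \<and> poly f x = u"] unfolding lift_def K'_def by blast+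
  define \<phi>' where "\<phi>' = (\<lambda>u. poly (map_poly \<phi> (lift u)) z)"
  have \<phi>': "\<phi>' (poly f x) = poly (map_poly \<phi> f) z" if f: "f \<in> polys_over K" for f
  proof -
    have u: "poly f x \<in> K'" using f by (simp add: K'_def)
    define g where "g = f - lift (poly f x)"
    have g: "g \<in> polys_over K" "poly g x = 0" using pc(3)[OF f lift(1)[OF u]] lift(2)[OF u] by (auto simp: g_def)
    have "map_poly \<phi> f = map_poly \<phi> (lift (poly f x)) + map_poly \<phi> g"
      using map_poly_hom_on(1)[OF K(1) \<phi> lift(1)[OF u] g(1)] by (simp add: g_def)
    then show ?thesis using vanish[OF g] by (simp add: \<phi>'_def)
  qed
  have ext: "\<phi>' y = \<phi> y" if "y \<in> K" for y
    using \<phi>'[OF pc(5)[OF that, of 0]] h(1) by (simp add: poly_monom map_poly_monom)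
  have "hom_on K' \<phi>'"
    unfolding hom_on_def
  proof (intro conjI ballI)
    show "\<phi>' 1 = 1" using ext[OF c(2)] h(2) by simp
    fix u v assume "u \<in> K'" "v \<in> K'"
    then obtain f g where fg: "f \<in> polys_over K" "g \<in> polys_over K" "u = poly f x" "v = poly g x" unfolding K'_def by blast
    show "\<phi>' (u + v) = \<phi>' u + \<phi>' v"
      using \<phi>'[OF pc(2)[OF fg(1,2)]] \<phi>'[OF fg(1)] \<phi>'[OF fg(2)] map_poly_hom_on(1)[OF K(1) \<phi> fg(1,2)] fg(3,4) by simp
    show "\<phi>' (u * v) = \<phi>' u * \<phi>' v"
      using \<phi>'[OF pc(4)[OF fg(1,2)]] \<phi>'[OF fg(1)] \<phi>'[OF fg(2)] map_poly_hom_on(2)[OF K(1) \<phi> fg(1,2)] fg(3,4) by simp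
  qed
  then show ?thesis using sub' KK' K'H xK' ext by blast
qed

text \<open>The finitely many elements of \<open>T\<close> are adjoined one after the other; a field
  that contains them contains their rational span, which is all of \<open>H\<close>.\<close>

lemma embedding_extends:
  assumes H: "number_field H" and F: "subfield_set F" "F \<subseteq> H" and \<phi>: "hom_on F \<phi>"
    and T: "finite T" "T \<subseteq> H" "H \<subseteq> QV.span T"
  shows "\<exists>\<tau>. hom_on H \<tau> \<and> (\<forall>y\<in>F. \<tau> y = \<phi> y)"
proof -
  have "\<exists>K \<psi>. subfield_set K \<and> F \<subseteq> K \<and> K \<subseteq> H \<and> T \<subseteq> K \<and> hom_on K \<psi> \<and> (\<forall>y\<in>F. \<psi> y = \<phi> y)"
    using T(1,2)
  proof (induction T rule: finite_induct)
    case empty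
    then show ?case using F \<phi> by (intro exI[of _ F] exI[of _ \<phi>]) auto
  next
    case (insert x T)
    then obtain K \<psi> where K: "subfield_set K" "F \<subseteq> K" "K \<subseteq> H" "T \<subseteq> K" "hom_on K \<psi>" "\<forall>y\<in>F. \<psi> y = \<phi> y" by auto
    obtain K' \<psi>' where "subfield_set K' \<and> K \<subseteq> K' \<and> K' \<subseteq> H \<and> x \<in> K' \<and> hom_on K' \<psi>' \<and> (\<forall>y\<in>K. \<psi>' y = \<psi> y)"
      using embedding_adjoin[OF H K(1,3,5), of x] insert.prems by blast
    then show ?case using K(2,4,6) by (intro exI[of _ K'] exI[of _ \<psi>']) auto
  qed
  then obtain K \<psi> where K: "subfield_set K" "F \<subseteq> K" "K \<subseteq> H" "T \<subseteq> K" "hom_on K \<psi>" "\<forall>y\<in>F. \<psi> y = \<phi> y" by blast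
  have "QV.span T \<subseteq> K"
  proof
    fix z assume "z \<in> QV.span T"
    then show "z \<in> K"
    proof (induction rule: QV.span_induct_alt)
      case base
      show ?case by (rule subfield_set_closed[OF K(1)])
    next
      case (step c x y)
      have "of_rat c \<in> K" by (cases c) (auto simp: of_rat_rat intro!: subfield_set_closed[OF K(1)])
      then show ?case using step K(4) by (intro subfield_set_closed(4,7)[OF K(1)]) auto
    qed
  qed
  then have "K = H" using K(3) T(3) by blast
  then show ?thesis using K by blast
qed

lemma algebraic_int_hom_on:
  assumes "subfield_set K" "hom_on K \<phi>" "x \<in> K" "algebraic_int x"
  shows "algebraic_int (\<phi> x)"
proof -
  note c = subfield_set_closed[OF assms(1)]
  note h = hom_on_simps[OF assms(1,2)]
  have hn: "\<phi> (of_nat n) = of_nat n \<and> of_nat n \<in> K" for n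
    by (induction n) (use h c(1,2,7) in auto)
  have hi: "\<phi> (of_int n) = of_int n" for n
    by (cases n rule: int_cases2) (use hn h(6) in auto)
  have hp: "poly (map_poly of_int p) x \<in> K \<and> \<phi> (poly (map_poly of_int p) x) = poly (map_poly of_int p) (\<phi> x)" for p
  proof (induction p)
    case 0
    then show ?case using h(1) c(1) by simp
  next
    case (pCons a p)
    then show ?case using h(3,4) hi c(4,7,9) assms(3) by (auto simp: map_poly_pCons)
  qed
  obtain p where p: "poly (map_poly of_int p) x = 0" "lead_coeff p = 1"
    using assms(4) unfolding algebraic_int_altdef_ipoly by blast
  then have "poly (map_poly of_int p) (\<phi> x) = 0" using hp[of p] h(1) by simp
  then show ?thesis using p(2) unfolding algebraic_int_altdef_ipoly by blast
qed

text \<open>In lowest terms, the square of the denominator of \<open>b\<close> divides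
  \<open>d\<close>.\<close>

lemma squarefree_denominator:
  fixes b :: rat
  assumes "squarefree (d::int)" "of_int d * b\<^sup>2 \<in> \<int>"
  shows "b \<in> \<int>"
proof -
  obtain p q where pq: "b = of_int p / of_int q" "q > 0" "coprime p q" by (cases b) (auto simp: Fract_of_int_quotient)
  obtain k where k: "of_int d * b\<^sup>2 = of_int k" using assms(2) by (auto elim: Ints_cases)
  have "(of_int (d * p\<^sup>2) :: rat) = of_int (k * q\<^sup>2)" using k pq(2) by (simp add: pq(1) field_simps power2_eq_square)
  then have "d * p\<^sup>2 = k * q\<^sup>2" by (simp only: of_int_eq_iff)
  then have "q\<^sup>2 dvd d * p\<^sup>2" by simp
  moreover have "coprime (q\<^sup>2) (p\<^sup>2)" using pq(3) by (simp add: coprime_commute)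
  ultimately have "q\<^sup>2 dvd d" using coprime_dvd_mult_left_iff by blast
  then have "is_unit q" using assms(1) by (simp add: squarefree_def)
  then have "q = 1" using pq(2) by simp
  then show ?thesis using pq(1) by simp
qed

section \<open>The field generated by \<surd>(l1 l2), its conjugation and its integers\<close>

locale quadratic =
  fixes l1 l2 :: nat
  assumes prime1: "Factorial_Ring.prime l1" and prime2: "Factorial_Ring.prime l2" and neq: "l1 \<noteq> l2"
    and mod1: "[l1 = 1] (mod 4)" and mod2: "[l2 = 1] (mod 4)"
begin

definition d :: int where "d = int (l1 * l2)"
definition s :: complex where "s = csqrt (of_int d)"
definition F :: "complex set" where "F = quadratic_field d"

lemma s_square: "s * s = of_int d" "s\<^sup>2 = of_int d"
  using power2_csqrt[of "of_int d"] by (simp_all add: s_def power2_eq_square)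

lemma d_pos: "d > 1"
proof -
  have "l1 > 1" "l2 > 1" using prime1 prime2 prime_gt_1_nat by blast+
  then have "l1 * l2 > 1 * 1" by (intro mult_strict_mono) auto
  then show ?thesis by (simp add: d_def flip: of_nat_mult)
qed

lemma d_mod_4: "d mod 4 = 1"
proof -
  have "(l1 * l2) mod 4 = (1 * 1) mod 4" using cong_mult[OF mod1 mod2] unfolding unique_euclidean_semiring_class.cong_def .
  then have "(l1 * l2) mod 4 = 1" by simp
  then have "int ((l1 * l2) mod 4) = 1" by simp
  then show ?thesis unfolding d_def zmod_int by simp
qed

lemma squarefree_d: "squarefree d"
proof -
  have "coprime (int l1) (int l2)" using prime1 prime2 neq primes_coprime by simp
  moreover have "squarefree (int l1)" "squarefree (int l2)"
    using prime1 prime2 by (simp_all add: squarefree_prime)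
  ultimately show ?thesis unfolding d_def of_nat_mult by (rule squarefree_mult_coprime)
qed

lemma s_real: "s = of_real (sqrt (of_int d))"
  using d_pos csqrt_of_real_nonneg[of "of_int d"] by (simp add: s_def)

lemma not_square:
  fixes u v :: rat
  assumes "u\<^sup>2 = of_int d * v\<^sup>2"
  shows "v = 0"
proof (rule ccontr)
  assume v: "v \<noteq> 0"
  \<comment> \<open>Chosen so that d b^2 = 1; this makes \<open>b\<close> integral and then
    \<open>d\<close> a unit.\<close>
  define b where "b = u / (of_int d * v)"
  have "of_int d * b\<^sup>2 = 1" using assms v d_pos by (simp add: b_def field_simps power2_eq_square)
  then have "b \<in> \<int>" using squarefree_denominator[OF squarefree_d, of b] by simp
  then obtain k where "b = of_int k" by (auto elim: Ints_cases)
  then have "(of_int (d * k\<^sup>2) :: rat) = of_int 1" using \<open>of_int d * b\<^sup>2 = 1\<close> by simp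
  then have "d * k\<^sup>2 = 1" by (simp only: of_int_eq_iff)
  then show False using d_pos by (metis less_irrefl pos_zmult_eq_1_iff zero_less_one order_less_trans)
qed

lemma coordinates_unique:
  assumes "of_rat u + of_rat v * s = of_rat u' + of_rat v' * s"
  shows "u = u' \<and> v = v'"
proof -
  have "of_rat u - of_rat u' - (of_rat v' - of_rat v) * s = (of_rat u + of_rat v * s) - (of_rat u' + of_rat v' * s)"
    by (simp add: algebra_simps)
  then have "of_rat (u - u') = of_rat (v' - v) * s" using assms by (simp add: of_rat_diff)
  then have "(of_rat (u - u'))\<^sup>2 = (of_rat (v' - v))\<^sup>2 * (of_int d :: complex)" by (simp add: power_mult_distrib s_square)
  then have "(of_rat ((u - u')\<^sup>2) :: complex) = of_rat (of_int d * (v' - v)\<^sup>2)"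
    by (simp add: of_rat_mult of_rat_power mult.commute)
  then have "(u - u')\<^sup>2 = of_int d * (v' - v)\<^sup>2" by (simp only: of_rat_eq_iff)
  moreover from this have "v' - v = 0" by (rule not_square)
  ultimately show ?thesis by simp
qed

lemma conjugate_product: "(of_rat u + of_rat v * s) * (of_rat u - of_rat v * s) = of_rat (u\<^sup>2 - of_int d * v\<^sup>2)"
proof -
  have "(a + b * s) * (a - b * s) = a\<^sup>2 - s\<^sup>2 * b\<^sup>2" for a b by (simp add: power2_eq_square algebra_simps)
  then show ?thesis by (simp add: s_square of_rat_diff of_rat_mult of_rat_power)
qed

lemma F_eq: "F = {of_rat u + of_rat v * s | u v. True}"
proof
  interpret CC: Ring.field CC by (rule field_from_type_algebra)
  let ?E = "{of_rat u + of_rat v * s | u v. True}"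
  have inv: "inverse (of_rat u + of_rat v * s) = of_rat (u / (u\<^sup>2 - of_int d * v\<^sup>2)) + of_rat (- v / (u\<^sup>2 - of_int d * v\<^sup>2)) * s" for u v
  proof (cases "u\<^sup>2 - of_int d * v\<^sup>2 = 0")
    \<comment> \<open>Norm zero forces u = v = 0, and then both sides are 0 by the convention for
      division.\<close>
    case True
    then have "v = 0" using not_square[of u v] by simp
    then show ?thesis using True by simp
  next
    case False
    define n where "n = u\<^sup>2 - of_int d * v\<^sup>2"
    have "(of_rat u + of_rat v * s) * (of_rat u - of_rat v * s) = of_rat n"
      by (simp add: conjugate_product n_def)
    moreover have "of_rat n \<noteq> (0 :: complex)" using False n_def by simp
    ultimately have "inverse (of_rat u + of_rat v * s) = (of_rat u - of_rat v * s) / of_rat n"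
      by (intro inverse_unique) simp
    then show ?thesis unfolding n_def[symmetric] by (simp add: of_rat_divide of_rat_minus diff_divide_distrib)
  qed
  have E: "x \<in> ?E" if "x = of_rat u + of_rat v * s" for x u v using that by blast
  have "x \<in> ?E" if "x \<in> generate_field CC {s}" for x
    using that
  proof (induction rule: generate_field.induct)
    case one
    show ?case by (rule E[of _ 1 0]) simp
  next
    case (incl h)
    then show ?case by (intro E[of _ 0 1]) simp
  next
    case (a_inv h)
    then obtain u v where "h = of_rat u + of_rat v * s" by blast
    then show ?case by (intro E[of _ "- u" "- v"]) (simp add: of_rat_minus)
  next
    case (m_inv h)
    then obtain u v where h: "h = of_rat u + of_rat v * s" by blast
    have "h \<noteq> 0" using m_inv(2) by simp
    then have "inv\<^bsub>CC\<^esub> h = inverse h" by (rule CC_inv)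
    also note inv[of u v, folded h]
    finally show ?case by (rule E)
  next
    case (eng_add h1 h2)
    then obtain u v u' v' where "h1 = of_rat u + of_rat v * s" "h2 = of_rat u' + of_rat v' * s" by blast
    then show ?case by (intro E[of _ "u + u'" "v + v'"]) (simp add: of_rat_add algebra_simps)
  next
    case (eng_mult h1 h2)
    then obtain u v u' v' where h: "h1 = of_rat u + of_rat v * s" "h2 = of_rat u' + of_rat v' * s" by blast
    have "h1 * h2 = of_rat u * of_rat u' + of_rat v * of_rat v' * (s * s) + (of_rat u * of_rat v' + of_rat v * of_rat u') * s"
      unfolding h by (simp add: algebra_simps)
    then have "h1 * h2 = of_rat (u * u' + v * v' * of_int d) + of_rat (u * v' + v * u') * s"
      by (simp add: s_square of_rat_add of_rat_mult)
    then show ?case unfolding CC_simps by (rule E)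
  qed
  then show "F \<subseteq> ?E" unfolding F_def quadratic_field_def s_def by blast
  have sub: "subfield F CC" unfolding F_def quadratic_field_def by (rule CC.generate_field_is_subfield) simp
  have "s \<in> F" unfolding F_def quadratic_field_def s_def by (rule generate_field.incl) simp
  have sF: "subfield_set F" using subfield_CC_D[OF sub] by (auto simp: subfield_set_def)
  note c = subfield_set_closed[OF sF]
  have "of_rat r \<in> F" for r by (cases r) (auto simp: of_rat_rat intro!: c)
  then show "?E \<subseteq> F" using \<open>s \<in> F\<close> by (auto intro!: c)
qed

lemma subfield_F: "subfield F CC"
proof -
  interpret CC: Ring.field CC by (rule field_from_type_algebra)
  show ?thesis unfolding F_def quadratic_field_def by (rule CC.generate_field_is_subfield) simp
qed

lemma s_in_F: "s \<in> F"
  unfolding F_eq by (rule CollectI, rule exI[of _ 0], rule exI[of _ 1]) simp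

lemma F_subset_span: "F \<subseteq> QV.span {1, s}"
proof
  fix x assume "x \<in> F"
  then obtain u v where x: "x = of_rat u * 1 + of_rat v * s" unfolding F_eq by auto
  show "x \<in> QV.span {1, s}" unfolding x by (intro QV.span_add QV.span_scale QV.span_base) auto
qed

sublocale F: number_field F
  using subfield_CC_D[OF subfield_F] F_subset_span by unfold_locales (auto intro!: exI[of _ "{1,s}"])

subsection \<open>Conjugation\<close>

text \<open>Read off from the rational coordinates with respect to 1 and \<open>s\<close>; outside
  \<open>F\<close> the value is arbitrary, so the rules for \<open>cj\<close> carry membership in
  \<open>F\<close> wherever it matters.\<close>

definition cj :: "complex \<Rightarrow> complex"
  where "cj x = (let (u, v) = SOME (u, v). x = of_rat u + of_rat v * s in of_rat u - of_rat v * s)"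

lemma cj_eq: "cj (of_rat u + of_rat v * s) = of_rat u - of_rat v * s"
proof -
  have "(SOME (u', v'). of_rat u + of_rat v * s = of_rat u' + of_rat v' * s) = (u, v)"
    by (rule some_equality) (use coordinates_unique in \<open>auto dest!: coordinates_unique\<close>)
  then show ?thesis by (simp add: cj_def)
qed

lemma F_cases:
  assumes "x \<in> F"
  obtains u v where "x = of_rat u + of_rat v * s" "cj x = of_rat u - of_rat v * s"
  using assms cj_eq unfolding F_eq by blast

lemma cj_of_rat [simp]: "cj (of_rat r) = of_rat r"
  using cj_eq[of r 0] by simp

lemma cj_of_int [simp]: "cj (of_int n) = of_int n"
  using cj_of_rat[of "of_int n"] by simp

lemma cj_of_nat [simp]: "cj (of_nat n) = of_nat n"
  using cj_of_rat[of "of_nat n"] by simp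

lemma cj_1 [simp]: "cj 1 = 1" and cj_0 [simp]: "cj 0 = 0"
  using cj_of_rat[of 1] cj_of_rat[of 0] by simp_all

lemma cj_s: "cj s = - s"
  using cj_eq[of 0 1] by simp

lemma cj_rat: "x \<in> \<rat> \<Longrightarrow> cj x = x"
  by (auto elim: Rats_cases)

lemma cj_in_F: "x \<in> F \<Longrightarrow> cj x \<in> F"
proof (elim F_cases)
  fix u v assume "cj x = of_rat u - of_rat v * s"
  then have "cj x = of_rat u + of_rat (- v) * s" by (simp add: of_rat_minus)
  then show ?thesis unfolding F_eq by blast
qed

lemma cj_cj [simp]: "x \<in> F \<Longrightarrow> cj (cj x) = x"
proof (elim F_cases)
  fix u v assume x: "x = of_rat u + of_rat v * s" "cj x = of_rat u - of_rat v * s"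
  then have "cj x = of_rat u + of_rat (- v) * s" by (simp add: of_rat_minus)
  then show ?thesis using cj_eq[of u "- v"] x by (simp add: of_rat_minus)
qed

lemma cj_add: "x \<in> F \<Longrightarrow> y \<in> F \<Longrightarrow> cj (x + y) = cj x + cj y"
proof (elim F_cases)
  fix u v u' v' assume x: "x = of_rat u + of_rat v * s" "cj x = of_rat u - of_rat v * s"
    "y = of_rat u' + of_rat v' * s" "cj y = of_rat u' - of_rat v' * s"
  have "x + y = of_rat (u + u') + of_rat (v + v') * s" using x by (simp add: of_rat_add algebra_simps)
  then have "cj (x + y) = of_rat (u + u') - of_rat (v + v') * s" by (simp only: cj_eq)
  then show ?thesis unfolding x(2,4) by (simp add: of_rat_add algebra_simps)
qed

lemma cj_mult: "x \<in> F \<Longrightarrow> y \<in> F \<Longrightarrow> cj (x * y) = cj x * cj y"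
proof (elim F_cases)
  fix u v u' v' assume x: "x = of_rat u + of_rat v * s" "cj x = of_rat u - of_rat v * s"
    "y = of_rat u' + of_rat v' * s" "cj y = of_rat u' - of_rat v' * s"
  have "x * y = of_rat u * of_rat u' + of_rat v * of_rat v' * (s * s) + (of_rat u * of_rat v' + of_rat v * of_rat u') * s"
    unfolding x by (simp add: algebra_simps)
  then have e: "x * y = of_rat (u * u' + v * v' * of_int d) + of_rat (u * v' + v * u') * s"
    by (simp add: s_square of_rat_add of_rat_mult)
  have "cj x * cj y = of_rat u * of_rat u' + of_rat v * of_rat v' * (s * s) - (of_rat u * of_rat v' + of_rat v * of_rat u') * s"
    unfolding x(2,4) by (simp add: algebra_simps)
  then have "cj x * cj y = of_rat (u * u' + v * v' * of_int d) - of_rat (u * v' + v * u') * s"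
    by (simp add: s_square of_rat_add of_rat_mult)
  then show ?thesis unfolding e cj_eq by simp
qed

lemma hom_on_cj: "hom_on F cj"
  by (simp add: hom_on_def cj_add cj_mult)

lemma cj_minus: "x \<in> F \<Longrightarrow> cj (- x) = - cj x"
  by (rule hom_on_simps(6)[OF F.subfield_set hom_on_cj])

lemma cj_diff: "x \<in> F \<Longrightarrow> y \<in> F \<Longrightarrow> cj (x - y) = cj x - cj y"
  using cj_add[of x "- y"] cj_minus[of y] F.minus_mem[of y] by simp

lemma cj_eq_0_iff [simp]: "x \<in> F \<Longrightarrow> cj x = 0 \<longleftrightarrow> x = 0"
  using cj_cj[of x] cj_0 by metis

lemma cj_divide: "x \<in> F \<Longrightarrow> y \<in> F \<Longrightarrow> cj (x / y) = cj x / cj y"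
proof (cases "y = 0")
  case False
  assume xy: "x \<in> F" "y \<in> F"
  then have "cj (x / y) * cj y = cj x" using cj_mult[OF F.divide_mem[OF xy] xy(2)] False by simp
  then show ?thesis using False xy by (simp add: field_simps)
qed simp

lemma cj_OK: "x \<in> F.OK \<Longrightarrow> cj x \<in> F.OK"
  using algebraic_int_hom_on[OF F.subfield_set hom_on_cj] cj_in_F by (auto simp: F.OK_def)

lemma trace_rational: "x \<in> F \<Longrightarrow> x + cj x \<in> \<rat>"
proof (elim F_cases)
  fix u v assume "x = of_rat u + of_rat v * s" "cj x = of_rat u - of_rat v * s"
  then have "x + cj x = of_rat u + of_rat u" by simp
  then show ?thesis by (metis Rats_add Rats_of_rat)
qed

lemma norm_rational: "x \<in> F \<Longrightarrow> x * cj x \<in> \<rat>"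
proof (elim F_cases)
  fix u v assume "x = of_rat u + of_rat v * s" "cj x = of_rat u - of_rat v * s"
  then have "x * cj x = of_rat (u\<^sup>2 - of_int d * v\<^sup>2)"
    by (simp add: conjugate_product)
  then show ?thesis by simp
qed

text \<open>In one direction trace and norm are both rational and algebraic integers; in the other,
  \<open>x\<close> is a root of the monic quadratic polynomial with these coefficients.\<close>

lemma OK_iff: "x \<in> F.OK \<longleftrightarrow> x \<in> F \<and> x + cj x \<in> \<int> \<and> x * cj x \<in> \<int>"
proof
  assume x: "x \<in> F.OK"
  then have "x \<in> F" by (simp add: F.OK_def)
  moreover have "x + cj x \<in> F.OK" "x * cj x \<in> F.OK" using x cj_OK by (auto intro: F.OK_add F.OK_mult)
  ultimately show "x \<in> F \<and> x + cj x \<in> \<int> \<and> x * cj x \<in> \<int>"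
    using F.OK_rational trace_rational norm_rational by blast
next
  assume x: "x \<in> F \<and> x + cj x \<in> \<int> \<and> x * cj x \<in> \<int>"
  have "algebraic_int x"
  proof (rule algebraic_int.intros)
    show "lead_coeff [:x * cj x, - (x + cj x), 1:] = 1" by simp
    show "\<forall>i. coeff [:x * cj x, - (x + cj x), 1:] i \<in> \<int>"
      using x Ints_minus[of "x + cj x"] by (auto simp: coeff_pCons split: nat.splits)
    show "poly [:x * cj x, - (x + cj x), 1:] x = 0" by (simp add: algebra_simps)
  qed
  then show "x \<in> F.OK" using x by (simp add: F.OK_def)
qed

definition w :: complex where "w = (1 + s) / 2"

text \<open>For x = u + v s the number d (2v)^2 is the square of the trace 2u minus four times the
  norm. As \<open>d\<close> is squarefree, 2v is an integer; as \<open>d\<close> is odd, 2v has the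
  parity of 2u. Conversely, \<open>w\<close> is integral because d = 1 modulo 4.\<close>

lemma OK_basis: "x \<in> F.OK \<longleftrightarrow> (\<exists>a b::int. x = of_int a + of_int b * w)"
proof
  assume x: "x \<in> F.OK"
  then have xF: "x \<in> F" by (simp add: F.OK_def)
  then obtain u v where uv: "x = of_rat u + of_rat v * s" "cj x = of_rat u - of_rat v * s" by (rule F_cases)
  have "x + cj x = of_rat (2 * u)" "x * cj x = of_rat (u\<^sup>2 - of_int d * v\<^sup>2)"
    using uv conjugate_product by (simp_all add: of_rat_mult)
  then obtain t n :: int where "(of_rat (2 * u) :: complex) = of_int t" "(of_rat (u\<^sup>2 - of_int d * v\<^sup>2) :: complex) = of_int n"
    using x unfolding OK_iff by (metis Ints_cases)
  then have tn: "2 * u = of_int t" "u\<^sup>2 - of_int d * v\<^sup>2 = of_int n"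
    by (metis of_rat_of_int_eq of_rat_eq_iff)+
  have "of_int d * (2 * v)\<^sup>2 = (2 * u)\<^sup>2 - 4 * (u\<^sup>2 - of_int d * v\<^sup>2)" by (simp add: power2_eq_square algebra_simps)
  also have "\<dots> = of_int (t\<^sup>2 - 4 * n)" unfolding tn by simp
  finally have *: "of_int d * (2 * v)\<^sup>2 = of_int (t\<^sup>2 - 4 * n)" .
  then have "2 * v \<in> \<int>" using squarefree_denominator[OF squarefree_d, of "2 * v"] by simp
  then obtain b where b: "2 * v = of_int b" by (auto elim: Ints_cases)
  have "(of_int (d * b\<^sup>2) :: rat) = of_int (t\<^sup>2 - 4 * n)" using * unfolding b by simp
  then have db: "d * b\<^sup>2 = t\<^sup>2 - 4 * n" by (simp only: of_int_eq_iff)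
  have "even (t - b)"
  proof -
    have "odd d" using d_mod_4 by presburger
    moreover have "even (t\<^sup>2 - d * b\<^sup>2)" using db by simp
    ultimately show ?thesis by simp
  qed
  then obtain a where a: "t - b = 2 * a" by blast
  have u: "u = of_int t / 2" and v: "v = of_int b / 2" using tn(1) b by auto
  have uv2: "of_rat u = (of_int t / 2 :: complex)" "of_rat v = (of_int b / 2 :: complex)"
    unfolding u v by (simp_all add: of_rat_divide)
  have "x = (of_int t + of_int b * s) / 2" unfolding uv(1) uv2 by (simp add: add_divide_distrib)
  moreover have "t = b + 2 * a" using a by simp
  ultimately have "x = of_int a + of_int b * w" by (simp add: w_def field_simps)
  then show "\<exists>a b::int. x = of_int a + of_int b * w" by blast
next
  have w: "w = of_rat (1/2) + of_rat (1/2) * s" by (simp add: w_def of_rat_divide add_divide_distrib)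
  have cw: "cj w = of_rat (1/2) - of_rat (1/2) * s" unfolding w by (rule cj_eq)
  have wF: "w \<in> F" unfolding F_eq using w by blast
  obtain k where k: "d = 4 * k + 1" using d_mod_4 by (metis mult_div_mod_eq)
  have "w + cj w = 1" unfolding cw by (subst w) (simp add: of_rat_divide)
  moreover have "w * cj w = of_rat ((1/2)\<^sup>2 - of_int d * (1/2)\<^sup>2)" unfolding cw by (subst w) (rule conjugate_product)
  moreover have "(1/2)\<^sup>2 - of_int d * (1/2)\<^sup>2 = (of_int (- k) :: rat)" by (simp add: k power_divide diff_divide_distrib add_divide_distrib)
  ultimately have "w + cj w = 1" "w * cj w = of_int (- k)" by (simp_all only: of_rat_of_int_eq)
  then have "w \<in> F.OK" using wF unfolding OK_iff by simp
  moreover assume "\<exists>a b::int. x = of_int a + of_int b * w"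
  ultimately show "x \<in> F.OK" using F.OK_add[OF F.OK_of_int F.OK_mult[OF F.OK_of_int]] by blast
qed

lemma w_OK: "w \<in> F.OK"
  unfolding OK_basis by (rule exI[of _ 0], rule exI[of _ 1]) simp

lemma s_OK: "s \<in> F.OK"
  unfolding OK_basis by (rule exI[of _ "-1"], rule exI[of _ 2]) (simp add: w_def)

end

section \<open>Fractional ideals\<close>

abbreviation scale :: "complex \<Rightarrow> complex set \<Rightarrow> complex set"
  where "scale c I \<equiv> (\<lambda>x. c * x) ` I"

lemma scale_scale: "scale a (scale b I) = scale (a * b) I"
  by (auto simp: image_image mult.assoc)

lemma scale_cancel: "c \<noteq> 0 \<Longrightarrow> scale c I = J \<Longrightarrow> I = scale (inverse c) J"
  by (force simp: image_image mult.assoc[symmetric])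

context number_field
begin

text \<open>Working form of \<open>fractional_ideal\<close>: the common denominator is a positive
  natural number, which conjugation leaves fixed.\<close>

definition frac :: "complex set \<Rightarrow> bool"
  where "frac I \<longleftrightarrow> I \<subseteq> K \<and> add_closed I \<and> I \<noteq> {0} \<and> (\<forall>a\<in>OK. \<forall>x\<in>I. a * x \<in> I) \<and>
    (\<exists>m>0::nat. \<forall>x\<in>I. of_nat m * x \<in> OK)"

lemma fracD:
  assumes "frac I"
  shows "x \<in> I \<Longrightarrow> x \<in> K" "add_closed I" "a \<in> OK \<Longrightarrow> x \<in> I \<Longrightarrow> a * x \<in> I" "\<exists>x\<in>I. x \<noteq> 0" "0 \<in> I" "I \<noteq> {0}"
    "\<exists>m>0::nat. \<forall>x\<in>I. of_nat m * x \<in> OK"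
    "x \<in> I \<Longrightarrow> y \<in> I \<Longrightarrow> x + y \<in> I" "x \<in> I \<Longrightarrow> y \<in> I \<Longrightarrow> x - y \<in> I"
  using assms add_closed_diff[of I x y] unfolding frac_def add_closed_def by auto

lemma fractional_ideal_iff: "fractional_ideal K I \<longleftrightarrow> frac I"
proof
  assume I: "fractional_ideal K I"
  then interpret additive_subgroup I CC by (simp add: fractional_ideal_def)
  have mult: "\<forall>a\<in>OK. \<forall>x\<in>I. a * x \<in> I" using I by (auto simp: fractional_ideal_def)
  then have "- x \<in> I" if "x \<in> I" for x using that OK_minus[OF OK_1] by force
  then have ac: "add_closed I" using zero_closed a_closed by (auto simp: add_closed_def)
  obtain d where d: "d \<in> OK" "d \<noteq> 0" "\<forall>x\<in>I. d * x \<in> OK" using I by (auto simp: fractional_ideal_def)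
  obtain n c where n: "n > (0::nat)" "c \<in> OK" "of_nat n = d * c" using nat_multiple[OF OK_mem] d by blast
  have "of_nat n * x \<in> OK" if "x \<in> I" for x
  proof -
    have "c * (d * x) \<in> OK" using OK_mult[OF n(2)] d(3) that by blast
    then show ?thesis unfolding n(3) by (simp add: mult.commute mult.left_commute)
  qed
  then show "frac I" using I ac mult n(1) unfolding frac_def fractional_ideal_def by auto
next
  assume I: "frac I"
  interpret CC: cring CC by (rule cring_from_type_algebra)
  have "subgroup I (add_monoid CC)"
  proof (rule CC.add.subgroupI)
    show "I \<subseteq> carrier CC" "I \<noteq> {}" using fracD(5)[OF I] by auto
  qed (use fracD(2,8)[OF I] in \<open>auto simp: add_closed_def\<close>)
  then have "additive_subgroup I CC" by (simp add: additive_subgroup_def)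
  moreover obtain m where "m > (0::nat)" "\<forall>x\<in>I. of_nat m * x \<in> OK" using fracD(7)[OF I] by blast
  then have "\<exists>d\<in>OK - {0}. \<forall>x\<in>I. d * x \<in> OK" by (intro bexI[of _ "of_nat m"]) auto
  ultimately show "fractional_ideal K I" using I unfolding fractional_ideal_def frac_def by auto
qed

lemma integral_ideal_imp_frac: "integral_ideal I \<Longrightarrow> I \<noteq> {0} \<Longrightarrow> frac I"
  unfolding frac_def integral_ideal_def by (auto intro!: exI[of _ 1] OK_mem)

lemma frac_imp_integral_ideal: "frac I \<Longrightarrow> I \<subseteq> OK \<Longrightarrow> integral_ideal I"
  unfolding frac_def integral_ideal_def by auto

lemma frac_OK: "frac OK"
  by (rule integral_ideal_imp_frac[OF integral_ideal_OK]) (use OK_1 in force)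

lemma frac_scale:
  assumes "frac I" "c \<in> K" "c \<noteq> 0"
  shows "frac (scale c I)"
proof -
  note I = fracD[OF assms(1)]
  obtain m where m: "m > (0::nat)" "\<forall>x\<in>I. of_nat m * x \<in> OK" using I(7) by blast
  obtain n where n: "n > (0::nat)" "of_nat n * c \<in> OK" using integral_multiple[OF assms(2)] by blast
  have "of_nat (n * m) * (c * x) \<in> OK" if "x \<in> I" for x
  proof -
    have "(of_nat n * c) * (of_nat m * x) \<in> OK" using OK_mult[OF n(2)] m(2) that by blast
    then show ?thesis by (simp add: mult.assoc mult.left_commute)
  qed
  then have "\<forall>x\<in>scale c I. of_nat (n * m) * x \<in> OK" by blast
  moreover have "n * m > 0" using n(1) m(1) by simp
  ultimately have "\<exists>m>0::nat. \<forall>x\<in>scale c I. of_nat m * x \<in> OK" by blast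
  moreover have "add_closed (scale c I)" unfolding add_closed_def
  proof (intro conjI ballI)
    show "0 \<in> scale c I" using I(5) by (intro image_eqI[of _ _ 0]) auto
    show "x + y \<in> scale c I" if "x \<in> scale c I" "y \<in> scale c I" for x y
      using that I(8) by (auto simp: distrib_left[symmetric] intro!: imageI)
    show "- x \<in> scale c I" if "x \<in> scale c I" for x
    proof -
      obtain y where y: "y \<in> I" "x = c * y" using \<open>x \<in> scale c I\<close> by blast
      then have "- y \<in> I" "- x = c * (- y)" using I(2) by (auto simp: add_closed_def)
      then show ?thesis by (metis imageI)
    qed
  qed
  moreover obtain x where "x \<in> I" "x \<noteq> 0" using I(4) by blast
  then have "scale c I \<noteq> {0}" using assms(3) by (metis image_eqI mult_eq_0_iff singletonD)
  moreover have "a * (c * x) \<in> scale c I" if "a \<in> OK" "x \<in> I" for a x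
    using I(3)[OF that] by (auto simp: mult.left_commute)
  ultimately show ?thesis using I(1) assms(2) unfolding frac_def by (auto intro: mult_mem)
qed

lemma frac_prod:
  assumes "frac I" "frac J"
  shows "frac (I \<diamondop> J)"
proof -
  note I = fracD[OF assms(1)]
  note J = fracD[OF assms(2)]
  obtain m where m: "m > (0::nat)" "\<forall>x\<in>I. of_nat m * x \<in> OK" using I(7) by blast
  obtain n where n: "n > (0::nat)" "\<forall>x\<in>J. of_nat n * x \<in> OK" using J(7) by blast
  have "I \<diamondop> J \<subseteq> {x \<in> K. of_nat (m * n) * x \<in> OK}"
  proof (rule set_prod_least)
    fix i j assume "i \<in> I" "j \<in> J"
    then have "(of_nat m * i) * (of_nat n * j) \<in> OK" "i * j \<in> K" using m(2) n(2) I(1) J(1) by (auto intro: OK_mult mult_mem)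
    then show "i * j \<in> {x \<in> K. of_nat (m * n) * x \<in> OK}" by (simp add: mult_ac)
  qed (auto simp: distrib_left intro: OK_add add_mem)
  moreover have "m * n > 0" using m(1) n(1) by simp
  moreover have "a * x \<in> I \<diamondop> J" if "a \<in> OK" "x \<in> I \<diamondop> J" for a x
    using that(2)
  proof (induction rule: set_prod_induct)
    case (mult i j)
    then show ?case using set_prod_mult[of "a * i" I j J] I(3)[OF that(1)] by (simp add: mult.assoc)
  next
    case (add x y)
    then show ?case by (simp add: distrib_left set_prod_add)
  qed
  moreover obtain i j where "i \<in> I" "i \<noteq> 0" "j \<in> J" "j \<noteq> 0" using I(4) J(4) by blast
  then have "i * j \<in> I \<diamondop> J" "i * j \<noteq> 0" by (auto intro: set_prod_mult)
  then have "I \<diamondop> J \<noteq> {0}" by blast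
  moreover have "add_closed (I \<diamondop> J)" by (rule add_closed_set_prod[OF I(2)]) (use J(5) in blast)
  ultimately show ?thesis unfolding frac_def by (blast intro: mult_mem)
qed

lemma frac_prod_OK: "frac I \<Longrightarrow> I \<diamondop> OK = I" "frac I \<Longrightarrow> OK \<diamondop> I = I"
  using set_prod_OK[of I] fracD by auto

lemma scale_OK_eq:
  assumes "scale a OK = scale b OK" "b \<noteq> 0"
  shows "a / b \<in> OK"
proof -
  have "a * 1 \<in> scale b OK" using assms(1) OK_1 by blast
  then show ?thesis using assms(2) by auto
qed

lemma scale_OK_eqI:
  assumes "a / b \<in> OK" "b / a \<in> OK" "a \<noteq> 0" "b \<noteq> 0"
  shows "scale a OK = scale b OK"
proof -
  have "scale a OK \<subseteq> scale b OK" if "a / b \<in> OK" "b \<noteq> 0" for a b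
  proof
    fix x assume "x \<in> scale a OK"
    then obtain y where "y \<in> OK" "x = a * y" by blast
    then have "x = b * ((a / b) * y)" "(a / b) * y \<in> OK" using that(2) OK_mult[OF that(1)] by auto
    then show "x \<in> scale b OK" by blast
  qed
  then show ?thesis using assms by blast
qed

lemma scale_prod_OK: "scale a OK \<diamondop> scale b OK = scale (a * b) OK"
  unfolding set_prod_scale set_prod_scale_right scale_scale frac_prod_OK(1)[OF frac_OK] mult.commute[of b a] ..

lemma scale_OK_prod: "frac I \<Longrightarrow> scale a OK \<diamondop> I = scale a I"
  by (simp only: set_prod_scale frac_prod_OK)

lemma OK_sqrt:
  assumes "x \<in> K" "x * x \<in> OK"
  shows "x \<in> OK"
proof -
  have "algebraic_int x"
    by (rule algebraic_int_root[of "x * x" "monom 1 2"])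
      (use assms(2) in \<open>auto simp: OK_def poly_monom power2_eq_square degree_monom_eq\<close>)
  then show ?thesis using assms(1) by (simp add: OK_def)
qed

text \<open>The quotient C = I J' squares to O_K. Its elements have integral squares, hence are
  integral, and then O_K = C C \<subseteq> C.\<close>

lemma square_root_unique:
  assumes "frac I" "frac J" "I \<diamondop> I = J \<diamondop> J" and J': "frac J'" "J \<diamondop> J' = OK"
  shows "I = J"
proof -
  define C where "C = I \<diamondop> J'"
  have C: "frac C" unfolding C_def by (rule frac_prod[OF assms(1) J'(1)])
  have "C \<diamondop> C = (I \<diamondop> I) \<diamondop> (J' \<diamondop> J')" unfolding C_def by (metis set_prod_assoc set_prod_commute)
  also have "\<dots> = (J \<diamondop> J') \<diamondop> (J \<diamondop> J')" unfolding assms(3) by (metis set_prod_assoc set_prod_commute)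
  also have "\<dots> = OK" unfolding J' by (rule frac_prod_OK[OF frac_OK])
  finally have CC: "C \<diamondop> C = OK" .
  have sub: "C \<subseteq> OK"
  proof
    fix x assume "x \<in> C"
    then show "x \<in> OK" using set_prod_mult[of x C x C] CC fracD(1)[OF C] OK_sqrt by blast
  qed
  have "OK \<subseteq> C" using set_prod_subset(1)[OF frac_imp_integral_ideal frac_imp_integral_ideal, OF C sub C sub] CC by simp
  then have "C = OK" using sub by blast
  have "I = I \<diamondop> (J \<diamondop> J')" unfolding J' by (rule frac_prod_OK(1)[OF assms(1), symmetric])
  also have "\<dots> = C \<diamondop> J" unfolding C_def by (metis set_prod_assoc set_prod_commute)
  also have "\<dots> = J" using \<open>C = OK\<close> frac_prod_OK(2)[OF assms(2)] by simp
  finally show ?thesis .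
qed

end

lemma int_squarefree_cases:
  assumes "squarefree (m::int)" "Factorial_Ring.prime a" "Factorial_Ring.prime b" "a \<noteq> (b::nat)"
    and pr: "\<And>q::nat. Factorial_Ring.prime q \<Longrightarrow> int q dvd m \<Longrightarrow> q = a \<or> q = b"
  shows "\<bar>m\<bar> \<in> {1, int a, int b, int a * int b}"
proof -
  have red: "\<exists>e m'. m = e * m' \<and> (e = 1 \<or> e = int p) \<and> \<not> int p dvd m'" if sq: "squarefree m" and p: "Factorial_Ring.prime p" for m p
  proof (cases "int p dvd m")
    case True
    then obtain k where k: "m = int p * k" by blast
    have "\<not> int p dvd k"
    proof
      assume "int p dvd k"
      then have "(int p)\<^sup>2 dvd m" unfolding k by (auto simp: power2_eq_square)
      then have "is_unit (int p)" using squarefreeD[OF sq] by blast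
      then show False using prime_gt_1_nat[OF p] by auto
    qed
    then show ?thesis using k by (intro exI[of _ "int p"] exI[of _ k]) auto
  qed (intro exI[of _ 1] exI[of _ m], simp)
  obtain e1 m1 where 1: "m = e1 * m1" "e1 = 1 \<or> e1 = int a" "\<not> int a dvd m1" using red[OF assms(1,2)] by blast
  have "squarefree m1" using assms(1) 1(1) squarefree_mono by (metis dvd_triv_right)
  then obtain e2 m2 where 2: "m1 = e2 * m2" "e2 = 1 \<or> e2 = int b" "\<not> int b dvd m2" using red[OF _ assms(3)] by blast
  have "nat \<bar>m2\<bar> = 1"
  proof (rule ccontr)
    assume "nat \<bar>m2\<bar> \<noteq> 1"
    then obtain q where q: "Factorial_Ring.prime q" "q dvd nat \<bar>m2\<bar>" using prime_factor_nat by blast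
    then have "int q dvd m2" by (simp add: int_dvd_int_iff[symmetric])
    then have "q = a \<or> q = b" using pr q(1) 1(1) 2(1) by simp
    then show False using 1 2 \<open>int q dvd m2\<close> by auto
  qed
  then have "\<bar>m2\<bar> = 1" by simp
  then show ?thesis using 1 2 by (auto simp: abs_mult)
qed

section \<open>Norms of ideals of \<open>F\<close> and square roots of principal ideals\<close>

context quadratic
begin

lemma frac_cj: "F.frac I \<Longrightarrow> F.frac (cj ` I)"
proof -
  assume "F.frac I"
  note I = F.fracD[OF this]
  obtain m where m: "m > (0::nat)" "\<forall>x\<in>I. of_nat m * x \<in> F.OK" using I(7) by blast
  have "of_nat m * cj x \<in> F.OK" if "x \<in> I" for x
    using cj_OK[of "of_nat m * x"] m(2) that cj_mult[OF F.of_nat_mem I(1)[OF that], of m] by simp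
  then have "\<exists>m>0::nat. \<forall>x\<in>cj ` I. of_nat m * x \<in> F.OK" using m(1) by blast
  moreover have "add_closed (cj ` I)" using I(1,2,5,8) unfolding add_closed_def
    by (auto simp: cj_add[symmetric] cj_minus[symmetric] intro!: image_eqI[of 0])
  moreover have "cj ` I \<noteq> {0}" using I(1,4) cj_eq_0_iff by (metis imageI singletonD)
  moreover have "a * cj x \<in> cj ` I" if "a \<in> F.OK" "x \<in> I" for a x
  proof -
    have "cj (cj a * x) = a * cj x" using cj_mult[OF cj_in_F I(1)[OF that(2)], of a] cj_cj[of a] F.OK_mem[OF that(1)] by simp
    moreover have "cj a * x \<in> I" using I(3)[OF cj_OK[OF that(1)] that(2)] .
    ultimately show ?thesis by (metis imageI)
  qed
  ultimately show ?thesis using I(1) cj_in_F unfolding F.frac_def by auto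
qed

text \<open>Let g generate the group of rational elements of I cj(I). For i and j in I put y = i
  cj(j). The trace of y is a rational element of the product, hence a multiple of g; its norm is the
  product of the norms of i and j, hence a multiple of g^2. So y / g has integral trace and norm.
  This is the source of all inverses of ideals of \<open>F\<close>.\<close>

lemma norm_ideal:
  assumes "F.frac I"
  shows "\<exists>g\<in>\<rat>. g \<noteq> 0 \<and> I \<diamondop> cj ` I = scale g F.OK"
proof -
  note I = F.fracD[OF assms]
  define C where "C = I \<diamondop> cj ` I"
  have C: "F.frac C" unfolding C_def by (rule F.frac_prod[OF assms frac_cj[OF assms]])
  note CD = F.fracD[OF C]
  obtain m where m: "m > (0::nat)" "\<forall>x\<in>C. of_nat m * x \<in> F.OK" using CD(7) by blast
  \<comment> \<open>The rational elements of \<open>C\<close>, recorded by their numerators over the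
    common denominator \<open>m\<close>.\<close>
  define G where "G = {n::int. of_int n / of_nat m \<in> C}"
  have "\<exists>g\<in>G. \<forall>x\<in>G. g dvd x"
  proof (rule int_subgroup_cyclic)
    show "0 \<in> G" using CD(5) by (simp add: G_def)
    show "x - y \<in> G" if "x \<in> G" "y \<in> G" for x y using CD(9) that by (simp add: G_def diff_divide_distrib)
  qed
  then obtain g0 where g0: "of_int g0 / of_nat m \<in> C" "\<And>n. n \<in> G \<Longrightarrow> g0 dvd n" unfolding G_def by blast
  have ratC: "\<exists>n. x = of_int n * (of_int g0 / of_nat m)" if x: "x \<in> C" "x \<in> \<rat>" for x
  proof -
    have "of_nat m * x \<in> \<int>" using m(2) x F.OK_rational by (metis Rats_mult Rats_of_nat)
    then obtain n where n: "of_nat m * x = of_int n" by (auto elim: Ints_cases)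
    then have xn: "x = of_int n / of_nat m" using m(1) by (metis nonzero_mult_div_cancel_left of_nat_0_eq_iff less_numeral_extra(3))
    then have "n \<in> G" using x(1) by (simp add: G_def)
    then obtain k where "n = g0 * k" using g0(2) by blast
    then show ?thesis using xn by (intro exI[of _ k]) simp
  qed
  define g where "g = (of_int g0 / of_nat m :: complex)"
  have normC: "i * cj i \<in> C" if "i \<in> I" for i unfolding C_def using that by (auto intro: set_prod_mult)
  obtain x where x: "x \<in> I" "x \<noteq> 0" using I(4) by blast
  then obtain n where n: "x * cj x = of_int n * g" using ratC[OF normC] norm_rational I(1) unfolding g_def by blast
  have "x * cj x \<noteq> 0" using x I(1) by simp
  then have g: "g \<in> \<rat>" "g \<noteq> 0" using n by (simp add: g_def, auto)
  have "C \<subseteq> scale g F.OK"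
    unfolding C_def
  proof (rule set_prod_least)
    fix i j' assume i: "i \<in> I" and "j' \<in> cj ` I"
    then obtain j where j: "j \<in> I" "j' = cj j" by blast
    note iF = I(1)[OF i]
    note jF = I(1)[OF j(1)]
    define y where "y = i * cj j"
    have yF: "y \<in> F" unfolding y_def by (intro F.mult_mem iF cj_in_F jF)
    have cy: "cj y = j * cj i" unfolding y_def using cj_mult[OF iF cj_in_F[OF jF]] jF by simp
    have "y \<in> C" "cj y \<in> C" unfolding cy using i j by (auto simp: y_def C_def intro: set_prod_mult)
    then have "y + cj y \<in> C" using CD(8) by blast
    then obtain t where t: "y + cj y = of_int t * g" using ratC trace_rational[OF yF] unfolding g_def by blast
    obtain a b where ab: "i * cj i = of_int a * g" "j * cj j = of_int b * g"
      using ratC[OF normC] norm_rational iF jF i j(1) unfolding g_def by meson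
    have "y * cj y = (i * cj i) * (j * cj j)" unfolding cy by (simp add: y_def)
    then have nn: "y * cj y = of_int (a * b) * g * g" unfolding ab by simp
    have cg: "cj (y / g) = cj y / g" using cj_divide[OF yF F.Rats_mem[OF g(1)]] cj_rat[OF g(1)] by simp
    have "y / g + cj (y / g) = of_int t" "(y / g) * cj (y / g) = of_int (a * b)"
      unfolding cg using t nn g(2) by (simp_all add: add_divide_distrib[symmetric])
    then have "y / g \<in> F.OK" unfolding OK_iff using F.divide_mem[OF yF F.Rats_mem[OF g(1)]] by simp
    then show "i * j' \<in> scale g F.OK" using g(2) unfolding j(2) y_def by (intro image_eqI[of _ _ "i * cj j / g"]) auto
  qed (auto simp: distrib_left[symmetric] intro!: imageI F.OK_add)
  moreover have "scale g F.OK \<subseteq> C" using CD(3)[OF _ g0(1)] by (auto simp: g_def mult.commute)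
  ultimately show ?thesis using g unfolding C_def by blast
qed

lemma frac_inverse:
  assumes "F.frac I"
  shows "\<exists>J. F.frac J \<and> I \<diamondop> J = F.OK"
proof -
  obtain g where g: "g \<in> \<rat>" "g \<noteq> 0" "I \<diamondop> cj ` I = scale g F.OK" using norm_ideal[OF assms] by blast
  have "F.frac (scale (inverse g) (cj ` I))"
    using F.frac_scale[OF frac_cj[OF assms] F.inverse_mem[OF F.Rats_mem[OF g(1)]]] g(2) by simp
  moreover have "I \<diamondop> scale (inverse g) (cj ` I) = scale (inverse g) (scale g F.OK)"
    unfolding set_prod_scale_right g(3) ..
  then have "I \<diamondop> scale (inverse g) (cj ` I) = scale (inverse g * g) F.OK" unfolding scale_scale .
  then have "I \<diamondop> scale (inverse g) (cj ` I) = F.OK" using g(2) by simp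
  ultimately show ?thesis by blast
qed

lemma square_root_unique:
  assumes "F.frac I" "F.frac J" "I \<diamondop> I = J \<diamondop> J"
  shows "I = J"
proof -
  obtain J' where "F.frac J'" "J \<diamondop> J' = F.OK" using frac_inverse[OF assms(2)] by blast
  then show ?thesis by (rule F.square_root_unique[OF assms])
qed

definition k0 :: int where "k0 = (d - 1) div 4"

lemma d_k0: "d = 4 * k0 + 1"
  unfolding k0_def using d_mod_4 by presburger

lemma w_square: "w * w = w + of_int k0"
proof -
  have "w * w = (1 + 2 * s + s * s) / 4" by (simp add: w_def algebra_simps)
  also have "\<dots> = w + of_int k0" unfolding s_square(1) by (subst d_k0) (simp add: w_def field_simps)
  finally show ?thesis .
qed

lemma cj_w: "cj w = 1 - w"
proof -
  have w: "w = of_rat (1/2) + of_rat (1/2) * s" by (simp add: w_def of_rat_divide add_divide_distrib)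
  have "cj w = of_rat (1/2) - of_rat (1/2) * s" unfolding w by (rule cj_eq)
  then show ?thesis by (simp add: w_def of_rat_divide field_simps)
qed

lemma w_in_F: "w \<in> F"
  using w_OK F.OK_mem by blast

lemma trace_norm_basis:
  "of_int a + of_int b * w + cj (of_int a + of_int b * w) = of_int (2 * a + b)"
  "(of_int a + of_int b * w) * cj (of_int a + of_int b * w) = of_int (a\<^sup>2 + a * b - k0 * b\<^sup>2)"
proof -
  have c: "cj (of_int a + of_int b * w) = of_int a + of_int b * (1 - w)"
    using cj_add[OF F.of_int_mem F.mult_mem[OF F.of_int_mem w_in_F]] cj_mult[OF F.of_int_mem w_in_F] by (simp add: cj_w)
  show "of_int a + of_int b * w + cj (of_int a + of_int b * w) = of_int (2 * a + b)"
    unfolding c by (simp add: algebra_simps)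
  have "(A + B * w) * (A + B * (1 - w)) = A\<^sup>2 + A * B + B\<^sup>2 * w - B\<^sup>2 * (w * w)" for A B
    by (simp add: algebra_simps power2_eq_square)
  then show "(of_int a + of_int b * w) * cj (of_int a + of_int b * w) = of_int (a\<^sup>2 + a * b - k0 * b\<^sup>2)"
    unfolding c w_square by (simp add: algebra_simps)
qed

text \<open>For x = a + b w in J the square of x is a multiple of m, so q divides the norm N and the
  trace T of x, and therefore d b^2 = T^2 - 4 N. If q did not divide d, it would divide b and a;
  then J \<subseteq> q O_F, and q^2 would divide m.\<close>

lemma ramified_prime:
  assumes J: "F.frac J" "J \<diamondop> J = scale (of_int m) F.OK" and m: "squarefree m"
    and q: "Factorial_Ring.prime (q::nat)" "int q dvd m"
  shows "int q dvd d"
proof (rule ccontr)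
  assume nd: "\<not> int q dvd d"
  have qp: "Factorial_Ring.prime (int q)" using q(1) by simp
  have m0: "m \<noteq> 0" using m by auto
  obtain m' where m': "m = int q * m'" using q(2) by blast
  have "J \<subseteq> scale (of_nat q) F.OK"
  proof
    fix x assume x: "x \<in> J"
    note xF = F.fracD(1)[OF J(1) x]
    obtain z where z: "z \<in> F.OK" "x * x = of_int m * z" using set_prod_mult[OF x x] J(2) by auto
    have "x \<in> F.OK" using F.OK_sqrt[OF xF] z F.OK_mult by simp
    then obtain a b where ab: "x = of_int a + of_int b * w" unfolding OK_basis by blast
    define T where "T = 2 * a + b"
    define N where "N = a\<^sup>2 + a * b - k0 * b\<^sup>2"
    have TN: "x + cj x = of_int T" "x * cj x = of_int N" using trace_norm_basis[of a b] by (simp_all add: ab T_def N_def)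
    have zF: "z \<in> F" using z(1) F.OK_mem by blast
    obtain t n where tn: "z + cj z = of_int t" "z * cj z = of_int n" using z(1) unfolding OK_iff by (metis Ints_cases)
    have cx: "cj x * cj x = of_int m * cj z"
      using cj_mult[OF xF xF] cj_mult[OF F.of_int_mem zF, of m] z(2) by simp
    have "(x * cj x) * (x * cj x) = (x * x) * (cj x * cj x)" by simp
    also have "\<dots> = of_int m * of_int m * (z * cj z)" unfolding z(2) cx by simp
    finally have "(of_int (N * N) :: complex) = of_int (m * m * n)" unfolding TN tn by simp
    then have "N * N = m * m * n" by (simp only: of_int_eq_iff)
    then have "int q dvd N * N" using q(2) by simp
    then have qN: "int q dvd N" using qp by (simp add: prime_dvd_mult_iff)
    have "(x + cj x) * (x + cj x) = x * x + cj x * cj x + 2 * (x * cj x)" by (simp add: algebra_simps)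
    also have "\<dots> = of_int m * (z + cj z) + 2 * (x * cj x)" unfolding z(2) cx by (simp add: algebra_simps)
    finally have "(of_int (T * T) :: complex) = of_int (m * t + 2 * N)" unfolding TN tn by simp
    then have "T * T = m * t + 2 * N" by (simp only: of_int_eq_iff)
    then have "int q dvd T * T" using q(2) qN by simp
    then have qT: "int q dvd T" using qp by (simp add: prime_dvd_mult_iff)
    have "d * b\<^sup>2 = T\<^sup>2 - 4 * N" unfolding d_k0 T_def N_def by (simp add: algebra_simps power2_eq_square)
    then have "int q dvd d * b\<^sup>2" using qT qN by (simp add: power2_eq_square)
    then have "int q dvd b\<^sup>2" using qp nd by (simp add: prime_dvd_mult_iff)
    then have qb: "int q dvd b" using qp prime_dvd_power by blast
    have "a\<^sup>2 = N - a * b + k0 * b\<^sup>2" by (simp add: N_def)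
    then have "int q dvd a\<^sup>2" using qN qb by (simp add: power2_eq_square)
    then have qa: "int q dvd a" using qp prime_dvd_power by blast
    obtain a' b' where "a = int q * a'" "b = int q * b'" using qa qb by blast
    then have "x = of_nat q * (of_int a' + of_int b' * w)" unfolding ab by (simp add: algebra_simps)
    moreover have "of_int a' + of_int b' * w \<in> F.OK" unfolding OK_basis by blast
    ultimately show "x \<in> scale (of_nat q) F.OK" by blast
  qed
  then have "J \<diamondop> J \<subseteq> scale (of_nat q) F.OK \<diamondop> scale (of_nat q) F.OK" by (intro set_prod_mono)
  then have "scale (of_int m) F.OK \<subseteq> scale (of_nat q * of_nat q) F.OK" unfolding J(2) F.scale_prod_OK .
  moreover have "of_int m * 1 \<in> scale (of_int m) F.OK" using F.OK_1 by blast
  ultimately obtain y where y: "y \<in> F.OK" "of_int m * 1 = of_nat q * of_nat q * y" by blast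
  have q0: "of_nat q \<noteq> (0::complex)" using prime_gt_0_nat[OF q(1)] by simp
  then have "y = of_int m' / of_nat q" using y(2) m' by (simp add: field_simps)
  moreover have "(of_int m' / of_nat q :: complex) \<in> \<rat>" by simp
  ultimately have "y \<in> \<int>" using F.OK_rational y(1) by blast
  then obtain n where "y = of_int n" by (auto elim: Ints_cases)
  then have "(of_int m :: complex) = of_int (int q * int q * n)" using y(2) by simp
  then have "m = int q * int q * n" by (simp only: of_int_eq_iff)
  then have "(int q)\<^sup>2 dvd m" by (simp add: power2_eq_square)
  then have "is_unit (int q)" using squarefreeD[OF m] by blast
  then show False using prime_gt_1_nat[OF q(1)] by auto
qed

lemma prime_dvd_d: "Factorial_Ring.prime (q::nat) \<Longrightarrow> int q dvd d \<Longrightarrow> q = l1 \<or> q = l2"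
proof -
  assume q: "Factorial_Ring.prime q" "int q dvd d"
  then have "q dvd l1 * l2" unfolding d_def by (simp only: int_dvd_int_iff)
  then show ?thesis using q(1) prime1 prime2 by (simp add: prime_dvd_mult_iff primes_dvd_imp_eq) (metis primes_dvd_imp_eq)
qed

text \<open>Multiplying I^2 = \<alpha> O_F by its conjugate gives g^2 O_F = \<alpha> cj(\<alpha>)
  O_F; the quotient of these two rational generators is a unit of \<int>.\<close>

lemma norm_of_square_root:
  assumes I: "F.frac I" "I \<diamondop> I = scale \<alpha> F.OK" and \<alpha>: "\<alpha> \<in> F" "\<alpha> \<noteq> 0"
  shows "\<exists>g\<in>\<rat>. g \<noteq> 0 \<and> (\<alpha> * cj \<alpha> = g\<^sup>2 \<or> \<alpha> * cj \<alpha> = - g\<^sup>2)"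
proof -
  obtain g where g: "g \<in> \<rat>" "g \<noteq> 0" "I \<diamondop> cj ` I = scale g F.OK" using norm_ideal[OF I(1)] by blast
  have cj_prod: "cj ` (A \<diamondop> B) = cj ` A \<diamondop> cj ` B" if "A \<subseteq> F" "B \<subseteq> F" for A B
  proof
    have "x \<in> F \<and> cj x \<in> cj ` A \<diamondop> cj ` B" if "x \<in> A \<diamondop> B" for x
      using that
    proof (induction rule: set_prod_induct)
      case (mult i j)
      then have "i \<in> F" "j \<in> F" using that(1) \<open>A \<subseteq> F\<close> \<open>B \<subseteq> F\<close> by auto
      then show ?case using mult by (simp add: cj_mult F.mult_mem set_prod_mult)
    next
      case (add x y)
      then show ?case by (auto simp: cj_add intro: F.add_mem set_prod_add)
    qed
    then show "cj ` (A \<diamondop> B) \<subseteq> cj ` A \<diamondop> cj ` B" by blast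
    have "x \<in> cj ` {y \<in> A \<diamondop> B. y \<in> F}" if "x \<in> cj ` A \<diamondop> cj ` B" for x
      using that
    proof (induction rule: set_prod_induct)
      case (mult i j)
      then obtain a b where ab: "a \<in> A" "b \<in> B" "i = cj a" "j = cj b" by blast
      have "a \<in> F" "b \<in> F" using ab(1,2) \<open>A \<subseteq> F\<close> \<open>B \<subseteq> F\<close> by auto
      then have "i * j = cj (a * b)" "a * b \<in> F" using ab(3,4) by (auto simp: cj_mult F.mult_mem)
      then show ?case using set_prod_mult[OF ab(1,2)] by blast
    next
      case (add x y)
      then obtain a b where "a \<in> A \<diamondop> B" "b \<in> A \<diamondop> B" "a \<in> F" "b \<in> F" "x = cj a" "y = cj b" by blast
      then have "x + y = cj (a + b)" "a + b \<in> F" "a + b \<in> A \<diamondop> B" by (auto simp: cj_add F.add_mem intro: set_prod_add)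
      then show ?case by blast
    qed
    then show "cj ` A \<diamondop> cj ` B \<subseteq> cj ` (A \<diamondop> B)" by blast
  qed
  have IF: "I \<subseteq> F" using F.fracD(1)[OF I(1)] by blast
  have cjO: "cj ` F.OK = F.OK"
  proof
    show "cj ` F.OK \<subseteq> F.OK" using cj_OK by blast
    have "x \<in> cj ` F.OK" if "x \<in> F.OK" for x
      using cj_OK[OF that] cj_cj[OF F.OK_mem[OF that]] by (metis imageI)
    then show "F.OK \<subseteq> cj ` F.OK" by blast
  qed
  have "cj ` scale \<alpha> F.OK = scale (cj \<alpha>) (cj ` F.OK)"
    unfolding image_image by (rule image_cong) (auto simp: cj_mult \<alpha>(1) F.OK_mem)
  then have c\<alpha>: "cj ` I \<diamondop> cj ` I = scale (cj \<alpha>) F.OK" using cj_prod[OF IF IF] I(2) cjO by simp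
  have "scale (g * g) F.OK = (I \<diamondop> cj ` I) \<diamondop> (I \<diamondop> cj ` I)" unfolding g(3) F.scale_prod_OK ..
  also have "\<dots> = (I \<diamondop> I) \<diamondop> (cj ` I \<diamondop> cj ` I)" by (metis set_prod_assoc set_prod_commute)
  also have "\<dots> = scale (\<alpha> * cj \<alpha>) F.OK" unfolding I(2) c\<alpha> F.scale_prod_OK ..
  finally have eq: "scale (\<alpha> * cj \<alpha>) F.OK = scale (g * g) F.OK" by simp
  have nz: "\<alpha> * cj \<alpha> \<noteq> 0" "g * g \<noteq> 0" using \<alpha> g(2) by auto
  have "(\<alpha> * cj \<alpha>) / (g * g) \<in> \<int>" "(g * g) / (\<alpha> * cj \<alpha>) \<in> \<int>"
    using F.scale_OK_eq[OF eq nz(2)] F.scale_OK_eq[OF eq[symmetric] nz(1)] F.OK_rational norm_rational[OF \<alpha>(1)] g(1)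
    by (metis Rats_divide Rats_mult)+
  then obtain a b where ab: "(\<alpha> * cj \<alpha>) / (g * g) = of_int a" "(g * g) / (\<alpha> * cj \<alpha>) = of_int b" by (metis Ints_cases)
  have "(of_int (a * b) :: complex) = ((\<alpha> * cj \<alpha>) / (g * g)) * ((g * g) / (\<alpha> * cj \<alpha>))" unfolding ab by simp
  also have "\<dots> = of_int 1" using nz by simp
  finally have "a * b = 1" by (simp only: of_int_eq_iff)
  then have "a = 1 \<or> a = -1" using zmult_eq_1_iff by blast
  then have "\<alpha> * cj \<alpha> = g\<^sup>2 \<or> \<alpha> * cj \<alpha> = - g\<^sup>2" using ab(1) nz(2) by (auto simp: field_simps power2_eq_square)
  then show ?thesis using g by blast
qed

text \<open>Hilbert 90 made explicit: with h^2 = \<alpha> cj(\<alpha>) and y = \<alpha> + h one has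
  y^2 = \<alpha> t, where t = \<alpha> + cj(\<alpha>) + 2 h is rational. If m is the squarefree part
  belonging to t, then I can be scaled to an ideal with square m O_F, so that only l1 and l2 can
  divide m. Up to squares, s^2 = l1 l2 identifies l2 with l1 and l1 l2 with 1.\<close>

lemma rational_square_class:
  assumes "\<alpha> \<in> F" "\<alpha> \<noteq> 0" "g \<in> \<rat>" "g \<noteq> 0" "\<alpha> * cj \<alpha> = g\<^sup>2" and I: "F.frac I" "I \<diamondop> I = scale \<alpha> F.OK"
  shows "\<exists>f\<in>F. f \<noteq> 0 \<and> (\<exists>m\<in>{1, - 1, of_nat l1, - of_nat l1}. \<alpha> = m * f\<^sup>2)"
proof -
  \<comment> \<open>The sign of the square root is chosen so that \<open>y\<close> does not vanish;
    both signs cannot fail, because g \<noteq> 0.\<close>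
  obtain h where h: "h \<in> \<rat>" "\<alpha> * cj \<alpha> = h\<^sup>2" "\<alpha> + h \<noteq> 0"
  proof (cases "\<alpha> + g = 0")
    case True
    have "\<alpha> + - g \<noteq> 0"
    proof
      assume "\<alpha> + - g = 0"
      then have "2 * g = 0" using True by simp
      then show False using assms(4) by simp
    qed
    then show ?thesis using that[of "- g"] assms(3,5) by simp
  qed (use assms(3,5) that in blast)
  have hF: "h \<in> F" using h(1) F.Rats_mem by blast
  define y where "y = \<alpha> + h"
  define t where "t = (\<alpha> + cj \<alpha>) + 2 * h"
  have yF: "y \<in> F" unfolding y_def by (intro F.add_mem assms(1) hF)
  have "t \<in> \<rat>" unfolding t_def using trace_rational[OF assms(1)] h(1) by simp
  have yt: "y\<^sup>2 = \<alpha> * t" unfolding y_def t_def using h(2) by (simp add: power2_eq_square algebra_simps)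
  then have t0: "t \<noteq> 0" using h(3) y_def by auto
  obtain p q where pq: "t = of_int p / of_int q" "q > 0" using \<open>t \<in> \<rat>\<close> Rats_cases' by metis
  \<comment> \<open>The fraction p / q and the integer p q differ by a square.\<close>
  define n where "n = p * q"
  define m where "m = squarefree_part n"
  define c where "c = square_part n"
  have n0: "n \<noteq> 0" using t0 pq by (auto simp: n_def)
  have n: "n = m * c\<^sup>2" unfolding m_def c_def by (rule squarefree_decompose)
  have m0: "m \<noteq> 0" "c \<noteq> 0" using n n0 by auto
  have "t = of_int n / (of_int q)\<^sup>2" using pq by (simp add: n_def power2_eq_square)
  then have tm: "t = of_int m * (of_int c / of_int q)\<^sup>2" unfolding n by (simp add: power_divide)
  define f where "f = y / (of_int m * (of_int c / of_int q))"
  have fF: "f \<in> F" unfolding f_def by (intro F.divide_mem F.mult_mem yF F.of_int_mem)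
  have y0: "y \<noteq> 0" using h(3) y_def by simp
  have f0: "f \<noteq> 0" using y0 m0 pq(2) by (simp add: f_def)
  have "\<alpha> = y\<^sup>2 / t" using yt t0 by simp
  then have \<alpha>f: "\<alpha> = of_int m * f\<^sup>2" unfolding tm f_def using m0 pq(2) by (simp add: power2_eq_square field_simps)
  define J where "J = scale (inverse f) I"
  have J: "F.frac J" unfolding J_def using F.frac_scale[OF I(1) F.inverse_mem[OF fF]] f0 by simp
  have "J \<diamondop> J = scale (inverse f * inverse f * \<alpha>) F.OK"
    unfolding J_def set_prod_scale set_prod_scale_right I(2) scale_scale by (simp add: mult.assoc)
  moreover have "inverse f * inverse f * \<alpha> = of_int m" unfolding \<alpha>f using f0 by (simp add: power2_eq_square field_simps)
  ultimately have JJ: "J \<diamondop> J = scale (of_int m) F.OK" by simp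
  have sq: "squarefree m" unfolding m_def by simp
  have "\<bar>m\<bar> \<in> {1, int l1, int l2, int l1 * int l2}"
  proof (rule int_squarefree_cases[OF sq prime1 prime2 neq])
    fix q :: nat assume q: "Factorial_Ring.prime q" "int q dvd m"
    show "q = l1 \<or> q = l2" by (rule prime_dvd_d[OF q(1) ramified_prime[OF J JJ sq q]])
  qed
  moreover have "m = sgn m * \<bar>m\<bar>" by (simp add: mult_sgn_abs)
  moreover have "sgn m \<in> {1, -1}" using m0(1) by (simp add: sgn_if)
  ultimately obtain e r where er: "e \<in> {1,-1::int}" "r \<in> {1, int l1, int l2, int l1 * int l2}" "m = e * r" by metis
  have "\<exists>k\<in>F. k \<noteq> 0 \<and> (\<exists>r'\<in>{1, of_nat l1}. of_int r = r' * k\<^sup>2)"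
  proof -
    have s0: "s \<noteq> 0" using s_square d_pos by auto
    have l0: "of_nat l1 \<noteq> (0::complex)" using prime_gt_0_nat[OF prime1] by simp
    have ss: "s\<^sup>2 = of_nat l1 * of_nat l2" using s_square(2) by (simp add: d_def)
    consider "r = 1" | "r = int l1" | "r = int l2" | "r = int l1 * int l2" using er(2) by blast
    then show ?thesis
    proof cases
      case 3
      have "of_int r = of_nat l1 * (s / of_nat l1)\<^sup>2" using l0 ss 3 by (simp add: power_divide power2_eq_square)
      then show ?thesis using s0 l0 s_in_F by (intro bexI[of _ "s / of_nat l1"]) (auto intro: F.divide_mem F.of_nat_mem)
    next
      case 4
      have "of_int r = 1 * s\<^sup>2" using ss 4 by simp
      then show ?thesis using s0 s_in_F by (intro bexI[of _ s]) auto
    qed (auto intro!: bexI[of _ 1] F.one_mem)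
  qed
  then obtain k r' where k: "k \<in> F" "k \<noteq> 0" "r' \<in> {1, of_nat l1}" "of_int r = r' * k\<^sup>2" by blast
  have "\<alpha> = (of_int e * r') * (k * f)\<^sup>2" unfolding \<alpha>f er(3) of_int_mult k(4) by (simp add: power_mult_distrib)
  moreover have "of_int e * r' \<in> {1, - 1, of_nat l1, - of_nat l1}" using er(1) k(3) by auto
  ultimately show ?thesis using F.mult_mem[OF k(1) fF] k(2) f0 by (intro bexI[of _ "k * f"]) auto
qed

end

section \<open>Galois theory\<close>

text \<open>Artin's argument: from a vanishing combination at y x, \<tau>(y) times the same
  combination at x is subtracted. This removes \<tau> but keeps a character \<sigma> with
  \<sigma>(y) \<noteq> \<tau>(y), so a shorter nonempty combination would vanish.\<close>

lemma characters_independent: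
  fixes H :: "complex set"
  assumes "finite S" "S \<noteq> {}" "\<And>\<sigma>. \<sigma> \<in> S \<Longrightarrow> hom_on H \<sigma>" "1 \<in> H" "\<And>x y. x \<in> H \<Longrightarrow> y \<in> H \<Longrightarrow> x * y \<in> H"
    "\<And>\<sigma> \<tau>. \<sigma> \<in> S \<Longrightarrow> \<tau> \<in> S \<Longrightarrow> \<sigma> \<noteq> \<tau> \<Longrightarrow> \<exists>x\<in>H. \<sigma> x \<noteq> \<tau> x" "\<And>\<sigma>. \<sigma> \<in> S \<Longrightarrow> c \<sigma> \<noteq> (0::complex)"
  shows "\<exists>x\<in>H. (\<Sum>\<sigma>\<in>S. c \<sigma> * \<sigma> x) \<noteq> 0"
  using assms(1,2,3,6,7)
proof (induction "card S" arbitrary: S c rule: less_induct)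
  case less
  show ?case
  proof (rule ccontr)
    assume "\<not> ?thesis"
    then have zero: "(\<Sum>\<sigma>\<in>S. c \<sigma> * \<sigma> x) = 0" if "x \<in> H" for x using that by blast
    obtain \<sigma> where \<sigma>: "\<sigma> \<in> S" using less.prems(2) by blast
    show False
    proof (cases "S = {\<sigma>}")
      case True
      then show False using zero[OF assms(4)] less.prems(3)[OF \<sigma>] less.prems(5)[OF \<sigma>] by (simp add: hom_on_def)
    next
      case False
      then obtain \<tau> where \<tau>: "\<tau> \<in> S" "\<tau> \<noteq> \<sigma>" using \<sigma> by blast
      obtain y where y: "y \<in> H" "\<sigma> y \<noteq> \<tau> y" using less.prems(4)[OF \<sigma> \<tau>(1)] \<tau>(2) by metis
      define S' where "S' = {\<rho> \<in> S. \<rho> y \<noteq> \<tau> y}"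
      define c' where "c' = (\<lambda>\<rho>. c \<rho> * (\<rho> y - \<tau> y))"
      have "(\<Sum>\<rho>\<in>S'. c' \<rho> * \<rho> x) = 0" if x: "x \<in> H" for x
      proof -
        have "(\<Sum>\<rho>\<in>S'. c' \<rho> * \<rho> x) = (\<Sum>\<rho>\<in>S. c' \<rho> * \<rho> x)"
          by (rule sum.mono_neutral_left) (use less.prems(1) in \<open>auto simp: S'_def c'_def\<close>)
        also have "\<dots> = (\<Sum>\<rho>\<in>S. c \<rho> * \<rho> (y * x) - \<tau> y * (c \<rho> * \<rho> x))"
          by (rule sum.cong) (use less.prems(3) x y(1) in \<open>auto simp: hom_on_def c'_def algebra_simps\<close>)
        also have "\<dots> = 0" using zero[OF x] zero[OF assms(5)[OF y(1) x]]
          by (simp add: sum_subtractf sum_distrib_left[symmetric])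
        finally show ?thesis .
      qed
      moreover have "\<exists>x\<in>H. (\<Sum>\<rho>\<in>S'. c' \<rho> * \<rho> x) \<noteq> 0"
      proof (rule less.hyps)
        have "S' \<subset> S" using \<tau>(1) by (auto simp: S'_def)
        then show "card S' < card S" using less.prems(1) by (rule psubset_card_mono[rotated])
        show "finite S'" "S' \<noteq> {}" using less.prems(1) \<sigma> y(2) by (auto simp: S'_def)
        show "hom_on H \<rho>" if "\<rho> \<in> S'" for \<rho> using that less.prems(3) by (simp add: S'_def)
        show "\<exists>x\<in>H. \<rho> x \<noteq> \<rho>' x" if "\<rho> \<in> S'" "\<rho>' \<in> S'" "\<rho> \<noteq> \<rho>'" for \<rho> \<rho>'
          by (rule less.prems(4)) (use that in \<open>auto simp: S'_def\<close>)
        show "c' \<rho> \<noteq> 0" if "\<rho> \<in> S'" for \<rho> using that less.prems(5)[of \<rho>] by (simp add: S'_def c'_def)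
      qed
      ultimately show False by blast
    qed
  qed
qed

text \<open>B is a maximal proper subgroup above D. For x outside B, let a be the last of the
  iterated squares x, x^2, x^4, ... before the sequence first enters B. Then the square of a lies in
  B, so B \<union> a B is a subgroup, and by maximality it is the whole group.\<close>

lemma (in comm_group) index_two_subgroup:
  assumes fin: "finite (carrier G)" and ord: "Coset.order G = 2 ^ k" and D: "subgroup D G" "D \<noteq> carrier G"
  shows "\<exists>B a. subgroup B G \<and> D \<subseteq> B \<and> a \<in> carrier G - B \<and> carrier G = B \<union> (\<lambda>b. a \<otimes> b) ` B"
proof -
  define Q where "Q = {B. subgroup B G \<and> D \<subseteq> B \<and> B \<noteq> carrier G}"
  have "Q \<subseteq> Pow (carrier G)" using subgroup.subset by (auto simp: Q_def)
  then have "finite Q" using fin finite_subset by blast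
  moreover have "D \<in> Q" using D by (simp add: Q_def)
  ultimately obtain B where B: "B \<in> Q" "\<forall>C\<in>Q. B \<subseteq> C \<longrightarrow> B = C" using finite_has_maximal[of Q] by blast
  then have sB: "subgroup B G" and BG: "B \<subseteq> carrier G" using subgroup.subset by (auto simp: Q_def)
  obtain x where x: "x \<in> carrier G" "x \<notin> B" using B(1) BG by (auto simp: Q_def)
  have "x [^] ((2::nat) ^ k) = \<one>" using pow_order_eq_1[OF x(1)] ord by simp
  then have ex: "\<exists>j. x [^] ((2::nat) ^ j) \<in> B" using subgroup.one_closed[OF sB] by metis
  define j where "j = (LEAST j. x [^] ((2::nat) ^ j) \<in> B)"
  have j: "x [^] ((2::nat) ^ j) \<in> B" unfolding j_def by (rule LeastI_ex[OF ex])
  have "j \<noteq> 0" using j x by (cases j) auto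
  then obtain i where i: "j = Suc i" by (cases j) auto
  define a where "a = x [^] ((2::nat) ^ i)"
  have aG: "a \<in> carrier G" using x(1) by (simp add: a_def)
  have aB: "a \<notin> B" unfolding a_def using not_less_Least[of i "\<lambda>j. x [^] ((2::nat) ^ j) \<in> B"] i by (simp add: j_def[symmetric])
  have aa: "a \<otimes> a \<in> B" using j x(1) unfolding i a_def by (simp add: nat_pow_mult mult_2)
  define C where "C = B \<union> (\<lambda>b. a \<otimes> b) ` B"
  have CG: "C \<subseteq> carrier G" using BG aG by (auto simp: C_def)
  have mB: "b \<otimes> c \<in> B" if "b \<in> B" "c \<in> B" for b c using subgroup.m_closed[OF sB that] .
  have iB: "inv b \<in> B" if "b \<in> B" for b using subgroup.m_inv_closed[OF sB that] .
  have "subgroup C G"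
  proof (rule subgroupI[OF CG])
    show "C \<noteq> {}" using subgroup.one_closed[OF sB] by (auto simp: C_def)
    fix u assume "u \<in> C"
    then consider "u \<in> B" | b where "b \<in> B" "u = a \<otimes> b" by (auto simp: C_def)
    note u_cases = this
    show "inv u \<in> C"
    proof (cases rule: u_cases)
      case 1
      then show ?thesis using iB by (simp add: C_def)
    next
      case (2 b)
      have bG: "b \<in> carrier G" using 2 BG by blast
      have "inv u = a \<otimes> (inv (a \<otimes> a) \<otimes> inv b)"
        unfolding 2(2) using aG bG by (simp add: inv_mult m_assoc[symmetric])
      then show ?thesis using mB[OF iB[OF aa] iB[OF 2(1)]] by (simp add: C_def)
    qed
    fix v assume "v \<in> C"
    then consider "v \<in> B" | b where "b \<in> B" "v = a \<otimes> b" by (auto simp: C_def)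
    note v_cases = this
    show "u \<otimes> v \<in> C"
    proof (cases rule: u_cases)
      case 1
      note u = 1
      then have uG: "u \<in> carrier G" using BG by blast
      show ?thesis
      proof (cases rule: v_cases)
        case 1
        then show ?thesis using mB u by (simp add: C_def)
      next
        case (2 b)
        then have "u \<otimes> v = a \<otimes> (u \<otimes> b)" using uG aG BG by (simp add: m_lcomm subset_iff)
        then show ?thesis using mB[OF u 2(1)] by (simp add: C_def)
      qed
    next
      case (2 b)
      note u = 2
      then have bG: "b \<in> carrier G" using BG by blast
      show ?thesis
      proof (cases rule: v_cases)
        case 1
        then have "u \<otimes> v = a \<otimes> (b \<otimes> v)" unfolding u(2) using bG aG BG by (simp add: m_assoc subset_iff)
        then show ?thesis using mB[OF u(1) 1] by (simp add: C_def)
      next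
        case (2 b')
        then have b'G: "b' \<in> carrier G" using BG by blast
        have "u \<otimes> v = (a \<otimes> a) \<otimes> (b \<otimes> b')" unfolding u(2) 2(2) using bG b'G aG by (simp add: m_ac)
        then show ?thesis using mB[OF aa mB[OF u(1) 2(1)]] by (simp add: C_def)
      qed
    qed
  qed
  moreover have "B \<subseteq> C" by (simp add: C_def)
  moreover have "a \<otimes> \<one> \<in> C" using subgroup.one_closed[OF sB] by (auto simp: C_def)
  then have "B \<noteq> C" using aB aG by auto
  ultimately have "C = carrier G" using B unfolding Q_def by blast
  then show ?thesis using sB B(1) aG aB unfolding Q_def C_def by blast
qed

section \<open>Prime avoidance and multipliers of fractional ideals\<close>

context number_field
begin

text \<open>If the element x found for the smaller set lies in the new ideal M, it is corrected by
  an element t of P that lies in all the old ideals but not in M. Such a t is a product of elements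
  outside M, one from P and one from each old ideal.\<close>

lemma prime_avoidance:
  assumes "finite Q" "\<And>q. q \<in> Q \<Longrightarrow> maximal q" "maximal P" "P \<notin> Q"
  shows "\<exists>x\<in>P. \<forall>q\<in>Q. x \<notin> q"
  using assms(1,2,4)
proof (induction Q rule: finite_induct)
  case empty
  then show ?case using integral_idealD(4)[OF maximalD(1)[OF assms(3)]] by blast
next
  case (insert M Q)
  note P = integral_idealD[OF maximalD(1)[OF assms(3)]]
  have diff: "\<exists>x\<in>A. x \<notin> M" if "maximal A" "A \<noteq> M" for A
    using that insert.prems(1)[of M] maximalD(1,2) unfolding maximal_def by (metis insertI1 subsetI)
  have M: "maximal M" using insert.prems(1) by blast
  note Mi = integral_idealD[OF maximalD(1)[OF M]]
  obtain x where x: "x \<in> P" "\<forall>q\<in>Q. x \<notin> q" using insert.IH insert.prems by blast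
  show ?case
  proof (cases "x \<in> M")
    case False
    then show ?thesis using x by auto
  next
    case True
    obtain y0 where y0: "y0 \<in> P" "y0 \<notin> M" using diff[OF assms(3)] insert.prems(2) by blast
    have "\<exists>y\<in>q. y \<notin> M" if "q \<in> Q" for q using diff[of q] insert.prems(1) insert.hyps(2) that by blast
    then obtain y where y: "\<And>q. q \<in> Q \<Longrightarrow> y q \<in> q" "\<And>q. q \<in> Q \<Longrightarrow> y q \<notin> M" by metis
    have yO: "y q \<in> OK" if "q \<in> Q" for q using integral_idealD(1)[OF maximalD(1)] insert.prems(1) y(1) that by blast
    have pO: "prod y Q \<in> OK" using yO by (rule OK_prod)
    have pM: "prod y R \<notin> M" if "R \<subseteq> Q" for R
    proof -
      have "finite R" using that insert.hyps(1) finite_subset by blast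
      then show ?thesis using that
      proof (induction R rule: finite_induct)
        case empty
        then show ?case using maximalD(2)[OF M] by simp
      next
        case (insert r R)
        have "y r \<in> OK" "prod y R \<in> OK" using insert.prems yO by (auto intro: OK_prod)
        then have "y r * prod y R \<notin> M" using maximal_prime[OF M] insert y(2)[of r] by blast
        then show ?case using insert.hyps by simp
      qed
    qed
    define t where "t = y0 * prod y Q"
    have tM: "t \<notin> M" unfolding t_def using maximal_prime[OF M P(1)[OF y0(1)] pO] y0(2) pM[of Q] by blast
    have tP: "t \<in> P" unfolding t_def using P(8)[OF pO y0(1)] .
    have tq: "t \<in> q" if "q \<in> Q" for q
    proof -
      have "t = (y0 * prod y (Q - {q})) * y q" unfolding t_def using prod.remove[OF insert.hyps(1) that, of y] by simp
      moreover have "y0 * prod y (Q - {q}) \<in> OK" using yO P(1)[OF y0(1)] by (auto intro!: OK_mult OK_prod)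
      ultimately show ?thesis using integral_idealD(3)[OF maximalD(1)[OF insert.prems(1)]] y(1)[OF that] that by simp
    qed
    have "x + t \<notin> M" using Mi(6)[of "x + t" x] True tM by auto
    moreover have "x + t \<notin> q" if "q \<in> Q" for q
      using integral_idealD(6)[OF maximalD(1)[OF insert.prems(1)], of q "x + t" t] tq[OF that] x(2) that by auto
    ultimately show ?thesis using P(5)[OF x(1) tP] by auto
  qed
qed

lemma inverse_not_integral:
  assumes "integral_ideal I" "1 \<notin> I" "I \<diamondop> J = OK"
  shows "\<not> J \<subseteq> OK"
proof
  assume "J \<subseteq> OK"
  then have "I \<diamondop> J \<subseteq> I \<diamondop> OK" by (rule set_prod_mono[OF subset_refl])
  also have "I \<diamondop> OK \<subseteq> I" by (rule set_prod_subset(1)[OF assms(1) integral_ideal_OK])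
  finally show False using assms(2,3) OK_1 by blast
qed

lemma OK_if_stable_frac:
  assumes I: "frac I" and x: "x \<in> K" "\<And>y. y \<in> I \<Longrightarrow> x * y \<in> I"
  shows "x \<in> OK"
proof -
  obtain m where m: "m > (0::nat)" "\<forall>x\<in>I. of_nat m * x \<in> OK" using fracD(7)[OF I] by blast
  have J: "frac (scale (of_nat m) I)" using frac_scale[OF I of_nat_mem] m(1) by simp
  show ?thesis
  proof (rule OK_if_stable[OF frac_imp_integral_ideal[OF J] fracD(6)[OF J] x(1)])
    show "scale (of_nat m) I \<subseteq> OK" using m(2) by blast
    fix y assume "y \<in> scale (of_nat m) I"
    then obtain z where "z \<in> I" "y = of_nat m * z" by blast
    then have "x * y = of_nat m * (x * z)" "x * z \<in> I" using x(2) by auto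
    then show "x * y \<in> scale (of_nat m) I" by blast
  qed
qed

end

locale unramified_extension = quadratic +
  fixes H :: "complex set"
  assumes unramified: "unramified_abelian_2_extension F H"
begin

abbreviation G where "G \<equiv> galois_group F H"
abbreviation A where "A \<equiv> carrier G"

lemma finite_galois: "finite_galois_extension F H" and comm_G: "comm_group G" and order_G: "\<exists>k. Coset.order G = 2 ^ k"
  and unram_finite: "P \<in> finite_primes H \<Longrightarrow> ramification_index F H P = 1"
  and unram_infinite: "\<tau> \<in> ring_hom (CC\<lparr>carrier := H\<rparr>) CC \<Longrightarrow> \<tau> ` F \<subseteq> \<real> \<Longrightarrow> \<tau> ` H \<subseteq> \<real>"
  using unramified unfolding unramified_abelian_2_extension_def abelian_2_extension_def
    unramified_at_finite_places_def unramified_at_infinite_places_def by auto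

lemma subfield_H: "subfield H CC" and F_subset_H: "F \<subseteq> H"
  and fixed_imp_F: "x \<in> H \<Longrightarrow> (\<And>\<sigma>. \<sigma> \<in> A \<Longrightarrow> \<sigma> x = x) \<Longrightarrow> x \<in> F"
  using finite_galois unfolding finite_galois_extension_def by auto

lemma H_span: "\<exists>T. finite T \<and> T \<subseteq> H \<and> H \<subseteq> QV.span T"
  by (rule finite_dimension_span[OF subfield_F F_subset_span])
    (use finite_galois s_in_F F.one_mem in \<open>auto simp: finite_galois_extension_def\<close>)

sublocale H: number_field H
  using subfield_CC_D[OF subfield_H] H_span by unfold_locales auto

sublocale G: comm_group G
  by (rule comm_G)

lemma finite_A: "finite A"
  using order_G by (metis card.infinite Coset.order_def power_not_zero zero_neq_numeral)

lemma A_D: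
  assumes "\<sigma> \<in> A"
  shows "\<sigma> \<in> Bij H" "hom_on H \<sigma>" "x \<in> F \<Longrightarrow> \<sigma> x = x" "x \<in> H \<Longrightarrow> \<sigma> x \<in> H"
    "x \<in> H \<Longrightarrow> y \<in> H \<Longrightarrow> \<sigma> (x + y) = \<sigma> x + \<sigma> y" "x \<in> H \<Longrightarrow> y \<in> H \<Longrightarrow> \<sigma> (x * y) = \<sigma> x * \<sigma> y" "\<sigma> 1 = 1"
    "inj_on \<sigma> H" "x \<in> H \<Longrightarrow> \<sigma> (- x) = - \<sigma> x" "\<sigma> 0 = 0"
proof -
  show B: "\<sigma> \<in> Bij H" and "x \<in> F \<Longrightarrow> \<sigma> x = x" using assms by (auto simp: galois_group_def)
  have hom: "\<sigma> \<in> ring_hom (CC\<lparr>carrier := H\<rparr>) (CC\<lparr>carrier := H\<rparr>)" using assms by (auto simp: galois_group_def)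
  show h: "hom_on H \<sigma>"
    using ring_hom_add[OF hom] ring_hom_mult[OF hom] ring_hom_one[OF hom] by (auto simp: hom_on_def)
  show "x \<in> H \<Longrightarrow> \<sigma> x \<in> H" using ring_hom_closed[OF hom, of x] by simp
  show "x \<in> H \<Longrightarrow> y \<in> H \<Longrightarrow> \<sigma> (x + y) = \<sigma> x + \<sigma> y" "x \<in> H \<Longrightarrow> y \<in> H \<Longrightarrow> \<sigma> (x * y) = \<sigma> x * \<sigma> y" "\<sigma> 1 = 1"
    "x \<in> H \<Longrightarrow> \<sigma> (- x) = - \<sigma> x" "\<sigma> 0 = 0"
    using hom_on_simps[OF H.subfield_set h] by auto
  show "inj_on \<sigma> H" using B by (simp add: Bij_def bij_betw_def)
qed

lemma A_mult: "\<sigma> \<in> A \<Longrightarrow> \<tau> \<in> A \<Longrightarrow> x \<in> H \<Longrightarrow> (\<sigma> \<otimes>\<^bsub>G\<^esub> \<tau>) x = \<sigma> (\<tau> x)"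
  using A_D(1)[of \<sigma>] A_D(1)[of \<tau>] by (simp add: galois_group_def BijGroup_def compose_eq)

lemma A_one: "x \<in> H \<Longrightarrow> \<one>\<^bsub>G\<^esub> x = x"
  by (simp add: galois_group_def BijGroup_def)

lemma A_inv: "\<sigma> \<in> A \<Longrightarrow> x \<in> H \<Longrightarrow> (inv\<^bsub>G\<^esub> \<sigma>) (\<sigma> x) = x" "\<sigma> \<in> A \<Longrightarrow> x \<in> H \<Longrightarrow> \<sigma> ((inv\<^bsub>G\<^esub> \<sigma>) x) = x"
  using A_mult[of "inv\<^bsub>G\<^esub> \<sigma>" \<sigma> x] A_mult[of \<sigma> "inv\<^bsub>G\<^esub> \<sigma>" x] by (simp_all add: A_one)

lemma A_ext: "\<sigma> \<in> A \<Longrightarrow> \<tau> \<in> A \<Longrightarrow> (\<And>x. x \<in> H \<Longrightarrow> \<sigma> x = \<tau> x) \<Longrightarrow> \<sigma> = \<tau>"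
  using A_D(1)[of \<sigma>] A_D(1)[of \<tau>] by (auto simp: Bij_def intro: extensionalityI)

lemma A_commute: "\<sigma> \<in> A \<Longrightarrow> \<tau> \<in> A \<Longrightarrow> x \<in> H \<Longrightarrow> \<sigma> (\<tau> x) = \<tau> (\<sigma> x)"
  using A_mult[of \<sigma> \<tau> x] A_mult[of \<tau> \<sigma> x] G.m_comm by simp

lemma A_OK: "\<sigma> \<in> A \<Longrightarrow> x \<in> H.OK \<Longrightarrow> \<sigma> x \<in> H.OK"
  using algebraic_int_hom_on[OF H.subfield_set A_D(2)] A_D(4) by (auto simp: H.OK_def)

lemma A_prod: "\<sigma> \<in> A \<Longrightarrow> (\<And>i. i \<in> I \<Longrightarrow> f i \<in> H) \<Longrightarrow> \<sigma> (prod f I) = (\<Prod>i\<in>I. \<sigma> (f i))"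
  by (induction I rule: infinite_finite_induct) (auto simp: A_D H.prod_mem)

lemma A_sum: "\<sigma> \<in> A \<Longrightarrow> (\<And>i. i \<in> I \<Longrightarrow> f i \<in> H) \<Longrightarrow> \<sigma> (sum f I) = (\<Sum>i\<in>I. \<sigma> (f i))"
  by (induction I rule: infinite_finite_induct) (auto simp: A_D H.sum_mem)

lemma OK_F_H: "x \<in> F.OK \<longleftrightarrow> x \<in> F \<and> x \<in> H.OK"
  using F_subset_H by (auto simp: F.OK_def H.OK_def)

lemma subgroup_translate:
  assumes B: "subgroup B G" "b \<in> B"
  shows "bij_betw (\<lambda>\<sigma>. b \<otimes>\<^bsub>G\<^esub> \<sigma>) B B"
proof (rule bij_betwI[where g = "\<lambda>\<sigma>. inv\<^bsub>G\<^esub> b \<otimes>\<^bsub>G\<^esub> \<sigma>"])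
  have sub: "\<sigma> \<in> A" if "\<sigma> \<in> B" for \<sigma> using subgroup.subset[OF B(1)] that by blast
  show "(\<lambda>\<sigma>. b \<otimes>\<^bsub>G\<^esub> \<sigma>) \<in> B \<rightarrow> B" using subgroup.m_closed[OF B(1) B(2)] by blast
  show "(\<lambda>\<sigma>. inv\<^bsub>G\<^esub> b \<otimes>\<^bsub>G\<^esub> \<sigma>) \<in> B \<rightarrow> B"
    using subgroup.m_closed[OF B(1) subgroup.m_inv_closed[OF B]] by blast
  show "inv\<^bsub>G\<^esub> b \<otimes>\<^bsub>G\<^esub> (b \<otimes>\<^bsub>G\<^esub> \<sigma>) = \<sigma>" if "\<sigma> \<in> B" for \<sigma>
    using sub[OF that] sub[OF B(2)] by (simp flip: G.m_assoc)
  show "b \<otimes>\<^bsub>G\<^esub> (inv\<^bsub>G\<^esub> b \<otimes>\<^bsub>G\<^esub> \<sigma>) = \<sigma>" if "\<sigma> \<in> B" for \<sigma>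
    using sub[OF that] sub[OF B(2)] by (simp flip: G.m_assoc)
qed

lemma subgroup_norm_fixed:
  assumes B: "subgroup B G" "b \<in> B" and x: "x \<in> H"
  shows "b (\<Prod>\<sigma>\<in>B. \<sigma> x) = (\<Prod>\<sigma>\<in>B. \<sigma> x)"
proof -
  have sub: "\<sigma> \<in> A" if "\<sigma> \<in> B" for \<sigma> using subgroup.subset[OF B(1)] that by blast
  have "b (\<Prod>\<sigma>\<in>B. \<sigma> x) = (\<Prod>\<sigma>\<in>B. b (\<sigma> x))" using sub x B(2) by (intro A_prod) (auto intro: A_D(4))
  also have "\<dots> = (\<Prod>\<sigma>\<in>B. (b \<otimes>\<^bsub>G\<^esub> \<sigma>) x)" using sub x B(2) by (intro prod.cong) (auto simp: A_mult)
  also have "\<dots> = (\<Prod>\<sigma>\<in>B. \<sigma> x)" by (rule prod.reindex_bij_betw[OF subgroup_translate[OF B]])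
  finally show ?thesis .
qed

lemma subgroup_trace_fixed:
  assumes B: "subgroup B G" "b \<in> B" and x: "x \<in> H"
  shows "b (\<Sum>\<sigma>\<in>B. \<sigma> x) = (\<Sum>\<sigma>\<in>B. \<sigma> x)"
proof -
  have sub: "\<sigma> \<in> A" if "\<sigma> \<in> B" for \<sigma> using subgroup.subset[OF B(1)] that by blast
  have "b (\<Sum>\<sigma>\<in>B. \<sigma> x) = (\<Sum>\<sigma>\<in>B. b (\<sigma> x))" using sub x B(2) by (intro A_sum) (auto intro: A_D(4))
  also have "\<dots> = (\<Sum>\<sigma>\<in>B. (b \<otimes>\<^bsub>G\<^esub> \<sigma>) x)" using sub x B(2) by (intro sum.cong) (auto simp: A_mult)
  also have "\<dots> = (\<Sum>\<sigma>\<in>B. \<sigma> x)" by (rule sum.reindex_bij_betw[OF subgroup_translate[OF B]])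
  finally show ?thesis .
qed

lemma norm_in_F:
  assumes "x \<in> H"
  shows "(\<Prod>\<sigma>\<in>A. \<sigma> x) \<in> F"
proof (rule fixed_imp_F)
  show "(\<Prod>\<sigma>\<in>A. \<sigma> x) \<in> H" using A_D(4) assms by (intro H.prod_mem)
  show "\<tau> (\<Prod>\<sigma>\<in>A. \<sigma> x) = (\<Prod>\<sigma>\<in>A. \<sigma> x)" if "\<tau> \<in> A" for \<tau>
    by (rule subgroup_norm_fixed[OF G.subgroup_self that assms])
qed

subsection \<open>Primes above a prime of \<open>F\<close>\<close>

lemma contraction_ideal: "H.integral_ideal P \<Longrightarrow> F.integral_ideal (P \<inter> F.OK)"
  unfolding F.integral_ideal_def add_closed_def using H.integral_idealD[of P]
  by (simp add: OK_F_H F.zero_mem F.add_mem F.minus_mem F.mult_mem H.OK_add H.OK_mult H.OK_minus)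

text \<open>The point is that q O_H is proper. Elements u of the inverse of q map q O_H into O_H, so
  1 \<in> q O_H would make all of them integral, whereas the inverse of a proper ideal is never
  integral.\<close>

lemma lying_over:
  assumes q: "F.maximal q" "q \<noteq> {0}"
  shows "\<exists>P. H.prime_id P \<and> P \<inter> F.OK = q"
proof -
  note qi = F.maximalD(1)[OF q(1)]
  note qD = F.integral_idealD[OF qi]
  obtain q' where q': "F.frac q'" "q \<diamondop> q' = F.OK" using frac_inverse[OF F.integral_ideal_imp_frac[OF qi q(2)]] by blast
  define Q where "Q = q \<diamondop> H.OK"
  have qH: "q \<subseteq> H.OK" using qD(1) OK_F_H by blast
  have QI: "H.integral_ideal Q"
    unfolding H.integral_ideal_def
  proof (intro conjI ballI)
    show "Q \<subseteq> H.OK" unfolding Q_def by (rule set_prod_least) (use qH in \<open>auto intro: H.OK_mult H.OK_add\<close>)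
    show "add_closed Q" unfolding Q_def by (rule add_closed_set_prod[OF qD(2)]) (use H.OK_1 in blast)
    fix a x assume a: "a \<in> H.OK" and "x \<in> Q"
    from this(2) show "a * x \<in> Q" unfolding Q_def
    proof (induction rule: set_prod_induct)
      case (mult i j)
      then show ?case using set_prod_mult[OF mult(1) H.OK_mult[OF a mult(2)]] by (simp add: mult.left_commute)
    next
      case (add x y)
      then show ?case by (simp add: distrib_left set_prod_add)
    qed
  qed
  have qQ: "q \<subseteq> Q" unfolding Q_def using set_prod_mult[OF _ H.OK_1] by force
  have "1 \<notin> Q"
  proof
    assume 1: "1 \<in> Q"
    have "u \<in> F.OK" if u: "u \<in> q'" for u
    proof -
      have uH: "u * x \<in> H.OK" if "x \<in> Q" for x
        using that unfolding Q_def
      proof (induction rule: set_prod_induct)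
        case (mult i j)
        have "i * u \<in> F.OK" using set_prod_mult[OF mult(1) u] q'(2) by simp
        then have "(i * u) * j \<in> H.OK" using mult(2) OK_F_H H.OK_mult by blast
        then show ?case by (simp add: mult_ac)
      next
        case (add x y)
        then show ?case by (simp add: distrib_left H.OK_add)
      qed
      then show ?thesis using uH[OF 1] F.fracD(1)[OF q'(1) u] OK_F_H by simp
    qed
    then show False using F.inverse_not_integral[OF qi F.maximalD(2)[OF q(1)] q'(2)] by blast
  qed
  moreover have "Q \<noteq> {0}" using qQ q(2) qD(4) by blast
  ultimately obtain P where P: "H.maximal P" "Q \<subseteq> P" using H.maximal_ideal_exists[OF QI] by blast
  have "P \<noteq> {0}" using P(2) \<open>Q \<noteq> {0}\<close> H.integral_idealD(4)[OF QI] by blast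
  then have "H.prime_id P" using H.maximal_imp_prime[OF P(1)] by blast
  moreover have "P \<inter> F.OK = q"
  proof -
    have "q \<subseteq> P \<inter> F.OK" using qQ P(2) qD(1) by blast
    moreover have "1 \<notin> P \<inter> F.OK" using H.maximalD(2)[OF P(1)] by blast
    ultimately show ?thesis using q(1) contraction_ideal[OF H.maximalD(1)[OF P(1)]] unfolding F.maximal_def by blast
  qed
  ultimately show ?thesis by blast
qed

lemma not_in_square: "H.prime_id P \<Longrightarrow> \<not> P \<inter> F.OK \<subseteq> P \<diamondop> P"
  using unramified_not_subset_square[OF F.number_field_axioms H.number_field_axioms F_subset_H] unram_finite H.finite_primes_iff
  by blast

subsection \<open>Square roots in \<open>H\<close>\<close>

text \<open>The ideal is I = F \<inter> y O_H, and b = I^2 / \<alpha> is an ideal of O_F. Suppose b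
  is contained in a maximal ideal q, and let P be a prime of \<open>H\<close> above q. For i in I
  the square of i / y lies in b, so i / y \<in> P and b \<subseteq> P^2. Write b = q c. If c
  \<subseteq> q, then I could be enlarged, contrary to its definition; if not, c contains a unit
  modulo P, and q \<subseteq> P^2 contradicts ramification index one.\<close>

lemma square_root_ideal:
  assumes y: "y \<in> H" "y \<noteq> 0" "y * y = \<alpha>" "\<alpha> \<in> F"
  shows "\<exists>I. F.frac I \<and> I \<diamondop> I = scale \<alpha> F.OK"
proof -
  have \<alpha>0: "\<alpha> \<noteq> 0" using y by auto
  define I where "I = {x \<in> F. x / y \<in> H.OK}"
  have I: "F.frac I"
    unfolding F.frac_def
  proof (intro conjI ballI)
    show "I \<subseteq> F" by (auto simp: I_def)
    show "add_closed I" unfolding add_closed_def I_def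
      by (auto simp: add_divide_distrib intro: F.zero_mem F.add_mem F.minus_mem H.OK_add H.OK_minus)
    obtain n c where n: "n > (0::nat)" "c \<in> H.OK" "of_nat n = y * c" using H.nat_multiple[OF y(1,2)] by blast
    have "of_nat n / y = c" using n(3) y(2) by simp
    then have "of_nat n \<in> I" using n(2) F.of_nat_mem[of n] unfolding I_def by simp
    then show "I \<noteq> {0}" using n(1) by auto
    show "a * x \<in> I" if "a \<in> F.OK" "x \<in> I" for a x
      using that H.OK_mult[of a "x / y"] by (auto simp: I_def OK_F_H F.mult_mem)
    obtain k where k: "k > (0::nat)" "of_nat k * y \<in> H.OK" using H.integral_multiple[OF y(1)] by blast
    have "of_nat k * x \<in> F.OK" if "x \<in> I" for x
    proof -
      have "x / y \<in> H.OK" using that by (simp add: I_def)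
      then have "(of_nat k * y) * (x / y) \<in> H.OK" by (rule H.OK_mult[OF k(2)])
      moreover have "(of_nat k * y) * (x / y) = of_nat k * x" using y(2) by simp
      ultimately show ?thesis using that by (simp add: OK_F_H I_def F.mult_mem F.of_nat_mem)
    qed
    then show "\<exists>m>0::nat. \<forall>x\<in>I. of_nat m * x \<in> F.OK" using k(1) by blast
  qed
  note ID = F.fracD[OF I]
  define b where "b = scale (inverse \<alpha>) (I \<diamondop> I)"
  have b: "F.frac b" unfolding b_def using F.frac_scale[OF F.frac_prod[OF I I] F.inverse_mem[OF y(4)]] \<alpha>0 by simp
  have bO: "b \<subseteq> F.OK"
  proof -
    have "I \<diamondop> I \<subseteq> {x. inverse \<alpha> * x \<in> F.OK}"
    proof (rule set_prod_least)
      fix i j assume ij: "i \<in> I" "j \<in> I"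
      then have "(i / y) * (j / y) \<in> H.OK" by (intro H.OK_mult) (auto simp: I_def)
      moreover have "(i / y) * (j / y) = inverse \<alpha> * (i * j)" using y(3)[symmetric] y(2) by (simp add: field_simps)
      ultimately show "i * j \<in> {x. inverse \<alpha> * x \<in> F.OK}" using ij ID(1) y(4)
        by (simp add: OK_F_H F.mult_mem F.inverse_mem)
    qed (simp add: distrib_left F.OK_add)
    then show ?thesis unfolding b_def by blast
  qed
  have bI: "F.integral_ideal b" by (rule F.frac_imp_integral_ideal[OF b bO])
  have "1 \<in> b"
  proof (rule ccontr)
    assume "1 \<notin> b"
    then obtain q where q: "F.maximal q" "b \<subseteq> q" using F.maximal_ideal_exists[OF bI] F.fracD(6)[OF b] by blast
    note qi = F.maximalD(1)[OF q(1)]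
    note qD = F.integral_idealD[OF qi]
    have q0: "q \<noteq> {0}" using q(2) F.fracD(4,6)[OF b] by blast
    have qf: "F.frac q" by (rule F.integral_ideal_imp_frac[OF qi q0])
    obtain q' where q': "F.frac q'" "q \<diamondop> q' = F.OK" using frac_inverse[OF qf] by blast
    obtain P where P: "H.prime_id P" "P \<inter> F.OK = q" using lying_over[OF q(1) q0] by blast
    note Pm = H.prime_id_maximal[OF P(1)]
    note Pi = H.maximalD(1)[OF Pm]
    note PP = H.integral_ideal_prod[OF Pi Pi]
    have iP: "i / y \<in> P" if i: "i \<in> I" for i
    proof -
      have "inverse \<alpha> * (i * i) \<in> b" unfolding b_def using set_prod_mult[OF i i] by blast
      then have "inverse \<alpha> * (i * i) \<in> P" using q(2) P(2) by blast
      moreover have "(i / y) * (i / y) = inverse \<alpha> * (i * i)" using y(3)[symmetric] y(2) by (simp add: field_simps)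
      moreover have "i / y \<in> H.OK" using i by (simp add: I_def)
      ultimately show ?thesis using H.maximal_prime[OF Pm, of "i / y" "i / y"] by simp
    qed
    have bPP: "b \<subseteq> P \<diamondop> P"
    proof -
      have "I \<diamondop> I \<subseteq> {x. inverse \<alpha> * x \<in> P \<diamondop> P}"
      proof (rule set_prod_least)
        fix i j assume ij: "i \<in> I" "j \<in> I"
        have "(i / y) * (j / y) = inverse \<alpha> * (i * j)" using y(3)[symmetric] y(2) by (simp add: field_simps)
        then show "i * j \<in> {x. inverse \<alpha> * x \<in> P \<diamondop> P}" using set_prod_mult[OF iP[OF ij(1)] iP[OF ij(2)]] by simp
      qed (simp add: distrib_left set_prod_add)
      then show ?thesis unfolding b_def by blast
    qed
    define c where "c = q' \<diamondop> b"
    have qc: "q \<diamondop> c = b" unfolding c_def set_prod_assoc[symmetric] q'(2) by (rule F.frac_prod_OK(2)[OF b])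
    have "c \<subseteq> q' \<diamondop> q" unfolding c_def by (rule set_prod_mono[OF subset_refl q(2)])
    then have cO: "c \<subseteq> F.OK" using q'(2) by (simp add: set_prod_commute)
    show False
    proof (cases "c \<subseteq> q")
      \<comment> \<open>Now b \<subseteq> q^2. For u in the inverse of q and i in I, the square of u
        i / y is integral, so u maps I into itself and is integral; the inverse of q would lie in
        O_F.\<close>
      case True
      then have bqq: "b \<subseteq> q \<diamondop> q" using qc set_prod_mono[OF subset_refl True, of q] by simp
      have "u \<in> F.OK" if u: "u \<in> q'" for u
      proof (rule F.OK_if_stable_frac[OF I])
        show uF: "u \<in> F" using F.fracD(1)[OF q'(1) u] .
        fix i assume i: "i \<in> I"
        have uu: "u * u * x \<in> F.OK" if "x \<in> q \<diamondop> q" for x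
          using that
        proof (induction rule: set_prod_induct)
          case (mult t t')
          have "(t * u) * (t' * u) \<in> F.OK" using set_prod_mult[OF mult(1) u] set_prod_mult[OF mult(2) u] q'(2) F.OK_mult by simp
          then show ?case by (simp add: mult_ac)
        next
          case (add x y)
          then show ?case by (simp add: distrib_left F.OK_add)
        qed
        have "inverse \<alpha> * (i * i) \<in> b" unfolding b_def using set_prod_mult[OF i i] by blast
        then have "u * u * (inverse \<alpha> * (i * i)) \<in> H.OK" using uu bqq OK_F_H by blast
        moreover have "(u * i / y) * (u * i / y) = u * u * (inverse \<alpha> * (i * i))" using y(3)[symmetric] y(2) by (simp add: field_simps)
        moreover have "u * i / y \<in> H" using uF ID(1)[OF i] F_subset_H y(1) by (blast intro: H.divide_mem H.mult_mem)
        ultimately have "u * i / y \<in> H.OK" using H.OK_sqrt by simp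
        then show "u * i \<in> I" using uF ID(1)[OF i] by (simp add: I_def F.mult_mem)
      qed
      then show False using F.inverse_not_integral[OF qi F.maximalD(2)[OF q(1)] q'(2)] by blast
    next
      case False
      then obtain e where e: "e \<in> c" "e \<notin> q" by blast
      have "e \<in> H.OK" "e \<notin> P" using e cO P(2) OK_F_H by blast+
      then obtain a where a: "a \<in> H.OK" "1 - a * e \<in> P" using H.maximalD(3)[OF Pm] by blast
      \<comment> \<open>Since q e \<subseteq> b \<subseteq> P^2 and a is an inverse of e modulo P,
        both terms of t = a (t e) + t (1 - a e) lie in P^2.\<close>
      have "q \<subseteq> P \<diamondop> P"
      proof
        fix t assume t: "t \<in> q"
        have "t * e \<in> P \<diamondop> P" using set_prod_mult[OF t e(1)] qc bPP by blast
        then have "a * (t * e) \<in> P \<diamondop> P" using H.integral_idealD(3)[OF PP a(1)] by blast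
        moreover have "t * (1 - a * e) \<in> P \<diamondop> P" using set_prod_mult[OF _ a(2)] t P(2) by blast
        ultimately have "a * (t * e) + t * (1 - a * e) \<in> P \<diamondop> P" by (rule set_prod_add)
        then show "t \<in> P \<diamondop> P" by (simp add: algebra_simps)
      qed
      then show False using not_in_square[OF P(1)] P(2) by blast
    qed
  qed
  then have "F.OK \<subseteq> b" using F.integral_idealD(8)[OF bI] by force
  then have "b = F.OK" using bO by blast
  then have "scale \<alpha> b = scale \<alpha> F.OK" by simp
  then have "I \<diamondop> I = scale \<alpha> F.OK" unfolding b_def scale_scale using \<alpha>0 by simp
  then show ?thesis using I by blast
qed

lemma of_rat_real: "(of_rat r :: complex) \<in> \<real>"
  by (cases r) (auto simp: of_rat_rat intro!: Reals_divide)

lemma F_real: "F \<subseteq> \<real>"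
proof
  fix x assume "x \<in> F"
  then obtain u v where "x = of_rat u + of_rat v * s" unfolding F_eq by blast
  then show "x \<in> \<real>" using of_rat_real[of u] of_rat_real[of v] s_real by simp
qed

text \<open>Both embeddings of \<open>F\<close> are real and extend to \<open>H\<close>. As no real
  place becomes complex, the image of y is a nonzero real number, and the image of y^2 is its
  square.\<close>

lemma conjugate_positive:
  assumes y: "y \<in> H" "y \<noteq> 0" "y * y \<in> F"
  shows "Re (y * y) > 0" "Re (cj (y * y)) > 0"
proof -
  have pos: "Re (\<phi> (y * y)) > 0" if \<phi>: "hom_on F \<phi>" "\<phi> ` F \<subseteq> \<real>" for \<phi>
  proof -
    obtain T where T: "finite T" "T \<subseteq> H" "H \<subseteq> QV.span T" using H_span by blast
    obtain \<tau> where \<tau>: "hom_on H \<tau>" "\<forall>y\<in>F. \<tau> y = \<phi> y"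
      using embedding_extends[OF H.number_field_axioms F.subfield_set F_subset_H \<phi>(1) T] by blast
    have "\<tau> \<in> ring_hom (CC\<lparr>carrier := H\<rparr>) CC"
      using \<tau>(1) by (intro ring_hom_memI) (auto simp: hom_on_def)
    moreover have "\<tau> ` F \<subseteq> \<real>" using \<tau>(2) \<phi>(2) by auto
    ultimately have "\<tau> y \<in> \<real>" using unram_infinite y(1) by blast
    then obtain r where r: "\<tau> y = of_real r" by (auto elim: Reals_cases)
    have "\<tau> y * \<tau> (inverse y) = 1"
      using hom_on_simps(2,4)[OF H.subfield_set \<tau>(1)] y(1,2) H.inverse_mem[OF y(1)] by (metis right_inverse)
    then have "r \<noteq> 0" using r by auto
    moreover have "\<phi> (y * y) = \<tau> y * \<tau> y"
      using \<tau>(2) y(3) hom_on_simps(4)[OF H.subfield_set \<tau>(1) y(1) y(1)] by simp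
    ultimately show ?thesis using r by (simp add: power2_eq_square[symmetric] flip: of_real_mult)
  qed
  show "Re (y * y) > 0" using pos[of "\<lambda>x. x"] F_real by (auto simp: hom_on_def)
  show "Re (cj (y * y)) > 0" using pos[OF hom_on_cj] cj_in_F F_real by blast
qed

text \<open>Positivity at both real places excludes the norm - g^2 and the representatives - 1 and -
  l1; the representative 1 would put \<open>y\<close> into \<open>F\<close>.\<close>

lemma square_root_class:
  assumes y: "y \<in> H" "y * y \<in> F" "y \<notin> F"
  shows "\<exists>f\<in>F. f \<noteq> 0 \<and> (f * y) * (f * y) = of_nat l1"
proof -
  define \<alpha> where "\<alpha> = y * y"
  have y0: "y \<noteq> 0" using y(3) F.zero_mem by auto
  have \<alpha>: "\<alpha> \<in> F" "\<alpha> \<noteq> 0" using y(2) y0 by (auto simp: \<alpha>_def)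
  obtain I where I: "F.frac I" "I \<diamondop> I = scale \<alpha> F.OK" using square_root_ideal[OF y(1) y0 _ \<alpha>(1)] \<alpha>_def by blast
  obtain g where g: "g \<in> \<rat>" "g \<noteq> 0" "\<alpha> * cj \<alpha> = g\<^sup>2 \<or> \<alpha> * cj \<alpha> = - g\<^sup>2" using norm_of_square_root[OF I \<alpha>] by blast
  have real: "z = of_real (Re z)" if "z \<in> \<real>" for z using that by simp
  have \<alpha>R: "\<alpha> = of_real (Re \<alpha>)" "cj \<alpha> = of_real (Re (cj \<alpha>))" using real F_real \<alpha>(1) cj_in_F[OF \<alpha>(1)] by blast+
  have pos: "Re \<alpha> > 0" "Re (cj \<alpha>) > 0" using conjugate_positive[OF y(1) y0 y(2)] by (auto simp: \<alpha>_def)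
  obtain r where r: "g = of_real r" using real F_real F.Rats_mem[OF g(1)] by blast
  have "\<alpha> * cj \<alpha> = of_real (Re \<alpha> * Re (cj \<alpha>))" by (subst \<alpha>R(1), subst \<alpha>R(2)) simp
  moreover have "Re \<alpha> * Re (cj \<alpha>) > 0" using pos by simp
  ultimately have n: "\<alpha> * cj \<alpha> = g\<^sup>2"
    using g(3) unfolding r by (metis (no_types, lifting) Re_complex_of_real neg_0_le_iff_le not_le of_real_power uminus_complex.sel(1) zero_le_power2 minus_le_iff minus_zero)
  obtain f m where f: "f \<in> F" "f \<noteq> 0" "m \<in> {1, - 1, of_nat l1, - of_nat l1}" "\<alpha> = m * f\<^sup>2"
    using rational_square_class[OF \<alpha> g(1,2) n I] by blast
  have fR: "f = of_real (Re f)" using real F_real f(1) by blast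
  have l0: "l1 > 0" using prime_gt_0_nat[OF prime1] .
  have Rf: "Re f \<noteq> 0" using fR f(2) by (metis of_real_0)
  have "m = 1 \<or> m = of_nat l1"
  proof (rule ccontr)
    assume "\<not> ?thesis"
    then obtain k :: real where k: "m = of_real (- k)" "k > 0" using f(3) l0
      by (metis insert_iff empty_iff of_real_minus of_real_1 of_real_of_nat_eq zero_less_one of_nat_0_less_iff)
    have "\<alpha> = of_real (- k * (Re f)\<^sup>2)" unfolding f(4) k(1) by (subst fR) simp
    then have "Re \<alpha> = - k * (Re f)\<^sup>2" by simp
    then show False using pos(1) k(2) by (metis mult_minus_left neg_0_less_iff_less not_less zero_le_mult_iff zero_le_power2 order_less_imp_le)
  qed
  moreover have "m \<noteq> 1"
  proof
    assume "m = 1"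
    then have "y\<^sup>2 = f\<^sup>2" using f(4) by (simp add: \<alpha>_def power2_eq_square)
    then have "y = f \<or> y = - f" by (simp add: power2_eq_iff)
    then show False using y(3) f(1) F.minus_mem by blast
  qed
  ultimately have "\<alpha> = of_nat l1 * f\<^sup>2" using f(4) by simp
  then have "(inverse f * y) * (inverse f * y) = of_nat l1"
    using f(2) unfolding \<alpha>_def by (simp add: power2_eq_square field_simps)
  then show ?thesis using F.inverse_mem[OF f(1)] f(2) by (intro bexI[of _ "inverse f"]) auto
qed

end

section \<open>Splitting of primes\<close>

context number_field
begin

lemma prime_id_prod:
  assumes "prime_id P" "finite S" "\<And>i. i \<in> S \<Longrightarrow> f i \<in> OK" "prod f S \<in> P"
  shows "\<exists>i\<in>S. f i \<in> P"
  using assms(2-4)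
proof (induction S rule: finite_induct)
  case empty
  then show ?case using assms(1) by (simp add: prime_id_def)
next
  case (insert i S)
  have "f i \<in> OK" "prod f S \<in> OK" using insert.prems(1) by (auto intro: OK_prod)
  then have "f i \<in> P \<or> prod f S \<in> P" using assms(1) insert.prems(2) insert.hyps unfolding prime_id_def by auto
  then show ?case using insert.IH insert.prems(1) by blast
qed

lemma prime_id_of_int:
  assumes "prime_id P" "Factorial_Ring.prime (p::nat)" "of_nat p \<in> P" "of_int n \<in> P"
  shows "int p dvd n"
proof (rule ccontr)
  assume "\<not> int p dvd n"
  then have "coprime n (int p)" using assms(2) by (metis coprime_commute prime_imp_coprime prime_nat_int_transfer)
  then obtain u v where uv: "u * n + v * int p = 1" using bezout_int[of n "int p"] by auto
  have P: "integral_ideal P" "1 \<notin> P" using assms(1) by (auto simp: prime_id_def)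
  have "of_int u * of_int n + of_int v * of_nat p \<in> P"
    using integral_idealD(5)[OF P(1) integral_idealD(3)[OF P(1) OK_of_int assms(4)] integral_idealD(3)[OF P(1) OK_of_int assms(3)]] .
  moreover have "of_int u * of_int n + of_int v * of_nat p = (of_int (u * n + v * int p) :: complex)" by simp
  ultimately show False using P(2) unfolding uv by simp
qed

text \<open>A maximal annihilator \<open>(J : w)\<close> is prime.\<close>

lemma associated_prime:
  assumes J: "integral_ideal J" "1 \<notin> J" "J \<noteq> {0}"
  shows "\<exists>w\<in>OK - J. \<exists>P. prime_id P \<and> J \<subseteq> P \<and> (\<forall>x\<in>P. w * x \<in> J)"
proof -
  note D = integral_idealD[OF J(1)]
  define ann where "ann = (\<lambda>w. {r \<in> OK. w * r \<in> J})"
  have annI: "integral_ideal (ann w)" if w: "w \<in> OK" for w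
    unfolding integral_ideal_def add_closed_def ann_def
    using D w by (auto simp: distrib_left mult.left_commute intro: OK_add OK_minus OK_mult)
  have Jann: "J \<subseteq> ann w" if "w \<in> OK" for w
    unfolding ann_def using D(1) D(3)[OF that] by blast
  obtain m where m: "m > (0::nat)" "of_nat m \<in> J" using integral_ideal_contains_nat[OF J(1,3)] by blast
  have "finite (ann ` (OK - J))"
    by (rule finite_subset[OF _ finite_ideals_above[OF m(1)]]) (use annI Jann m(2) in blast)
  moreover have "ann 1 \<in> ann ` (OK - J)" using J(2) OK_1 by (intro imageI) simp
  then have "ann ` (OK - J) \<noteq> {}" by (metis emptyE)
  ultimately have "\<exists>P\<in>ann ` (OK - J). \<forall>Q\<in>ann ` (OK - J). P \<subseteq> Q \<longrightarrow> P = Q"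
    by (rule finite_has_maximal)
  then obtain P where P0: "P \<in> ann ` (OK - J)" "\<forall>Q\<in>ann ` (OK - J). P \<subseteq> Q \<longrightarrow> P = Q" by (rule bexE)
  from P0(1) obtain w where w0: "P = ann w" "w \<in> OK - J" by (rule imageE)
  then have w: "w \<in> OK" "w \<notin> J" "P = ann w" by simp_all
  have P: "P = ann v" if "v \<in> OK" "v \<notin> J" "P \<subseteq> ann v" for v
    using bspec[OF P0(2), of "ann v"] that by simp
  have "prime_id P"
    unfolding prime_id_def
  proof (intro conjI ballI impI)
    show "integral_ideal P" using annI w by blast
    show "1 \<notin> P" using w by (simp add: ann_def)
    show "P \<noteq> {0}" using Jann[OF w(1)] w(3) J(3) D(4) by blast
    fix a b assume ab: "a \<in> OK" "b \<in> OK" "a * b \<in> P"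
    show "a \<in> P \<or> b \<in> P"
    proof (rule disjCI)
      assume "b \<notin> P"
      then have wb: "w * b \<in> OK" "w * b \<notin> J" using w ab(2) OK_mult by (auto simp: ann_def)
      have "ann w \<subseteq> ann (w * b)"
      proof
        fix r assume "r \<in> ann w"
        then have "r \<in> OK" "b * (w * r) \<in> J" using D(3)[OF ab(2)] by (auto simp: ann_def)
        then show "r \<in> ann (w * b)" by (simp add: ann_def mult_ac)
      qed
      then have Pwb: "P = ann (w * b)" using P[OF wb] w(3) by simp
      have "a * b \<in> ann w" using ab(3) w(3) by simp
      then have "w * (a * b) \<in> J" by (simp add: ann_def)
      then have "a \<in> ann (w * b)" using ab(1) by (simp add: ann_def mult_ac)
      then show "a \<in> P" unfolding Pwb .
    qed
  qed
  moreover have "\<forall>x\<in>P. w * x \<in> J" using w(3) by (simp add: ann_def)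
  ultimately show ?thesis using w Jann by blast
qed

end

section \<open>Conjugacy of the primes of \<open>H\<close> above a prime of \<open>F\<close>\<close>

context unramified_extension
begin

lemma A_image_OK: "\<sigma> \<in> A \<Longrightarrow> \<sigma> ` H.OK = H.OK"
proof
  assume s: "\<sigma> \<in> A"
  show "\<sigma> ` H.OK \<subseteq> H.OK" using A_OK[OF s] by blast
  show "H.OK \<subseteq> \<sigma> ` H.OK"
  proof
    fix x assume x: "x \<in> H.OK"
    then have "(inv\<^bsub>G\<^esub> \<sigma>) x \<in> H.OK" using A_OK G.inv_closed[OF s] by blast
    then show "x \<in> \<sigma> ` H.OK" using A_inv(2)[OF s H.OK_mem[OF x]] by (metis image_eqI)
  qed
qed

lemma A_image_iff:
  assumes "\<sigma> \<in> A" "P \<subseteq> H" "x \<in> H"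
  shows "\<sigma> x \<in> \<sigma> ` P \<longleftrightarrow> x \<in> P"
  using inj_on_image_mem_iff[OF A_D(8)[OF assms(1)] assms(3,2)] .

lemma prime_id_image:
  assumes s: "\<sigma> \<in> A" and P: "H.prime_id P"
  shows "H.prime_id (\<sigma> ` P)"
proof -
  have I: "H.integral_ideal P" "1 \<notin> P" "P \<noteq> {0}" using P by (auto simp: H.prime_id_def)
  note D = H.integral_idealD[OF I(1)]
  have PH: "P \<subseteq> H" using D(1) H.OK_mem by blast
  note a = A_D[OF s]
  show ?thesis
    unfolding H.prime_id_def
  proof (intro conjI ballI impI)
    show "H.integral_ideal (\<sigma> ` P)"
      unfolding H.integral_ideal_def add_closed_def
    proof (intro conjI ballI)
      show "\<sigma> ` P \<subseteq> H.OK" using D(1) A_OK[OF s] by blast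
      show "0 \<in> \<sigma> ` P" using D(4) a(10) by force
      show "x + y \<in> \<sigma> ` P" if h: "x \<in> \<sigma> ` P" "y \<in> \<sigma> ` P" for x y
      proof -
        obtain u v where "u \<in> P" "v \<in> P" "x = \<sigma> u" "y = \<sigma> v" using h by blast
        then show ?thesis using a(5)[of u v] D(5) PH by (metis image_eqI subsetD)
      qed
      show "- x \<in> \<sigma> ` P" if h: "x \<in> \<sigma> ` P" for x
      proof -
        obtain u where "u \<in> P" "x = \<sigma> u" using h by blast
        then show ?thesis using a(9)[of u] D(7) PH by (metis image_eqI subsetD)
      qed
      show "r * x \<in> \<sigma> ` P" if h: "r \<in> H.OK" "x \<in> \<sigma> ` P" for r x
      proof -
        obtain u t where "u \<in> P" "x = \<sigma> u" "t \<in> H.OK" "r = \<sigma> t" using h A_image_OK[OF s] by blast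
        then show ?thesis using a(6)[of t u] D(3) PH H.OK_mem by (metis image_eqI subsetD)
      qed
    qed
    show "1 \<notin> \<sigma> ` P" using A_image_iff[OF s PH H.one_mem] a(7) I(2) by simp
    obtain x where "x \<in> P" "x \<noteq> 0" using I(3) D(4) by blast
    then have "\<sigma> x \<in> \<sigma> ` P" "\<sigma> x \<noteq> 0" using inj_onD[OF a(8), of x 0] PH H.zero_mem a(10) by auto
    then show "\<sigma> ` P \<noteq> {0}" by (metis singletonD)
    fix x y assume xy: "x \<in> H.OK" "y \<in> H.OK" "x * y \<in> \<sigma> ` P"
    have "x \<in> \<sigma> ` H.OK" "y \<in> \<sigma> ` H.OK" using xy(1,2) A_image_OK[OF s] by simp_all
    then obtain u v where uv: "u \<in> H.OK" "v \<in> H.OK" "x = \<sigma> u" "y = \<sigma> v" by (elim imageE)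
    have "\<sigma> (u * v) \<in> \<sigma> ` P" using xy(3) uv a(6) H.OK_mem by simp
    then have "u * v \<in> P" using A_image_iff[OF s PH H.mult_mem[OF H.OK_mem H.OK_mem]] uv(1,2) by simp
    then have "u \<in> P \<or> v \<in> P" using P uv by (auto simp: H.prime_id_def)
    then show "x \<in> \<sigma> ` P \<or> y \<in> \<sigma> ` P" using uv(3,4) by (metis imageI)
  qed
qed

text \<open>Otherwise prime avoidance gives x in P' outside every conjugate of P. The norm of x to
  \<open>F\<close> lies in P' \<inter> O_F \<subseteq> P, so some conjugate of x lies in P, a
  contradiction.\<close>

lemma primes_conjugate:
  assumes P: "H.prime_id P" "H.prime_id P'" "P' \<inter> F.OK \<subseteq> P"
  shows "\<exists>\<sigma>\<in>A. P' = \<sigma> ` P"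
proof (rule ccontr)
  assume nc: "\<not> ?thesis"
  have PO: "P \<subseteq> H.OK" using P(1) H.integral_idealD(1) by (auto simp: H.prime_id_def)
  have PH: "P \<subseteq> H" using PO H.OK_mem by blast
  have "\<exists>x\<in>P'. \<forall>q\<in>(\<lambda>\<sigma>. \<sigma> ` P) ` A. x \<notin> q"
    by (rule H.prime_avoidance) (use finite_A nc H.prime_id_maximal prime_id_image P in auto)
  then obtain x where x: "x \<in> P'" "\<And>\<sigma>. \<sigma> \<in> A \<Longrightarrow> x \<notin> \<sigma> ` P" by blast
  have P'I: "H.integral_ideal P'" using P(2) by (simp add: H.prime_id_def)
  have xO: "x \<in> H.OK" using H.integral_idealD(1)[OF P'I x(1)] .
  have xH: "x \<in> H" using xO H.OK_mem by blast
  define n where "n = (\<Prod>\<sigma>\<in>A. \<sigma> x)"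
  have "n = \<one>\<^bsub>G\<^esub> x * (\<Prod>\<sigma>\<in>A - {\<one>\<^bsub>G\<^esub>}. \<sigma> x)" unfolding n_def using finite_A by (intro prod.remove) auto
  then have "n = x * (\<Prod>\<sigma>\<in>A - {\<one>\<^bsub>G\<^esub>}. \<sigma> x)" using A_one[OF xH] by simp
  moreover have "(\<Prod>\<sigma>\<in>A - {\<one>\<^bsub>G\<^esub>}. \<sigma> x) \<in> H.OK" using A_OK xO by (intro H.OK_prod) auto
  ultimately have nP': "n \<in> P'" using H.integral_idealD(8)[OF P'I _ x(1)] by simp
  then have "n \<in> F.OK" using H.integral_idealD(1)[OF P'I] norm_in_F[OF xH] OK_F_H by (simp add: n_def)
  then have "n \<in> P" using P(3) nP' by blast
  then obtain \<sigma> where s: "\<sigma> \<in> A" "\<sigma> x \<in> P"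
    using H.prime_id_prod[OF P(1) finite_A, of "\<lambda>\<sigma>. \<sigma> x"] A_OK xO unfolding n_def by blast
  have "x = (inv\<^bsub>G\<^esub> \<sigma>) (\<sigma> x)" using A_inv(1)[OF s(1) xH] by simp
  then have "x \<in> (inv\<^bsub>G\<^esub> \<sigma>) ` P" using s(2) by blast
  then show False using x(2) G.inv_closed[OF s(1)] by blast
qed

end

text \<open>The assumption \<open>root\<close> makes c a root modulo p of X^2 - X - k0, the minimal
  polynomial of w, and thereby selects the prime (p, w - c) of \<open>F\<close>. The assumption
  \<open>inert\<close> says that the norm form of the integers of Q(\<surd>l1) has no nontrivial
  zero modulo p, which expresses inertness in the same way for all p, 2 included.\<close>

locale split_prime = unramified_extension +
  fixes p :: nat and c :: int
  assumes prime_p: "Factorial_Ring.prime p"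
    and root: "int p dvd c * c - c - k0"
    and inert: "int p dvd a * a + a * b - b * b * ((int l1 - 1) div 4) \<Longrightarrow> int p dvd a \<and> int p dvd b"
    and coprime_l1: "\<not> int p dvd int l1"
begin

definition above :: "complex set \<Rightarrow> bool"
  where "above P \<longleftrightarrow> H.prime_id P \<and> of_nat p \<in> P \<and> w - of_int c \<in> P"

text \<open>Modulo P the generator w may be replaced by c, so the integers of \<open>F\<close>
  reduce to the prime field.\<close>

lemma residue:
  assumes P: "above P" and x: "x \<in> F.OK"
  shows "\<exists>n::int. x - of_int n \<in> P"
proof -
  obtain a b :: int where ab: "x = of_int a + of_int b * w" using x OK_basis by blast
  have "of_int b * (w - of_int c) \<in> P" using P H.integral_idealD(3)[OF _ H.OK_of_int] by (auto simp: above_def H.prime_id_def)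
  moreover have "of_int b * (w - of_int c) = x - of_int (a + b * c)" unfolding ab by (simp add: algebra_simps)
  ultimately show ?thesis by metis
qed

lemma of_int_above: "above P \<Longrightarrow> of_int n \<in> P \<longleftrightarrow> int p dvd n"
proof
  assume P: "above P"
  then have I: "H.prime_id P" "of_nat p \<in> P" "H.integral_ideal P" by (auto simp: above_def H.prime_id_def)
  show "int p dvd n" if "of_int n \<in> P" by (rule H.prime_id_of_int[OF I(1) prime_p I(2) that])
  assume "int p dvd n"
  then obtain k where "n = int p * k" by blast
  then show "of_int n \<in> P" using H.integral_idealD(8)[OF I(3) H.OK_of_int I(2), of k] by simp
qed

text \<open>The right-hand side depends on \<open>c\<close> only: all primes of \<open>H\<close>
  that contain p and w - c have the same contraction to \<open>F\<close>.\<close>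

lemma contraction_eq:
  assumes P: "above P"
  shows "P \<inter> F.OK = {of_int a + of_int b * w | a b. int p dvd a + b * c}"
proof -
  have I: "H.integral_ideal P" "w - of_int c \<in> P" using P by (auto simp: above_def H.prime_id_def)
  note D = H.integral_idealD[OF I(1)]
  have key: "of_int a + of_int b * w \<in> P \<longleftrightarrow> int p dvd a + b * c" for a b
  proof -
    have bP: "of_int b * (w - of_int c) \<in> P" using D(3)[OF H.OK_of_int I(2)] .
    have "of_int a + of_int b * w \<in> P \<longleftrightarrow> of_int (a + b * c) \<in> P"
    proof
      assume "of_int a + of_int b * w \<in> P"
      then have "(of_int a + of_int b * w) - of_int b * (w - of_int c) \<in> P" using bP D(6) by blast
      then show "of_int (a + b * c) \<in> P" by (simp add: algebra_simps)
    next
      assume "of_int (a + b * c) \<in> P"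
      then have "of_int (a + b * c) + of_int b * (w - of_int c) \<in> P" using bP D(5) by blast
      then show "of_int a + of_int b * w \<in> P" by (simp add: algebra_simps)
    qed
    then show ?thesis using of_int_above[OF P] by blast
  qed
  have "x \<in> P \<inter> F.OK \<longleftrightarrow> (\<exists>a b. x = of_int a + of_int b * w \<and> int p dvd a + b * c)" for x
    using key unfolding Int_iff OK_basis by blast
  then show ?thesis by blast
qed

lemma contraction_F: "above P \<Longrightarrow> above P' \<Longrightarrow> x \<in> F \<Longrightarrow> x \<in> P \<Longrightarrow> x \<in> P'"
proof -
  assume P: "above P" "above P'" "x \<in> F" "x \<in> P"
  then have "x \<in> H.OK" using H.integral_idealD(1) by (auto simp: above_def H.prime_id_def)
  then have "x \<in> P \<inter> F.OK" using P(3,4) OK_F_H by blast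
  then show ?thesis using contraction_eq[OF P(1)] contraction_eq[OF P(2)] by blast
qed

lemma above_image:
  assumes "\<sigma> \<in> A" "above P"
  shows "above (\<sigma> ` P)"
proof -
  have P: "H.prime_id P" "of_nat p \<in> P" "w - of_int c \<in> P" using assms(2) by (auto simp: above_def)
  have "\<sigma> (of_nat p) = of_nat p" "\<sigma> (w - of_int c) = w - of_int c"
    using A_D(3)[OF assms(1)] F.of_nat_mem F.diff_mem[OF w_in_F F.of_int_mem] by blast+
  then show ?thesis using prime_id_image[OF assms(1) P(1)] P(2,3) unfolding above_def by (metis imageI)
qed

text \<open>The subgroup B \<supseteq> D of index two has fixed field F(r) with r^2 = l1. To
  contradict inertness without residue field extensions, an integer z of F(r) is produced that lies
  in P but not in a(P), where a restricts to the nontrivial automorphism of F(r). The norm of l1 z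
  to \<open>F\<close> is a value of the norm form of Q(\<surd>l1) and lies in P; inertness forces
  both coordinates of l1 z into P, hence into a(P), and so z into a(P).\<close>

lemma above_unique:
  assumes P: "above P" and P': "above P'"
  shows "P = P'"
proof (rule ccontr)
  assume neq: "P \<noteq> P'"
  have Pp: "H.prime_id P" "H.prime_id P'" using P P' by (auto simp: above_def)
  have PI: "H.integral_ideal P" using Pp by (auto simp: H.prime_id_def)
  have PH: "P \<subseteq> H" using H.integral_idealD(1)[OF PI] H.OK_mem by blast
  define D where "D = {\<sigma> \<in> A. \<sigma> ` P = P}"
  have comp: "(\<sigma> \<otimes>\<^bsub>G\<^esub> \<tau>) ` P = \<sigma> ` \<tau> ` P" if "\<sigma> \<in> A" "\<tau> \<in> A" for \<sigma> \<tau>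
    unfolding image_image by (rule image_cong) (use A_mult[OF that] PH in auto)
  have D: "subgroup D G"
  proof (rule G.subgroupI)
    show "D \<subseteq> A" by (auto simp: D_def)
    have "\<one>\<^bsub>G\<^esub> ` P = P" using A_one PH by (force simp: image_iff)
    then show "D \<noteq> {}" unfolding D_def using G.one_closed by blast
    show "inv\<^bsub>G\<^esub> \<sigma> \<in> D" if "\<sigma> \<in> D" for \<sigma>
    proof -
      have s: "\<sigma> \<in> A" "\<sigma> ` P = P" using that by (auto simp: D_def)
      have "(inv\<^bsub>G\<^esub> \<sigma>) ` P = (inv\<^bsub>G\<^esub> \<sigma>) ` \<sigma> ` P" using s(2) by simp
      also have "\<dots> = P" unfolding image_image using A_inv(1)[OF s(1)] PH by (force simp: image_iff)
      finally show ?thesis using G.inv_closed[OF s(1)] by (simp add: D_def)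
    qed
    show "\<sigma> \<otimes>\<^bsub>G\<^esub> \<tau> \<in> D" if "\<sigma> \<in> D" "\<tau> \<in> D" for \<sigma> \<tau>
      using that comp[of \<sigma> \<tau>] G.m_closed by (auto simp: D_def)
  qed
  have "P' \<inter> F.OK \<subseteq> P" using contraction_eq[OF P] contraction_eq[OF P'] by blast
  then obtain \<sigma> where "\<sigma> \<in> A" "P' = \<sigma> ` P" using primes_conjugate[OF Pp] by blast
  then have "\<sigma> \<in> A" "\<sigma> \<notin> D" using neq by (auto simp: D_def)
  then have DA: "D \<noteq> A" by blast
  obtain k where k: "Coset.order G = 2 ^ k" using order_G by blast
  obtain B a where B: "subgroup B G" "D \<subseteq> B" "a \<in> A - B" "A = B \<union> (\<lambda>b. a \<otimes>\<^bsub>G\<^esub> b) ` B"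
    using G.index_two_subgroup[OF finite_A k D DA] by blast
  have a: "a \<in> A" "a \<notin> B" using B(3) by auto
  have BA: "\<And>b. b \<in> B \<Longrightarrow> b \<in> A" using subgroup.subset[OF B(1)] by blast
  have finB: "finite B" using BA finite_A by (meson finite_subset subsetI)
  note aD = A_D[OF a(1)]
  have aa: "a \<otimes>\<^bsub>G\<^esub> a \<in> B"
  proof (rule ccontr)
    assume "a \<otimes>\<^bsub>G\<^esub> a \<notin> B"
    then obtain b where b: "b \<in> B" "a \<otimes>\<^bsub>G\<^esub> a = a \<otimes>\<^bsub>G\<^esub> b" using B(4) G.m_closed[OF a(1) a(1)] by blast
    then have "a = b" using a(1) BA[OF b(1)] by (metis G.l_cancel)
    then show False using b(1) a(2) by blast
  qed
  have inF: "x \<in> F" if x: "x \<in> H" "\<And>b. b \<in> B \<Longrightarrow> b x = x" "a x = x" for x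
  proof (rule fixed_imp_F[OF x(1)])
    fix \<sigma> assume "\<sigma> \<in> A"
    then consider "\<sigma> \<in> B" | b where "b \<in> B" "\<sigma> = a \<otimes>\<^bsub>G\<^esub> b" using B(4) by blast
    then show "\<sigma> x = x"
    proof cases
      case 2
      then show ?thesis using A_mult[OF a(1) BA[OF 2(1)] x(1)] x(2)[OF 2(1)] x(3) by simp
    qed (rule x(2))
  qed
  have fixB_a: "b (a x) = a x" if "x \<in> H" "b \<in> B" "b x = x" for b x
    using A_commute[OF BA[OF that(2)] a(1) that(1)] that(3) by simp
  have aax: "a (a x) = x" if x: "x \<in> H" "\<And>b. b \<in> B \<Longrightarrow> b x = x" for x
    using A_mult[OF a(1) a(1) x(1)] x(2)[OF aa] by simp
  have disj: "B \<inter> (\<lambda>b. a \<otimes>\<^bsub>G\<^esub> b) ` B = {}"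
  proof (rule ccontr)
    assume "B \<inter> (\<lambda>b. a \<otimes>\<^bsub>G\<^esub> b) ` B \<noteq> {}"
    then obtain b b' where b: "b \<in> B" "b' \<in> B" "b' = a \<otimes>\<^bsub>G\<^esub> b" by blast
    then have "a = b' \<otimes>\<^bsub>G\<^esub> inv\<^bsub>G\<^esub> b" using BA[OF b(1)] a(1) by (simp add: G.m_assoc)
    then show False using subgroup.m_closed[OF B(1) b(2) subgroup.m_inv_closed[OF B(1) b(1)]] a(2) by simp
  qed
  have inj: "inj_on (\<lambda>b. a \<otimes>\<^bsub>G\<^esub> b) B"
    by (rule inj_onI) (use a(1) BA in \<open>metis G.l_cancel\<close>)
  \<comment> \<open>The signs are the nontrivial character of A / B. Independence of the
    automorphisms gives v whose signed sum is nonzero; this sum is the y below, fixed by B and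
    negated by a.\<close>
  have "\<exists>v\<in>H. (\<Sum>\<sigma>\<in>A. (if \<sigma> \<in> B then 1 else - 1) * \<sigma> v) \<noteq> 0"
  proof (rule characters_independent[OF finite_A])
    show "\<exists>x\<in>H. \<sigma> x \<noteq> \<tau> x" if "\<sigma> \<in> A" "\<tau> \<in> A" "\<sigma> \<noteq> \<tau>" for \<sigma> \<tau> using A_ext[OF that(1,2)] that(3) by blast
  qed (use G.one_closed A_D(2) H.one_mem H.mult_mem in auto)
  then obtain v where v: "v \<in> H" "(\<Sum>\<sigma>\<in>A. (if \<sigma> \<in> B then 1 else - 1) * \<sigma> v) \<noteq> 0" by blast
  define t where "t = (\<Sum>b\<in>B. b v)"
  have bvH: "b v \<in> H" if "b \<in> B" for b by (rule A_D(4)[OF BA[OF that] v(1)])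
  have tH: "t \<in> H" unfolding t_def by (intro H.sum_mem bvH)
  have tB: "b t = t" if "b \<in> B" for b unfolding t_def by (rule subgroup_trace_fixed[OF B(1) that v(1)])
  define y where "y = t - a t"
  have yH: "y \<in> H" unfolding y_def by (rule H.diff_mem[OF tH aD(4)[OF tH]])
  have "(\<Sum>\<sigma>\<in>A. (if \<sigma> \<in> B then 1 else - 1) * \<sigma> v) = (\<Sum>\<sigma>\<in>B. (if \<sigma> \<in> B then 1 else - 1) * \<sigma> v)
     + (\<Sum>\<sigma>\<in>(\<lambda>b. a \<otimes>\<^bsub>G\<^esub> b) ` B. (if \<sigma> \<in> B then 1 else - 1) * \<sigma> v)"
  proof -
    have "(\<Sum>\<sigma>\<in>B \<union> (\<lambda>b. a \<otimes>\<^bsub>G\<^esub> b) ` B. (if \<sigma> \<in> B then 1 else - 1) * \<sigma> v) = (\<Sum>\<sigma>\<in>B. (if \<sigma> \<in> B then 1 else - 1) * \<sigma> v)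
     + (\<Sum>\<sigma>\<in>(\<lambda>b. a \<otimes>\<^bsub>G\<^esub> b) ` B. (if \<sigma> \<in> B then 1 else - 1) * \<sigma> v)"
      by (rule sum.union_disjoint) (use finB disj in auto)
    then show ?thesis unfolding B(4)[symmetric] .
  qed
  also have "(\<Sum>\<sigma>\<in>B. (if \<sigma> \<in> B then 1 else - 1) * \<sigma> v) = t" unfolding t_def by (rule sum.cong) auto
  also have "(\<Sum>\<sigma>\<in>(\<lambda>b. a \<otimes>\<^bsub>G\<^esub> b) ` B. (if \<sigma> \<in> B then 1 else - 1) * \<sigma> v) = (\<Sum>\<sigma>\<in>(\<lambda>b. a \<otimes>\<^bsub>G\<^esub> b) ` B. - \<sigma> v)"
    proof (rule sum.cong)
    fix \<sigma> assume "\<sigma> \<in> (\<lambda>b. a \<otimes>\<^bsub>G\<^esub> b) ` B"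
    then have "\<sigma> \<notin> B" using disj by blast
    then show "(if \<sigma> \<in> B then 1 else - 1) * \<sigma> v = - \<sigma> v" by simp
  qed simp
  also have "\<dots> = (\<Sum>b\<in>B. - (a \<otimes>\<^bsub>G\<^esub> b) v)" by (simp add: sum.reindex[OF inj])
  also have "\<dots> = - (\<Sum>b\<in>B. a (b v))" unfolding sum_negf by (simp add: A_mult[OF a(1) BA v(1)])
  also have "(\<Sum>b\<in>B. a (b v)) = a t" unfolding t_def by (rule A_sum[OF a(1), symmetric]) (rule bvH)
  finally have y0: "y \<noteq> 0" using v(2) by (simp add: y_def)
  have diffA: "\<sigma> (u - v) = \<sigma> u - \<sigma> v" if "\<sigma> \<in> A" "u \<in> H" "v \<in> H" for \<sigma> u v
    using A_D(5)[OF that(1,2) H.minus_mem[OF that(3)]] A_D(9)[OF that(1,3)] by simp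
  have yB: "b y = y" if "b \<in> B" for b
    unfolding y_def using diffA[OF BA[OF that] tH aD(4)[OF tH]] tB[OF that] fixB_a[OF tH that tB[OF that]] by simp
  have aat: "a (a t) = t" by (rule aax[OF tH]) (rule tB)
  have ya: "a y = - y"
    unfolding y_def using diffA[OF a(1) tH aD(4)[OF tH]] aat by simp
  have "y * y \<in> F"
  proof (rule inF)
    show "y * y \<in> H" by (rule H.mult_mem[OF yH yH])
    show "b (y * y) = y * y" if "b \<in> B" for b using A_D(6)[OF BA[OF that] yH yH] yB[OF that] by simp
    show "a (y * y) = y * y" using aD(6)[OF yH yH] ya by simp
  qed
  moreover have "y \<notin> F" using A_D(3)[OF a(1)] ya y0 by force
  ultimately obtain f where f: "f \<in> F" "f \<noteq> 0" "(f * y) * (f * y) = of_nat l1" using square_root_class[OF yH] by blast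
  define r where "r = f * y"
  have fH: "f \<in> H" using f(1) F_subset_H by blast
  have rH: "r \<in> H" unfolding r_def by (intro H.mult_mem fH yH)
  have rr: "r * r = of_nat l1" using f(3) by (simp add: r_def)
  have rB: "b r = r" if "b \<in> B" for b
    unfolding r_def using A_D(6)[OF BA[OF that] fH yH] yB[OF that] A_D(3)[OF BA[OF that] f(1)] by simp
  have ra: "a r = - r" unfolding r_def using aD(6)[OF fH yH] ya aD(3)[OF f(1)] by simp
  have rO: "r \<in> H.OK" using H.OK_sqrt[OF rH] rr by simp
  define k1 where "k1 = (int l1 - 1) div 4"
  have "l1 mod 4 = 1" using mod1 by (simp add: unique_euclidean_semiring_class.cong_def)
  then have "int l1 = 4 * k1 + 1" unfolding k1_def by presburger
  then have l1k: "(of_nat l1 :: complex) = 4 * of_int k1 + 1" by (metis of_int_add of_int_mult of_int_numeral of_int_of_nat_eq of_int_1)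
  \<comment> \<open>Integral like r, with a(\<theta>) = 1 - \<theta>. Coordinates with respect to 1
    and \<theta> lead to the form a^2 + a b - k b^2, which keeps p = 2 within the argument.\<close>
  define \<theta> where "\<theta> = (1 + r) / 2"
  have \<theta>H: "\<theta> \<in> H" unfolding \<theta>_def by (intro H.divide_mem H.add_mem H.one_mem rH H.numeral_mem)
  have "\<theta> * \<theta> = (1 + 2 * r + r * r) / 4" by (simp add: \<theta>_def algebra_simps)
  also have "\<dots> = \<theta> + of_int k1" unfolding rr l1k by (simp add: \<theta>_def field_simps)
  finally have \<theta>\<theta>: "\<theta> * \<theta> = \<theta> + of_int k1" .
  have "algebraic_int \<theta>"
  proof (rule algebraic_int.intros)
    show "lead_coeff [:- of_int k1, - 1, 1:] = (1::complex)" by simp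
    show "\<forall>i. coeff [:- of_int k1, - 1, 1:] i \<in> (\<int> :: complex set)" by (auto simp: coeff_pCons split: nat.splits)
    show "poly [:- of_int k1, - 1, 1:] \<theta> = 0" using \<theta>\<theta> by (simp add: algebra_simps)
  qed
  then have \<theta>O: "\<theta> \<in> H.OK" using \<theta>H by (simp add: H.OK_def)
  have hom2: "\<sigma> ((1 + r) / 2) = (1 + \<sigma> r) / 2" if s: "\<sigma> \<in> A" for \<sigma>
  proof -
    have "\<sigma> 2 * \<sigma> \<theta> = \<sigma> (2 * \<theta>)" using A_D(6)[OF s H.numeral_mem \<theta>H] by simp
    also have "2 * \<theta> = 1 + r" by (simp add: \<theta>_def)
    also have "\<sigma> (1 + r) = 1 + \<sigma> r" using A_D(5)[OF s H.one_mem rH] A_D(7)[OF s] by simp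
    finally show ?thesis using A_D(3)[OF s F.numeral_mem] by (simp add: \<theta>_def field_simps)
  qed
  have \<theta>B: "b \<theta> = \<theta>" if "b \<in> B" for b unfolding \<theta>_def using hom2[OF BA[OF that]] rB[OF that] by simp
  have \<theta>a: "a \<theta> = 1 - \<theta>" unfolding \<theta>_def hom2[OF a(1)] ra by (simp add: field_simps)
  define P2 where "P2 = a ` P"
  have P2: "above P2" unfolding P2_def by (rule above_image[OF a(1) P])
  \<comment> \<open>Since D \<subseteq> B, no automorphism outside B fixes P, and P can be separated
    from all its images under A - B. The norm z of x over B is then fixed by B, lies in P and avoids
    a(P).\<close>
  have "\<exists>x\<in>P. \<forall>q\<in>(\<lambda>\<sigma>. \<sigma> ` P) ` (A - B). x \<notin> q"
  proof (rule H.prime_avoidance)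
    show "finite ((\<lambda>\<sigma>. \<sigma> ` P) ` (A - B))" using finite_A by auto
    show "H.maximal q" if "q \<in> (\<lambda>\<sigma>. \<sigma> ` P) ` (A - B)" for q
      using that H.prime_id_maximal[OF prime_id_image[OF _ Pp(1)]] by blast
    show "H.maximal P" by (rule H.prime_id_maximal[OF Pp(1)])
    show "P \<notin> (\<lambda>\<sigma>. \<sigma> ` P) ` (A - B)" using B(2) unfolding D_def by force
  qed
  then obtain x where x0: "x \<in> P" "\<forall>q\<in>(\<lambda>\<sigma>. \<sigma> ` P) ` (A - B). x \<notin> q" by (rule bexE)
  have x: "x \<in> P" "\<And>\<sigma>. \<sigma> \<in> A - B \<Longrightarrow> x \<notin> \<sigma> ` P"
    using x0(1) bspec[OF x0(2) imageI] by simp_all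
  have xO: "x \<in> H.OK" using H.integral_idealD(1)[OF PI x(1)] .
  have xH: "x \<in> H" using xO H.OK_mem by blast
  define z where "z = (\<Prod>b\<in>B. b x)"
  have bxO: "b x \<in> H.OK" if "b \<in> B" for b by (rule A_OK[OF BA[OF that] xO])
  have zO: "z \<in> H.OK" unfolding z_def by (intro H.OK_prod bxO)
  have zH: "z \<in> H" using zO H.OK_mem by blast
  have zB: "b z = z" if "b \<in> B" for b unfolding z_def by (rule subgroup_norm_fixed[OF B(1) that xH])
  have oneB: "\<one>\<^bsub>G\<^esub> \<in> B" by (rule subgroup.one_closed[OF B(1)])
  have "z = \<one>\<^bsub>G\<^esub> x * (\<Prod>b\<in>B - {\<one>\<^bsub>G\<^esub>}. b x)" unfolding z_def using finB oneB by (rule prod.remove)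
  then have "z = x * (\<Prod>b\<in>B - {\<one>\<^bsub>G\<^esub>}. b x)" using A_one[OF xH] by simp
  moreover have "(\<Prod>b\<in>B - {\<one>\<^bsub>G\<^esub>}. b x) \<in> H.OK" by (intro H.OK_prod bxO) simp
  ultimately have zP: "z \<in> P" using H.integral_idealD(8)[OF PI _ x(1)] by simp
  have P2p: "H.prime_id P2" "H.integral_ideal P2" using P2 by (auto simp: above_def H.prime_id_def)
  have zP2: "z \<notin> P2"
  proof
    assume "z \<in> P2"
    then have "\<exists>b\<in>B. b x \<in> P2"
      using H.prime_id_prod[of P2 B "\<lambda>b. b x"] P2p(1) finB bxO unfolding z_def by simp
    then obtain b where b: "b \<in> B" "b x \<in> P2" by (rule bexE)
    from b(2) have "b x \<in> a ` P" unfolding P2_def .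
    then obtain u where u: "b x = a u" "u \<in> P" by (rule imageE)
    have ib: "inv\<^bsub>G\<^esub> b \<in> A" by (rule G.inv_closed[OF BA[OF b(1)]])
    have uH: "u \<in> H" using u(2) PH by blast
    have "x = (inv\<^bsub>G\<^esub> b) (a u)" using A_inv(1)[OF BA[OF b(1)] xH] u(1) by simp
    then have "x = (inv\<^bsub>G\<^esub> b \<otimes>\<^bsub>G\<^esub> a) u" using A_mult[OF ib a(1) uH] by simp
    moreover have "inv\<^bsub>G\<^esub> b \<otimes>\<^bsub>G\<^esub> a \<notin> B"
    proof
      assume "inv\<^bsub>G\<^esub> b \<otimes>\<^bsub>G\<^esub> a \<in> B"
      then have "b \<otimes>\<^bsub>G\<^esub> (inv\<^bsub>G\<^esub> b \<otimes>\<^bsub>G\<^esub> a) \<in> B" by (rule subgroup.m_closed[OF B(1) b(1)])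
      then show False using a BA[OF b(1)] by (simp flip: G.m_assoc)
    qed
    then have "inv\<^bsub>G\<^esub> b \<otimes>\<^bsub>G\<^esub> a \<in> A - B" using G.m_closed[OF ib a(1)] by blast
    ultimately show False using x(2)[of "inv\<^bsub>G\<^esub> b \<otimes>\<^bsub>G\<^esub> a"] imageI[OF u(2), of "inv\<^bsub>G\<^esub> b \<otimes>\<^bsub>G\<^esub> a"] by simp
  qed
  define z' where "z' = a z"
  have z'O: "z' \<in> H.OK" unfolding z'_def by (rule A_OK[OF a(1) zO])
  have z'H: "z' \<in> H" using z'O H.OK_mem by blast
  have z'B: "b z' = z'" if "b \<in> B" for b unfolding z'_def by (rule fixB_a[OF zH that zB[OF that]])
  have z'a: "a z' = z" unfolding z'_def by (rule aax[OF zH]) (rule zB)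
  \<comment> \<open>The coordinates of l1 z: if z = u + v \<theta>, then z - z' = v r, so that
    \<beta> = l1 v and \<alpha> = l1 u. The factor l1 makes both integral.\<close>
  define \<beta> where "\<beta> = r * (z - z')"
  define \<alpha> where "\<alpha> = of_nat l1 * z - \<beta> * \<theta>"
  have dH: "z - z' \<in> H" by (intro H.diff_mem zH z'H)
  have \<beta>O: "\<beta> \<in> H.OK" unfolding \<beta>_def by (intro H.OK_mult H.OK_diff rO zO z'O)
  have \<beta>H: "\<beta> \<in> H" using \<beta>O H.OK_mem by blast
  have \<beta>B: "b \<beta> = \<beta>" if "b \<in> B" for b
    unfolding \<beta>_def using A_D(6)[OF BA[OF that] rH dH] diffA[OF BA[OF that] zH z'H] rB[OF that] zB[OF that] z'B[OF that] by simp
  have \<beta>a: "a \<beta> = \<beta>"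
    unfolding \<beta>_def using aD(6)[OF rH dH] diffA[OF a(1) zH z'H] ra z'a z'_def[symmetric] by (simp add: algebra_simps)
  have "\<beta> \<in> F" by (rule inF[OF \<beta>H _ \<beta>a]) (rule \<beta>B)
  then have \<beta>F: "\<beta> \<in> F.OK" using \<beta>O OK_F_H by blast
  have \<alpha>O: "\<alpha> \<in> H.OK" unfolding \<alpha>_def by (intro H.OK_diff H.OK_mult H.OK_of_nat zO \<beta>O \<theta>O)
  have \<alpha>H: "\<alpha> \<in> H" using \<alpha>O H.OK_mem by blast
  have \<alpha>A: "\<sigma> \<alpha> = of_nat l1 * \<sigma> z - \<sigma> \<beta> * \<sigma> \<theta>" if s: "\<sigma> \<in> A" for \<sigma>
    unfolding \<alpha>_def using diffA[OF s H.mult_mem[OF H.of_nat_mem zH] H.mult_mem[OF \<beta>H \<theta>H]]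
      A_D(6)[OF s H.of_nat_mem zH] A_D(6)[OF s \<beta>H \<theta>H] A_D(3)[OF s F.of_nat_mem] by simp
  have l1z': "of_nat l1 * z' = \<alpha> + \<beta> * (1 - \<theta>)"
  proof -
    have "\<beta> * (2 * \<theta> - 1) = (r * r) * (z - z')" by (simp add: \<beta>_def \<theta>_def)
    then show ?thesis unfolding rr \<alpha>_def by (simp add: algebra_simps)
  qed
  have \<alpha>a: "a \<alpha> = \<alpha>" using \<alpha>A[OF a(1)] l1z' unfolding \<beta>a \<theta>a z'_def[symmetric] by simp
  have \<alpha>B: "b \<alpha> = \<alpha>" if "b \<in> B" for b
    using \<alpha>A[OF BA[OF that]] unfolding \<beta>B[OF that] \<theta>B[OF that] zB[OF that] by (simp add: \<alpha>_def)
  have "\<alpha> \<in> F" by (rule inF[OF \<alpha>H _ \<alpha>a]) (rule \<alpha>B)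
  then have \<alpha>F: "\<alpha> \<in> F.OK" using \<alpha>O OK_F_H by blast
  have l1z: "of_nat l1 * z = \<alpha> + \<beta> * \<theta>" by (simp add: \<alpha>_def)
  have "(\<alpha> + \<beta> * \<theta>) * (\<alpha> + \<beta> * (1 - \<theta>)) = \<alpha> * \<alpha> + \<alpha> * \<beta> + \<beta> * \<beta> * \<theta> - \<beta> * \<beta> * (\<theta> * \<theta>)" by (simp add: algebra_simps)
  also have "\<dots> = \<alpha> * \<alpha> + \<alpha> * \<beta> - \<beta> * \<beta> * of_int k1" unfolding \<theta>\<theta> by (simp add: algebra_simps)
  finally have "(of_nat l1 * z) * (of_nat l1 * z') = \<alpha> * \<alpha> + \<alpha> * \<beta> - \<beta> * \<beta> * of_int k1" unfolding l1z l1z' .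
  then have nf: "\<alpha> * \<alpha> + \<alpha> * \<beta> - \<beta> * \<beta> * of_int k1 = (of_nat l1 * of_nat l1 * z') * z" by (simp add: mult_ac)
  have nP: "\<alpha> * \<alpha> + \<alpha> * \<beta> - \<beta> * \<beta> * of_int k1 \<in> P" unfolding nf
    by (rule H.integral_idealD(3)[OF PI _ zP]) (intro H.OK_mult H.OK_of_nat z'O)
  obtain i j where ij: "\<alpha> - of_int i \<in> P" "\<beta> - of_int j \<in> P" using residue[OF P \<alpha>F] residue[OF P \<beta>F] by blast
  \<comment> \<open>The difference of the norm form at (\<alpha>, \<beta>) and at the integers (i,
    j) congruent to them modulo P, arranged so that membership in P is visible.\<close>
  define e where "e = (\<alpha> + of_int i + \<beta>) * (\<alpha> - of_int i) + (of_int i - (\<beta> + of_int j) * of_int k1) * (\<beta> - of_int j)"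
  have eP: "e \<in> P" unfolding e_def
    by (intro H.integral_idealD(5)[OF PI] H.integral_idealD(3)[OF PI] ij H.OK_add H.OK_mult H.OK_diff \<alpha>O \<beta>O H.OK_of_int)
  have "(\<alpha> * \<alpha> + \<alpha> * \<beta> - \<beta> * \<beta> * of_int k1) - e = of_int (i * i + i * j - j * j * k1)"
    unfolding e_def by (simp add: algebra_simps)
  then have "of_int (i * i + i * j - j * j * k1) \<in> P" using H.integral_idealD(6)[OF PI nP eP] by simp
  then have "int p dvd i * i + i * j - j * j * k1" using of_int_above[OF P] by blast
  then have "int p dvd i" "int p dvd j" using inert unfolding k1_def by blast+
  then have "of_int i \<in> P" "of_int j \<in> P" using of_int_above[OF P] by blast+
  then have "\<alpha> \<in> P" "\<beta> \<in> P" using H.integral_idealD(5)[OF PI ij(1)] H.integral_idealD(5)[OF PI ij(2)] by force+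
  \<comment> \<open>Elements of \<open>F\<close> cannot distinguish P from P2, which have the same
    contraction.\<close>
  then have "\<alpha> \<in> P2" "\<beta> \<in> P2" using contraction_F[OF P P2] \<alpha>F \<beta>F OK_F_H by blast+
  then have "of_nat l1 * z \<in> P2" unfolding l1z
    using H.integral_idealD(5)[OF P2p(2) _ H.integral_idealD(8)[OF P2p(2) \<theta>O]] by blast
  then have "of_nat l1 \<in> P2 \<or> z \<in> P2" using P2p(1) zO unfolding H.prime_id_def by auto
  moreover have "of_nat l1 \<notin> P2" using of_int_above[OF P2, of "int l1"] coprime_l1 by simp
  ultimately show False using zP2 by blast
qed

end

section \<open>Extension of prime ideals from \<open>F\<close> to \<open>H\<close>\<close>

context unramified_extension
begin

lemma extended_ideal:
  assumes q: "F.integral_ideal q"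
  shows "H.integral_ideal (q \<diamondop> H.OK)" "q \<subseteq> q \<diamondop> H.OK"
proof -
  note qD = F.integral_idealD[OF q]
  have qH: "q \<subseteq> H.OK" using qD(1) OK_F_H by blast
  show "H.integral_ideal (q \<diamondop> H.OK)"
    unfolding H.integral_ideal_def
  proof (intro conjI ballI)
    show "q \<diamondop> H.OK \<subseteq> H.OK" by (rule set_prod_least) (use qH in \<open>auto intro: H.OK_mult H.OK_add\<close>)
    show "add_closed (q \<diamondop> H.OK)" by (rule add_closed_set_prod[OF qD(2)]) (use H.OK_1 in blast)
    fix a x assume a: "a \<in> H.OK" and "x \<in> q \<diamondop> H.OK"
    from this(2) show "a * x \<in> q \<diamondop> H.OK"
    proof (induction rule: set_prod_induct)
      case (mult i j)
      then show ?case using set_prod_mult[OF mult(1) H.OK_mult[OF a mult(2)]] by (simp add: mult.left_commute)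
    next
      case (add x y)
      then show ?case by (simp add: distrib_left set_prod_add)
    qed
  qed
  show "q \<subseteq> q \<diamondop> H.OK" using set_prod_mult[OF _ H.OK_1] by force
qed

text \<open>If \<open>P\<close> is the only prime above \<open>q\<close>, an associated prime of \<open>O\<^sub>H / q O\<^sub>H\<close> must be \<open>P\<close>,
  which makes \<open>P\<close> invertible.\<close>

lemma inert_prime:
  assumes P: "H.prime_id P" and q: "P \<inter> F.OK = q" "q \<noteq> {0}"
    and uniq: "\<And>P'. H.prime_id P' \<Longrightarrow> q \<subseteq> P' \<Longrightarrow> P' = P"
  shows "q \<diamondop> H.OK = P"
proof -
  note Pm = H.prime_id_maximal[OF P]
  note Pi = H.maximalD(1)[OF Pm]
  note PD = H.integral_idealD[OF Pi]
  have P0: "P \<noteq> {0}" using P by (simp add: H.prime_id_def)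
  have qi: "F.integral_ideal q" using contraction_ideal[OF Pi] q(1) by simp
  define J where "J = q \<diamondop> H.OK"
  have JI: "H.integral_ideal J" and qJ: "q \<subseteq> J" unfolding J_def using extended_ideal[OF qi] by auto
  note JD = H.integral_idealD[OF JI]
  have JP: "J \<subseteq> P" unfolding J_def by (rule set_prod_least) (use q(1) PD in auto)
  have J0: "J \<noteq> {0}" using qJ q(2) F.integral_idealD(4)[OF qi] by blast
  have J1: "1 \<notin> J" using JP H.maximalD(2)[OF Pm] by blast
  obtain v where v: "v \<in> H.OK" "v \<notin> J" "\<forall>x\<in>P. v * x \<in> J"
  proof -
    obtain v P' where "v \<in> H.OK - J" "H.prime_id P'" "J \<subseteq> P'" "\<forall>x\<in>P'. v * x \<in> J"
      using H.associated_prime[OF JI J1 J0] by blast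
    moreover from this have "P' = P" using uniq qJ by blast
    ultimately show ?thesis using that by blast
  qed
  obtain q' where q': "F.frac q'" "q \<diamondop> q' = F.OK" using frac_inverse[OF F.integral_ideal_imp_frac[OF qi q(2)]] by blast
  define P' where "P' = {x \<in> H. \<forall>y\<in>P. x * y \<in> H.OK}"
  have vP': "u * v \<in> P'" if u: "u \<in> q'" for u
  proof -
    have uJ: "u * x \<in> H.OK" if "x \<in> J" for x
      using that unfolding J_def
    proof (induction rule: set_prod_induct)
      case (mult i j)
      have "i * u \<in> F.OK" using set_prod_mult[OF mult(1) u] q'(2) by simp
      then have "(i * u) * j \<in> H.OK" using mult(2) OK_F_H H.OK_mult by blast
      then show ?case by (simp add: mult_ac)
    next
      case (add x y)
      then show ?case by (simp add: distrib_left H.OK_add)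
    qed
    have "(u * v) * y \<in> H.OK" if "y \<in> P" for y using uJ[of "v * y"] v(3) that by (simp add: mult.assoc)
    moreover have "u * v \<in> H" using F.fracD(1)[OF q'(1) u] F_subset_H v(1) H.OK_mem by (blast intro: H.mult_mem)
    ultimately show ?thesis by (simp add: P'_def)
  qed
  have P'add: "x + y \<in> P'" if "x \<in> P'" "y \<in> P'" for x y
    using that by (auto simp: P'_def distrib_right intro: H.add_mem H.OK_add)
  have OP': "H.OK \<subseteq> P'" using H.OK_mem PD(1) H.OK_mult by (auto simp: P'_def)
  have "1 \<in> P \<diamondop> P'"
  proof (rule ccontr)
    assume n1: "1 \<notin> P \<diamondop> P'"
    have "H.integral_ideal (P \<diamondop> P')"
      unfolding H.integral_ideal_def
    proof (intro conjI ballI)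
      show "P \<diamondop> P' \<subseteq> H.OK" by (rule set_prod_least) (auto simp: P'_def mult.commute intro: H.OK_add)
      show "add_closed (P \<diamondop> P')" by (rule add_closed_set_prod[OF PD(2)]) (use OP' H.OK_1 in blast)
      fix a x assume a: "a \<in> H.OK" and "x \<in> P \<diamondop> P'"
      from this(2) show "a * x \<in> P \<diamondop> P'"
      proof (induction rule: set_prod_induct)
        case (mult i j)
        then show ?case using set_prod_mult[OF PD(3)[OF a mult(1)] mult(2)] by (simp add: mult.assoc)
      next
        case (add x y)
        then show ?case by (simp add: distrib_left set_prod_add)
      qed
    qed
    moreover have "P \<subseteq> P \<diamondop> P'" using set_prod_mult[of _ P 1 P'] OP' H.OK_1 by force
    ultimately have PP: "P \<diamondop> P' = P" using Pm n1 unfolding H.maximal_def by blast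
    \<comment> \<open>If P P' = P, then elements of P' map P into itself and are integral. Hence v
      times the inverse of q is integral, and multiplying by q puts v into J, against the choice of
      v.\<close>
    have P'O: "x \<in> H.OK" if x: "x \<in> P'" for x
    proof (rule H.OK_if_stable[OF Pi P0])
      show "x \<in> H" using x by (simp add: P'_def)
      show "x * y \<in> P" if "y \<in> P" for y using set_prod_mult[OF that x] PP by (simp add: mult.commute)
    qed
    have vJ: "x * v \<in> J" if "x \<in> q \<diamondop> q'" for x
      using that
    proof (induction rule: set_prod_induct)
      case (mult i j)
      have "i * (j * v) \<in> J" unfolding J_def by (rule set_prod_mult[OF mult(1) P'O[OF vP'[OF mult(2)]]])
      then show ?case by (simp add: mult.assoc)
    next
      case (add x y)
      then show ?case using JD(5) by (simp add: distrib_right)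
    qed
    have "1 * v \<in> J" by (rule vJ) (use q'(2) F.OK_1 in simp)
    then show False using v(2) by simp
  qed
  note one = this
  define I where "I = P' \<diamondop> J"
  have I_OK: "I \<subseteq> H.OK" unfolding I_def
    by (rule set_prod_least) (use JP in \<open>auto simp: P'_def intro: H.OK_add\<close>)
  have II: "H.integral_ideal I"
    unfolding H.integral_ideal_def
  proof (intro conjI ballI)
    show "I \<subseteq> H.OK" by (rule I_OK)
    show "add_closed I" unfolding I_def set_prod_commute[of P' J]
      by (rule add_closed_set_prod[OF JD(2)]) (use OP' H.OK_1 in blast)
    fix a x assume a: "a \<in> H.OK" and "x \<in> I"
    from this(2) show "a * x \<in> I" unfolding I_def
    proof (induction rule: set_prod_induct)
      case (mult i j)
      then show ?case using set_prod_mult[OF mult(1) JD(3)[OF a mult(2)]] by (simp add: mult.left_commute)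
    next
      case (add x y)
      then show ?case by (simp add: distrib_left set_prod_add)
    qed
  qed
  have PI: "P \<diamondop> I \<subseteq> J"
  proof -
    have "P \<diamondop> P' \<subseteq> H.OK" by (rule set_prod_least) (auto simp: P'_def mult.commute intro: H.OK_add)
    then have "(P \<diamondop> P') \<diamondop> J \<subseteq> H.OK \<diamondop> J" by (rule set_prod_mono) simp
    also have "\<dots> \<subseteq> J" by (rule H.set_prod_subset(2)[OF H.integral_ideal_OK JI])
    finally show ?thesis unfolding I_def set_prod_assoc .
  qed
  have JPI: "J \<subseteq> P \<diamondop> I"
  proof
    fix x assume x: "x \<in> J"
    have "y * x \<in> P \<diamondop> I" if "y \<in> P \<diamondop> P'" for y
      using set_prod_mult[OF that x] unfolding I_def set_prod_assoc .
    from this[OF one] show "x \<in> P \<diamondop> I" by simp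
  qed
  have JI': "J \<subseteq> I" unfolding I_def using set_prod_mult[of 1 P' _ J] OP' H.OK_1 by force
  \<comment> \<open>I is J divided by P. If it were proper, it would lie in a maximal ideal above q,
    that is in P, and q \<subseteq> J \<subseteq> P I \<subseteq> P^2 would contradict ramification
    index one.\<close>
  have "1 \<in> I"
  proof (rule ccontr)
    assume "1 \<notin> I"
    moreover have "I \<noteq> {0}" using JI' J0 JD(4) by blast
    ultimately obtain M where M: "H.maximal M" "I \<subseteq> M" using H.maximal_ideal_exists[OF II] by blast
    have "M \<noteq> {0}" using M(2) \<open>I \<noteq> {0}\<close> H.integral_idealD(4)[OF II] by blast
    then have "M = P" using uniq H.maximal_imp_prime[OF M(1)] M(2) JI' qJ by blast
    then have "P \<diamondop> I \<subseteq> P \<diamondop> P" using M(2) by (intro set_prod_mono) auto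
    then have "q \<subseteq> P \<diamondop> P" using JPI qJ by blast
    then show False using not_in_square[OF P] q(1) by simp
  qed
  then have "P \<subseteq> P \<diamondop> I" using set_prod_mult[of _ P 1 I] by force
  then have "P \<subseteq> J" using PI by blast
  then show ?thesis using JP unfolding J_def by blast
qed

end

context split_prime
begin

text \<open>In coordinates, \<open>q\<close> is the kernel of the ring map from O_F to the integers
  modulo p that sends w to c. It is proper, because the norm of any of its elements is divisible by
  p; a prime of \<open>H\<close> over a maximal ideal containing it has the required
  property.\<close>

lemma contraction_ideal_eq: "\<exists>P. above P"
proof -
  define q where "q = {x. \<exists>a b. x = of_int a + of_int b * w \<and> int p dvd a + b * c}"
  have mem: "of_int a + of_int b * w \<in> q" if "int p dvd a + b * c" for a b using that unfolding q_def by blast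
  have qI: "F.integral_ideal q"
    unfolding F.integral_ideal_def add_closed_def
  proof (intro conjI ballI)
    show "q \<subseteq> F.OK" unfolding q_def OK_basis[symmetric] using OK_basis by blast
    show "0 \<in> q" using mem[of 0 0] by simp
    fix x assume "x \<in> q"
    then obtain a b where x: "x = of_int a + of_int b * w" "int p dvd a + b * c" unfolding q_def by blast
    have "int p dvd (- a) + (- b) * c" using x(2) dvd_minus_iff[of "int p" "a + b * c"] by (simp add: algebra_simps)
    then show "- x \<in> q" using mem[of "- a" "- b"] x(1) by simp
    fix y assume "y \<in> q"
    then obtain a' b' where y: "y = of_int a' + of_int b' * w" "int p dvd a' + b' * c" unfolding q_def by blast
    have "int p dvd (a + a') + (b + b') * c" using dvd_add[OF x(2) y(2)] by (simp add: algebra_simps)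
    then show "x + y \<in> q" using mem[of "a + a'" "b + b'"] x(1) y(1) by (simp add: algebra_simps)
  next
    fix r x assume "r \<in> F.OK" "x \<in> q"
    then obtain a b a' b' where x: "x = of_int a + of_int b * w" "int p dvd a + b * c" "r = of_int a' + of_int b' * w"
      unfolding q_def OK_basis by blast
    have "r * x = of_int a' * of_int a + (of_int a' * of_int b + of_int b' * of_int a) * w + of_int b' * of_int b * (w * w)"
      unfolding x by (simp add: algebra_simps)
    then have rx: "r * x = of_int (a' * a + b' * b * k0) + of_int (a' * b + b' * a + b' * b) * w"
      unfolding w_square by (simp add: algebra_simps)
    \<comment> \<open>Substituting c for w is multiplicative up to a multiple of c^2 - c -
      k0.\<close>
    have "(a' * a + b' * b * k0) + (a' * b + b' * a + b' * b) * c = (a + b * c) * (a' + b' * c) - b * b' * (c * c - c - k0)"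
      by (simp add: algebra_simps)
    then have "int p dvd (a' * a + b' * b * k0) + (a' * b + b' * a + b' * b) * c" using x(2) root by simp
    then show "r * x \<in> q" unfolding rx by (rule mem)
  qed
  have "1 \<notin> q"
  proof
    assume "1 \<in> q"
    then obtain a b where ab: "1 = of_int a + of_int b * w" "int p dvd a + b * c" unfolding q_def by blast
    have "1 * cj 1 = of_int (a\<^sup>2 + a * b - k0 * b\<^sup>2)" unfolding ab(1) by (rule trace_norm_basis(2))
    then have "(of_int 1 :: complex) = of_int (a\<^sup>2 + a * b - k0 * b\<^sup>2)" by simp
    then have one: "1 = a\<^sup>2 + a * b - k0 * b\<^sup>2" by (simp only: of_int_eq_iff)
    have "a\<^sup>2 + a * b - k0 * b\<^sup>2 = (a + b * c) * (a + b * (1 - c)) + b * b * (c * c - c - k0)"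
      by (simp add: algebra_simps power2_eq_square)
    with one have "1 = (a + b * c) * (a + b * (1 - c)) + b * b * (c * c - c - k0)" by (rule trans)
    then have "int p dvd 1" using dvd_add[OF dvd_mult2[OF ab(2)] dvd_mult[OF root]] by metis
    then show False using prime_gt_1_nat[OF prime_p] by simp
  qed
  have pq: "of_nat p \<in> q" using mem[of "int p" 0] by simp
  then have q0: "q \<noteq> {0}" using prime_gt_0_nat[OF prime_p] by auto
  obtain m where m: "F.maximal m" "q \<subseteq> m" using F.maximal_ideal_exists[OF qI \<open>1 \<notin> q\<close> q0] by blast
  have "m \<noteq> {0}" using m(2) q0 F.integral_idealD(4)[OF qI] by blast
  then obtain P where P: "H.prime_id P" "P \<inter> F.OK = m" using lying_over[OF m(1)] by blast
  have "w - of_int c \<in> q" using mem[of "- c" 1] by simp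
  then have "above P" using P pq m(2) unfolding above_def by blast
  then show ?thesis by blast
qed

definition Pc :: "complex set" where "Pc = (SOME P. above P)"

lemma above_Pc: "above P \<longleftrightarrow> P = Pc"
  using someI_ex[OF contraction_ideal_eq] above_unique unfolding Pc_def by blast

text \<open>A prime of \<open>H\<close> above the contraction of \<open>Pc\<close> contains p and w
  - c, hence is \<open>Pc\<close> itself; this is the uniqueness that \<open>inert_prime\<close>
  asks for.\<close>

lemma Pc_extended: "{of_int a + of_int b * w | a b. int p dvd a + b * c} \<diamondop> H.OK = Pc"
proof -
  have ab: "above Pc" using above_Pc by blast
  have eq: "Pc \<inter> F.OK = {of_int a + of_int b * w | a b. int p dvd a + b * c}" by (rule contraction_eq[OF ab])
  have pc: "of_nat p \<in> Pc \<inter> F.OK" "w - of_int c \<in> Pc \<inter> F.OK"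
    using ab F.OK_diff[OF w_OK F.OK_of_int] by (auto simp: above_def)
  have "(Pc \<inter> F.OK) \<diamondop> H.OK = Pc"
  proof (rule inert_prime)
    show "H.prime_id Pc" using ab by (simp add: above_def)
    show "Pc \<inter> F.OK \<noteq> {0}"
    proof
      assume "Pc \<inter> F.OK = {0}"
      then have "of_nat p \<in> {0::complex}" using pc(1) by simp
      then show False using prime_gt_0_nat[OF prime_p] by simp
    qed
    show "P' = Pc" if "H.prime_id P'" "Pc \<inter> F.OK \<subseteq> P'" for P'
    proof -
      have "above P'" unfolding above_def using that(1) subsetD[OF that(2) pc(1)] subsetD[OF that(2) pc(2)] by simp
      then show ?thesis using above_Pc by simp
    qed
  qed (rule refl)
  then show ?thesis unfolding eq .
qed

end

section \<open>The Kronecker conditions expressed by quadratic congruences\<close>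

lemma kronecker_prime: "Factorial_Ring.prime p \<Longrightarrow> kronecker (int l) (int p) = kronecker_at_prime (int l) (int p)"
  using prime_gt_1_nat[of p] by (simp add: kronecker_def prime_factorization_prime prime_gt_0_nat)

text \<open>For odd p complete the square: four times the form is (2 a + b)^2 - l b^2, and b prime
  to p would make l a square modulo p. For p = 2 the symbol - 1 means l = 5 modulo 8, so k is odd,
  and a^2 + a b + b^2 has no nontrivial zero modulo 2.\<close>

lemma inert_form:
  assumes l: "l mod 4 = (1::nat)" and p: "Factorial_Ring.prime p" and kr: "kronecker (int l) (int p) = - 1"
    and dv: "int p dvd a * a + a * b - b * b * ((int l - 1) div 4)"
  shows "int p dvd a \<and> int p dvd b"
proof -
  define k where "k = (int l - 1) div 4"
  have lk: "int l = 4 * k + 1" using l unfolding k_def by presburger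
  have pp: "Factorial_Ring.prime (int p)" using p by simp
  show ?thesis
  proof (cases "p = 2")
    case True
    then have "int l mod 8 \<noteq> 1" using kr kronecker_prime[OF p, of l] by (auto simp: kronecker_at_prime_def split: if_splits)
    then have "odd k" unfolding lk by presburger
    moreover have "even (a * a + a * b - b * b * k)" using dv True unfolding k_def[symmetric] by simp
    ultimately show ?thesis using True by (cases "even a"; cases "even b") simp_all
  next
    case False
    then have leg: "Legendre (int l) (int p) = - 1" using kr kronecker_prime[OF p, of l] by (simp add: kronecker_at_prime_def)
    then have nq: "\<not> QuadRes (int p) (int l)" by (auto simp: Legendre_def split: if_splits)
    have eq: "(2 * a + b)\<^sup>2 - int l * b\<^sup>2 = 4 * (a * a + a * b - b * b * k)" unfolding lk by (simp add: power2_eq_square algebra_simps)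
    have d1: "int p dvd (2 * a + b)\<^sup>2 - int l * b\<^sup>2" unfolding eq by (rule dvd_mult[OF dv[folded k_def]])
    have pb: "int p dvd b"
    proof (rule ccontr)
      assume "\<not> int p dvd b"
      then have "coprime b (int p)" using pp by (metis coprime_commute prime_imp_coprime)
      then obtain u v where uv: "u * b + v * int p = 1" using bezout_int[of b "int p"] by auto
      define y where "y = u * (2 * a + b)"
      have "u * b = 1 - v * int p" using uv by simp
      have "y\<^sup>2 - int l = u\<^sup>2 * ((2 * a + b)\<^sup>2 - int l * b\<^sup>2) + int l * ((u * b)\<^sup>2 - 1)"
        by (simp add: y_def power2_eq_square algebra_simps)
      also have "(u * b)\<^sup>2 - 1 = int p * (v * v * int p - 2 * v)" unfolding \<open>u * b = _\<close> by (simp add: power2_eq_square algebra_simps)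
      finally have "int p dvd y\<^sup>2 - int l" using dvd_add[OF dvd_mult[OF d1] dvd_mult[OF dvd_triv_left]] by metis
      then have "[y\<^sup>2 = int l] (mod int p)" by (simp add: cong_iff_dvd_diff)
      then show False using nq by (auto simp: QuadRes_def)
    qed
    then obtain b' where b': "b = int p * b'" by blast
    have "int p dvd a * a + b * (a - b * k)" using dv unfolding k_def[symmetric] by (simp add: algebra_simps)
    then have "int p dvd a * a" using pb by (simp add: dvd_add_left_iff)
    then show ?thesis using pp pb by (simp add: prime_dvd_mult_iff)
  qed
qed

lemma kronecker_not_dvd:
  assumes "l mod 4 = (1::nat)" "Factorial_Ring.prime p" "kronecker (int l) (int p) = - 1"
  shows "\<not> int p dvd int l"
proof
  assume dv: "int p dvd int l"
  show False
  proof (cases "p = 2")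
    case True
    then show False using dv assms(1) by presburger
  next
    case False
    then have "Legendre (int l) (int p) = - 1" using assms(3) kronecker_prime[OF assms(2), of l] by (simp add: kronecker_at_prime_def)
    moreover have "[int l = 0] (mod int p)" using dv by (simp add: cong_0_iff)
    ultimately show False by (simp add: Legendre_def)
  qed
qed

context unramified_extension
begin

lemma l1_mod: "l1 mod 4 = 1" and l2_mod: "l2 mod 4 = 1"
  using mod1 mod2 by (simp_all add: unique_euclidean_semiring_class.cong_def)

text \<open>The discriminant of X^2 - X - k0 is d. For odd p Euler's criterion turns the two symbols
  - 1 into the symbol 1 for the product d. For p = 2 both primes are 5 modulo 8, hence d = 1 modulo
  8, and k0 is even.\<close>

lemma split_root:
  assumes p: "Factorial_Ring.prime (p::nat)" and k1: "kronecker (int l1) (int p) = - 1" and k2: "kronecker (int l2) (int p) = - 1"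
  shows "\<exists>c. int p dvd c * c - c - k0"
proof (cases "p = 2")
  case True
  have "int l1 mod 8 \<noteq> 1" "int l2 mod 8 \<noteq> 1"
    using k1 k2 kronecker_prime[OF p] True by (auto simp: kronecker_at_prime_def split: if_splits)
  then have "int l1 mod 8 = 5" "int l2 mod 8 = 5" using l1_mod l2_mod by presburger+
  then have "d mod 8 = (5 * 5) mod 8" unfolding d_def of_nat_mult by (metis mod_mult_eq)
  then have "even k0" using d_k0 by presburger
  then show ?thesis using True by (intro exI[of _ 0]) simp
next
  case False
  then have p2: "2 < p" using prime_ge_2_nat[OF p] by simp
  have leg: "Legendre (int l1) (int p) = - 1" "Legendre (int l2) (int p) = - 1"
    using k1 k2 kronecker_prime[OF p] False by (simp_all add: kronecker_at_prime_def)
  let ?e = "(p - 1) div 2"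
  have "[(int l1) ^ ?e * (int l2) ^ ?e = (- 1) * (- 1)] (mod int p)"
    using euler_criterion[OF p p2, of "int l1"] euler_criterion[OF p p2, of "int l2"] leg
    by (intro cong_mult) (simp_all add: cong_sym)
  then have "[d ^ ?e = 1] (mod int p)" by (simp add: d_def power_mult_distrib)
  moreover have "[Legendre d (int p) = d ^ ?e] (mod int p)" by (rule euler_criterion[OF p p2])
  ultimately have L: "[Legendre d (int p) = 1] (mod int p)" using cong_trans by blast
  have "QuadRes (int p) d"
  proof (rule ccontr)
    assume "\<not> QuadRes (int p) d"
    then have "Legendre d (int p) = 0 \<or> Legendre d (int p) = - 1" by (simp add: Legendre_def)
    then have "int p dvd 1 \<or> int p dvd 2" using L by (auto simp: cong_iff_dvd_diff)
    then show False using p2 zdvd_imp_le[of "int p" 2] zdvd_imp_le[of "int p" 1] by auto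
  qed
  then obtain y where y: "[y\<^sup>2 = d] (mod int p)" by (auto simp: QuadRes_def)
  have "odd p" using p p2 prime_odd_nat by blast
  then have "odd (int p)" by simp
  \<comment> \<open>Adding the odd number p if necessary makes the square root of d odd, hence of
    the form 2 c - 1.\<close>
  define t where "t = (if odd y then y else y + int p)"
  have "odd t" using \<open>odd (int p)\<close> by (simp add: t_def)
  then have "even (t + 1)" by simp
  then obtain c where "t + 1 = 2 * c" by (rule evenE)
  then have c: "t = 2 * c - 1" by simp
  have "int p dvd y\<^sup>2 - d" using y by (simp add: cong_iff_dvd_diff)
  moreover have "t\<^sup>2 - d = (y\<^sup>2 - d) + int p * (if odd y then 0 else 2 * y + int p)"
    by (simp add: t_def power2_eq_square algebra_simps)
  ultimately have "int p dvd t\<^sup>2 - d" using dvd_add[OF _ dvd_triv_left] by metis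
  moreover have "t\<^sup>2 - d = 4 * (c * c - c - k0)" unfolding c by (subst d_k0) (simp add: power2_eq_square algebra_simps)
  ultimately have "int p dvd 4 * (c * c - c - k0)" by metis
  moreover have "coprime (int p) (2 ^ 2)" using \<open>odd (int p)\<close> coprime_right_2_iff_odd coprime_power_right_iff by blast
  then have "coprime (int p) 4" by simp
  ultimately show ?thesis using coprime_dvd_mult_right_iff by blast
qed

text \<open>The roots c and 1 - c give two ideals of O_F with product p O_F. Each of them extends to
  the unique prime of \<open>H\<close> above it, and extension of ideals is multiplicative.\<close>

theorem splits_into_two:
  assumes p: "Factorial_Ring.prime (p::nat)" and k1: "kronecker (int l1) (int p) = - 1" and k2: "kronecker (int l2) (int p) = - 1"
  shows "splits_into_exactly H p 2"
proof -
  obtain c where c: "int p dvd c * c - c - k0" using split_root[OF assms] by blast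
  have nd: "\<not> int p dvd d"
    using kronecker_not_dvd[OF l1_mod p k1] kronecker_not_dvd[OF l2_mod p k2] p by (simp add: d_def prime_dvd_mult_iff)
  have pp: "Factorial_Ring.prime (int p)" using p by simp
  \<comment> \<open>This is the difference of the two roots; its square is congruent to d, so the
    roots are distinct modulo p.\<close>
  have sep: "\<not> int p dvd 2 * c - 1"
  proof
    assume "int p dvd 2 * c - 1"
    then have "int p dvd (2 * c - 1) * (2 * c - 1) - 4 * (c * c - c - k0)"
      using dvd_diff[OF dvd_mult2 dvd_mult[OF c]] by blast
    also have "(2 * c - 1) * (2 * c - 1) - 4 * (c * c - c - k0) = d" by (subst d_k0) (simp add: algebra_simps)
    finally show False using nd by simp
  qed
  interpret C: split_prime l1 l2 H p c
  proof unfold_locales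
    show "Factorial_Ring.prime p" by (rule p)
    show "int p dvd c * c - c - k0" by (rule c)
    show "\<not> int p dvd int l1" by (rule kronecker_not_dvd[OF l1_mod p k1])
    show "int p dvd a \<and> int p dvd b" if "int p dvd a * a + a * b - b * b * ((int l1 - 1) div 4)" for a b
      by (rule inert_form[OF l1_mod p k1 that])
  qed
  have c': "int p dvd (1 - c) * (1 - c) - (1 - c) - k0" using c by (simp add: algebra_simps)
  interpret C': split_prime l1 l2 H p "1 - c"
  proof unfold_locales
    show "Factorial_Ring.prime p" by (rule p)
    show "int p dvd (1 - c) * (1 - c) - (1 - c) - k0" by (rule c')
    show "\<not> int p dvd int l1" by (rule kronecker_not_dvd[OF l1_mod p k1])
    show "int p dvd a \<and> int p dvd b" if "int p dvd a * a + a * b - b * b * ((int l1 - 1) div 4)" for a b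
      by (rule inert_form[OF l1_mod p k1 that])
  qed
  define q1 where "q1 = {of_int a + of_int b * w | a b. int p dvd a + b * c}"
  define q2 where "q2 = {of_int a + of_int b * w | a b. int p dvd a + b * (1 - c)}"
  have prod_w: "(w - of_int c) * (w - of_int (1 - c)) = - of_int (c * c - c - k0)"
  proof -
    have "(w - of_int c) * (w - of_int (1 - c)) = w * w - w + of_int c * (1 - of_int c)" by (simp add: algebra_simps)
    then show ?thesis unfolding w_square by (simp add: algebra_simps)
  qed
  obtain e where e: "c * c - c - k0 = int p * e" using c by blast
  have primes: "primes_above H p = {C.Pc, C'.Pc}"
  proof
    have "C.above C.Pc" "C'.above C'.Pc" using C.above_Pc C'.above_Pc by blast+
    then show "{C.Pc, C'.Pc} \<subseteq> primes_above H p"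
      unfolding primes_above_def H.finite_primes_iff[symmetric] C.above_def C'.above_def by (simp add: H.finite_primes_iff)
    show "primes_above H p \<subseteq> {C.Pc, C'.Pc}"
    proof
      fix P assume "P \<in> primes_above H p"
      then have P: "H.prime_id P" "of_nat p \<in> P" by (auto simp: primes_above_def H.finite_primes_iff)
      have PI: "H.integral_ideal P" using P by (simp add: H.prime_id_def)
      have "(w - of_int c) * (w - of_int (1 - c)) = of_int (- e) * of_nat p" unfolding prod_w e by simp
      then have "(w - of_int c) * (w - of_int (1 - c)) \<in> P" using H.integral_idealD(3)[OF PI H.OK_of_int P(2)] by metis
      moreover have "w \<in> H.OK" using w_OK OK_F_H by blast
      then have "w - of_int c \<in> H.OK" "w - of_int (1 - c) \<in> H.OK" using H.OK_diff H.OK_of_int by blast+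
      ultimately have "w - of_int c \<in> P \<or> w - of_int (1 - c) \<in> P" using P(1) by (auto simp: H.prime_id_def)
      then have "C.above P \<or> C'.above P" using P by (simp add: C.above_def C'.above_def)
      then show "P \<in> {C.Pc, C'.Pc}" using C.above_Pc C'.above_Pc by blast
    qed
  qed
  have distinct: "C.Pc \<noteq> C'.Pc"
  proof
    assume eq: "C.Pc = C'.Pc"
    have ab: "C.above C.Pc" "C'.above C.Pc" using C.above_Pc C'.above_Pc eq by simp_all
    then have "w - of_int (1 - c) - (w - of_int c) \<in> C.Pc"
      unfolding C.above_def C'.above_def H.prime_id_def by (blast intro: H.integral_idealD(6))
    moreover have "w - of_int (1 - c) - (w - of_int c) = of_int (2 * c - 1)" by simp
    ultimately have "of_int (2 * c - 1) \<in> C.Pc" by (simp only:)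
    then have "int p dvd 2 * c - 1" unfolding C.of_int_above[OF ab(1)] .
    then show False using sep by blast
  qed
  have qq: "q1 \<diamondop> q2 = scale (of_nat p) F.OK"
  proof
    show "q1 \<diamondop> q2 \<subseteq> scale (of_nat p) F.OK"
    proof (rule set_prod_least)
      fix i j assume "i \<in> q1" "j \<in> q2"
      then obtain a b a' b' where i: "i = of_int a + of_int b * w" "int p dvd a + b * c"
        and j: "j = of_int a' + of_int b' * w" "int p dvd a' + b' * (1 - c)" unfolding q1_def q2_def by blast
      obtain m where m: "a + b * c = int p * m" using i(2) by blast
      obtain n where n: "a' + b' * (1 - c) = int p * n" using j(2) by blast
      \<comment> \<open>Each factor is a multiple of p plus a multiple of w - c or of w - (1 - c),
        and the product of these two elements is divisible by p because c is a root.\<close>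
      have "i = of_int (a + b * c) + of_int b * (w - of_int c)" unfolding i(1) by (simp add: algebra_simps)
      then have i': "i = of_nat p * of_int m + of_int b * (w - of_int c)" unfolding m by simp
      have "j = of_int (a' + b' * (1 - c)) + of_int b' * (w - of_int (1 - c))" unfolding j(1) by (simp add: algebra_simps)
      then have j': "j = of_nat p * of_int n + of_int b' * (w - of_int (1 - c))" unfolding n by simp
      have expand: "(x1 * m1 + b1 * y1) * j = x1 * (m1 * j) + b1 * (y1 * j)" for x1 m1 b1 y1 :: complex
        by (simp add: algebra_simps)
      have "(w - of_int c) * j = of_nat p * (of_int n * (w - of_int c)) + of_int b' * ((w - of_int c) * (w - of_int (1 - c)))"
        unfolding j' by (simp add: algebra_simps)
      also have "\<dots> = of_nat p * (of_int n * (w - of_int c) - of_int b' * of_int e)" unfolding prod_w e by (simp add: algebra_simps)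
      finally have wj: "(w - of_int c) * j = of_nat p * (of_int n * (w - of_int c) - of_int b' * of_int e)" .
      have "i * j = of_nat p * (of_int m * j) + of_int b * ((w - of_int c) * j)" unfolding i' by (rule expand)
      also have "\<dots> = of_nat p * (of_int m * j + of_int b * (of_int n * (w - of_int c) - of_int b' * of_int e))"
        unfolding wj by (simp add: algebra_simps)
      finally have ij: "i * j = of_nat p * (of_int m * j + of_int b * (of_int n * (w - of_int c) - of_int b' * of_int e))" .
      have jO: "j \<in> F.OK" unfolding j(1) OK_basis by blast
      have "of_int m * j + of_int b * (of_int n * (w - of_int c) - of_int b' * of_int e) \<in> F.OK"
        by (intro F.OK_add F.OK_mult F.OK_diff F.OK_of_int jO w_OK)
      then show "i * j \<in> scale (of_nat p) F.OK" unfolding ij by (rule imageI)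
    qed (auto simp: distrib_left[symmetric] intro!: imageI F.OK_add)
    have p1: "of_nat p \<in> q1" "of_nat p \<in> q2" unfolding q1_def q2_def
      by (rule CollectI, rule exI[of _ "int p"], rule exI[of _ 0], simp)+
    have w1: "w - of_int c \<in> q1" unfolding q1_def
      by (rule CollectI, rule exI[of _ "- c"], rule exI[of _ 1]) simp
    have w2: "w - of_int (1 - c) \<in> q2" unfolding q2_def
      by (rule CollectI, rule exI[of _ "- (1 - c)"], rule exI[of _ 1]) simp
    \<comment> \<open>The product of the ideals contains p^2 and the difference p (2 c - 1) of p (w
      - (1 - c)) and p (w - c); a Bezout combination of them is p.\<close>
    have "coprime (2 * c - 1) (int p)" using sep pp by (metis coprime_commute prime_imp_coprime)
    then obtain u v where uv: "u * (2 * c - 1) + v * int p = 1" using bezout_int[of "2 * c - 1" "int p"] by auto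
    have q1mul: "r * x \<in> q1" if "r \<in> F.OK" "x \<in> q1" for r x
    proof -
      have "q1 = C.Pc \<inter> F.OK" unfolding q1_def using C.contraction_eq C.above_Pc by blast
      moreover have "F.integral_ideal (C.Pc \<inter> F.OK)"
        using contraction_ideal C.above_Pc unfolding C.above_def H.prime_id_def by blast
      ultimately show ?thesis using F.integral_idealD(3)[of q1 r x] that by simp
    qed
    show "scale (of_nat p) F.OK \<subseteq> q1 \<diamondop> q2"
    proof
      fix x assume "x \<in> scale (of_nat p) F.OK"
      then obtain y where y: "y \<in> F.OK" "x = of_nat p * y" by blast
      have m1: "(of_int (- u) * y) * (w - of_int c) \<in> q1" "(of_int u * y) * of_nat p \<in> q1" "(of_int v * y) * of_nat p \<in> q1"
        by (rule q1mul; intro F.OK_mult F.OK_of_int y(1) w1 p1)+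
      have "((of_int (- u) * y) * (w - of_int c)) * of_nat p + ((of_int u * y) * of_nat p) * (w - of_int (1 - c))
         + ((of_int v * y) * of_nat p) * of_nat p \<in> q1 \<diamondop> q2"
        by (intro set_prod_add set_prod_mult m1 p1(2) w2)
      also have "((of_int (- u) * y) * (w - of_int c)) * of_nat p + ((of_int u * y) * of_nat p) * (w - of_int (1 - c))
         + ((of_int v * y) * of_nat p) * of_nat p = of_nat p * y * of_int (u * (2 * c - 1) + v * int p)"
        by (simp add: algebra_simps)
      finally show "x \<in> q1 \<diamondop> q2" unfolding uv y(2) by simp
    qed
  qed
  have "C.Pc \<diamondop> C'.Pc = (q1 \<diamondop> H.OK) \<diamondop> (q2 \<diamondop> H.OK)" unfolding q1_def q2_def C.Pc_extended C'.Pc_extended ..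
  also have "\<dots> = (q1 \<diamondop> q2) \<diamondop> (H.OK \<diamondop> H.OK)" by (metis set_prod_assoc set_prod_commute)
  also have "\<dots> = scale (of_nat p) (F.OK \<diamondop> H.OK)" unfolding qq H.frac_prod_OK(1)[OF H.frac_OK] set_prod_scale ..
  also have "F.OK \<diamondop> H.OK = H.OK"
  proof
    show "F.OK \<diamondop> H.OK \<subseteq> H.OK" by (rule set_prod_least) (use OK_F_H in \<open>auto intro: H.OK_mult H.OK_add\<close>)
    show "H.OK \<subseteq> F.OK \<diamondop> H.OK" using set_prod_mult[OF F.OK_1] by force
  qed
  finally have prod: "C.Pc \<diamondop> C'.Pc = scale (of_nat p) H.OK" .
  interpret R: cring H.R by (rule H.cring_R)
  interpret M: Group.comm_monoid "ideals_set H.R" by (rule R.ideals_set_is_comm_monoid)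
  have Pi: "H.integral_ideal C.Pc" "H.integral_ideal C'.Pc"
    using C.above_Pc C'.above_Pc unfolding C.above_def C'.above_def H.prime_id_def by blast+
  then have carr: "C.Pc \<in> carrier (ideals_set H.R)" "C'.Pc \<in> carrier (ideals_set H.R)"
    by (simp_all add: ideals_set_def H.ideal_R_iff)
  have "finprod (ideals_set H.R) (\<lambda>P. P) {C.Pc, C'.Pc} = C.Pc \<otimes>\<^bsub>ideals_set H.R\<^esub> C'.Pc"
    using carr distinct by (subst M.finprod_insert) (auto simp: M.finprod_insert)
  also have "\<dots> = C.Pc \<diamondop> C'.Pc" by (simp add: ideals_set_def H.ideal_prod_R)
  also have "\<dots> = cgenideal H.R (of_nat p)"
    unfolding prod cgenideal_def H.R_simps H.carrier_ring_of_integers by (auto simp: mult.commute)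
  finally show ?thesis unfolding splits_into_exactly_def primes using distinct by simp
qed

end

section \<open>The class group of \<open>F\<close>\<close>

context quadratic
begin

subsection \<open>Finiteness\<close>

lemma norm_Ints: "x \<in> F.OK \<Longrightarrow> \<exists>n::int. x * cj x = of_int n"
  unfolding OK_iff by (auto elim: Ints_cases)

lemma Re_F: "x \<in> F \<Longrightarrow> x = of_real (Re x)"
proof -
  have of_rat_real: "(of_rat r :: complex) \<in> \<real>" for r
    by (cases r) (auto simp: of_rat_rat intro!: Reals_divide)
  assume "x \<in> F"
  then obtain u v where "x = of_rat u + of_rat v * s" unfolding F_eq by blast
  then have "x \<in> \<real>" using of_rat_real[of u] of_rat_real[of v] s_real by simp
  then show ?thesis by simp
qed

text \<open>Hurwitz's substitute for Euclidean division. Dirichlet's theorem approximates the two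
  coordinates of a with respect to 1 and w simultaneously, with a denominator t \<le> N^2, a bound
  independent of a. Since N exceeds 1 + |w| and 1 + |1 - w|, coordinate errors below 1 / N keep the
  remainder and its conjugate below 1 in absolute value.\<close>

lemma norm_approximation: "\<exists>M::nat. \<forall>a\<in>F. \<exists>t\<in>{1..M}. \<exists>z\<in>F.OK. cmod ((of_nat t * a - z) * cj (of_nat t * a - z)) < 1"
proof -
  obtain N :: nat where N: "real N > 1 + cmod w + cmod (1 - w)" using reals_Archimedean2 by blast
  then have N0: "N > 0" using norm_ge_zero[of w] norm_ge_zero[of "1 - w"] by (metis add_increasing2 gr0I less_le_not_le of_nat_0 zero_le_one)
  have "\<exists>t\<in>{1..N\<^sup>2}. \<exists>z\<in>F.OK. cmod ((of_nat t * a - z) * cj (of_nat t * a - z)) < 1" if aF: "a \<in> F" for a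
  proof -
    obtain u v where "a = of_rat u + of_rat v * s" using aF unfolding F_eq by blast
    then have a: "a = of_rat (u - v) + of_rat (2 * v) * w" by (simp add: w_def of_rat_diff of_rat_mult field_simps)
    define \<theta> where "\<theta> = (\<lambda>i::nat. if i = 0 then real_of_rat (u - v) else real_of_rat (2 * v))"
    obtain q p where qp: "0 < q" "q \<le> int (N ^ 2)" "\<And>i. i < 2 \<Longrightarrow> \<bar>of_int q * \<theta> i - of_int (p i)\<bar> < 1 / N"
      using Dirichlet_approx_simult[of N 2 \<theta>] N0 by blast
    define t where "t = nat q"
    have qt: "q = int t" using qp(1) by (simp add: t_def)
    have "int t \<le> int (N ^ 2)" using qp(2) unfolding qt .
    then have "t \<le> N\<^sup>2" by (simp only: of_nat_le_iff)
    then have t: "t \<in> {1..N\<^sup>2}" "of_int q = (of_nat t :: real)" using qp(1) qt by auto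
    define z where "z = of_int (p 0) + of_int (p 1) * w"
    have zO: "z \<in> F.OK" unfolding z_def OK_basis by blast
    define e0 where "e0 = of_nat t * (u - v) - of_int (p 0)"
    define e1 where "e1 = of_nat t * (2 * v) - of_int (p 1)"
    have real_e: "real_of_rat e0 = of_int q * \<theta> 0 - of_int (p 0)" "real_of_rat e1 = of_int q * \<theta> 1 - of_int (p 1)"
      by (simp_all add: e0_def e1_def \<theta>_def t(2) of_rat_diff of_rat_mult)
    have small: "\<bar>real_of_rat e0\<bar> < 1 / N" "\<bar>real_of_rat e1\<bar> < 1 / N" unfolding real_e using qp(3)[of 0] qp(3)[of 1] by simp_all
    have cr: "cmod (of_rat e) = \<bar>real_of_rat e\<bar>" for e
    proof -
      have "(of_rat e :: complex) = of_real (of_rat e)" by (cases e) (simp add: of_rat_rat)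
      then show ?thesis by simp
    qed
    have x: "of_nat t * a - z = of_rat e0 + of_rat e1 * w"
      unfolding a z_def e0_def e1_def by (simp add: of_rat_add of_rat_diff of_rat_mult algebra_simps)
    have cx: "cj (of_nat t * a - z) = of_rat e0 + of_rat e1 * (1 - w)"
      unfolding x using cj_add[OF F.of_rat_mem F.mult_mem[OF F.of_rat_mem w_in_F]] cj_mult[OF F.of_rat_mem w_in_F] by (simp add: cj_w)
    have bound: "cmod (of_rat e0 + of_rat e1 * y) < 1" if y: "1 + cmod y \<le> real N" for y
    proof -
      have "cmod (of_rat e0 + of_rat e1 * y) \<le> \<bar>real_of_rat e0\<bar> + \<bar>real_of_rat e1\<bar> * cmod y"
        using norm_triangle_ineq[of "of_rat e0" "of_rat e1 * y"] by (simp add: norm_mult cr)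
      also have "\<dots> < 1 / N + 1 / N * cmod y"
        using small by (intro add_less_le_mono mult_right_mono) auto
      also have "\<dots> = (1 + cmod y) / N" by (simp add: add_divide_distrib)
      also have "\<dots> \<le> 1" using y N0 by (simp add: divide_le_eq)
      finally show ?thesis .
    qed
    have "cmod (of_nat t * a - z) < 1" unfolding x by (rule bound) (use N norm_ge_zero[of "1 - w"] in linarith)
    moreover have "cmod (cj (of_nat t * a - z)) < 1" unfolding cx by (rule bound) (use N norm_ge_zero[of w] in linarith)
    ultimately have "cmod (of_nat t * a - z) * cmod (cj (of_nat t * a - z)) < 1 * 1"
      by (intro mult_strict_mono') auto
    then show ?thesis using t(1) zO by (intro bexI[of _ t] bexI[of _ z]) (auto simp: norm_mult)
  qed
  then show ?thesis by blast
qed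

text \<open>Let \<beta> have the smallest absolute norm among the nonzero elements of I. For
  \<alpha> in I, some t \<le> M makes t \<alpha> - z \<beta> of smaller norm, hence zero, so M!
  \<alpha> / \<beta> is integral. Thus M! / \<beta> scales I to an ideal of O_F that contains M!,
  and there are finitely many of these.\<close>

lemma finitely_many_classes:
  "\<exists>C. finite C \<and> (\<forall>I. F.frac I \<longrightarrow> (\<exists>x\<in>F. x \<noteq> 0 \<and> (\<exists>J\<in>C. F.frac J \<and> I = scale x J)))"
proof -
  obtain M :: nat where M: "\<forall>a\<in>F. \<exists>t\<in>{1..M}. \<exists>z\<in>F.OK. cmod ((of_nat t * a - z) * cj (of_nat t * a - z)) < 1"
    using norm_approximation by blast
  define C where "C = {J. F.integral_ideal J \<and> of_nat (fact M) \<in> J}"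
  have "finite C" unfolding C_def by (rule F.finite_ideals_above) simp
  moreover have "\<exists>x\<in>F. x \<noteq> 0 \<and> (\<exists>J\<in>C. F.frac J \<and> I = scale x J)" if I0: "F.frac I0" and "I = I0" for I I0
  proof -
    obtain m where m: "m > (0::nat)" "\<forall>x\<in>I. of_nat m * x \<in> F.OK" using F.fracD(7)[OF I0] \<open>I = I0\<close> by blast
    have I: "F.frac I" using that by simp
    note ID = F.fracD[OF I]
    \<comment> \<open>Scaling by the denominator \<open>m\<close> turns absolute norms into natural
      numbers, among which a smallest one exists.\<close>
    define S where "S = {n::nat. \<exists>x\<in>I. x \<noteq> 0 \<and> cmod ((of_nat m * x) * cj (of_nat m * x)) = of_nat n}"
    have nat_norm: "\<exists>n::nat. cmod (y * cj y) = of_nat n" if y: "y \<in> F.OK" for y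
    proof -
      obtain k :: int where "y * cj y = of_int k" using norm_Ints[OF y] by blast
      then have "cmod (y * cj y) = of_nat (nat \<bar>k\<bar>)" by simp
      then show ?thesis by blast
    qed
    have inS: "\<exists>n\<in>S. cmod ((of_nat m * x) * cj (of_nat m * x)) = of_nat n" if "x \<in> I" "x \<noteq> 0" for x
      using nat_norm[of "of_nat m * x"] m(2) that unfolding S_def by blast
    obtain x1 where "x1 \<in> I" "x1 \<noteq> 0" using ID(4) by blast
    then have "\<exists>n. n \<in> S" using inS by blast
    then have "(LEAST n. n \<in> S) \<in> S" by (rule LeastI_ex)
    then obtain \<beta> where \<beta>: "\<beta> \<in> I" "\<beta> \<noteq> 0" "cmod ((of_nat m * \<beta>) * cj (of_nat m * \<beta>)) = of_nat (LEAST n. n \<in> S)"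
      unfolding S_def by blast
    have \<beta>F: "\<beta> \<in> F" using ID(1)[OF \<beta>(1)] .
    have min: "cmod (\<beta> * cj \<beta>) \<le> cmod (x * cj x)" if x: "x \<in> I" "x \<noteq> 0" for x
    proof -
      obtain n where n: "n \<in> S" "cmod ((of_nat m * x) * cj (of_nat m * x)) = of_nat n" using inS[OF x] by blast
      have "(LEAST n. n \<in> S) \<le> n" using n(1) by (rule Least_le)
      then have "cmod ((of_nat m * \<beta>) * cj (of_nat m * \<beta>)) \<le> cmod ((of_nat m * x) * cj (of_nat m * x))" unfolding \<beta>(3) n(2) by simp
      then have "real m * real m * cmod (\<beta> * cj \<beta>) \<le> real m * real m * cmod (x * cj x)"
        using cj_mult[OF F.of_nat_mem \<beta>F] cj_mult[OF F.of_nat_mem ID(1)[OF x(1)]] by (simp add: norm_mult mult_ac)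
      then show ?thesis using m(1) by (simp add: mult_le_cancel_left)
    qed
    have key: "of_nat (fact M) * \<alpha> / \<beta> \<in> F.OK" if \<alpha>: "\<alpha> \<in> I" for \<alpha>
    proof -
      have \<alpha>F: "\<alpha> \<in> F" using ID(1)[OF \<alpha>] .
      have "\<alpha> / \<beta> \<in> F" by (rule F.divide_mem[OF \<alpha>F \<beta>F])
      then obtain t z where tz: "t \<in> {1..M}" "z \<in> F.OK" "cmod ((of_nat t * (\<alpha> / \<beta>) - z) * cj (of_nat t * (\<alpha> / \<beta>) - z)) < 1"
        using M by blast
      define y where "y = of_nat t * (\<alpha> / \<beta>) - z"
      have yF: "y \<in> F" unfolding y_def using F.diff_mem[OF F.mult_mem[OF F.of_nat_mem \<open>\<alpha> / \<beta> \<in> F\<close>] F.OK_mem[OF tz(2)]] .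
      define x where "x = of_nat t * \<alpha> - z * \<beta>"
      have xy: "x = y * \<beta>" using \<beta>(2) by (simp add: x_def y_def field_simps)
      have xI: "x \<in> I" unfolding x_def by (intro ID(9) ID(3) F.OK_of_nat \<alpha> \<beta>(1) tz(2))
      have "x = 0"
      proof (rule ccontr)
        assume "x \<noteq> 0"
        then have "cmod (\<beta> * cj \<beta>) \<le> cmod (x * cj x)" by (rule min[OF xI])
        also have "x * cj x = (y * cj y) * (\<beta> * cj \<beta>)" unfolding xy cj_mult[OF yF \<beta>F] by simp
        finally have "cmod (\<beta> * cj \<beta>) \<le> cmod (y * cj y) * cmod (\<beta> * cj \<beta>)" by (simp only: norm_mult)
        moreover have "cmod (\<beta> * cj \<beta>) > 0" using \<beta>(2) \<beta>F by simp
        ultimately have "1 \<le> cmod (y * cj y)" by (metis mult_le_cancel_right1 not_less)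
        then show False using tz(3) unfolding y_def by simp
      qed
      then have tz2: "of_nat t * \<alpha> / \<beta> = z" using \<beta>(2) by (simp add: x_def field_simps)
      have "t dvd fact M" using tz(1) by (intro dvd_fact) auto
      then obtain r where r: "fact M = t * r" by blast
      have "of_nat (fact M) * \<alpha> / \<beta> = of_nat r * (of_nat t * \<alpha> / \<beta>)" unfolding r by simp
      then show ?thesis unfolding tz2 using F.OK_mult[OF F.OK_of_nat tz(2)] by simp
    qed
    define x where "x = \<beta> / of_nat (fact M)"
    have x: "x \<in> F" "x \<noteq> 0" unfolding x_def by (rule F.divide_mem[OF \<beta>F F.of_nat_mem]) (use \<beta>(2) in simp)
    define J where "J = scale (inverse x) I"
    have J: "F.frac J" unfolding J_def using F.frac_scale[OF I F.inverse_mem[OF x(1)]] x(2) by simp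
    have inv_x: "inverse x * \<alpha> = of_nat (fact M) * \<alpha> / \<beta>" for \<alpha> by (simp add: x_def)
    have "J \<subseteq> F.OK" unfolding J_def inv_x using key by blast
    then have "F.integral_ideal J" by (rule F.frac_imp_integral_ideal[OF J])
    moreover have "inverse x * \<beta> \<in> J" unfolding J_def using \<beta>(1) by blast
    then have "of_nat (fact M) \<in> J" using \<beta>(2) by (simp add: x_def)
    ultimately have "J \<in> C" by (simp add: C_def)
    moreover have "I = scale x J" unfolding J_def scale_scale using x(2) by simp
    ultimately show ?thesis using x J by blast
  qed
  ultimately show ?thesis by blast
qed

subsection \<open>Units\<close>

definition unit :: "complex \<Rightarrow> bool"
  where "unit u \<longleftrightarrow> u \<noteq> 0 \<and> u \<in> F.OK \<and> inverse u \<in> F.OK"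

lemma unit_mult: "unit u \<Longrightarrow> unit v \<Longrightarrow> unit (u * v)"
  by (simp add: unit_def F.OK_mult)

lemma unit_inverse: "unit u \<Longrightarrow> unit (inverse u)"
  by (simp add: unit_def)

lemma unit_minus: "unit u \<Longrightarrow> unit (- u)"
  by (simp add: unit_def F.OK_minus)

lemma unit_1: "unit 1"
  by (simp add: unit_def)

lemma unit_power: "unit u \<Longrightarrow> unit (u ^ n)"
  by (induction n) (auto intro: unit_1 unit_mult)

lemma unit_F: "unit u \<Longrightarrow> u \<in> F"
  using F.OK_mem by (auto simp: unit_def)

lemma unit_scale: "unit u \<Longrightarrow> scale u F.OK = F.OK"
  using F.scale_OK_eqI[of u 1] by (auto simp: unit_def divide_inverse)

lemma unit_iff_scale: "x \<in> F \<Longrightarrow> y \<in> F \<Longrightarrow> x \<noteq> 0 \<Longrightarrow> y \<noteq> 0 \<Longrightarrow> scale x F.OK = scale y F.OK \<Longrightarrow> unit (x / y)"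
  using F.scale_OK_eq[of x y] F.scale_OK_eq[of y x] by (simp add: unit_def)

lemma unit_norm: "unit u \<Longrightarrow> u * cj u = 1 \<or> u * cj u = - 1"
proof -
  assume u: "unit u"
  obtain a b :: int where ab: "u * cj u = of_int a" "inverse u * cj (inverse u) = of_int b"
    using norm_Ints u unfolding unit_def by blast
  have "cj u * cj (inverse u) = 1" using cj_mult[OF unit_F[OF u] unit_F[OF unit_inverse[OF u]]] u by (simp add: unit_def)
  then have "(u * cj u) * (inverse u * cj (inverse u)) = 1" using u by (simp add: unit_def field_simps)
  then have "(of_int (a * b) :: complex) = of_int 1" unfolding ab by simp
  then have "a * b = 1" by (simp only: of_int_eq_iff)
  then have "a = 1 \<or> a = -1" using zmult_eq_1_iff by blast
  then show ?thesis using ab(1) by auto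
qed

text \<open>\<open>F\<close> consists of real numbers, so \<open>Re\<close> is its inclusion into
  \<real>; it supplies the order by which units are compared.\<close>

lemma Re_mult_F: "x \<in> F \<Longrightarrow> Re (x * y) = Re x * Re y"
  by (subst Re_F) auto

lemma Re_power_F: "x \<in> F \<Longrightarrow> Re (x ^ n) = Re x ^ n"
  by (induction n) (simp_all only: power_0 power_Suc one_complex.sel Re_mult_F)

lemma Re_inverse_F: "x \<in> F \<Longrightarrow> Re (inverse x) = inverse (Re x)"
  using Re_complex_of_real[of "inverse (Re x)"] unfolding of_real_inverse by (metis Re_F)

lemma Re_eq_0: "x \<in> F \<Longrightarrow> Re x = 0 \<Longrightarrow> x = 0"
  using Re_F by force

lemma Re_inj: "x \<in> F \<Longrightarrow> y \<in> F \<Longrightarrow> Re x = Re y \<Longrightarrow> x = y"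
  using Re_F by metis

text \<open>Take x = q s - p with |x| < 1 / N and 0 < q \<le> N. The conjugate has absolute value at
  most |x| + 2 N \<surd>d, so the norm is at most |x|^2 + 2 |x| N \<surd>d \<le> 1 + 2 \<surd>d,
  independently of how small x is.\<close>

lemma small_elements:
  assumes "e > 0"
  shows "\<exists>x\<in>F.OK. x \<noteq> 0 \<and> cmod x < e \<and> cmod (x * cj x) \<le> 1 + 2 * sqrt (of_int d)"
proof -
  obtain N :: nat where N: "real N > 1 / e" using reals_Archimedean2 by blast
  have N0: "N > 0" using N assms by (metis gr0I less_divide_eq_1_pos not_less_iff_gr_or_eq of_nat_0 zero_less_divide_1_iff order_less_trans)
  obtain q and p :: "nat \<Rightarrow> int" where qp: "0 < q" "q \<le> int (N ^ 1)" "\<And>i. i < 1 \<Longrightarrow> \<bar>of_int q * sqrt (of_int d) - of_int (p i)\<bar> < 1 / N"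
    using Dirichlet_approx_simult[of N 1 "\<lambda>_. sqrt (of_int d)"] N0 by blast
  define r where "r = of_int q * sqrt (of_int d) - of_int (p 0)"
  have r: "\<bar>r\<bar> < 1 / N" using qp(3)[of 0] by (simp add: r_def)
  define x where "x = of_int q * s - of_int (p 0)"
  have xr: "x = of_real r" by (simp add: x_def r_def s_real)
  have xO: "x \<in> F.OK" unfolding x_def by (intro F.OK_diff F.OK_mult F.OK_of_int s_OK)
  have cx: "cj x = - of_int q * s - of_int (p 0)"
    unfolding x_def using cj_diff[OF F.mult_mem[OF F.of_int_mem s_in_F] F.of_int_mem] cj_mult[OF F.of_int_mem s_in_F] by (simp add: cj_s)
  have x0: "x \<noteq> 0"
  proof
    assume "x = 0"
    then have "cj x = 0" by simp
    then have "x - cj x = 0" using \<open>x = 0\<close> by simp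
    then have "2 * (of_int q * s) = 0" unfolding cx by (simp add: x_def)
    then show False using qp(1) s_square d_pos by auto
  qed
  have "1 / N < e" using N assms N0 by (simp add: field_simps)
  then have "cmod x < e" using r unfolding xr norm_of_real by linarith
  moreover have "cmod (x * cj x) \<le> 1 + 2 * sqrt (of_int d)"
  proof -
    have sd: "sqrt (of_int d) \<ge> 0" using d_pos by simp
    have "cj x = of_real (r - 2 * of_int q * sqrt (of_int d))" unfolding cx r_def s_real by simp
    then have "cmod (cj x) = \<bar>r - 2 * of_int q * sqrt (of_int d)\<bar>" by (simp only: norm_of_real)
    also have "\<dots> \<le> \<bar>r\<bar> + 2 * of_int q * sqrt (of_int d)" using qp(1) sd by (smt (verit) mult_nonneg_nonneg of_int_0_le_iff)
    also have "\<dots> \<le> \<bar>r\<bar> + 2 * N * sqrt (of_int d)"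
    proof -
      have "q \<le> int N" using qp(2) by simp
      then have "of_int q \<le> real N" by linarith
      then show ?thesis using sd by (simp add: mult_right_mono)
    qed
    finally have b: "cmod (cj x) \<le> \<bar>r\<bar> + 2 * N * sqrt (of_int d)" .
    have r1: "\<bar>r\<bar> \<le> 1 / N" "1 / real N \<le> 1" using r N0 by (auto simp: divide_le_eq)
    then have r2: "\<bar>r\<bar> \<le> 1" by linarith
    have "cmod (x * cj x) \<le> \<bar>r\<bar> * (\<bar>r\<bar> + 2 * N * sqrt (of_int d))" unfolding norm_mult using b by (simp add: xr mult_left_mono)
    also have "\<dots> = \<bar>r\<bar> * \<bar>r\<bar> + (\<bar>r\<bar> * N) * (2 * sqrt (of_int d))" by (simp add: algebra_simps)
    also have "\<dots> \<le> 1 * 1 + 1 * (2 * sqrt (of_int d))"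
    proof (intro add_mono mult_mono)
      show "\<bar>r\<bar> * real N \<le> 1" using r1(1) N0 by (simp add: field_simps)
    qed (use r2 sd in auto)
    finally show ?thesis by simp
  qed
  ultimately show ?thesis using xO x0 by blast
qed

text \<open>There is an infinite sequence of integers of strictly decreasing absolute value and norm
  at most B. The principal ideal of each contains its norm, hence also \<open>m\<close>, the
  factorial of the integer part of B; so two of these ideals agree, and the quotient of their
  generators is a unit.\<close>

lemma nontrivial_unit: "\<exists>u. unit u \<and> cmod u < 1"
proof -
  define B where "B = 1 + 2 * sqrt (of_int d)"
  define Y where "Y = {x \<in> F.OK. x \<noteq> 0 \<and> cmod (x * cj x) \<le> B}"
  define m where "m = (fact (nat \<lfloor>B\<rfloor>) :: nat)"
  have ideal: "F.integral_ideal (scale x F.OK) \<and> of_nat m \<in> scale x F.OK" if x: "x \<in> Y" for x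
  proof
    have xO: "x \<in> F.OK" "x \<noteq> 0" "cmod (x * cj x) \<le> B" using x by (auto simp: Y_def)
    have f: "F.frac (scale x F.OK)" by (rule F.frac_scale[OF F.frac_OK F.OK_mem[OF xO(1)] xO(2)])
    show "F.integral_ideal (scale x F.OK)" by (rule F.frac_imp_integral_ideal[OF f]) (use xO(1) F.OK_mult in blast)
    obtain n :: int where n: "x * cj x = of_int n" using norm_Ints[OF xO(1)] by blast
    have n0: "n \<noteq> 0" using n xO(2) F.OK_mem[OF xO(1)] by auto
    have "real_of_int \<bar>n\<bar> \<le> B" using xO(3) unfolding n by simp
    then have "\<bar>n\<bar> \<le> \<lfloor>B\<rfloor>" by linarith
    then have "nat \<bar>n\<bar> dvd m" unfolding m_def using n0 by (intro dvd_fact) auto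
    then have "n dvd int m" by (metis abs_dvd_iff int_dvd_int_iff nat_0_le abs_ge_zero)
    then obtain k where "int m = n * k" by blast
    then have "(of_nat m :: complex) = of_int n * of_int k" by (metis of_int_mult of_int_of_nat_eq)
    then have "of_nat m = x * (cj x * of_int k)" unfolding n[symmetric] by simp
    moreover have "cj x * of_int k \<in> F.OK" by (intro F.OK_mult cj_OK xO F.OK_of_int)
    ultimately show "of_nat m \<in> scale x F.OK" by blast
  qed
  have step: "\<exists>y. y \<in> Y \<and> cmod y < cmod x" if "x \<in> Y" for x
    using small_elements[of "cmod x"] that unfolding Y_def B_def by auto
  obtain x0 where "x0 \<in> Y" using small_elements[of 1] unfolding Y_def B_def by auto
  then obtain f :: "nat \<Rightarrow> complex" where f: "\<And>n. f n \<in> Y" "\<And>n. cmod (f (Suc n)) < cmod (f n)"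
    using dependent_nat_choice[of "\<lambda>_ x. x \<in> Y" "\<lambda>_ x y. cmod y < cmod x"] step by metis
  have dec: "cmod (f j) < cmod (f i)" if "i < j" for i j
    using lift_Suc_mono_less[of "\<lambda>n. - cmod (f n)"] f(2) that by simp
  have "m > 0" by (simp add: m_def)
  then have "finite {I. F.integral_ideal I \<and> of_nat m \<in> I}" by (rule F.finite_ideals_above)
  moreover have "range (\<lambda>n. scale (f n) F.OK) \<subseteq> {I. F.integral_ideal I \<and> of_nat m \<in> I}" using ideal f(1) by auto
  ultimately have "finite (range (\<lambda>n. scale (f n) F.OK))" by (rule rev_finite_subset)
  then have "\<not> inj (\<lambda>n. scale (f n) F.OK)" using finite_imageD infinite_UNIV_nat by blast
  then obtain i j where ij: "i < j" "scale (f i) F.OK = scale (f j) F.OK" unfolding inj_def by (metis linorder_neqE_nat)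
  have fi: "f i \<in> F" "f i \<noteq> 0" "f j \<in> F" "f j \<noteq> 0" using f(1) F.OK_mem by (auto simp: Y_def)
  have "unit (f j / f i)" by (rule unit_iff_scale[OF fi(3,1,4,2) ij(2)[symmetric]])
  moreover have "cmod (f j / f i) < 1" using dec[OF ij(1)] fi(2) by (simp add: norm_divide)
  ultimately show ?thesis by blast
qed

lemma unit_gt_1_cases:
  assumes "unit u"
  shows "u = 1 \<or> u = - 1 \<or> (\<exists>v. unit v \<and> Re v > 1 \<and> (u = v \<or> u = - v \<or> u = inverse v \<or> u = - inverse v))"
proof -
  have uF: "u \<in> F" by (rule unit_F[OF assms])
  have u0: "Re u \<noteq> 0" using Re_eq_0[OF uF] assms by (auto simp: unit_def)
  consider "Re u = 1" | "Re u = - 1" | "Re u > 1" | "Re u < - 1" | "0 < Re u" "Re u < 1" | "- 1 < Re u" "Re u < 0"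
    using u0 by linarith
  then show ?thesis
  proof cases
    case 1
    then show ?thesis using Re_inj[OF uF F.one_mem] by simp
  next
    case 2
    then show ?thesis using Re_inj[OF uF F.minus_mem[OF F.one_mem]] by simp
  next
    case 3
    then show ?thesis using assms by blast
  next
    case 4
    then show ?thesis using unit_minus[OF assms] by (intro disjI2 exI[of _ "- u"]) auto
  next
    case 5
    then have "Re (inverse u) > 1" unfolding Re_inverse_F[OF uF] by (simp add: one_less_inverse_iff)
    then show ?thesis using unit_inverse[OF assms] by (intro disjI2 exI[of _ "inverse u"]) auto
  next
    case 6
    then have "1 < inverse (- Re u)" by (intro one_less_inverse) auto
    then have "Re (inverse (- u)) > 1" unfolding Re_inverse_F[OF F.minus_mem[OF uF]] uminus_complex.sel .
    then show ?thesis using unit_inverse[OF unit_minus[OF assms]] by (intro disjI2 exI[of _ "inverse (- u)"]) auto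
  qed
qed

text \<open>Units greater than 1 and at most a given unit u0 have norm \<plusminus> 1 and bounded
  trace, so they are roots of finitely many quadratic polynomials and there is a smallest one, e.
  Dividing a unit u with e^k \<le> u < e^(k+1) by e^k leaves a unit in [1, e), which is 1.\<close>

lemma fundamental_unit: "\<exists>e. unit e \<and> Re e > 1 \<and> (\<forall>u. unit u \<longrightarrow> Re u > 1 \<longrightarrow> (\<exists>n. u = e ^ n))"
proof -
  obtain u1 where "unit u1" "cmod u1 < 1" using nontrivial_unit by blast
  then obtain u0 where u0: "unit u0" "Re u0 > 1" using unit_gt_1_cases[of u1] by auto
  define S where "S = {u. unit u \<and> 1 < Re u \<and> Re u \<le> Re u0}"
  \<comment> \<open>Bounds the trace: the conjugate of a unit greater than 1 has absolute value at
    most 1.\<close>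
  define T where "T = \<lceil>Re u0\<rceil> + 1"
  have "S \<subseteq> (\<Union>t\<in>{-T..T}. \<Union>n\<in>{1,-1}. {x::complex. poly [:n, - of_int t, 1:] x = 0})"
  proof
    fix u assume "u \<in> S"
    then have u: "unit u" "1 < Re u" "Re u \<le> Re u0" by (auto simp: S_def)
    have uF: "u \<in> F" by (rule unit_F[OF u(1)])
    obtain t where t: "u + cj u = of_int t" using u(1) unfolding unit_def OK_iff by (metis Ints_cases)
    have "\<bar>Re u * Re (cj u)\<bar> = 1" using unit_norm[OF u(1)] Re_mult_F[OF uF, of "cj u"]
      by (metis abs_1 abs_minus_cancel one_complex.sel(1) uminus_complex.sel(1))
    then have "Re u * \<bar>Re (cj u)\<bar> = 1" using u(2) by (simp add: abs_mult)
    moreover have "\<bar>Re (cj u)\<bar> \<le> Re u * \<bar>Re (cj u)\<bar>" using u(2) by (simp add: mult_le_cancel_right1)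
    ultimately have "\<bar>Re (cj u)\<bar> \<le> 1" by linarith
    moreover have "Re u + Re (cj u) = of_int t" using t by (metis plus_complex.sel(1) Re_complex_of_real of_real_of_int_eq)
    ultimately have "\<bar>of_int t\<bar> \<le> Re u0 + 1" using u(2,3) by linarith
    then have "t \<in> {-T..T}" unfolding T_def by (simp, linarith)
    moreover have "poly [:u * cj u, - of_int t, 1:] u = 0" unfolding t[symmetric] by (simp add: algebra_simps)
    ultimately show "u \<in> (\<Union>t\<in>{-T..T}. \<Union>n\<in>{1,-1}. {x::complex. poly [:n, - of_int t, 1:] x = 0})"
      using unit_norm[OF u(1)] by (intro UN_I[of t] UN_I[of "u * cj u"]) auto
  qed
  moreover have "finite (\<Union>t\<in>{-T..T}. \<Union>n\<in>{1,-1}. {x::complex. poly [:n, - of_int t, 1:] x = 0})"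
    by (intro finite_UN_I poly_roots_finite) auto
  ultimately have finS: "finite S" by (rule finite_subset)
  have "u0 \<in> S" using u0 by (simp add: S_def)
  then have "Re ` S \<noteq> {}" by blast
  then have "Min (Re ` S) \<in> Re ` S" using finS by (intro Min_in) auto
  then obtain e where e: "e \<in> S" "Re e = Min (Re ` S)" by force
  have min: "Re e \<le> Re u" if "unit u" "Re u > 1" for u
  proof (cases "Re u \<le> Re u0")
    case True
    then show ?thesis unfolding e(2) using that finS by (intro Min_le) (auto simp: S_def)
  next
    case False
    have "Re e \<le> Re u0" using e(1) by (simp add: S_def)
    then show ?thesis using False by simp
  qed
  have ue: "unit e" "Re e > 1" using e(1) by (auto simp: S_def)
  have eF: "e \<in> F" by (rule unit_F[OF ue(1)])
  have "\<exists>n. u = e ^ n" if u: "unit u" "Re u > 1" for u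
  proof -
    obtain N where N: "Re u < Re e ^ N" using real_arch_pow[OF ue(2)] by blast
    define n where "n = (LEAST N. Re u < Re e ^ N)"
    have n: "Re u < Re e ^ n" unfolding n_def by (rule LeastI[of "\<lambda>N. Re u < Re e ^ N", OF N])
    have "n \<noteq> 0" using n u(2) by (cases n) auto
    then obtain k where k: "n = Suc k" by (cases n) auto
    have ge: "Re e ^ k \<le> Re u" using not_less_Least[of k "\<lambda>N. Re u < Re e ^ N"] k by (simp add: n_def[symmetric] not_less)
    have pos: "Re e ^ k > 0" using ue(2) by simp
    define v where "v = u * inverse (e ^ k)"
    have v: "unit v" unfolding v_def by (intro unit_mult unit_inverse unit_power u ue)
    have "Re v = Re u / Re e ^ k" unfolding v_def Re_mult_F[OF unit_F[OF u(1)]] Re_inverse_F[OF unit_F[OF unit_power[OF ue(1)]]] Re_power_F[OF eF]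
      by (simp add: divide_inverse)
    then have "1 \<le> Re v" "Re v < Re e" using ge n pos unfolding k by (simp_all add: field_simps)
    then have "Re v = 1" using min[OF v] by linarith
    then have "v = 1" using Re_inj[OF unit_F[OF v] F.one_mem] by simp
    then have "u = e ^ k" using ue(1) by (simp add: v_def unit_def field_simps)
    then show ?thesis by blast
  qed
  then show ?thesis using ue by blast
qed

end

lemma prime_times_square_not_1:
  fixes b :: rat
  assumes "Factorial_Ring.prime (l::nat)"
  shows "of_nat l * b\<^sup>2 \<noteq> 1"
proof
  assume eq: "of_nat l * b\<^sup>2 = 1"
  have "squarefree (int l)" using assms by (simp add: squarefree_prime)
  moreover have "of_int (int l) * b\<^sup>2 \<in> \<int>" using eq by simp
  ultimately have "b \<in> \<int>" by (rule squarefree_denominator)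
  then obtain k where "b = of_int k" by (auto elim: Ints_cases)
  then have "(of_int (int l * k\<^sup>2) :: rat) = of_int 1" using eq by simp
  then have "int l * k\<^sup>2 = 1" by (simp only: of_int_eq_iff)
  then have "is_unit (int l)" by (metis dvd_triv_left)
  then show False using prime_gt_1_nat[OF assms] by simp
qed

section \<open>The sum of two squares and the square class of l1\<close>

lemma minus_one_square_root:
  assumes l: "Factorial_Ring.prime l" "l mod 4 = (1::nat)"
  shows "\<exists>i::int. [i * i = - 1] (mod int l)"
proof -
  have l2: "2 < l" using prime_ge_2_nat[OF l(1)] l(2) by (cases "l = 2") auto
  have "l mod 4 = 1 \<Longrightarrow> even ((l - 1) div 2)" by presburger
  then have ev: "even ((l - 1) div 2)" using l(2) by blast
  have "[Legendre (- 1) (int l) = (- 1) ^ ((l - 1) div 2)] (mod int l)" by (rule euler_criterion[OF l(1) l2])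
  then have L: "[Legendre (- 1) (int l) = 1] (mod int l)" using ev by simp
  have "QuadRes (int l) (- 1)"
  proof (rule ccontr)
    assume "\<not> QuadRes (int l) (- 1)"
    then have "Legendre (- 1) (int l) = 0 \<or> Legendre (- 1) (int l) = - 1" by (simp add: Legendre_def)
    then have "int l dvd 1 \<or> int l dvd 2" using L by (auto simp: cong_iff_dvd_diff)
    then show False using l2 zdvd_imp_le[of "int l" 2] zdvd_imp_le[of "int l" 1] by auto
  qed
  then show ?thesis by (auto simp: QuadRes_def power2_eq_square)
qed

context quadratic
begin

text \<open>Thue's argument. With j^2 = - 1 modulo d, a Dirichlet approximation of j / d gives 0 < q
  \<le> N and r = q j - p d such that d divides r^2 + q^2. With N the integer part of \<surd>d one
  only gets |r| \<le> N + 1, hence r^2 + q^2 < 3 d. So the sum is d or 2 d; in the second case half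
  the sum and half the difference of r and q are taken.\<close>

lemma sum_of_two_squares: "\<exists>a b::int. b \<noteq> 0 \<and> d = a\<^sup>2 + b\<^sup>2"
proof -
  have lm: "l1 mod 4 = 1" "l2 mod 4 = 1" using mod1 mod2 by (simp_all add: unique_euclidean_semiring_class.cong_def)
  obtain i1 i2 where i: "[i1 * i1 = - 1] (mod int l1)" "[i2 * i2 = - 1] (mod int l2)"
    using minus_one_square_root[OF prime1 lm(1)] minus_one_square_root[OF prime2 lm(2)] by blast
  have cop: "coprime (int l1) (int l2)" using prime1 prime2 neq primes_coprime by simp
  obtain j where j: "[j = i1] (mod int l1)" "[j = i2] (mod int l2)" using binary_chinese_remainder_int[OF cop] by blast
  have "[j * j = - 1] (mod int l1)" "[j * j = - 1] (mod int l2)"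
    using cong_trans[OF cong_mult[OF j(1) j(1)] i(1)] cong_trans[OF cong_mult[OF j(2) j(2)] i(2)] .
  then have "int l1 dvd j * j + 1" "int l2 dvd j * j + 1" by (simp_all add: cong_iff_dvd_diff)
  then have dj: "d dvd j * j + 1" unfolding d_def of_nat_mult by (rule divides_mult[OF _ _ cop])
  define N where "N = nat \<lfloor>sqrt (of_int d)\<rfloor>"
  \<comment> \<open>Primes congruent to 1 modulo 4 are at least 5, whence N \<ge> 5; this yields (N
    + 1)^2 + N^2 < 3 N^2 \<le> 3 d.\<close>
  have l5: "l1 \<ge> 5" "l2 \<ge> 5" using prime_gt_1_nat[OF prime1] prime_gt_1_nat[OF prime2] lm by presburger+
  then have "l1 * l2 \<ge> 5 * 5" by (intro mult_le_mono)
  then have d25: "d \<ge> 25" unfolding d_def by linarith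
  then have s5: "sqrt (of_int d) \<ge> 5" by (intro real_le_rsqrt) simp
  have N5: "int N \<ge> 5" using s5 unfolding N_def by linarith
  have "real N \<le> sqrt (of_int d)" "sqrt (of_int d) < real N + 1" using s5 unfolding N_def by linarith+
  moreover have "sqrt (of_int d) * sqrt (of_int d) = of_int d" using d_pos by simp
  ultimately have "real N * real N \<le> of_int d" "of_int d < (real N + 1) * (real N + 1)"
    using mult_mono[of "real N" "sqrt (of_int d)" "real N" "sqrt (of_int d)"]
      mult_strict_mono'[of "sqrt (of_int d)" "real N + 1" "sqrt (of_int d)" "real N + 1"] s5 by simp_all
  then have "of_int (int N * int N) \<le> (of_int d :: real)" "(of_int d :: real) < of_int ((int N + 1) * (int N + 1))" by simp_all
  then have Nd: "int N * int N \<le> d" "d < (int N + 1) * (int N + 1)" by (simp_all only: of_int_le_iff of_int_less_iff)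
  obtain q and p :: "nat \<Rightarrow> int" where qp: "0 < q" "q \<le> int (N ^ 1)" "\<And>i. i < 1 \<Longrightarrow> \<bar>of_int q * (of_int j / of_int d) - of_int (p i)\<bar> < 1 / N"
    using Dirichlet_approx_simult[of N 1 "\<lambda>_. of_int j / of_int d"] N5 by auto
  define r where "r = q * j - p 0 * d"
  have rN: "\<bar>r\<bar> * int N < d"
  proof -
    have "of_int r / of_int d = of_int q * (of_int j / of_int d) - real_of_int (p 0)" using d_pos by (simp add: r_def field_simps)
    then have "\<bar>of_int r / of_int d\<bar> < 1 / real N" using qp(3)[of 0] by simp
    then have "\<bar>real_of_int r\<bar> * real N < of_int d" using d_pos N5 by (simp add: field_simps)
    then have "of_int (\<bar>r\<bar> * int N) < (of_int d :: real)" by simp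
    then show ?thesis by (simp only: of_int_less_iff)
  qed
  \<comment> \<open>Since d \<le> N^2 + 2 N, the bound |r| N < d leaves no room for |r| \<ge> N +
    2.\<close>
  have rb: "\<bar>r\<bar> \<le> int N + 1"
  proof (rule ccontr)
    assume "\<not> \<bar>r\<bar> \<le> int N + 1"
    then have "(int N + 2) * int N \<le> \<bar>r\<bar> * int N" by (intro mult_right_mono) auto
    then show False using rN Nd(2) by (simp add: algebra_simps)
  qed
  have "r * r \<le> (int N + 1) * (int N + 1)" using rb mult_mono[OF rb rb] by (simp flip: abs_mult)
  moreover have "q * q \<le> int N * int N" using qp(1,2) by (intro mult_mono) auto
  moreover have "5 * int N \<le> int N * int N" using N5 by (intro mult_right_mono) auto
  moreover have "(int N + 1) * (int N + 1) = int N * int N + 2 * int N + 1" by (simp add: algebra_simps)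
  ultimately have lt: "r * r + q * q < 3 * d" using Nd(1) N5 by linarith
  have "r * r + q * q = q * q * (j * j + 1) + d * (p 0 * p 0 * d - 2 * q * j * p 0)" by (simp add: r_def algebra_simps)
  then have "d dvd r * r + q * q" using dvd_add[OF dvd_mult[OF dj] dvd_triv_left] by metis
  then obtain k where k: "r * r + q * q = d * k" by blast
  have qq: "q * q > 0" using qp(1) by simp
  have "r * r + q * q > 0" using qq by (simp add: add_nonneg_pos)
  then have "0 < d * k" "d * k < d * 3" using lt unfolding k by (simp_all only: mult.commute)
  moreover have "d > 0" using d_pos by simp
  ultimately have "0 < k" "k < 3" using zero_less_mult_pos[of d k] mult_less_cancel_left_pos[of d k 3] by blast+
  then have "k = 1 \<or> k = 2" by linarith
  moreover have not_sq: "b \<noteq> 0" if "d = a\<^sup>2 + b\<^sup>2" for a b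
  proof
    assume "b = 0"
    then have "a\<^sup>2 dvd d" using that by simp
    then have "is_unit a" using squarefree_d squarefreeD by blast
    then have "a = 1 \<or> a = - 1" by (simp add: abs_if split: if_splits)
    then show False using that \<open>b = 0\<close> d_pos by auto
  qed
  moreover have "\<exists>a b. d = a\<^sup>2 + b\<^sup>2" if "k = 2"
  proof -
    have e: "r * r + q * q = 2 * d" using k that by simp
    then have "even (r * r + q * q)" by simp
    then have "even (r + q)" "even (r - q)" by auto
    then obtain x y where xy: "r + q = 2 * x" "r - q = 2 * y" by blast
    then have "r = x + y" "q = x - y" by simp_all
    then have "r * r + q * q = 2 * (x\<^sup>2 + y\<^sup>2)" by (simp only:) (simp add: power2_eq_square algebra_simps)
    then have "2 * d = 2 * (x\<^sup>2 + y\<^sup>2)" using e by simp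
    then have "d = x\<^sup>2 + y\<^sup>2" by simp
    then show ?thesis by blast
  qed
  moreover have "\<exists>a b. d = a\<^sup>2 + b\<^sup>2" if "k = 1"
    using k that by (intro exI[of _ r] exI[of _ q]) (simp add: power2_eq_square)
  ultimately show ?thesis by blast
qed

text \<open>For x = u + v s the mixed term 2 u v vanishes, so l1 would be the square of a rational,
  or l2 the inverse of such a square.\<close>

lemma l1_not_square:
  assumes "x \<in> F"
  shows "x * x \<noteq> of_nat l1"
proof
  assume eq: "x * x = of_nat l1"
  obtain u v where x: "x = of_rat u + of_rat v * s" using assms unfolding F_eq by blast
  have "x * x = of_rat u * of_rat u + of_rat v * of_rat v * (s * s) + (of_rat u * of_rat v + of_rat v * of_rat u) * s"
    unfolding x by (simp add: algebra_simps)
  then have "of_rat (u * u + v * v * of_int d) + of_rat (2 * u * v) * s = of_rat (of_nat l1) + of_rat 0 * s"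
    unfolding eq by (simp add: s_square of_rat_add of_rat_mult)
  then have uv: "u * u + v * v * of_int d = of_nat l1" "2 * u * v = 0" using coordinates_unique by blast+
  have l0: "(of_nat l1 :: rat) \<noteq> 0" using prime_gt_0_nat[OF prime1] by simp
  show False
  proof (cases "v = 0")
    case True
    then have "u * u = of_nat l1" using uv(1) by simp
    then have "of_nat l1 * (u / of_nat l1)\<^sup>2 = 1" using l0 by (simp add: power2_eq_square)
    then show False using prime_times_square_not_1[OF prime1] by blast
  next
    case False
    then have "v * v * of_int d = of_nat l1" using uv by simp
    then have "of_nat l1 * (of_nat l2 * v\<^sup>2) = of_nat l1 * 1" by (simp add: d_def power2_eq_square mult_ac)
    then have "of_nat l2 * v\<^sup>2 = 1" using l0 by simp
    then show False using prime_times_square_not_1[OF prime2] by blast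
  qed
qed

section \<open>The ramified prime above l1 and the 2-torsion of the class group\<close>

definition principal :: "complex set \<Rightarrow> bool"
  where "principal I \<longleftrightarrow> (\<exists>x\<in>F. x \<noteq> 0 \<and> I = scale x F.OK)"

text \<open>The ideal (l1, s). It enters the computation of classes through
  \<open>Q1_square\<close>.\<close>

definition Q1 :: "complex set"
  where "Q1 = {of_nat l1 * a + s * b | a b. a \<in> F.OK \<and> b \<in> F.OK}"

lemma l1_nonzero: "(of_nat l1 :: complex) \<noteq> 0"
  using prime_gt_0_nat[OF prime1] by simp

lemma Q1_mem: "a \<in> F.OK \<Longrightarrow> b \<in> F.OK \<Longrightarrow> of_nat l1 * a + s * b \<in> Q1"
  unfolding Q1_def by blast

lemma Q1_frac: "F.frac Q1"
proof (rule F.integral_ideal_imp_frac)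
  show "F.integral_ideal Q1"
    unfolding F.integral_ideal_def add_closed_def
  proof (intro conjI ballI)
    show "Q1 \<subseteq> F.OK" unfolding Q1_def by (auto intro!: F.OK_add F.OK_mult s_OK)
    show "0 \<in> Q1" using Q1_mem[of 0 0] by simp
    fix x assume "x \<in> Q1"
    then obtain a b where x: "x = of_nat l1 * a + s * b" "a \<in> F.OK" "b \<in> F.OK" unfolding Q1_def by blast
    show "- x \<in> Q1" using Q1_mem[OF F.OK_minus[OF x(2)] F.OK_minus[OF x(3)]] x(1) by simp
    fix y assume "y \<in> Q1"
    then obtain a' b' where y: "y = of_nat l1 * a' + s * b'" "a' \<in> F.OK" "b' \<in> F.OK" unfolding Q1_def by blast
    show "x + y \<in> Q1" using Q1_mem[OF F.OK_add[OF x(2) y(2)] F.OK_add[OF x(3) y(3)]] x(1) y(1) by (simp add: algebra_simps)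
  next
    fix r x assume r: "r \<in> F.OK" and "x \<in> Q1"
    then obtain a b where x: "x = of_nat l1 * a + s * b" "a \<in> F.OK" "b \<in> F.OK" unfolding Q1_def by blast
    show "r * x \<in> Q1" using Q1_mem[OF F.OK_mult[OF r x(2)] F.OK_mult[OF r x(3)]] x(1) by (simp add: algebra_simps)
  qed
  have "of_nat l1 \<in> Q1" using Q1_mem[of 1 0] by simp
  then show "Q1 \<noteq> {0}" using l1_nonzero by blast
qed

lemma Q1_square: "Q1 \<diamondop> Q1 = scale (of_nat l1) F.OK"
proof
  have ss: "s * s = of_nat l1 * of_nat l2" using s_square(1) by (simp add: d_def)
  show "Q1 \<diamondop> Q1 \<subseteq> scale (of_nat l1) F.OK"
  proof (rule set_prod_least)
    fix i j assume "i \<in> Q1" "j \<in> Q1"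
    then obtain a b a' b' where x: "i = of_nat l1 * a + s * b" "a \<in> F.OK" "b \<in> F.OK"
      and y: "j = of_nat l1 * a' + s * b'" "a' \<in> F.OK" "b' \<in> F.OK" unfolding Q1_def by blast
    have "i * j = of_nat l1 * (of_nat l1 * a * a' + s * (a * b' + b * a')) + (s * s) * (b * b')"
      unfolding x(1) y(1) by (simp add: algebra_simps)
    then have "i * j = of_nat l1 * (of_nat l1 * a * a' + s * (a * b' + b * a') + of_nat l2 * (b * b'))"
      unfolding ss by (simp add: algebra_simps)
    moreover have "of_nat l1 * a * a' + s * (a * b' + b * a') + of_nat l2 * (b * b') \<in> F.OK"
      by (intro F.OK_add F.OK_mult F.OK_of_nat s_OK x y)
    ultimately show "i * j \<in> scale (of_nat l1) F.OK" by blast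
  qed (auto simp: distrib_left[symmetric] intro!: imageI F.OK_add)
  have "coprime (int l1) (int l2)" using prime1 prime2 neq primes_coprime by simp
  \<comment> \<open>The square of the ideal contains l1^2 and s^2 = l1 l2, whose greatest common
    divisor is l1.\<close>
  then obtain u v where uv: "u * int l1 + v * int l2 = 1" using bezout_int[of "int l1" "int l2"] by auto
  have m: "of_nat l1 \<in> Q1" "s \<in> Q1" using Q1_mem[of 1 0] Q1_mem[of 0 1] by simp_all
  have Q: "F.frac (Q1 \<diamondop> Q1)" by (rule F.frac_prod[OF Q1_frac Q1_frac])
  have "of_int u * (of_nat l1 * of_nat l1) + of_int v * (s * s) \<in> Q1 \<diamondop> Q1"
    by (intro set_prod_add F.fracD(3)[OF Q] F.OK_of_int set_prod_mult m)
  also have "of_int u * (of_nat l1 * of_nat l1) + of_int v * (s * s) = of_nat l1 * of_int (u * int l1 + v * int l2)"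
    unfolding ss by (simp add: algebra_simps)
  finally have "of_nat l1 \<in> Q1 \<diamondop> Q1" unfolding uv by simp
  then show "scale (of_nat l1) F.OK \<subseteq> Q1 \<diamondop> Q1" using F.fracD(3)[OF Q] by (auto simp: mult.commute)
qed

text \<open>The sign of \<open>m\<close> is a unit and disappears at the level of ideals; what
  remains is the uniqueness of square roots of ideals.\<close>

lemma square_class_ideal:
  assumes I: "F.frac I" "I \<diamondop> I = scale \<alpha> F.OK" and f: "f \<in> F" "f \<noteq> 0" "\<alpha> = m * f\<^sup>2"
    and m: "m \<in> {1, - 1, of_nat l1, - of_nat l1}"
  shows "I = scale f F.OK \<or> I = scale f Q1"
proof -
  have ff: "scale (e * r * f\<^sup>2) F.OK = scale (f * f) (scale r F.OK)" if "e = 1 \<or> e = - 1" for e r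
  proof -
    have "unit e" using that unit_1 unit_minus by auto
    then have "scale e F.OK = F.OK" by (rule unit_scale)
    then have "scale (f * f) (scale r F.OK) = scale (f * f) (scale r (scale e F.OK))" by simp
    then show ?thesis unfolding scale_scale by (simp add: power2_eq_square mult_ac)
  qed
  obtain e r where er: "e = 1 \<or> e = - 1" "r = 1 \<or> r = of_nat l1" "m = e * r" using m by (auto intro: that[of 1 1] that[of "-1" 1] that[of 1 "of_nat l1"] that[of "-1" "of_nat l1"])
  have II: "I \<diamondop> I = scale (f * f) (scale r F.OK)" unfolding I(2) f(3) er(3) by (rule ff[OF er(1)])
  show ?thesis
  proof (cases "r = 1")
    case True
    then have "I \<diamondop> I = scale f F.OK \<diamondop> scale f F.OK" unfolding II F.scale_prod_OK by simp
    then show ?thesis using square_root_unique[OF I(1) F.frac_scale[OF F.frac_OK f(1,2)]] by blast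
  next
    case False
    then have r: "r = of_nat l1" using er(2) by blast
    have "scale f Q1 \<diamondop> scale f Q1 = I \<diamondop> I" unfolding II r set_prod_scale set_prod_scale_right Q1_square scale_scale by (simp only: mult.assoc)
    then show ?thesis using square_root_unique[OF I(1) F.frac_scale[OF Q1_frac f(1,2)]] by simp
  qed
qed

lemma positive_class:
  assumes I: "F.frac I" "I \<diamondop> I = scale \<alpha> F.OK" and \<alpha>: "\<alpha> \<in> F" "\<alpha> \<noteq> 0" and g: "g \<in> \<rat>" "g \<noteq> 0" "\<alpha> * cj \<alpha> = g\<^sup>2"
  shows "\<exists>f\<in>F. f \<noteq> 0 \<and> (I = scale f F.OK \<or> I = scale f Q1)"
proof -
  obtain f m where f: "f \<in> F" "f \<noteq> 0" "m \<in> {1, - 1, of_nat l1, - of_nat l1}" "\<alpha> = m * f\<^sup>2"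
    using rational_square_class[OF \<alpha> g I] by blast
  then show ?thesis using square_class_ideal[OF I f(1,2,4,3)] by blast
qed

lemma rational_squares_sign:
  assumes "r \<in> \<rat>" "g \<in> \<rat>" "g \<noteq> (0::complex)"
  shows "r\<^sup>2 \<noteq> - g\<^sup>2"
proof
  assume eq: "r\<^sup>2 = - g\<^sup>2"
  have "r \<in> F" "g \<in> F" using assms F.Rats_mem by auto
  then have "Re (r ^ 2) = Re r ^ 2" "Re (g ^ 2) = Re g ^ 2" by (simp_all only: Re_power_F)
  then have "Re r ^ 2 = - (Re g ^ 2)" using eq by simp
  moreover have "Re g \<noteq> 0" using Re_eq_0[OF \<open>g \<in> F\<close>] assms(3) by blast
  ultimately show False by (metis add_nonneg_pos neg_0_le_iff_le not_less zero_le_power2 zero_less_power2)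
qed

text \<open>Up to sign and inversion u is a power e^n. Norm 1 makes n even, because e has norm - 1,
  and positivity removes the sign.\<close>

lemma norm_positive_unit:
  assumes "unit u" "Re u > 0" "u * cj u = 1" "unit e" "e * cj e = - 1" and e: "\<And>v. unit v \<Longrightarrow> Re v > 1 \<Longrightarrow> \<exists>n. v = e ^ n"
  shows "\<exists>v\<in>F. v \<noteq> 0 \<and> u = v * v"
proof -
  have sq: "\<exists>v\<in>F. v \<noteq> 0 \<and> y = v * v" if y: "unit y" "Re y > 1" "y * cj y = 1" for y
  proof -
    obtain n where n: "y = e ^ n" using e[OF y(1,2)] by blast
    have eF: "e \<in> F" by (rule unit_F[OF assms(4)])
    have cp: "cj (e ^ k) = cj e ^ k" for k by (induction k) (auto simp: cj_mult eF F.power_mem)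
    have "(- 1 :: complex) ^ n = 1" using y(3) unfolding n cp power_mult_distrib[symmetric] assms(5) .
    then have "even n" by (metis minus_one_power_iff one_neq_neg_one)
    then obtain k where "n = 2 * k" by blast
    then have "y = e ^ k * e ^ k" unfolding n by (simp add: mult_2 power_add)
    then show ?thesis using F.power_mem[OF eF] assms(4) by (intro bexI[of _ "e ^ k"]) (auto simp: unit_def)
  qed
  have uF: "u \<in> F" by (rule unit_F[OF assms(1)])
  consider "u = 1" | "u = - 1" | v where "unit v" "Re v > 1" "u = v \<or> u = - v \<or> u = inverse v \<or> u = - inverse v"
    using unit_gt_1_cases[OF assms(1)] by blast
  then show ?thesis
  proof cases
    case 1
    then show ?thesis by (intro bexI[of _ 1]) (auto intro: F.one_mem)
  next
    case 2
    then show ?thesis using assms(2) by simp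
  next
    case (3 v)
    have vF: "v \<in> F" by (rule unit_F[OF 3(1)])
    have "Re (inverse v) > 0" using 3(2) unfolding Re_inverse_F[OF vF] by simp
    then have "u = v \<or> u = inverse v" using 3 assms(2) by auto
    then show ?thesis
    proof
      assume "u = v"
      then show ?thesis using sq[OF 3(1,2)] assms(3) by blast
    next
      assume uv: "u = inverse v"
      have "u * v = 1" using uv 3(1) by (simp add: unit_def)
      then have "cj u * cj v = 1" using cj_mult[OF uF vF] by simp
      have "(u * cj u) * (v * cj v) = (u * v) * (cj u * cj v)" by simp
      then have "v * cj v = 1" unfolding assms(3) \<open>u * v = 1\<close> \<open>cj u * cj v = 1\<close> by simp
      then obtain x where x: "x \<in> F" "x \<noteq> 0" "v = x * x" using sq[OF 3(1,2)] by blast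
      then show ?thesis using F.inverse_mem[OF x(1)] uv by (intro bexI[of _ "inverse x"]) auto
    qed
  qed
qed

text \<open>A generator z would make z^2 / l1 a positive unit whose norm is a rational square, hence
  1. By \<open>norm_positive_unit\<close> it would be a square in \<open>F\<close>, and so would
  l1.\<close>

lemma Q1_not_principal:
  assumes e: "unit e" "e * cj e = - 1" "\<And>v. unit v \<Longrightarrow> Re v > 1 \<Longrightarrow> \<exists>n. v = e ^ n"
  shows "\<not> principal Q1"
proof
  assume "principal Q1"
  then obtain z where z: "z \<in> F" "z \<noteq> 0" "Q1 = scale z F.OK" unfolding principal_def by blast
  have eq: "scale (z * z) F.OK = scale (of_nat l1) F.OK" using Q1_square unfolding z(3) F.scale_prod_OK .
  define u where "u = z * z / of_nat l1"
  have zz: "z * z \<in> F" "z * z \<noteq> 0" using z F.mult_mem by auto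
  have u: "unit u" unfolding u_def by (rule unit_iff_scale[OF zz(1) F.of_nat_mem zz(2) l1_nonzero eq])
  have "u = of_real (Re z * Re z / of_nat l1)" unfolding u_def by (subst (1 2) Re_F[OF z(1)]) simp
  then have "Re u = Re z * Re z / of_nat l1" by simp
  moreover have "Re z \<noteq> 0" using Re_eq_0 z by blast
  then have "Re z * Re z > 0" by (metis not_real_square_gt_zero)
  ultimately have Reu: "Re u > 0" using prime_gt_0_nat[OF prime1] by (simp add: divide_pos_pos)
  define r where "r = z * cj z / of_nat l1"
  have "r \<in> \<rat>" unfolding r_def using norm_rational[OF z(1)] by simp
  have "cj u = cj z * cj z / of_nat l1" unfolding u_def using cj_divide[OF zz(1) F.of_nat_mem] cj_mult[OF z(1,1)] by simp
  then have ur: "u * cj u = r\<^sup>2" by (simp add: u_def r_def power2_eq_square)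
  have "u * cj u = 1"
  proof (rule ccontr)
    assume "u * cj u \<noteq> 1"
    then have "r\<^sup>2 = - (1\<^sup>2)" using unit_norm[OF u] ur by auto
    then show False using rational_squares_sign[OF \<open>r \<in> \<rat>\<close>, of 1] by simp
  qed
  then obtain v where v: "v \<in> F" "v \<noteq> 0" "u = v * v" using norm_positive_unit[OF u Reu _ e] by blast
  have "(z / v) * (z / v) = of_nat l1" using v l1_nonzero unfolding u_def by (simp add: field_simps)
  then show False using l1_not_square[OF F.divide_mem[OF z(1) v(1)]] by blast
qed

text \<open>The unit e itself is put into \<open>rational_square_class\<close>, with O_F as the
  ideal whose square is e O_F, so that e = m f^2. Either O_F = f Q1, and Q1 is principal; or f is a
  unit and e = \<plusminus> f^2, where the minus sign is excluded by e > 1 and the plus sign because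
  a fundamental unit is not a square.\<close>

lemma Q1_principal:
  assumes e: "unit e" "Re e > 1" "e * cj e = 1" "\<And>v. unit v \<Longrightarrow> Re v > 1 \<Longrightarrow> \<exists>n. v = e ^ n"
  shows "principal Q1"
proof -
  have eF: "e \<in> F" by (rule unit_F[OF e(1)])
  have e0: "e \<noteq> 0" using e(1) by (simp add: unit_def)
  have OO: "F.OK \<diamondop> F.OK = scale e F.OK" unfolding unit_scale[OF e(1)] by (rule F.frac_prod_OK[OF F.frac_OK])
  have n1: "e * cj e = 1\<^sup>2" using e(3) by simp
  obtain f m where f: "f \<in> F" "f \<noteq> 0" "m \<in> {1, - 1, of_nat l1, - of_nat l1}" "e = m * f\<^sup>2"
    using rational_square_class[OF eF e0 Rats_1 one_neq_zero n1 F.frac_OK OO] by blast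
  have fr: "f\<^sup>2 = of_real ((Re f)\<^sup>2)" by (subst Re_F[OF f(1)]) simp
  have "F.OK = scale f F.OK \<or> F.OK = scale f Q1" by (rule square_class_ideal[OF F.frac_OK OO f(1,2,4,3)])
  then show ?thesis
  proof
    assume O: "F.OK = scale f F.OK"
    have "unit (f / 1)" by (rule unit_iff_scale[OF f(1) F.one_mem f(2)]) (use O in auto)
    then have fu: "unit f" by simp
    have mu: "unit m"
    proof -
      have "m = e * inverse f * inverse f" using f(2,4) by (simp add: power2_eq_square field_simps)
      then show ?thesis using unit_mult[OF unit_mult[OF e(1) unit_inverse[OF fu]] unit_inverse[OF fu]] by simp
    qed
    have "m * cj m = 1 \<or> m * cj m = - 1" by (rule unit_norm[OF mu])
    moreover have "m * cj m = of_nat l1 * of_nat l1 \<or> m = 1 \<or> m = - 1"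
      using f(3) cj_minus[OF F.of_nat_mem, of l1] by auto
    moreover have "(of_nat l1 * of_nat l1 :: complex) \<noteq> 1" "(of_nat l1 * of_nat l1 :: complex) \<noteq> - 1"
    proof -
      have "l1 * l1 \<noteq> 1" using prime_gt_1_nat[OF prime1] by simp
      then show "(of_nat l1 * of_nat l1 :: complex) \<noteq> 1" by (metis of_nat_1_eq_iff of_nat_mult)
      show "(of_nat l1 * of_nat l1 :: complex) \<noteq> - 1"
      proof
        assume "(of_nat l1 * of_nat l1 :: complex) = - 1"
        then have "(of_nat (l1 * l1 + 1) :: complex) = 0" by simp
        then show False by (simp only: of_nat_eq_0_iff)
      qed
    qed
    ultimately have m1: "m = 1 \<or> m = - 1" by auto
    have "m \<noteq> - 1"
    proof
      assume "m = - 1"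
      then have "Re e = - (Re f)\<^sup>2" using f(4) unfolding fr by simp
      moreover have "0 \<le> (Re f)\<^sup>2" by simp
      ultimately show False using e(2) by linarith
    qed
    then have ef: "e = f * f" using m1 f(4) by (simp add: power2_eq_square)
    have Ree: "Re e = Re f * Re f" unfolding ef by (rule Re_mult_F[OF f(1)])
    obtain y where y: "unit y" "Re y > 0" "e = y * y"
    proof (cases "Re f > 0")
      case False
      have "Re f \<noteq> 0" using Re_eq_0 f(1,2) by blast
      then have "Re (- f) > 0" using False by simp
      then show ?thesis using that[of "- f"] unit_minus[OF fu] ef by simp
    qed (use that fu ef in blast)
    have "Re e = Re y * Re y" unfolding y(3) by (rule Re_mult_F[OF unit_F[OF y(1)]])
    moreover have "Re y * Re y \<le> 1 * 1" if "Re y \<le> 1" using that y(2) by (intro mult_mono) auto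
    ultimately have "Re y > 1" using e(2) by linarith
    then obtain n where "y = e ^ n" using e(4) y(1) by blast
    then have "e ^ 1 = e ^ (n + n)" using y(3) by (simp add: power_add)
    then have "Re e ^ 1 = Re e ^ (n + n)" using Re_power_F[OF eF] by metis
    then have "1 = n + n" using e(2) power_inject_exp by blast
    then have False by presburger
    then show ?thesis ..
  next
    assume "F.OK = scale f Q1"
    then have "scale f Q1 = F.OK" by simp
    then have "Q1 = scale (inverse f) F.OK" by (rule scale_cancel[OF f(2)])
    then show ?thesis using F.inverse_mem[OF f(1)] f(2) unfolding principal_def by (intro bexI[of _ "inverse f"]) auto
  qed
qed

text \<open>With d = a^2 + b^2 the element x0 = (a + s) / b has norm - 1. For I = O_F + x0 O_F this
  gives x0 cj(I) = I, hence I^2 = x0 I cj(I) = x0 g O_F with g rational, and x0 g has norm -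
  g^2.\<close>

lemma negative_norm_ideal: "\<exists>I \<alpha>. F.frac I \<and> \<alpha> \<in> F \<and> \<alpha> \<noteq> 0 \<and> I \<diamondop> I = scale \<alpha> F.OK \<and> (\<exists>g\<in>\<rat>. g \<noteq> 0 \<and> \<alpha> * cj \<alpha> = - g\<^sup>2)"
proof -
  obtain a b :: int where ab: "b \<noteq> 0" "d = a\<^sup>2 + b\<^sup>2" using sum_of_two_squares by blast
  define x0 where "x0 = (of_int a + s) / of_int b"
  have aF: "of_int a + s \<in> F" by (intro F.add_mem F.of_int_mem s_in_F)
  have xF: "x0 \<in> F" unfolding x0_def by (intro F.divide_mem aF F.of_int_mem)
  have cx: "cj x0 = (of_int a - s) / of_int b"
    unfolding x0_def using cj_divide[OF aF F.of_int_mem] cj_add[OF F.of_int_mem s_in_F] by (simp add: cj_s)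
  have "(of_int a + s) * (of_int a - s) = of_int a * of_int a - s * s" by (simp add: algebra_simps)
  also have "\<dots> = of_int (- (b\<^sup>2))" unfolding s_square ab(2) by (simp add: power2_eq_square)
  finally have prod: "(of_int a + s) * (of_int a - s) = of_int (- (b\<^sup>2))" .
  have "x0 * cj x0 = x0 * ((of_int a - s) / of_int b)" unfolding cx ..
  also have "\<dots> = - 1" unfolding x0_def times_divide_times_eq prod using ab(1) by (simp add: power2_eq_square)
  finally have nx: "x0 * cj x0 = - 1" .
  have x0: "x0 \<noteq> 0" using nx by auto
  define I where "I = {x + x0 * y | x y. x \<in> F.OK \<and> y \<in> F.OK}"
  have mem: "x + x0 * y \<in> I" if "x \<in> F.OK" "y \<in> F.OK" for x y using that unfolding I_def by blast
  have IF: "I \<subseteq> F" unfolding I_def using xF by (auto intro!: F.add_mem F.mult_mem dest: F.OK_mem)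
  have I: "F.frac I"
    unfolding F.frac_def add_closed_def
  proof (intro conjI ballI)
    show "I \<subseteq> F" by (rule IF)
    show "0 \<in> I" using mem[of 0 0] by simp
    show "I \<noteq> {0}" using mem[of 1 0] by auto
    fix u assume "u \<in> I"
    then obtain x y where u: "u = x + x0 * y" "x \<in> F.OK" "y \<in> F.OK" unfolding I_def by blast
    show "- u \<in> I" using mem[OF F.OK_minus[OF u(2)] F.OK_minus[OF u(3)]] u(1) by simp
    fix v assume "v \<in> I"
    then obtain x' y' where v: "v = x' + x0 * y'" "x' \<in> F.OK" "y' \<in> F.OK" unfolding I_def by blast
    show "u + v \<in> I" using mem[OF F.OK_add[OF u(2) v(2)] F.OK_add[OF u(3) v(3)]] u(1) v(1) by (simp add: algebra_simps)
  next
    fix r u assume r: "r \<in> F.OK" and "u \<in> I"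
    then obtain x y where u: "u = x + x0 * y" "x \<in> F.OK" "y \<in> F.OK" unfolding I_def by blast
    show "r * u \<in> I" using mem[OF F.OK_mult[OF r u(2)] F.OK_mult[OF r u(3)]] u(1) by (simp add: algebra_simps)
  next
    obtain m where m: "m > (0::nat)" "of_nat m * x0 \<in> F.OK" using F.integral_multiple[OF xF] by blast
    have "of_nat m * u \<in> F.OK" if uI: "u \<in> I" for u
    proof -
      obtain x y where u: "u = x + x0 * y" "x \<in> F.OK" "y \<in> F.OK" using uI unfolding I_def by blast
      have "of_nat m * x + (of_nat m * x0) * y \<in> F.OK" by (intro F.OK_add F.OK_mult F.OK_of_nat m(2) u)
      then show ?thesis unfolding u(1) by (simp add: algebra_simps)
    qed
    then show "\<exists>m>0::nat. \<forall>x\<in>I. of_nat m * x \<in> F.OK" using m(1) by blast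
  qed
  have x0cx: "x0 * cj x0 * y = - y" for y unfolding nx by simp
  have "scale x0 (cj ` I) = I"
  proof
    show "scale x0 (cj ` I) \<subseteq> I"
    proof
      fix v assume "v \<in> scale x0 (cj ` I)"
      then obtain u where uI: "u \<in> I" and v: "v = x0 * cj u" by blast
      obtain x y where u: "u = x + x0 * y" "x \<in> F.OK" "y \<in> F.OK" using uI unfolding I_def by blast
      have "cj u = cj x + cj x0 * cj y" unfolding u(1)
        using cj_add[OF F.OK_mem[OF u(2)] F.mult_mem[OF xF F.OK_mem[OF u(3)]]] cj_mult[OF xF F.OK_mem[OF u(3)]] by simp
      then have "v = - cj y + x0 * cj x" unfolding v using x0cx[of "cj y"] by (simp add: algebra_simps)
      then show "v \<in> I" using mem[OF F.OK_minus[OF cj_OK[OF u(3)]] cj_OK[OF u(2)]] by simp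
    qed
    show "I \<subseteq> scale x0 (cj ` I)"
    proof
      fix u assume uI: "u \<in> I"
      obtain x y where u: "u = x + x0 * y" "x \<in> F.OK" "y \<in> F.OK" using uI unfolding I_def by blast
      define t where "t = cj y + x0 * (- cj x)"
      have tI: "t \<in> I" unfolding t_def by (rule mem[OF cj_OK[OF u(3)] F.OK_minus[OF cj_OK[OF u(2)]]])
      have yF: "y \<in> F" "x \<in> F" "cj y \<in> F" "cj x \<in> F" "- cj x \<in> F" using u F.OK_mem cj_in_F F.minus_mem by auto
      have "cj t = y + cj x0 * (- x)" unfolding t_def
        using cj_add[OF yF(3) F.mult_mem[OF xF yF(5)]] cj_mult[OF xF yF(5)] cj_minus[OF yF(4)] yF(1,2) by simp
      then have "x0 * cj t = x0 * y + x0 * cj x0 * (- x)" by (simp only: distrib_left mult.assoc)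
      then have "x0 * cj t = u" unfolding x0cx u(1) by simp
      then show "u \<in> scale x0 (cj ` I)" using tI by blast
    qed
  qed
  moreover obtain g where g: "g \<in> \<rat>" "g \<noteq> 0" "I \<diamondop> cj ` I = scale g F.OK" using norm_ideal[OF I] by blast
  ultimately have "I \<diamondop> I = scale x0 (scale g F.OK)" using set_prod_scale_right[of I x0 "cj ` I"] by simp
  then have II: "I \<diamondop> I = scale (x0 * g) F.OK" unfolding scale_scale .
  have gF: "g \<in> F" using g(1) F.Rats_mem by blast
  have "(x0 * g) * cj (x0 * g) = (x0 * cj x0) * g\<^sup>2" unfolding cj_mult[OF xF gF] cj_rat[OF g(1)] by (simp add: power2_eq_square)
  then have "(x0 * g) * cj (x0 * g) = - g\<^sup>2" unfolding nx by simp
  then show ?thesis using I II F.mult_mem[OF xF gF] x0 g by (intro exI[of _ I] exI[of _ "x0 * g"]) auto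
qed

theorem two_torsion:
  "\<exists>T. F.frac T \<and> \<not> principal T \<and> principal (T \<diamondop> T) \<and>
    (\<forall>I. F.frac I \<longrightarrow> principal (I \<diamondop> I) \<longrightarrow> principal I \<or> (\<exists>x\<in>F. x \<noteq> 0 \<and> I = scale x T))"
proof -
  obtain e where e: "unit e" "Re e > 1" "\<And>u. unit u \<Longrightarrow> Re u > 1 \<Longrightarrow> \<exists>n. u = e ^ n" using fundamental_unit by blast
  have eF: "e \<in> F" and e0: "e \<noteq> 0" using unit_F[OF e(1)] e(1) by (auto simp: unit_def)
  consider "e * cj e = - 1" | "e * cj e = 1" using unit_norm[OF e(1)] by blast
  then show ?thesis
  proof cases
    case 1
    have "principal I \<or> (\<exists>x\<in>F. x \<noteq> 0 \<and> I = scale x Q1)" if I: "F.frac I" "principal (I \<diamondop> I)" for I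
    proof -
      obtain \<alpha> where \<alpha>: "\<alpha> \<in> F" "\<alpha> \<noteq> 0" "I \<diamondop> I = scale \<alpha> F.OK" using I(2) unfolding principal_def by blast
      obtain g where g: "g \<in> \<rat>" "g \<noteq> 0" "\<alpha> * cj \<alpha> = g\<^sup>2 \<or> \<alpha> * cj \<alpha> = - g\<^sup>2"
        using norm_of_square_root[OF I(1) \<alpha>(3,1,2)] by blast
      have "\<exists>f\<in>F. f \<noteq> 0 \<and> (I = scale f F.OK \<or> I = scale f Q1)"
      proof (cases "\<alpha> * cj \<alpha> = g\<^sup>2")
        case True
        then show ?thesis by (rule positive_class[OF I(1) \<alpha>(3,1,2) g(1,2)])
      next
        case False
        \<comment> \<open>Multiplying the generator by the unit e of norm - 1 changes the sign of
          its norm but not the ideal.\<close>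
        have n: "(\<alpha> * e) * cj (\<alpha> * e) = g\<^sup>2"
        proof -
          have "(\<alpha> * e) * cj (\<alpha> * e) = (\<alpha> * cj \<alpha>) * (e * cj e)" unfolding cj_mult[OF \<alpha>(1) eF] by simp
          then show ?thesis using g(3) False 1 by simp
        qed
        have "scale \<alpha> F.OK = scale (\<alpha> * e) F.OK" unfolding scale_scale[symmetric] unit_scale[OF e(1)] ..
        then have "I \<diamondop> I = scale (\<alpha> * e) F.OK" using \<alpha>(3) by simp
        then show ?thesis using positive_class[OF I(1) _ F.mult_mem[OF \<alpha>(1) eF] _ g(1,2) n] \<alpha>(2) e0 by simp
      qed
      then show ?thesis unfolding principal_def by blast
    qed
    moreover have "principal (Q1 \<diamondop> Q1)" unfolding Q1_square principal_def using F.of_nat_mem l1_nonzero by blast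
    moreover have "\<not> principal Q1" by (rule Q1_not_principal[OF e(1) 1 e(3)])
    ultimately show ?thesis using Q1_frac by blast
  next
    case 2
    have unit_norm_1: "u * cj u = 1" if u: "unit u" for u
    proof -
      have uF: "u \<in> F" by (rule unit_F[OF u])
      have cp: "cj (e ^ k) = cj e ^ k" for k by (induction k) (auto simp: cj_mult eF F.power_mem)
      have pow: "e ^ n * cj (e ^ n) = 1" for n unfolding cp power_mult_distrib[symmetric] 2 by simp
      consider "u = 1" | "u = - 1" | v where "unit v" "Re v > 1" "u = v \<or> u = - v \<or> u = inverse v \<or> u = - inverse v"
        using unit_gt_1_cases[OF u] by blast
      then show ?thesis
      proof cases
        case 2
        then show ?thesis using cj_minus[OF F.one_mem] by simp
      next
        case (3 v)
        obtain n where n: "v = e ^ n" using e(3)[OF 3(1,2)] by blast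
        have vv: "v * cj v = 1" unfolding n by (rule pow)
        have vF: "v \<in> F" by (rule unit_F[OF 3(1)])
        have v0: "v \<noteq> 0" using 3(1) by (simp add: unit_def)
        have ci: "cj (inverse v) = inverse (cj v)" using cj_divide[OF F.one_mem vF] by (simp add: inverse_eq_divide)
        have "inverse v * inverse (cj v) = 1" using vv by (metis inverse_1 inverse_mult_distrib)
        then show ?thesis using 3(3) vv ci cj_minus[OF vF] cj_minus[OF F.inverse_mem[OF vF]] by auto
      qed simp
    qed
    have Q1p: "principal Q1" by (rule Q1_principal[OF e(1,2) 2 e(3)])
    then obtain q where q: "q \<in> F" "q \<noteq> 0" "Q1 = scale q F.OK" unfolding principal_def by blast
    have pos: "principal I" if "F.frac I" "I \<diamondop> I = scale \<alpha> F.OK" "\<alpha> \<in> F" "\<alpha> \<noteq> 0" "g \<in> \<rat>" "g \<noteq> 0" "\<alpha> * cj \<alpha> = g\<^sup>2" for I \<alpha> g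
    proof -
      have "\<exists>f\<in>F. f \<noteq> 0 \<and> (I = scale f F.OK \<or> I = scale f Q1)" by (rule positive_class[OF that])
      then obtain f where f: "f \<in> F" "f \<noteq> 0" "I = scale f F.OK \<or> I = scale (f * q) F.OK" unfolding q(3) scale_scale by blast
      moreover have "f * q \<in> F" "f * q \<noteq> 0" using f q F.mult_mem by auto
      ultimately show ?thesis unfolding principal_def by blast
    qed
    obtain T \<alpha>0 g0 where T: "F.frac T" "\<alpha>0 \<in> F" "\<alpha>0 \<noteq> 0" "T \<diamondop> T = scale \<alpha>0 F.OK" "g0 \<in> \<rat>" "g0 \<noteq> 0" "\<alpha>0 * cj \<alpha>0 = - g0\<^sup>2"
      using negative_norm_ideal by blast
    \<comment> \<open>All units have norm 1 here, so a generator z of T would give (z cj(z))^2 = -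
      g0^2 with rational numbers on both sides.\<close>
    have "\<not> principal T"
    proof
      assume "principal T"
      then obtain z where z: "z \<in> F" "z \<noteq> 0" "T = scale z F.OK" unfolding principal_def by blast
      have eq: "scale (z * z) F.OK = scale \<alpha>0 F.OK" using T(4) unfolding z(3) F.scale_prod_OK .
      have zz: "z * z \<in> F" "z * z \<noteq> 0" using z F.mult_mem by auto
      have "unit (z * z / \<alpha>0)" by (rule unit_iff_scale[OF zz(1) T(2) zz(2) T(3) eq])
      then have "(z * z / \<alpha>0) * cj (z * z / \<alpha>0) = 1" by (rule unit_norm_1)
      moreover have "(z * z / \<alpha>0) * cj (z * z / \<alpha>0) = (z * cj z)\<^sup>2 / (\<alpha>0 * cj \<alpha>0)"
        unfolding cj_divide[OF zz(1) T(2)] cj_mult[OF z(1) z(1)] by (simp add: power2_eq_square)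
      ultimately have "(z * cj z)\<^sup>2 = - g0\<^sup>2" unfolding T(7) using T(6) by (simp add: field_simps)
      then show False using rational_squares_sign[OF norm_rational[OF z(1)] T(5,6)] by blast
    qed
    moreover have "principal (T \<diamondop> T)" unfolding T(4) principal_def using T(2,3) by blast
    moreover have "principal I \<or> (\<exists>x\<in>F. x \<noteq> 0 \<and> I = scale x T)" if I: "F.frac I" "principal (I \<diamondop> I)" for I
    proof -
      obtain \<alpha> where \<alpha>: "\<alpha> \<in> F" "\<alpha> \<noteq> 0" "I \<diamondop> I = scale \<alpha> F.OK" using I(2) unfolding principal_def by blast
      obtain g where g: "g \<in> \<rat>" "g \<noteq> 0" "\<alpha> * cj \<alpha> = g\<^sup>2 \<or> \<alpha> * cj \<alpha> = - g\<^sup>2"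
        using norm_of_square_root[OF I(1) \<alpha>(3,1,2)] by blast
      show ?thesis
      proof (cases "\<alpha> * cj \<alpha> = g\<^sup>2")
        case True
        then show ?thesis using pos[OF I(1) \<alpha>(3,1,2) g(1,2)] by blast
      next
        case False
        \<comment> \<open>Dividing I by T cancels the two negative norms and leads back to the
          positive case.\<close>
        obtain J where J: "F.frac J" "T \<diamondop> J = F.OK" using frac_inverse[OF T(1)] by blast
        define L where "L = I \<diamondop> J"
        have L: "F.frac L" unfolding L_def by (rule F.frac_prod[OF I(1) J(1)])
        have "L \<diamondop> L = (I \<diamondop> I) \<diamondop> (J \<diamondop> J)" unfolding L_def by (metis set_prod_assoc set_prod_commute)
        also have "\<dots> = scale \<alpha> (J \<diamondop> J)" unfolding \<alpha>(3) by (rule F.scale_OK_prod[OF F.frac_prod[OF J(1) J(1)]])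
        also have "J \<diamondop> J = scale (inverse \<alpha>0) F.OK"
        proof (rule scale_cancel[OF T(3)])
          have "scale \<alpha>0 (J \<diamondop> J) = (T \<diamondop> T) \<diamondop> (J \<diamondop> J)" unfolding T(4) by (rule F.scale_OK_prod[OF F.frac_prod[OF J(1) J(1)], symmetric])
          also have "\<dots> = (T \<diamondop> J) \<diamondop> (T \<diamondop> J)" by (metis set_prod_assoc set_prod_commute)
          also have "\<dots> = F.OK" unfolding J(2) by (rule F.frac_prod_OK(1)[OF F.frac_OK])
          finally show "scale \<alpha>0 (J \<diamondop> J) = F.OK" .
        qed
        finally have LL: "L \<diamondop> L = scale (\<alpha> / \<alpha>0) F.OK" unfolding scale_scale divide_inverse .
        have "(\<alpha> / \<alpha>0) * cj (\<alpha> / \<alpha>0) = (\<alpha> * cj \<alpha>) / (\<alpha>0 * cj \<alpha>0)" unfolding cj_divide[OF \<alpha>(1) T(2)] by simp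
        also have "\<dots> = (g / g0)\<^sup>2" using g(3) False unfolding T(7) by (simp add: power_divide)
        finally have n: "(\<alpha> / \<alpha>0) * cj (\<alpha> / \<alpha>0) = (g / g0)\<^sup>2" .
        have "principal L"
          by (rule pos[OF L LL F.divide_mem[OF \<alpha>(1) T(2)] _ _ _ n]) (use \<alpha>(2) T(3,5,6) g(1,2) in auto)
        then obtain x where x: "x \<in> F" "x \<noteq> 0" "L = scale x F.OK" unfolding principal_def by blast
        have "I = I \<diamondop> (T \<diamondop> J)" unfolding J(2) by (rule F.frac_prod_OK(1)[OF I(1), symmetric])
        also have "\<dots> = L \<diamondop> T" unfolding L_def by (metis set_prod_assoc set_prod_commute)
        also have "\<dots> = scale x T" unfolding x(3) by (rule F.scale_OK_prod[OF T(1)])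
        finally show ?thesis using x(1,2) by blast
      qed
    qed
    ultimately show ?thesis using T(1) by blast
  qed
qed

end

section \<open>Cyclicity of the 2-primary part\<close>

text \<open>Squaring maps the elements killed by 2^(k+1) to those killed by 2^k, and each nonempty
  fibre lies in a set {z, z t}.\<close>

lemma (in comm_group) two_power_torsion_card:
  assumes fin: "finite (carrier G)" and t: "t \<in> carrier G"
    and tor: "\<And>x. x \<in> carrier G \<Longrightarrow> x \<otimes> x = \<one> \<Longrightarrow> x = \<one> \<or> x = t"
  shows "card {x \<in> carrier G. x [^] ((2::nat) ^ k) = \<one>} \<le> 2 ^ k"
proof (induction k)
  case 0
  have "{x \<in> carrier G. x [^] ((2::nat) ^ 0) = \<one>} = {\<one>}" by auto
  then show ?case by simp
next
  case (Suc k)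
  define S where "S = {x \<in> carrier G. x [^] ((2::nat) ^ Suc k) = \<one>}"
  define T where "T = {x \<in> carrier G. x [^] ((2::nat) ^ k) = \<one>}"
  have finT: "finite T" and finS: "finite S" using fin by (auto simp: S_def T_def)
  have sq: "x \<otimes> x \<in> T" if "x \<in> S" for x
  proof -
    have xG: "x \<in> carrier G" using that by (simp add: S_def)
    have "(x \<otimes> x) [^] ((2::nat) ^ k) = x [^] ((2::nat) ^ Suc k)"
      using xG by (simp add: nat_pow_distrib nat_pow_mult mult_2)
    then show ?thesis using that xG by (simp add: S_def T_def)
  qed
  have fib: "card {x \<in> S. x \<otimes> x = y} \<le> 2" for y
  proof (cases "{x \<in> S. x \<otimes> x = y} = {}")
    case False
    then obtain z where z: "z \<in> S" "z \<otimes> z = y" by blast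
    then have zG: "z \<in> carrier G" by (simp add: S_def)
    have "{x \<in> S. x \<otimes> x = y} \<subseteq> {z, z \<otimes> t}"
    proof
      fix x assume "x \<in> {x \<in> S. x \<otimes> x = y}"
      then have x: "x \<in> carrier G" "x \<otimes> x = z \<otimes> z" using z by (auto simp: S_def)
      have "(inv z \<otimes> x) \<otimes> (inv z \<otimes> x) = inv z \<otimes> inv z \<otimes> (x \<otimes> x)" using x(1) zG by (simp add: m_ac)
      also have "\<dots> = \<one>" unfolding x(2) using zG by (metis inv_closed inv_mult l_inv m_closed)
      finally have "inv z \<otimes> x = \<one> \<or> inv z \<otimes> x = t" using tor x(1) zG by simp
      then have "z \<otimes> (inv z \<otimes> x) = z \<otimes> \<one> \<or> z \<otimes> (inv z \<otimes> x) = z \<otimes> t" by auto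
      then show "x \<in> {z, z \<otimes> t}" using x(1) zG by (simp add: m_assoc[symmetric])
    qed
    then have "card {x \<in> S. x \<otimes> x = y} \<le> card {z, z \<otimes> t}" by (intro card_mono) auto
    also have "\<dots> \<le> 2" by (simp add: card_insert_if)
    finally show ?thesis .
  next
    case True
    show ?thesis unfolding True by simp
  qed
  have "S = (\<Union>y\<in>T. {x \<in> S. x \<otimes> x = y})" using sq by blast
  then have "card S \<le> (\<Sum>y\<in>T. card {x \<in> S. x \<otimes> x = y})" using card_UN_le[OF finT, of "\<lambda>y. {x \<in> S. x \<otimes> x = y}"] by simp
  also have "\<dots> \<le> (\<Sum>y\<in>T. 2)" by (rule sum_mono) (rule fib)
  also have "\<dots> \<le> 2 ^ Suc k" using Suc.IH unfolding T_def by simp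
  finally show ?case unfolding S_def .
qed

text \<open>With n the least exponent such that 2^n kills the whole primary part, some g has order
  exactly 2^n. Its powers exhaust the primary part, which has at most 2^n elements by
  \<open>two_power_torsion_card\<close>.\<close>

lemma primary_part_2_cyclic:
  fixes G :: "'a monoid" (structure)
  assumes G: "comm_group G" and fin: "finite (carrier G)" and t: "t \<in> carrier G" "t \<noteq> \<one>" "t \<otimes> t = \<one>"
    and tor: "\<And>x. x \<in> carrier G \<Longrightarrow> x \<otimes> x = \<one> \<Longrightarrow> x = \<one> \<or> x = t"
  shows "\<exists>n\<ge>1. primary_part 2 G \<cong> integer_mod_group (2 ^ n)"
proof -
  interpret comm_group G by (rule G)
  define T where "T = (\<lambda>k. {x \<in> carrier G. x [^] ((2::nat) ^ k) = \<one>})"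
  define P where "P = {x \<in> carrier G. \<exists>k. x [^] ((2::nat) ^ k) = \<one>}"
  have TG: "T k \<subseteq> carrier G" for k by (auto simp: T_def)
  have finT: "finite (T k)" for k using fin TG finite_subset by blast
  have T_Suc: "T k \<subseteq> T (Suc k)" for k
  proof
    fix x assume "x \<in> T k"
    then have x: "x \<in> carrier G" "x [^] ((2::nat) ^ k) = \<one>" by (auto simp: T_def)
    have "x [^] ((2::nat) ^ Suc k) = (x [^] ((2::nat) ^ k)) [^] (2::nat)" using x(1) by (simp add: nat_pow_pow mult.commute)
    then show "x \<in> T (Suc k)" using x by (simp add: T_def)
  qed
  then have T_mono: "i \<le> j \<Longrightarrow> T i \<subseteq> T j" for i j by (rule lift_Suc_mono_le)
  have finP: "finite P" using fin by (simp add: P_def)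
  have "\<exists>k. P \<subseteq> T k"
  proof -
    have "\<exists>k. x [^] ((2::nat) ^ k) = \<one>" if "x \<in> P" for x using that by (simp add: P_def)
    then obtain h where h: "\<And>x. x \<in> P \<Longrightarrow> x [^] ((2::nat) ^ h x) = \<one>" by metis
    have "x \<in> T (Max (h ` P))" if "x \<in> P" for x
    proof -
      have "x \<in> T (h x)" using h[OF that] that by (simp add: T_def P_def)
      moreover have "h x \<le> Max (h ` P)" using finP that by simp
      ultimately show ?thesis using T_mono by blast
    qed
    then show ?thesis by blast
  qed
  define n where "n = (LEAST k. P \<subseteq> T k)"
  have "P \<subseteq> T n" unfolding n_def by (rule LeastI_ex) fact
  moreover have "T n \<subseteq> P" by (auto simp: T_def P_def)
  ultimately have PT: "P = T n" by blast
  have "t [^] ((2::nat) ^ 1) = \<one>" using t by (simp add: numeral_2_eq_2)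
  then have "t \<in> P" unfolding P_def using t(1) by blast
  have n0: "n \<noteq> 0"
  proof
    assume "n = 0"
    then show False using \<open>t \<in> P\<close> t(1,2) unfolding PT T_def by simp
  qed
  then obtain m where m: "n = Suc m" by (cases n) auto
  have "\<not> P \<subseteq> T m" using not_less_Least[of m "\<lambda>k. P \<subseteq> T k"] m by (simp add: n_def[symmetric])
  then obtain g where g: "g \<in> P" "g \<notin> T m" by blast
  then have gG: "g \<in> carrier G" by (simp add: P_def)
  have gn: "g [^] ((2::nat) ^ n) = \<one>" using g(1) unfolding PT T_def by simp
  have gm: "g [^] ((2::nat) ^ m) \<noteq> \<one>" using g(2) gG by (simp add: T_def)
  have "ord g dvd 2 ^ n" using gn gG pow_eq_id by blast
  then obtain i where i: "i \<le> n" "ord g = 2 ^ i" using divides_primepow_nat[OF two_is_prime_nat] by blast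
  have "i = n"
  proof (rule ccontr)
    assume "i \<noteq> n"
    then have "ord g dvd 2 ^ m" unfolding i(2) using i(1) m by (intro le_imp_power_dvd) simp
    then show False using gm gG pow_eq_id by blast
  qed
  then have og: "ord g = 2 ^ n" using i(2) by simp
  define h where "h = (\<lambda>j::int. g [^] j)"
  have h_mod: "h (j mod 2 ^ n) = h j" for j
  proof -
    have "int (2 ^ n) dvd j mod 2 ^ n - j" by (simp add: mod_eq_dvd_iff[symmetric])
    then have "int (ord g) dvd j mod 2 ^ n - j" unfolding og .
    then show ?thesis unfolding h_def by (simp add: int_pow_eq[OF gG] dvd_diff_commute)
  qed
  have hP: "h j \<in> P" for j
  proof -
    have "(g [^] j) [^] ((2::nat) ^ n) = (g [^] ((2::nat) ^ n)) [^] j"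
      using gG by (metis int_pow_int int_pow_pow mult.commute)
    also have "\<dots> = \<one>" unfolding gn by simp
    finally show ?thesis unfolding h_def P_def using gG by blast
  qed
  have inj: "inj_on h {0..<2 ^ n}"
  proof (rule inj_onI)
    fix a b :: int assume ab: "a \<in> {0..<2 ^ n}" "b \<in> {0..<2 ^ n}" "h a = h b"
    then have "int (ord g) dvd a - b" by (simp add: h_def int_pow_eq[OF gG] dvd_diff_commute)
    then have "a mod 2 ^ n = b mod 2 ^ n" unfolding og by (simp add: mod_eq_dvd_iff)
    then show "a = b" using ab by simp
  qed
  have "card P \<le> card (h ` {0..<2 ^ n})"
    unfolding card_image[OF inj] PT T_def using two_power_torsion_card[OF fin t(1) tor, of n] by (simp add: nat_power_eq)
  moreover have "h ` {0..<2 ^ n} \<subseteq> P" using hP by blast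
  ultimately have im: "h ` {0..<2 ^ n} = P" using finP by (simp add: card_seteq)
  have cP: "carrier (primary_part 2 G) = P" by (simp add: primary_part_def P_def)
  have cZ: "carrier (integer_mod_group (2 ^ n)) = {0..<2 ^ n}" by (simp add: carrier_integer_mod_group)
  have "h \<in> iso (integer_mod_group (2 ^ n)) (primary_part 2 G)"
    unfolding iso_def bij_betw_def
  proof (intro CollectI conjI homI)
    show "h j \<in> carrier (primary_part 2 G)" for j unfolding cP by (rule hP)
    show "h (a \<otimes>\<^bsub>integer_mod_group (2 ^ n)\<^esub> b) = h a \<otimes>\<^bsub>primary_part 2 G\<^esub> h b" for a b
    proof -
      have "h (a \<otimes>\<^bsub>integer_mod_group (2 ^ n)\<^esub> b) = h (a + b)" using h_mod[of "a + b"] by simp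
      also have "\<dots> = h a \<otimes> h b" unfolding h_def using gG by (simp add: int_pow_mult)
      finally show ?thesis by (simp add: primary_part_def)
    qed
    show "inj_on h (carrier (integer_mod_group (2 ^ n)))" unfolding cZ by (rule inj)
    show "h ` carrier (integer_mod_group (2 ^ n)) = carrier (primary_part 2 G)" unfolding cZ cP by (rule im)
  qed
  then have "integer_mod_group (2 ^ n) \<cong> primary_part 2 G" by (rule is_isoI)
  then have "primary_part 2 G \<cong> integer_mod_group (2 ^ n)" by (rule group.iso_sym[OF group_integer_mod_group])
  then show ?thesis using n0 by (intro exI[of _ n]) simp
qed

section \<open>The class group of \<open>F\<close> as a finite quotient group\<close>

context quadratic
begin

abbreviation frac_group :: "complex set monoid" where "frac_group \<equiv> fractional_ideal_group F"
abbreviation principals :: "complex set set" where "principals \<equiv> principal_fractional_ideals F"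

lemma frac_group_simps:
  "carrier frac_group = {I. F.frac I}" "I \<otimes>\<^bsub>frac_group\<^esub> J = I \<diamondop> J" "\<one>\<^bsub>frac_group\<^esub> = F.OK"
  by (simp_all add: fractional_ideal_group_def F.fractional_ideal_iff)

lemma comm_group_frac_group: "comm_group frac_group"
proof (rule comm_groupI, unfold frac_group_simps mem_Collect_eq)
  fix I assume I: "F.frac I"
  then obtain J where J: "F.frac J" "I \<diamondop> J = F.OK" using frac_inverse by blast
  then have "J \<diamondop> I = F.OK" by (simp add: set_prod_commute)
  then show "\<exists>J\<in>{J. F.frac J}. J \<diamondop> I = F.OK" using J(1) by blast
next
  show "I \<diamondop> J = J \<diamondop> I" for I J by (rule set_prod_commute)
qed (simp_all add: F.frac_prod F.frac_OK set_prod_assoc F.frac_prod_OK)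

lemma principals_eq: "principals = {I. principal I}"
  unfolding principal_fractional_ideals_def principal_def F.carrier_ring_of_integers by blast

lemma principal_imp_frac: "principal I \<Longrightarrow> F.frac I"
  unfolding principal_def using F.frac_scale[OF F.frac_OK] by blast

lemma subgroup_principals: "subgroup principals frac_group"
proof -
  interpret G: comm_group frac_group by (rule comm_group_frac_group)
  show ?thesis
  proof (rule G.subgroupI, unfold frac_group_simps principals_eq mem_Collect_eq)
    show "{I. principal I} \<subseteq> {I. F.frac I}" using principal_imp_frac by blast
    have "principal F.OK" unfolding principal_def by (intro bexI[of _ 1]) (auto intro: F.OK_mem F.OK_1)
    then show "{I. principal I} \<noteq> {}" by blast
    show "principal (I \<diamondop> J)" if "principal I" "principal J" for I J
    proof -
      obtain x y where "x \<in> F" "x \<noteq> 0" "I = scale x F.OK" "y \<in> F" "y \<noteq> 0" "J = scale y F.OK"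
        using \<open>principal I\<close> \<open>principal J\<close> unfolding principal_def by blast
      then have "I \<diamondop> J = scale (x * y) F.OK" "x * y \<in> F" "x * y \<noteq> 0" by (simp_all add: F.scale_prod_OK F.mult_mem)
      then show ?thesis unfolding principal_def by blast
    qed
    show "principal (inv\<^bsub>frac_group\<^esub> I)" if "principal I" for I
    proof -
      obtain x where x: "x \<in> F" "x \<noteq> 0" "I = scale x F.OK" using \<open>principal I\<close> unfolding principal_def by blast
      let ?J = "scale (inverse x) F.OK"
      have J: "principal ?J" unfolding principal_def using F.inverse_mem[OF x(1)] x(2) by (intro bexI[of _ "inverse x"]) auto
      have "?J \<diamondop> I = F.OK" unfolding x(3) F.scale_prod_OK using x(2) by simp
      then have "inv\<^bsub>frac_group\<^esub> I = ?J"
        by (intro G.inv_equality) (simp_all add: frac_group_simps principal_imp_frac J \<open>principal I\<close>)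
      then show ?thesis using J by simp
    qed
  qed
qed

lemma comm_group_class_group: "comm_group (class_group F)"
  unfolding class_group_def
  by (rule comm_group.abelian_FactGroup[OF comm_group_frac_group subgroup_principals])

definition ideal_class :: "complex set \<Rightarrow> complex set set" where "ideal_class I = principals #>\<^bsub>frac_group\<^esub> I"

lemma carrier_class_group: "carrier (class_group F) = ideal_class ` {I. F.frac I}"
  unfolding class_group_def carrier_FactGroup ideal_class_def frac_group_simps ..

lemma one_class_group: "\<one>\<^bsub>class_group F\<^esub> = principals"
  by (simp add: class_group_def)

lemma ideal_class_mult:
  assumes "F.frac I" "F.frac J"
  shows "ideal_class I \<otimes>\<^bsub>class_group F\<^esub> ideal_class J = ideal_class (I \<diamondop> J)"
proof -
  interpret N: normal principals frac_group
    by (rule comm_group.subgroup_imp_normal[OF comm_group_frac_group subgroup_principals])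
  show ?thesis using N.rcos_sum[of I J] assms by (simp add: class_group_def ideal_class_def frac_group_simps)
qed

lemma ideal_class_eq_one_iff:
  assumes "F.frac I"
  shows "ideal_class I = \<one>\<^bsub>class_group F\<^esub> \<longleftrightarrow> principal I"
proof -
  interpret G: comm_group frac_group by (rule comm_group_frac_group)
  have I: "I \<in> carrier frac_group" using assms by (simp add: frac_group_simps)
  have "principals #>\<^bsub>frac_group\<^esub> I = principals \<longleftrightarrow> I \<in> principals"
    using G.coset_join1[OF _ I subgroup_principals] G.coset_join2[OF I subgroup_principals] by blast
  then show ?thesis unfolding one_class_group ideal_class_def principals_eq mem_Collect_eq .
qed

lemma ideal_class_scale:
  assumes "F.frac I" "x \<in> F" "x \<noteq> 0"
  shows "ideal_class (scale x I) = ideal_class I"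
proof -
  interpret G: comm_group "class_group F" by (rule comm_group_class_group)
  have p: "principal (scale x F.OK)" unfolding principal_def using assms(2,3) by blast
  have "ideal_class (scale x I) = ideal_class (scale x F.OK) \<otimes>\<^bsub>class_group F\<^esub> ideal_class I"
    unfolding ideal_class_mult[OF principal_imp_frac[OF p] assms(1)] F.scale_OK_prod[OF assms(1)] ..
  also have "\<dots> = ideal_class I"
    unfolding iffD2[OF ideal_class_eq_one_iff[OF principal_imp_frac[OF p]] p]
    by (rule G.l_one) (use assms(1) in \<open>simp add: carrier_class_group\<close>)
  finally show ?thesis .
qed

lemma finite_class_group: "finite (carrier (class_group F))"
proof -
  obtain C where C: "finite C" "\<forall>I. F.frac I \<longrightarrow> (\<exists>x\<in>F. x \<noteq> 0 \<and> (\<exists>J\<in>C. F.frac J \<and> I = scale x J))"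
    using finitely_many_classes by blast
  have "carrier (class_group F) \<subseteq> ideal_class ` C"
  proof
    fix c assume "c \<in> carrier (class_group F)"
    then obtain I where I: "F.frac I" "c = ideal_class I" unfolding carrier_class_group by blast
    obtain x J where "x \<in> F" "x \<noteq> 0" "J \<in> C" "F.frac J" "I = scale x J" using C(2) I(1) by blast
    then have "c = ideal_class J" "J \<in> C" unfolding I(2) using ideal_class_scale by blast+
    then show "c \<in> ideal_class ` C" by (rule image_eqI)
  qed
  then show ?thesis using C(1) finite_surj by blast
qed

lemma primary_part_class_group: "\<exists>n\<ge>1. primary_part 2 (class_group F) \<cong> integer_mod_group (2 ^ n)"
proof -
  obtain T where T: "F.frac T" "\<not> principal T" "principal (T \<diamondop> T)"
    and tor: "\<forall>I. F.frac I \<longrightarrow> principal (I \<diamondop> I) \<longrightarrow> principal I \<or> (\<exists>x\<in>F. x \<noteq> 0 \<and> I = scale x T)"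
    using two_torsion by blast
  have sq: "ideal_class I \<otimes>\<^bsub>class_group F\<^esub> ideal_class I = \<one>\<^bsub>class_group F\<^esub> \<longleftrightarrow> principal (I \<diamondop> I)" if "F.frac I" for I
    unfolding ideal_class_mult[OF that that] by (rule ideal_class_eq_one_iff[OF F.frac_prod[OF that that]])
  show ?thesis
  proof (rule primary_part_2_cyclic[OF comm_group_class_group finite_class_group])
    show "ideal_class T \<in> carrier (class_group F)" using T(1) by (simp add: carrier_class_group)
    show "ideal_class T \<noteq> \<one>\<^bsub>class_group F\<^esub>" using ideal_class_eq_one_iff[OF T(1)] T(2) by simp
    show "ideal_class T \<otimes>\<^bsub>class_group F\<^esub> ideal_class T = \<one>\<^bsub>class_group F\<^esub>" using sq[OF T(1)] T(3) by simp
    fix c assume c: "c \<in> carrier (class_group F)" "c \<otimes>\<^bsub>class_group F\<^esub> c = \<one>\<^bsub>class_group F\<^esub>"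
    obtain I where I: "F.frac I" "c = ideal_class I" using c(1) unfolding carrier_class_group by blast
    have "principal (I \<diamondop> I)" using c(2) sq[OF I(1)] unfolding I(2) by blast
    then consider "principal I" | x where "x \<in> F" "x \<noteq> 0" "I = scale x T" using tor I(1) by blast
    then show "c = \<one>\<^bsub>class_group F\<^esub> \<or> c = ideal_class T"
    proof cases
      case 1
      then show ?thesis using ideal_class_eq_one_iff[OF I(1)] unfolding I(2) by blast
    next
      case 2
      then show ?thesis using ideal_class_scale[OF T(1)] unfolding I(2) by simp
    qed
  qed
qed

end

theorem theorem5p3:
  fixes l1 l2 :: nat and F :: "complex set"
  assumes "Factorial_Ring.prime l1" and "Factorial_Ring.prime l2" and "l1 \<noteq> l2"
    and "[l1 = 1] (mod 4)" and "[l2 = 1] (mod 4)"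
    and "F = quadratic_field (int (l1 * l2))"
  shows "(\<exists>n\<ge>1. primary_part 2 (class_group F) \<cong> integer_mod_group (2 ^ n)) \<and>
    (\<forall>(p::nat) H. Factorial_Ring.prime p \<longrightarrow> kronecker (int l1) (int p) = - 1 \<longrightarrow> kronecker (int l2) (int p) = - 1 \<longrightarrow>
       hilbert_2_class_field F H \<longrightarrow> splits_into_exactly H p 2)"
proof -
  interpret quadratic l1 l2 using assms(1-5) by unfold_locales
  have F: "F = quadratic.F l1 l2" unfolding F_def d_def by (rule assms(6))
  have "splits_into_exactly H p 2"
    if "Factorial_Ring.prime p" "kronecker (int l1) (int p) = - 1" "kronecker (int l2) (int p) = - 1" "hilbert_2_class_field F H" for p H
  proof -
    have "unramified_abelian_2_extension (quadratic.F l1 l2) H" using that(4) unfolding hilbert_2_class_field_def F by blast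
    then interpret unramified_extension l1 l2 H by unfold_locales
    show ?thesis using that(1-3) by (rule splits_into_two)
  qed
  then show ?thesis using primary_part_class_group unfolding F by blast
qed

end
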